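(* Assume the setting and notation of the context, let $\delta\in(0,1]$, and suppose: (i) $\sup_{s\in\mathcal X}G(s,s)=:\gamma^2<\infty$ and $\sup_{m\in\mathcal P}K(m,m)=:\kappa^2<\infty$; (ii) for some $\alpha\in(0,1]$, $L>0$: $\|K_{m_1}-K_{m_2}\|_{\mathcal H_K}\le L\|m_1-m_2\|_{\mathcal H_G}^{\alpha}$ for all $m_1,m_2\in\mathcal P$; (iii) $f_\rho=L_K^r h_\rho$ with $\|h_\rho\|_{L^2}\le R<\infty$, where $0<r\le\frac12$; (iv) for some $\nu\in(0,1]$, $c_\nu<\infty$: $\mathcal N(\lambda)\le c_\nu\lambda^{-\nu}$ for $\lambda>0$; (v) $0<\eta_n<1/\kappa^2$, and with $\lambda=(\eta_nT_n)^{-1}$: $n\ge \frac{32\kappa^2\log(4/\delta)}{\lambda}\log\big(e\,\mathcal N(\lambda)(1+\frac{\lambda}{\|T_K\|})\big)$ and $n\ge64e\kappa^2\log^2(24/\delta)\,(\eta_nT_n)\log((\eta_nT_n)^\nu)$. Then second-stage tail-averaged gradient descent with step size $\eta_n$, $T_n$ iterations and second-stage sample size $N=N_n$ satisfies, with probability not less than $1-\delta$ with respect to $D$: 1. If $2r+\nu>1$, $\eta_nT_n=\big(\frac{R^2}{M^2}n\big)^{\frac1{2r+\nu}}$ and $N_n\ge\log^{2/\alpha}(n)\big(\frac{R^2n}{M^2}\big)^{\frac{2+\nu}{\alpha(2r+\nu)}}$, then $$\mathbb E_{\hat D|D}[\|S_K\bar{\hat f}_{T_n}-f_\rho\|_{L^2}]\le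 C\log(24/\delta)\,R\Big(\frac{M^2}{R^2n}\Big)^{\frac r{2r+\nu}}$$ for some $C<\infty$, provided $n$ is sufficiently large. 2. If $2r+\nu\le1$, $\eta_nT_n=\frac{R^2n}{M^2\log^q(n)}$ for some $q>1$ and $N_n\ge\log^{2/\alpha}(n)\big(\frac{R^2n}{M^2\log^q(n)}\big)^{\frac{2+\nu}{\alpha}}$, then $$\mathbb E_{\hat D|D}[\|S_K\bar{\hat f}_{T_n}-f_\rho\|_{L^2}]\le C'\log(6/\delta)\,R\Big(\frac{M^2\log^q(n)}{R^2n}\Big)^{r}$$ for some $C'<\infty$, provided $n$ is sufficiently large.
   Context: Setting. $\mathcal X$ is a compact topological space, $\mathcal M^+(\mathcal X)$ the Borel probability measures on $\mathcal X$ (weak topology), $\mathcal Y\subseteq[-M,M]$ with $M>0$. $G$ is a Mercer kernel on $\mathcal X$ (symmetric, continuous, positive semidefinite) with RKHS $\mathcal H_G$; the mean embedding of $x\in\mathcal M^+(\mathcal X)$ is $\mu_x=\int_{\mathcal X}G(s,\cdot)\,dx(s)\in\mathcal H_G$; $\mathcal P:=\{\mu_x:x\in\mathcal M^+(\mathcal X)\}\subset\mathcal H_G$. $K$ is a reproducing kernel on $\mathcal P$ with RKHS $\mathcal H_K$; $K_m:=K(m,\cdot)$. $\rho$ is a probability measure on $\mathcal P\times\mathcal Y$ with marginal $\rho_\mu$ on $\mathcal P$; $L^2=L^2(\mathcal P,\rho_\mu)$; $f_\rho(m)=\int_{\mathcal Y}y\,d\rho(y|m)$ is the regression function. $S_K:\mathcal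 H_K\to L^2$ is the inclusion, $T_K=S_K^*S_K$, $L_K=S_KS_K^*$ (powers via spectral calculus), $\mathcal N(\lambda)=\mathrm{trace}(L_K(L_K+\lambda)^{-1})$. Data. First stage: $(x_j,y_j)$, $j=1,\dots,n$, i.i.d. on $\mathcal M^+(\mathcal X)\times\mathcal Y$ such that $(\mu_{x_j},y_j)\sim\rho$; $D=\{(\mu_{x_j},y_j)\}_{j=1}^n$. Second stage: for each $j$, $x_{j,1},\dots,x_{j,N}$ are i.i.d. from $x_j$; $\mu_{\hat x_j}=\frac1N\sum_{i=1}^NG(x_{j,i},\cdot)$; $\hat D=\{(\mu_{\hat x_j},y_j)\}_{j=1}^n$. $\mathbb E_{\hat D|D}$ is conditional expectation over $\hat D$ given $D$. Algorithm (second-stage tail-averaged gradient descent). $\hat f_0=0$, $\hat f_{t+1}=\hat f_t-\eta\frac1n\sum_{j=1}^n(\hat f_t(\mu_{\hat x_j})-y_j)K_{\mu_{\hat x_j}}$, $\ \bar{\hat f}_T=\frac2T\sum_{t=\lfloor T/2\rfloor+1}^T\hat f_t$. Constants do not depend on $n,N,\delta$; "$n$ sufficiently large" may depend on $\delta$ and the problem parameters. *)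

theory Defs
  imports "HOL-Probability.Probability"
begin

definition mercer_kernel :: "('x::topological_space \<Rightarrow> 'x \<Rightarrow> real) \<Rightarrow> bool" where
  "mercer_kernel G \<longleftrightarrow>
     continuous_on UNIV (\<lambda>(s, t). G s t) \<and>
     (\<forall>s t. G s t = G t s) \<and>
     (\<forall>A c. finite A \<longrightarrow> 0 \<le> (\<Sum>s\<in>A. \<Sum>t\<in>A. c s * c t * G s t))"

(* This says that the Hilbert space 'h, each element f of which is identified with the function evl f on S, is the
   reproducing kernel Hilbert space of K, with k s = K(s, .).  Injectivity of evl makes 'h a space
   of functions.  Linearity of evl follows from the reproducing property. *)
definition is_rkhs ::
  "'s set \<Rightarrow> ('s \<Rightarrow> 's \<Rightarrow> real) \<Rightarrow> ('h::{real_inner,banach} \<Rightarrow> 's \<Rightarrow> real) \<Rightarrow> ('s \<Rightarrow> 'h) \<Rightarrow> bool"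
  where
  "is_rkhs S K evl k \<longleftrightarrow>
     (\<forall>f g. (\<forall>s\<in>S. evl f s = evl g s) \<longrightarrow> f = g) \<and>
     (\<forall>s\<in>S. \<forall>t\<in>S. evl (k s) t = K s t) \<and>
     (\<forall>f. \<forall>s\<in>S. evl f s = f \<bullet> k s)"

definition square_integrable_funs :: "'a measure \<Rightarrow> ('a \<Rightarrow> real) set" where
  "square_integrable_funs M = {f \<in> borel_measurable M. integrable M (\<lambda>x. (f x)\<^sup>2)}"

(* This says that the Hilbert space 'l is L^2(M), where cls f is the class of the square integrable function f.
   The first conjunct makes cls linear on square integrable functions, and makes cls f = cls g
   equivalent to f = g almost everywhere.  Values of cls elsewhere are irrelevant. *)
definition is_L2 :: "'a measure \<Rightarrow> (('a \<Rightarrow> real) \<Rightarrow> 'l::{real_inner,banach}) \<Rightarrow> bool" where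
  "is_L2 M cls \<longleftrightarrow>
     (\<forall>f\<in>square_integrable_funs M. \<forall>g\<in>square_integrable_funs M.
        cls f \<bullet> cls g = (\<integral>x. f x * g x \<partial>M)) \<and>
     cls ` square_integrable_funs M = UNIV"

definition orthonormal_basis :: "'a::real_inner set \<Rightarrow> bool" where
  "orthonormal_basis B \<longleftrightarrow>
     (\<forall>b\<in>B. norm b = 1) \<and> pairwise orthogonal B \<and> closure (span B) = UNIV"

(* Meaningful for trace class operators, where the sum does not depend on the basis. *)
definition op_trace :: "('a::{real_inner,banach} \<Rightarrow> 'a) \<Rightarrow> real" where
  "op_trace A = (\<Sum>\<^sub>\<infinity>e\<in>(SOME B. orthonormal_basis B). A e \<bullet> e)"

(* Spectral calculus for a compact positive self-adjoint operator A: with an orthonormal basis of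
   eigenvectors e and eigenvalues A e \<bullet> e, the power A^r h is the sum of (A e \<bullet> e)^r (h \<bullet> e) e,
   which does not depend on the basis.  Eigenvalue 0 contributes 0. *)
definition op_powr :: "('a::{real_inner,banach} \<Rightarrow> 'a) \<Rightarrow> real \<Rightarrow> 'a \<Rightarrow> 'a" where
  "op_powr A r h =
     (\<Sum>\<^sub>\<infinity>e\<in>(SOME B. orthonormal_basis B \<and> (\<forall>e\<in>B. \<exists>\<sigma>. A e = \<sigma> *\<^sub>R e)).
        ((A e \<bullet> e) powr r * (h \<bullet> e)) *\<^sub>R e)"

(* For the operator S_K S_K^* of a bounded kernel, A is trace class, so op_trace is meaningful. *)
definition effective_dim :: "('a::{real_inner,banach} \<Rightarrow> 'a) \<Rightarrow> real \<Rightarrow> real" where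
  "effective_dim A lam = op_trace (A \<circ> inv (\<lambda>h. A h + lam *\<^sub>R h))"

(* Second countability of 'g, needed for the Bochner integral, is no restriction for the RKHS of a
   continuous kernel on a compact space, which is separable. *)
definition mean_embedding ::
  "('x \<Rightarrow> 'g::{real_inner,banach,second_countable_topology}) \<Rightarrow> 'x measure \<Rightarrow> 'g" where
  "mean_embedding \<Phi> x = (\<integral>s. \<Phi> s \<partial>x)"

definition mean_embeddings ::
  "('x::topological_space \<Rightarrow> 'g::{real_inner,banach,second_countable_topology}) \<Rightarrow> 'g set" where
  "mean_embeddings \<Phi> = mean_embedding \<Phi> ` {x. prob_space x \<and> sets x = sets borel}"

(* cond m is the conditional law of the second component given that the first is m, for a law \<rho>
   on the product of MX and MY. *)
definition is_conditional_law ::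
  "'a measure \<Rightarrow> 'b measure \<Rightarrow> ('a \<times> 'b) measure \<Rightarrow> ('a \<Rightarrow> 'b measure) \<Rightarrow> bool" where
  "is_conditional_law MX MY \<rho> cond \<longleftrightarrow>
     cond \<in> MX \<rightarrow>\<^sub>M prob_algebra MY \<and>
     (\<forall>A\<in>sets MX. \<forall>B\<in>sets MY.
        measure \<rho> (A \<times> B) = (LINT m:A|distr \<rho> MX fst. measure (cond m) B))"

(* The law of ((x, y), s) where (x, y) has law \<tau> and, given (x, y), the N entries of s are
   independent draws from x.  For this to be a Markov kernel, the maps x \<mapsto> x(A) have to be
   measurable, so the measures x carry the sigma-algebra of prob_algebra borel, the smallest one
   with this property.  For compact metrizable 'x it is the Borel sigma-algebra of the weak
   topology. *)
definition two_stage_law ::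
  "('x::topological_space measure \<times> real) measure \<Rightarrow> nat
    \<Rightarrow> (('x measure \<times> real) \<times> (nat \<Rightarrow> 'x)) measure" where
  "two_stage_law \<tau> N =
     \<tau> \<bind> (\<lambda>(x, y). distr (PiM {..<N} (\<lambda>_. x)) (\<tau> \<Otimes>\<^sub>M PiM {..<N} (\<lambda>_. borel)) (\<lambda>s. ((x, y), s)))"

(* An outcome \<omega> gives, for j < n, the triple \<omega> j = ((x_j, y_j), (x_{j,i})_i).  The pairs (x_j, y_j)
   are i.i.d. and second-stage draws for different j are independent, so the triples are i.i.d. *)
definition two_stage_sample ::
  "('x::topological_space measure \<times> real) measure \<Rightarrow> nat \<Rightarrow> nat
    \<Rightarrow> (nat \<Rightarrow> ('x measure \<times> real) \<times> (nat \<Rightarrow> 'x)) measure" where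
  "two_stage_sample \<tau> n N = PiM {..<n} (\<lambda>_. two_stage_law \<tau> N)"

definition first_stage_data ::
  "('x \<Rightarrow> 'g::{real_inner,banach,second_countable_topology}) \<Rightarrow> nat
    \<Rightarrow> (nat \<Rightarrow> ('x measure \<times> real) \<times> (nat \<Rightarrow> 'x)) \<Rightarrow> nat \<Rightarrow> 'g \<times> real" where
  "first_stage_data \<Phi> n \<omega> = (\<lambda>j\<in>{..<n}. (mean_embedding \<Phi> (fst (fst (\<omega> j))), snd (fst (\<omega> j))))"

definition second_stage_data ::
  "('x \<Rightarrow> 'g::real_inner) \<Rightarrow> nat
    \<Rightarrow> (nat \<Rightarrow> ('x measure \<times> real) \<times> (nat \<Rightarrow> 'x)) \<Rightarrow> nat \<Rightarrow> 'g \<times> real" where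
  "second_stage_data \<Phi> N \<omega> j = ((1 / real N) *\<^sub>R (\<Sum>i<N. \<Phi> (snd (\<omega> j) i)), snd (fst (\<omega> j)))"

primrec gradient_descent ::
  "('h::real_inner \<Rightarrow> 'g \<Rightarrow> real) \<Rightarrow> ('g \<Rightarrow> 'h) \<Rightarrow> real \<Rightarrow> nat \<Rightarrow> (nat \<Rightarrow> 'g \<times> real) \<Rightarrow> nat \<Rightarrow> 'h" where
  "gradient_descent evl k \<eta> n d 0 = 0"
| "gradient_descent evl k \<eta> n d (Suc t) =
     gradient_descent evl k \<eta> n d t
       - (\<eta> * (1 / real n)) *\<^sub>R
         (\<Sum>j<n. (evl (gradient_descent evl k \<eta> n d t) (fst (d j)) - snd (d j)) *\<^sub>R k (fst (d j)))"

definition tail_average ::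
  "('h::real_inner \<Rightarrow> 'g \<Rightarrow> real) \<Rightarrow> ('g \<Rightarrow> 'h) \<Rightarrow> real \<Rightarrow> nat \<Rightarrow> (nat \<Rightarrow> 'g \<times> real) \<Rightarrow> nat \<Rightarrow> 'h" where
  "tail_average evl k \<eta> n d T =
     (2 / real T) *\<^sub>R (\<Sum>t = T div 2 + 1..T. gradient_descent evl k \<eta> n d t)"

(* Conditional expectation of Z given the first-stage data D, the points of which take values in
   the measurable space \<rho>. *)
definition cond_exp_given_first_stage ::
  "('x::topological_space \<Rightarrow> 'g::{real_inner,banach,second_countable_topology})
    \<Rightarrow> ('x measure \<times> real) measure \<Rightarrow> ('g \<times> real) measure \<Rightarrow> nat \<Rightarrow> nat
    \<Rightarrow> ((nat \<Rightarrow> ('x measure \<times> real) \<times> (nat \<Rightarrow> 'x)) \<Rightarrow> real)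
    \<Rightarrow> (nat \<Rightarrow> ('x measure \<times> real) \<times> (nat \<Rightarrow> 'x)) \<Rightarrow> real" where
  "cond_exp_given_first_stage \<Phi> \<tau> \<rho> n N Z =
     real_cond_exp (two_stage_sample \<tau> n N)
       (vimage_algebra (space (two_stage_sample \<tau> n N)) (first_stage_data \<Phi> n)
         (PiM {..<n} (\<lambda>_. \<rho>))) Z"

end

theory Submission
  imports Defs "HOL-Complex_Analysis.Great_Picard" "HOL-Real_Asymp.Real_Asymp"
begin

text \<open>Put \<open>lam = 1 / (\<eta> T)\<close>. The empirical covariance operator \<open>T'\<close> of the first-stage data satisfies
  \<open>T \<le> C (T' + lam)\<close> with high probability as soon as \<open>n lam\<close> is a large multiple of \<open>ln n\<close>: adding one
  observation at a time is a rank-one update of the resolvent, which decreases the trace of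
  \<open>(resolvent \<circ> T) ^^ p\<close> in expectation at a rate that forces it to be of order \<open>(p + n) powr (1 - p)\<close>,
  and \<open>p\<close> of order \<open>ln n\<close> makes this a bound of the operator norm. On this event gradient descent
  stays close to a regularized target \<open>f\<close> with \<open>SK f\<close> close to the regression function, the distance
  being governed by the noise \<open>(1 / n) (\<Sum>j<n. (y\<^sub>j - f\<rho> (m\<^sub>j)) K (m\<^sub>j))\<close> measured by
  \<open>(T + lam) powr (-1/2)\<close>. A Bernstein inequality in Hilbert space bounds that noise through the effective
  dimension. Replacing the mean embeddings by empirical ones perturbs the iteration by a forcing
  term whose conditional second moment is of order \<open>N powr - \<alpha>\<close>, and the condition on \<open>N\<close> makes its effect
  of lower order.\<close>

section \<open>Positive operators\<close>

text \<open>Since r \<le> 1/2, the regression function need not lie in the range of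
  \<open>SK\<close>. The target \<open>f\<close> therefore varies with \<open>lam\<close>, the bound
  on its norm grows like \<open>lam powr (r - 1/2)\<close>, and its misfit at the sample points is a
  second random quantity to be controlled beside the noise. Both are measured in the norm dual to
  that of the empirical covariance plus \<open>lam\<close>; gradient descent turns such a bound
  \<open>Q\<close> into the bound \<open>3 * Q\<close> for the iterate as long as
  \<open>\<eta> * t * lam \<le> 1\<close>. The times averaged, those above T/2, are also late enough
  for the bias to be of order \<open>sqrt lam * norm f\<close>. Resolvent and covariance do not
  commute, so no joint spectral calculus is available for the operator inequality. It is obtained
  from quadratic forms: a trace is an integral of moments against the law of the features, and
  log-convexity of these moments takes the place of eigenvalues. The spectral theorem serves for
  powers of \<open>LK\<close>, for the inverse square root of the regularized covariance and for the
  effective dimension. The bound on the conditional expectation is reached by integrating over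
  events of the first stage.\<close>

definition psd_op :: "('a::real_inner \<Rightarrow> 'a) \<Rightarrow> bool" where
  "psd_op A \<longleftrightarrow> bounded_linear A \<and> (\<forall>x y. A x \<bullet> y = x \<bullet> A y) \<and> (\<forall>x. 0 \<le> A x \<bullet> x)"

lemma psd_opD:
  assumes "psd_op A"
  shows "bounded_linear A" "\<And>x y. A x \<bullet> y = x \<bullet> A y" "\<And>x. 0 \<le> A x \<bullet> x" "\<And>x. 0 \<le> x \<bullet> A x"
    "\<And>x y. A (x + y) = A x + A y" "\<And>x y. A (x - y) = A x - A y" "\<And>c x. A (c *\<^sub>R x) = c *\<^sub>R A x"
    "A 0 = 0"
  using assms unfolding psd_op_def
  by (auto simp: inner_commute bounded_linear.linear linear_add linear_diff linear_cmul linear_0)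

text \<open>Discriminant argument for the form of \<open>A\<close> along the line
  \<open>x + t *\<^sub>R y\<close>. The form is only semidefinite, so
  \<open>A y \<bullet> y = 0\<close> is treated apart.\<close>

lemma psd_op_cauchy_schwarz:
  assumes "psd_op A"
  shows "(A x \<bullet> y)\<^sup>2 \<le> (A x \<bullet> x) * (A y \<bullet> y)"
proof -
  note A = psd_opD[OF assms]
  have quad: "0 \<le> A x \<bullet> x + 2 * t * (A x \<bullet> y) + t\<^sup>2 * (A y \<bullet> y)" for t
  proof -
    have "0 \<le> A (x + t *\<^sub>R y) \<bullet> (x + t *\<^sub>R y)" by (rule A)
    moreover have "A y \<bullet> x = A x \<bullet> y" using A(2)[of x y] by (simp add: inner_commute)
    ultimately show ?thesis
      by (simp add: A inner_simps power2_eq_square algebra_simps)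
  qed
  show ?thesis
  proof (cases "A y \<bullet> y = 0")
    case True
    have "A x \<bullet> y = 0"
    proof (rule ccontr)
      assume "A x \<bullet> y \<noteq> 0"
      \<comment> \<open>With \<open>A y \<bullet> y = 0\<close> the quadratic is affine in
        \<open>t\<close>, and this \<open>t\<close> gives it the value -1.\<close>
      then show False
        using quad[of "- (A x \<bullet> x + 1) / (2 * (A x \<bullet> y))"] True by (simp add: field_simps)
    qed
    then show ?thesis using True by simp
  next
    case False
    then have pos: "A y \<bullet> y > 0" using A(3)[of y] by simp
    have "0 \<le> A x \<bullet> x - (A x \<bullet> y)\<^sup>2 / (A y \<bullet> y)"
      using quad[of "- (A x \<bullet> y) / (A y \<bullet> y)"] False
      by (simp add: field_simps power2_eq_square)
    then show ?thesis using pos by (simp add: field_simps)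
  qed
qed

section \<open>Log-convex sequences\<close>

text \<open>A zero propagates through the inequality in both directions, except that
  \<open>s 0\<close> may stay positive when all later terms vanish. Away from that case ratios of
  consecutive terms can be formed.\<close>

lemma log_convex_dichotomy:
  fixes s :: "nat \<Rightarrow> real"
  assumes nn: "\<And>i. 0 \<le> s i" and lc: "\<And>i. (s (Suc i))\<^sup>2 \<le> s i * s (Suc (Suc i))"
  obtains (zero) "\<And>i. s (Suc i) = 0" | (pos) "\<And>i. 0 < s i"
proof -
  have up: "s (Suc i) = 0" if "s i = 0" for i
    using lc[of i] that by simp
  have down: "s (Suc i) = 0" if "s (Suc (Suc i)) = 0" for i
    using lc[of i] that by simp
  show thesis
  proof (cases "s 1 = 0")
    case True
    have "s (Suc i) = 0" for i using True up by (induction i) auto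
    then show thesis by (rule zero)
  next
    case False
    have *: "s (Suc i) \<noteq> 0" for i using False down by (induction i) auto
    have "0 < s i" for i
      using * up nn[of i] by (metis order_le_less)
    then show thesis by (rule pos)
  qed
qed

text \<open>The ratios \<open>s (Suc i) / s i\<close> do not decrease; the claim compares those at
  \<open>a\<close> and \<open>a + d\<close> with denominators cleared.\<close>

lemma log_convex_shift:
  fixes s :: "nat \<Rightarrow> real"
  assumes nn: "\<And>i. 0 < s i" and lc: "\<And>i. (s (Suc i))\<^sup>2 \<le> s i * s (Suc (Suc i))"
  shows "s (Suc a) * s (a + d) \<le> s a * s (Suc (a + d))"
proof (induction d)
  case (Suc d)
  have "(s (Suc a) * s (a + Suc d)) * s (a + d) = (s (Suc a) * s (a + d)) * s (Suc (a + d))" by simp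
  also have "\<dots> \<le> s a * s (Suc (a + d)) * s (Suc (a + d))"
    using Suc nn[of "Suc (a+d)"] by (intro mult_right_mono) auto
  also have "\<dots> \<le> s a * (s (a + d) * s (Suc (Suc (a + d))))"
    using lc[of "a + d"] nn[of a] by (simp add: power2_eq_square mult.assoc)
  finally have "(s (Suc a) * s (a + Suc d)) * s (a + d) \<le> (s a * s (Suc (a + Suc d))) * s (a + d)"
    by (simp add: algebra_simps)
  then show ?case using nn[of "a + d"] mult_right_le_imp_le by blast
qed simp

text \<open>By \<open>log_convex_shift\<close>, lowering the smaller index and raising the larger
  one by 1 does not decrease the product. This is repeated until the smaller index is 0.\<close>

lemma log_convex_mult:
  fixes s :: "nat \<Rightarrow> real"
  assumes nn: "\<And>i. 0 \<le> s i" and lc: "\<And>i. (s (Suc i))\<^sup>2 \<le> s i * s (Suc (Suc i))"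
  shows "s a * s b \<le> s 0 * s (a + b)"
proof (cases rule: log_convex_dichotomy[where s=s, OF nn lc])
  case zero: 1
  then show ?thesis by (cases a; cases b) auto
next
  case pos: 2
  have main: "s a * s (a + d) \<le> s 0 * s (a + (a + d))" for a d
  proof (induction a arbitrary: d)
    case (Suc a)
    have "s (Suc a) * s (a + Suc d) \<le> s a * s (Suc (a + Suc d))"
      by (rule log_convex_shift[where s=s, OF pos lc])
    also have "\<dots> = s a * s (a + (Suc (Suc d)))" by simp
    also have "\<dots> \<le> s 0 * s (a + (a + Suc (Suc d)))" by (rule Suc)
    finally show ?case by simp
  qed simp
  show ?thesis
    using main[of a "b - a"] main[of b "a - b"]
    by (cases "a \<le> b") (auto simp: mult.commute add.commute)
qed

text \<open>For moments of a measure this is Jensen's inequality; here one factor \<open>s 1\<close>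
  after the other is absorbed by \<open>log_convex_mult\<close>.\<close>

lemma log_convex_power:
  fixes s :: "nat \<Rightarrow> real"
  assumes nn: "\<And>i. 0 \<le> s i" and lc: "\<And>i. (s (Suc i))\<^sup>2 \<le> s i * s (Suc (Suc i))"
  shows "s 1 ^ Suc p \<le> s (Suc p) * s 0 ^ p"
proof (induction p)
  case (Suc p)
  have "s 1 ^ Suc (Suc p) \<le> s 1 * (s (Suc p) * s 0 ^ p)"
    using Suc nn[of 1] by (simp add: mult_left_mono)
  also have "\<dots> \<le> (s 0 * s (1 + Suc p)) * s 0 ^ p"
    using log_convex_mult[where s=s and a=1 and b="Suc p", OF nn lc] nn by (simp add: mult.assoc[symmetric] mult_right_mono)
  finally show ?case by (simp add: algebra_simps)
qed simp

text \<open>If \<open>s i\<close> is the integral of x^i, this integrates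
  \<open>a * x^p - a^(p+1) \<le> x^(p+1)\<close>, which is clear from comparing x with a. It gives a
  lower bound for \<open>s (Suc p)\<close> that is affine in \<open>s p\<close> and therefore passes
  to expectations.\<close>

lemma log_convex_tangent:
  fixes s :: "nat \<Rightarrow> real"
  assumes nn: "\<And>i. 0 \<le> s i" and lc: "\<And>i. (s (Suc i))\<^sup>2 \<le> s i * s (Suc (Suc i))" and a: "0 \<le> a"
  shows "a * s p - a ^ Suc p * s 0 \<le> s (Suc p)"
proof (cases "a * s p \<le> s (Suc p)")
  case True
  have "0 \<le> a ^ Suc p * s 0" using a nn[of 0] by (simp del: power_Suc)
  then show ?thesis using True by linarith
next
  case False
  have le: "a * s p \<le> a ^ Suc p * s 0"
  proof (cases rule: log_convex_dichotomy[where s=s, OF nn lc])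
    case zero: 1
    then show ?thesis using nn a by (cases p) auto
  next
    case pos: 2
    \<comment> \<open>The ratio at \<open>p\<close> is below \<open>a\<close>, hence so are all
      earlier ones, and \<open>s p \<le> a ^ p * s 0\<close>. The left-hand side of the claim is
      then not positive.\<close>
    have rat: "s (Suc i) \<le> a * s i" if "i \<le> p" for i
    proof -
      have "s (Suc i) * s p \<le> s i * s (Suc p)"
        using log_convex_shift[where s=s and a=i and d="p - i", OF pos lc] that by simp
      also have "\<dots> \<le> s i * (a * s p)" using False pos[of i] by (intro mult_left_mono) auto
      finally have "s (Suc i) * s p \<le> (a * s i) * s p" by (simp add: algebra_simps)
      then show ?thesis using pos[of p] mult_right_le_imp_le by blast
    qed
    have "s i \<le> a ^ i * s 0" if "i \<le> p" for i using that
    proof (induction i)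
      case (Suc i)
      have "s (Suc i) \<le> a * s i" using Suc rat by simp
      also have "\<dots> \<le> a * (a ^ i * s 0)" using Suc a by (intro mult_left_mono) auto
      finally show ?case by simp
    qed simp
    from this[of p] a have "a * s p \<le> a * (a ^ p * s 0)" by (intro mult_left_mono) auto
    then show ?thesis by simp
  qed
  show ?thesis using le nn[of "Suc p"] by linarith
qed

section \<open>Moments of a pair of positive operators\<close>

text \<open>With Z the operator X^(1/2) T X^(1/2), this is the i-th moment of Z at the vector
  X^(1/2) g. The word in \<open>T\<close> and \<open>X\<close> avoids the square root.\<close>

definition moment :: "('a::real_inner \<Rightarrow> 'a) \<Rightarrow> ('a \<Rightarrow> 'a) \<Rightarrow> nat \<Rightarrow> 'a \<Rightarrow> real" where
  "moment X T i g = g \<bullet> X (((T \<circ> X) ^^ i) g)"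

text \<open>Moving one \<open>X\<close> and one \<open>T\<close> to the other side of the inner
  product turns \<open>g\<close> into \<open>T (X g)\<close> in both arguments and lowers the index
  by two. Facts on moments thus follow from indices 0 and 1, where they are facts on the forms of
  \<open>X\<close> and \<open>T\<close>.\<close>

lemma moment_shift:
  assumes "psd_op X" "psd_op T"
  shows "moment X T (Suc (Suc i)) g = moment X T i (T (X g))"
proof -
  have "((T \<circ> X) ^^ Suc (Suc i)) g = (T \<circ> X) (((T \<circ> X) ^^ Suc i) g)" by simp
  also have "\<dots> = T (X (((T \<circ> X) ^^ i) (T (X g))))" unfolding funpow_Suc_right by simp
  finally have "((T \<circ> X) ^^ Suc (Suc i)) g = T (X (((T \<circ> X) ^^ i) (T (X g))))" .
  then show ?thesis
    by (simp add: moment_def psd_opD(2)[OF assms(1), symmetric] psd_opD(2)[OF assms(2), symmetric])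
qed

lemma moment_nonneg:
  assumes "psd_op X" "psd_op T"
  shows "0 \<le> moment X T i g"
proof (induction i arbitrary: g rule: induct_nat_012)
  case 0
  then show ?case using psd_opD(4)[OF assms(1)] by (simp add: moment_def)
next
  case 1
  show ?case using psd_opD(4)[OF assms(2), of "X g"]
    by (simp add: moment_def psd_opD(2)[OF assms(1), symmetric])
next
  case (ge2 n)
  then show ?case by (simp add: moment_shift[OF assms])
qed

text \<open>Cauchy-Schwarz for the form of \<open>X\<close> when \<open>i = 0\<close> and for that
  of \<open>T\<close> when \<open>i = 1\<close>; the shift by two gives the rest.\<close>

lemma moment_log_convex:
  assumes "psd_op X" "psd_op T"
  shows "(moment X T (Suc i) g)\<^sup>2 \<le> moment X T i g * moment X T (Suc (Suc i)) g"
proof (induction i arbitrary: g rule: induct_nat_012)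
  case 0
  show ?case
    using psd_op_cauchy_schwarz[OF assms(1), of g "T (X g)"]
    by (simp add: moment_def psd_opD(2)[OF assms(1)] psd_opD(2)[OF assms(2)] inner_commute)
next
  case 1
  have "(T (X g) \<bullet> X (T (X g)))\<^sup>2 \<le> (T (X g) \<bullet> X g) * (T (X (T (X g))) \<bullet> X (T (X g)))"
    by (rule psd_op_cauchy_schwarz[OF assms(2)])
  then show ?case
    by (simp add: moment_def psd_opD(2)[OF assms(1)] psd_opD(2)[OF assms(2)] inner_commute)
next
  case (ge2 n)
  then show ?case by (simp add: moment_shift[OF assms])
qed

section \<open>Rank-one updates\<close>

text \<open>Sherman-Morrison formula: if \<open>X\<close> inverts \<open>S\<close>, this inverts
  \<open>S\<close> plus the rank-one operator of \<open>k\<close>.\<close>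

definition rank_one_update :: "'a::real_inner \<Rightarrow> ('a \<Rightarrow> 'a) \<Rightarrow> 'a \<Rightarrow> 'a" where
  "rank_one_update k X u = X u - (X k \<bullet> u / (1 + k \<bullet> X k)) *\<^sub>R X k"

lemma psd_op_rank_one_update:
  assumes X: "psd_op X"
  shows "psd_op (rank_one_update k X)"
    and "rank_one_update k X u \<bullet> u \<le> X u \<bullet> u"
proof -
  note XD = psd_opD[OF X]
  have l: "0 \<le> k \<bullet> X k" by (rule XD)
  have eq: "rank_one_update k X u \<bullet> u = X u \<bullet> u - (X k \<bullet> u)\<^sup>2 / (1 + k \<bullet> X k)" for u
    by (simp add: rank_one_update_def inner_simps power2_eq_square)
  show "rank_one_update k X u \<bullet> u \<le> X u \<bullet> u"
    using l by (simp add: eq)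
  have "bounded_linear (rank_one_update k X)"
    unfolding rank_one_update_def[abs_def]
    by (intro bounded_linear_sub XD bounded_linear_compose[OF bounded_linear_scaleR_left]
        bounded_linear_divide bounded_linear_compose[OF bounded_linear_divide] bounded_linear_inner_right)
  moreover have "rank_one_update k X x \<bullet> y = x \<bullet> rank_one_update k X y" for x y
    using XD(2)[of x y] XD(2)[of k x] XD(2)[of k y]
    by (simp add: rank_one_update_def inner_simps inner_commute algebra_simps)
  moreover have "0 \<le> rank_one_update k X u \<bullet> u" for u
  proof -
    have "(X k \<bullet> u)\<^sup>2 \<le> (X k \<bullet> k) * (X u \<bullet> u)" by (rule psd_op_cauchy_schwarz[OF X])
    also have "\<dots> \<le> (1 + k \<bullet> X k) * (X u \<bullet> u)"
      using XD(3)[of u] by (intro mult_right_mono) (auto simp: inner_commute)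
    finally show ?thesis using l by (simp add: eq field_simps)
  qed
  ultimately show "psd_op (rank_one_update k X)" by (simp add: psd_op_def)
qed

text \<open>Sherman-Morrison at a single vector \<open>f\<close>, so that an induction over
  observations can carry the inverted operator as an explicit sum.\<close>

lemma rank_one_update_inverse:
  assumes X: "psd_op X" and inv: "X (S f) = f"
  shows "rank_one_update k X (S f + (k \<bullet> f) *\<^sub>R k) = f"
proof -
  note XD = psd_opD[OF X]
  have l: "1 + k \<bullet> X k \<noteq> 0" using XD(4)[of k] by simp
  have "X k \<bullet> S f = k \<bullet> f" using inv by (simp add: XD(2))
  moreover have "X k \<bullet> k = k \<bullet> X k" by (rule XD)
  ultimately have "rank_one_update k X (S f + (k \<bullet> f) *\<^sub>R k)
      = f + ((k \<bullet> f) - (k \<bullet> f) * (1 + k \<bullet> X k) / (1 + k \<bullet> X k)) *\<^sub>R X k"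
    by (simp add: rank_one_update_def inner_simps XD inv algebra_simps add_divide_distrib)
  then show ?thesis using l by simp
qed

text \<open>Terms of this shape arise when a power with the updated resolvent is compared letter by
  letter with one for the old resolvent: \<open>b\<close> factors already carry \<open>X'\<close>,
  \<open>i\<close> factors still carry \<open>X\<close>.\<close>

definition mixed :: "('a::real_inner \<Rightarrow> 'a) \<Rightarrow> ('a \<Rightarrow> 'a) \<Rightarrow> ('a \<Rightarrow> 'a) \<Rightarrow> 'a \<Rightarrow> nat \<Rightarrow> nat \<Rightarrow> real" where
  "mixed X X' T x b i = T (((X' \<circ> T) ^^ b) x) \<bullet> ((X \<circ> T) ^^ i) x"

lemma mixed_eq_moment: "((X \<circ> T) ^^ i) (X k) = X (((T \<circ> X) ^^ i) k)"
  by (induction i) auto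

lemma mixed_self:
  assumes "psd_op X" "psd_op T"
  shows "mixed X X T (X k) b i = moment X T (Suc (b + i)) k"
proof -
  have sw: "T (((X \<circ> T) ^^ b) u) \<bullet> v = T u \<bullet> ((X \<circ> T) ^^ b) v" for u v
  proof (induction b arbitrary: v)
    case (Suc b)
    have "T (((X \<circ> T) ^^ Suc b) u) \<bullet> v = T (X (T (((X \<circ> T) ^^ b) u))) \<bullet> v" by simp
    also have "\<dots> = T (((X \<circ> T) ^^ b) u) \<bullet> X (T v)"
      by (simp add: psd_opD(2)[OF assms(1)] psd_opD(2)[OF assms(2)])
    also have "\<dots> = T u \<bullet> ((X \<circ> T) ^^ b) (X (T v))" by (rule Suc)
    finally show ?case unfolding funpow_Suc_right by simp
  qed simp
  have "mixed X X T (X k) b i = T (X k) \<bullet> ((X \<circ> T) ^^ b) (((X \<circ> T) ^^ i) (X k))"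
    unfolding mixed_def by (rule sw)
  also have "\<dots> = T (X k) \<bullet> ((X \<circ> T) ^^ (b + i)) (X k)" by (simp add: funpow_add)
  also have "\<dots> = moment X T (Suc (b + i)) k"
    by (simp add: moment_def mixed_eq_moment psd_opD(2)[OF assms(1)] psd_opD(2)[OF assms(2)])
  finally show ?thesis .
qed

text \<open>Trades the outermost \<open>X'\<close> on the left for an \<open>X\<close> on the right.
  The correction has rank one and passes through the vector \<open>X k\<close>, so it splits into a
  product of two scalars.\<close>

lemma mixed_Suc:
  fixes k :: "'a::real_inner"
  assumes X: "psd_op X" and T: "psd_op T"
  defines "X' \<equiv> rank_one_update k X"
  shows "mixed X X' T (X k) (Suc b) i
       = mixed X X' T (X k) b (Suc i)
         - mixed X X' T (X k) b 0 * moment X T (Suc i) k / (1 + k \<bullet> X k)"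
proof -
  have X': "psd_op X'" unfolding X'_def by (rule psd_op_rank_one_update[OF X])
  let ?w = "((X' \<circ> T) ^^ b) (X k)" and ?y = "((X \<circ> T) ^^ i) (X k)"
  have "mixed X X' T (X k) (Suc b) i = T (X' (T ?w)) \<bullet> ?y" by (simp add: mixed_def)
  also have "\<dots> = T ?w \<bullet> X' (T ?y)" by (simp add: psd_opD(2)[OF X'] psd_opD(2)[OF T])
  also have "\<dots> = T ?w \<bullet> X (T ?y) - (T ?w \<bullet> X k) * (X k \<bullet> T ?y) / (1 + k \<bullet> X k)"
    by (simp add: X'_def rank_one_update_def inner_simps)
  also have "X k \<bullet> T ?y = moment X T (Suc i) k"
    using mixed_self[OF X T, of k 0 i] by (simp add: mixed_def psd_opD(2)[OF T])
  finally show ?thesis by (simp add: mixed_def comp_def)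
qed

text \<open>Each trade of \<open>X'\<close> for \<open>X\<close> costs something nonnegative, whence
  the upper bound. The cost is a product of two moments at most, which log-convexity merges into one
  moment of full order times \<open>moment X T 0 k\<close>, the leverage
  \<open>k \<bullet> X k\<close>. After \<open>b\<close> trades the relative loss is at most
  \<open>b\<close> leverages.\<close>

lemma mixed_bounds:
  fixes k :: "'a::real_inner"
  assumes X: "psd_op X" and T: "psd_op T"
  defines "X' \<equiv> rank_one_update k X"
  shows "mixed X X' T (X k) b i \<le> moment X T (Suc (b + i)) k"
    and "(1 - real b * (k \<bullet> X k)) * moment X T (Suc (b + i)) k \<le> mixed X X' T (X k) b i"
proof -
  have X': "psd_op X'" unfolding X'_def by (rule psd_op_rank_one_update[OF X])
  have l: "0 \<le> k \<bullet> X k" by (rule psd_opD[OF X])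
  note mn = moment_nonneg[OF X T]
  have nn: "0 \<le> mixed X X' T (X k) b 0" for b
    using moment_nonneg[OF T X', of b "X k"] by (simp add: mixed_def moment_def inner_commute)
  have m0: "mixed X X' T (X k) 0 i = moment X T (Suc i) k" for i
    using mixed_self[OF X T, of k 0 i] by (simp add: mixed_def)
  note step = mixed_Suc[OF X T, of k, folded X'_def]
  have up: "mixed X X' T (X k) b i \<le> moment X T (Suc (b + i)) k" for b i
  proof (induction b arbitrary: i)
    case (Suc b)
    have "0 \<le> mixed X X' T (X k) b 0 * moment X T (Suc i) k / (1 + k \<bullet> X k)"
      using nn mn l by simp
    then show ?case using Suc[of "Suc i"] by (simp add: step)
  qed (simp add: m0)
  show "mixed X X' T (X k) b i \<le> moment X T (Suc (b + i)) k" by (rule up)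
  show "(1 - real b * (k \<bullet> X k)) * moment X T (Suc (b + i)) k \<le> mixed X X' T (X k) b i"
  proof (induction b arbitrary: i)
    case (Suc b)
    have "mixed X X' T (X k) b 0 * moment X T (Suc i) k / (1 + k \<bullet> X k)
        \<le> mixed X X' T (X k) b 0 * moment X T (Suc i) k"
      using mult_nonneg_nonneg[OF nn[of b] mn[of "Suc i" k]] l by (simp add: divide_le_eq mult_left_le algebra_simps)
    also have "\<dots> \<le> moment X T (Suc b) k * moment X T (Suc i) k"
      using up[of b 0] mn by (intro mult_right_mono) auto
    also have "\<dots> \<le> moment X T 0 k * moment X T (Suc b + Suc i) k"
      by (rule log_convex_mult[where s = "\<lambda>i. moment X T i k", OF mn moment_log_convex[OF X T]])
    finally show ?case using Suc[of "Suc i"]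
      by (simp add: step moment_def[of X T 0 k] algebra_simps)
  qed (simp add: m0)
qed

text \<open>Telescoping over words in which the first \<open>p - i\<close> resolvents are updated
  and the last \<open>i\<close> are not: consecutive words differ in one resolvent, whose change has
  rank one. Every term is then a product of two linear functionals of \<open>g\<close>, ready to be
  integrated into an inner product with \<open>T\<close>.\<close>

lemma moment_diff_rank_one_update:
  fixes k :: "'a::real_inner"
  assumes X: "psd_op X" and T: "psd_op T"
  defines "X' \<equiv> rank_one_update k X"
  shows "moment X T p g - moment X' T p g
       = (\<Sum>i\<le>p. (g \<bullet> ((X' \<circ> T) ^^ (p - i)) (X k)) * (g \<bullet> ((X \<circ> T) ^^ i) (X k))) / (1 + k \<bullet> X k)"
proof -
  have X': "psd_op X'" unfolding X'_def by (rule psd_op_rank_one_update[OF X])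
  have lin: "((X' \<circ> T) ^^ b) (u - c *\<^sub>R v) = ((X' \<circ> T) ^^ b) u - c *\<^sub>R ((X' \<circ> T) ^^ b) v" for b u v c
    by (induction b) (simp_all add: psd_opD[OF X'] psd_opD[OF T])
  have adj: "X k \<bullet> ((T \<circ> X) ^^ i) g = g \<bullet> ((X \<circ> T) ^^ i) (X k)" for i
  proof -
    have "((X \<circ> T) ^^ i) u \<bullet> v = u \<bullet> ((T \<circ> X) ^^ i) v" for u v
    proof (induction i arbitrary: v)
      case (Suc i)
      have "((X \<circ> T) ^^ Suc i) u \<bullet> v = ((X \<circ> T) ^^ i) u \<bullet> T (X v)"
        by (simp add: psd_opD(2)[OF X] psd_opD(2)[OF T])
      also have "\<dots> = u \<bullet> ((T \<circ> X) ^^ i) (T (X v))" by (rule Suc)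
      finally show ?case unfolding funpow_Suc_right by simp
    qed simp
    then show ?thesis by (simp add: inner_commute)
  qed
  define W where "W i = g \<bullet> ((X' \<circ> T) ^^ (p - i)) (X (((T \<circ> X) ^^ i) g))" for i
  define V where "V i = g \<bullet> ((X' \<circ> T) ^^ (p - i)) (X' (((T \<circ> X) ^^ i) g))" for i
  have WV: "W i - V i = (g \<bullet> ((X' \<circ> T) ^^ (p - i)) (X k)) * (g \<bullet> ((X \<circ> T) ^^ i) (X k)) / (1 + k \<bullet> X k)" for i
  proof -
    have "X' (((T \<circ> X) ^^ i) g) = X (((T \<circ> X) ^^ i) g) - ((X k \<bullet> ((T \<circ> X) ^^ i) g) / (1 + k \<bullet> X k)) *\<^sub>R X k"
      by (simp add: X'_def rank_one_update_def)
    then show ?thesis unfolding W_def V_def by (simp add: lin inner_simps adj)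
  qed
  have shift: "V (Suc i) = W i" if "Suc i \<le> p" for i
  proof -
    have "p - i = Suc (p - Suc i)" using that by simp
    moreover have "((X' \<circ> T) ^^ Suc (p - Suc i)) u = ((X' \<circ> T) ^^ (p - Suc i)) (X' (T u))" for u
      by (simp only: funpow_Suc_right comp_apply)
    moreover have "((T \<circ> X) ^^ Suc i) g = T (X (((T \<circ> X) ^^ i) g))" by simp
    ultimately have "((X' \<circ> T) ^^ (p - i)) (X (((T \<circ> X) ^^ i) g))
        = ((X' \<circ> T) ^^ (p - Suc i)) (X' (((T \<circ> X) ^^ Suc i) g))"
      by (simp only:)
    then show ?thesis by (simp add: V_def W_def)
  qed
  have "(\<Sum>i\<le>m. W i - V i) = W m - V 0" if "m \<le> p" for m
    using that by (induction m) (auto simp: shift)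
  from this[of p] have "(\<Sum>i\<le>p. W i - V i) = W p - V 0" by simp
  moreover have "W p = moment X T p g" by (simp add: W_def moment_def)
  moreover have "V 0 = moment X' T p g"
    by (simp add: V_def moment_def mixed_eq_moment)
  ultimately show ?thesis by (simp add: WV sum_divide_distrib)
qed

section \<open>Lower bounds for empirical covariance operators\<close>

text \<open>The discriminant argument under the integral sign. It carries log-convexity from moments
  to their integrals.\<close>

lemma integral_prod_le:
  fixes a b c :: "'a \<Rightarrow> real"
  assumes "integrable M a" "integrable M b" "integrable M c"
    and "\<And>x. x \<in> space M \<Longrightarrow> 0 \<le> a x" "\<And>x. x \<in> space M \<Longrightarrow> 0 \<le> c x"
    and "\<And>x. x \<in> space M \<Longrightarrow> (b x)\<^sup>2 \<le> a x * c x"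
  shows "(\<integral>x. b x \<partial>M)\<^sup>2 \<le> (\<integral>x. a x \<partial>M) * (\<integral>x. c x \<partial>M)"
proof -
  have quad: "0 \<le> (\<integral>x. a x \<partial>M) + 2 * t * (\<integral>x. b x \<partial>M) + t\<^sup>2 * (\<integral>x. c x \<partial>M)" for t
  proof -
    have pt: "0 \<le> a x + 2 * t * b x + t\<^sup>2 * c x" if x: "x \<in> space M" for x
    proof -
      have "\<bar>b x\<bar> \<le> sqrt (a x) * sqrt (c x)"
        using real_sqrt_le_mono[OF assms(6)[OF x]] by (simp add: real_sqrt_mult)
      then have "\<bar>t * b x\<bar> \<le> \<bar>t\<bar> * (sqrt (a x) * sqrt (c x))"
        by (simp add: abs_mult mult_left_mono)
      moreover have "0 \<le> (sqrt (a x) - \<bar>t\<bar> * sqrt (c x))\<^sup>2" by simp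
      ultimately show ?thesis
        using assms(4)[OF x] assms(5)[OF x]
        by (simp add: power2_diff power_mult_distrib algebra_simps)
    qed
    have "0 \<le> (\<integral>x. a x + 2 * t * b x + t\<^sup>2 * c x \<partial>M)"
      using pt by (intro integral_nonneg_AE) auto
    then show ?thesis using assms(1-3) by simp
  qed
  let ?A = "\<integral>x. a x \<partial>M" and ?B = "\<integral>x. b x \<partial>M" and ?C = "\<integral>x. c x \<partial>M"
  have C: "0 \<le> ?C" using assms(5) by (intro integral_nonneg_AE) auto
  show ?thesis
  proof (cases "?C = 0")
    case True
    have "?B = 0"
    proof (rule ccontr)
      assume "?B \<noteq> 0"
      then show False using quad[of "- (?A + 1) / (2 * ?B)"] True by (simp add: field_simps)
    qed
    then show ?thesis using True by simp
  next
    case False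
    then have "?C > 0" using C by simp
    then show ?thesis using quad[of "- ?B / ?C"] by (simp add: field_simps power2_eq_square)
  qed
qed

lemma moment_continuous:
  assumes "psd_op X" "psd_op T"
  shows "continuous_on UNIV (moment X T i)"
proof -
  have b: "bounded_linear ((T \<circ> X) ^^ i)"
  proof (induction i)
    case (Suc i)
    have "bounded_linear (\<lambda>u. T (X (((T \<circ> X) ^^ i) u)))"
      by (intro bounded_linear_compose[OF psd_opD(1)[OF assms(2)]]
          bounded_linear_compose[OF psd_opD(1)[OF assms(1)]] Suc)
    then show ?case by (simp add: comp_def)
  qed (simp add: id_def)
  have "continuous_on UNIV (\<lambda>g. g \<bullet> X (((T \<circ> X) ^^ i) g))"
    by (intro continuous_intros bounded_linear.continuous_on[OF psd_opD(1)[OF assms(1)]]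
        bounded_linear.continuous_on[OF b])
  then show ?thesis by (simp add: moment_def[abs_def])
qed

lemma moment_bound:
  assumes "psd_op X" "psd_op T" and "\<And>u. norm (X u) \<le> a * norm u" "\<And>u. norm (T u) \<le> b * norm u"
    and "0 \<le> a" "0 \<le> b"
  shows "moment X T i g \<le> a * (a * b) ^ i * (norm g)\<^sup>2"
proof -
  have pw: "norm (((T \<circ> X) ^^ i) g) \<le> (a * b) ^ i * norm g"
  proof (induction i)
    case (Suc i)
    have "norm (((T \<circ> X) ^^ Suc i) g) \<le> b * norm (X (((T \<circ> X) ^^ i) g))" using assms(4) by simp
    also have "\<dots> \<le> b * (a * norm (((T \<circ> X) ^^ i) g))" using assms by (intro mult_left_mono) auto
    also have "\<dots> \<le> b * (a * ((a * b) ^ i * norm g))" by (intro mult_left_mono Suc assms(5,6))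
    finally show ?case by (simp add: comp_def algebra_simps)
  qed simp
  have "moment X T i g \<le> norm g * norm (X (((T \<circ> X) ^^ i) g))"
    unfolding moment_def by (rule norm_cauchy_schwarz)
  also have "\<dots> \<le> norm g * (a * norm (((T \<circ> X) ^^ i) g))" using assms(3) by (intro mult_left_mono) auto
  also have "\<dots> \<le> norm g * (a * ((a * b) ^ i * norm g))" using assms pw by (intro mult_left_mono) auto
  finally show ?thesis by (simp add: power2_eq_square algebra_simps)
qed

section \<open>The covariance operator of a bounded random vector and the trace functional\<close>

locale bounded_random_vector = prob_space M for M :: "'a measure" +
  fixes k :: "'a \<Rightarrow> 'h::{real_inner,banach,second_countable_topology}" and \<kappa> :: real
  assumes k_measurable [measurable]: "k \<in> borel_measurable M"
    and k_bound: "\<And>x. x \<in> space M \<Longrightarrow> norm (k x) \<le> \<kappa>"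
begin

definition T :: "'h \<Rightarrow> 'h" where
  "T u = (\<integral>x. (k x \<bullet> u) *\<^sub>R k x \<partial>M)"

lemma kappa_nonneg: "0 \<le> \<kappa>"
proof -
  obtain x where "x \<in> space M" using not_empty by blast
  then show ?thesis using k_bound[of x] norm_ge_zero[of "k x"] by linarith
qed

lemma abs_inner_k: "x \<in> space M \<Longrightarrow> \<bar>k x \<bullet> u\<bar> \<le> \<kappa> * norm u"
  by (rule order_trans[OF Cauchy_Schwarz_ineq2]) (intro mult_right_mono k_bound norm_ge_zero)

lemma integrable_inner_scale: "integrable M (\<lambda>x. (k x \<bullet> u) *\<^sub>R k x)"
proof (rule integrable_const_bound[where B = "\<kappa> * norm u * \<kappa>"])
  show "AE x in M. norm ((k x \<bullet> u) *\<^sub>R k x) \<le> \<kappa> * norm u * \<kappa>"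
    by (rule AE_I2) (auto intro!: mult_mono abs_inner_k k_bound mult_nonneg_nonneg kappa_nonneg)
qed simp

lemma integrable_inner_mult: "integrable M (\<lambda>x. (k x \<bullet> u) * (k x \<bullet> v))"
proof (rule integrable_const_bound[where B = "\<kappa> * norm u * (\<kappa> * norm v)"])
  show "AE x in M. norm ((k x \<bullet> u) * (k x \<bullet> v)) \<le> \<kappa> * norm u * (\<kappa> * norm v)"
    by (rule AE_I2) (auto simp: abs_mult intro!: mult_mono abs_inner_k mult_nonneg_nonneg kappa_nonneg)
qed simp

lemma T_inner: "T u \<bullet> v = (\<integral>x. (k x \<bullet> u) * (k x \<bullet> v) \<partial>M)"
proof -
  have "(\<integral>x. ((k x \<bullet> u) *\<^sub>R k x) \<bullet> v \<partial>M) = (\<integral>x. (k x \<bullet> u) *\<^sub>R k x \<partial>M) \<bullet> v"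
    by (rule integral_inner_left) (use integrable_inner_scale in auto)
  then show ?thesis by (simp add: T_def)
qed

lemma T_bound: "norm (T u) \<le> \<kappa>\<^sup>2 * norm u"
proof -
  have "norm (T u) \<le> (\<integral>x. norm ((k x \<bullet> u) *\<^sub>R k x) \<partial>M)"
    unfolding T_def by (rule integral_norm_bound)
  also have "\<dots> \<le> (\<integral>x. \<kappa> * norm u * \<kappa> \<partial>M)"
    by (intro integral_mono integrable_norm integrable_inner_scale)
      (auto intro!: mult_mono abs_inner_k k_bound mult_nonneg_nonneg kappa_nonneg)
  also have "\<dots> = \<kappa>\<^sup>2 * norm u" by (simp add: prob_space power2_eq_square)
  finally show ?thesis .
qed

lemma psd_op_T: "psd_op T"
proof -
  have "bounded_linear T"
  proof (rule bounded_linear_intro[where K = "\<kappa>\<^sup>2"])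
    fix u v :: 'h and c :: real
    show "T (u + v) = T u + T v"
      using integrable_inner_scale[of u] integrable_inner_scale[of v]
      by (simp add: T_def inner_simps scaleR_add_left)
    have "T (c *\<^sub>R u) = (\<integral>x. c *\<^sub>R ((k x \<bullet> u) *\<^sub>R k x) \<partial>M)" by (simp add: T_def)
    then show "T (c *\<^sub>R u) = c *\<^sub>R T u" by (simp only: T_def integral_scaleR_right)
    show "norm (T u) \<le> norm u * \<kappa>\<^sup>2" using T_bound[of u] by (simp add: mult.commute)
  qed
  moreover have "T u \<bullet> v = u \<bullet> T v" for u v
    by (simp add: T_inner inner_commute[of u] mult.commute)
  moreover have "0 \<le> T u \<bullet> u" for u
    by (simp add: T_inner)
  ultimately show ?thesis by (simp add: psd_op_def)
qed

text \<open>The trace of \<open>(X \<circ> T) ^^ Suc i\<close>, expressed without a basis.\<close>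

definition phi :: "('h \<Rightarrow> 'h) \<Rightarrow> nat \<Rightarrow> real" where
  "phi X i = (\<integral>x. moment X T i (k x) \<partial>M)"

lemma integrable_moment:
  assumes "psd_op X"
  shows "integrable M (\<lambda>x. moment X T i (k x))"
proof -
  obtain a where a: "0 \<le> a" "\<And>u. norm (X u) \<le> norm u * a"
    using bounded_linear.nonneg_bounded[OF psd_opD(1)[OF assms]] by auto
  have meas: "moment X T i \<in> borel_measurable borel"
    by (rule borel_measurable_continuous_onI[OF moment_continuous[OF assms psd_op_T]])
  show ?thesis
  proof (rule integrable_const_bound[where B = "a * (a * \<kappa>\<^sup>2) ^ i * \<kappa>\<^sup>2"])
    show "AE x in M. norm (moment X T i (k x)) \<le> a * (a * \<kappa>\<^sup>2) ^ i * \<kappa>\<^sup>2"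
    proof (rule AE_I2)
      fix x assume x: "x \<in> space M"
      have "moment X T i (k x) \<le> a * (a * \<kappa>\<^sup>2) ^ i * (norm (k x))\<^sup>2"
        using a T_bound by (intro moment_bound[OF assms psd_op_T]) (auto simp: mult.commute)
      also have "\<dots> \<le> a * (a * \<kappa>\<^sup>2) ^ i * \<kappa>\<^sup>2"
        using a k_bound[OF x] by (intro mult_left_mono power_mono) auto
      finally show "norm (moment X T i (k x)) \<le> a * (a * \<kappa>\<^sup>2) ^ i * \<kappa>\<^sup>2"
        using moment_nonneg[OF assms psd_op_T] by simp
    qed
    show "(\<lambda>x. moment X T i (k x)) \<in> borel_measurable M"
      using meas by measurable
  qed
qed

lemma phi_nonneg: "psd_op X \<Longrightarrow> 0 \<le> phi X i"
  unfolding phi_def by (intro integral_nonneg_AE AE_I2 moment_nonneg psd_op_T)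

lemma phi_log_convex:
  assumes "psd_op X"
  shows "(phi X (Suc i))\<^sup>2 \<le> phi X i * phi X (Suc (Suc i))"
  unfolding phi_def
  by (intro integral_prod_le integrable_moment moment_nonneg moment_log_convex psd_op_T assms)

text \<open>Integrating the telescoped difference over the law of \<open>k x\<close> gives a
  first-order decrease of p + 1 times the moment of order p + 1 at the new observation. The
  remaining factor pays for the denominator in the Sherman-Morrison formula and for the trades in
  \<open>mixed_bounds\<close>.\<close>

lemma phi_rank_one_update:
  assumes X: "psd_op X" and l: "g \<bullet> X g \<le> \<epsilon>" and eps: "real p * \<epsilon> \<le> 1"
  shows "phi (rank_one_update g X) p
       \<le> phi X p - (real p + 1) * ((1 - real p * \<epsilon>) / (1 + \<epsilon>)) * moment X T (Suc p) g"
proof -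
  define X' where "X' = rank_one_update g X"
  have X': "psd_op X'" unfolding X'_def by (rule psd_op_rank_one_update[OF X])
  have l0: "0 \<le> g \<bullet> X g" by (rule psd_opD[OF X])
  have m0: "0 \<le> moment X T (Suc p) g" by (rule moment_nonneg[OF X psd_op_T])
  have int: "integrable M (\<lambda>x. (k x \<bullet> u) * (k x \<bullet> v))" for u v by (rule integrable_inner_mult)
  have "phi X p - phi X' p = (\<integral>x. moment X T p (k x) - moment X' T p (k x) \<partial>M)"
    unfolding phi_def by (simp add: integrable_moment X X')
  also have "\<dots> = (\<integral>x. (\<Sum>i\<le>p. (k x \<bullet> ((X' \<circ> T) ^^ (p - i)) (X g)) * (k x \<bullet> ((X \<circ> T) ^^ i) (X g)))
        / (1 + g \<bullet> X g) \<partial>M)"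
    unfolding X'_def by (simp only: moment_diff_rank_one_update[OF X psd_op_T])
  also have "\<dots> = (\<Sum>i\<le>p. mixed X X' T (X g) (p - i) i) / (1 + g \<bullet> X g)"
    by (simp add: int mixed_def T_inner)
  finally have diff: "phi X p - phi X' p = (\<Sum>i\<le>p. mixed X X' T (X g) (p - i) i) / (1 + g \<bullet> X g)" .
  have summand: "(1 - real p * \<epsilon>) * moment X T (Suc p) g \<le> mixed X X' T (X g) (p - i) i" if "i \<le> p" for i
  proof -
    have "real (p - i) * (g \<bullet> X g) \<le> real p * \<epsilon>" using l l0 by (intro mult_mono) auto
    then have "(1 - real p * \<epsilon>) * moment X T (Suc p) g
        \<le> (1 - real (p - i) * (g \<bullet> X g)) * moment X T (Suc ((p - i) + i)) g"
      using m0 that by (simp add: mult_right_mono)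
    also have "\<dots> \<le> mixed X X' T (X g) (p - i) i"
      unfolding X'_def by (rule mixed_bounds[OF X psd_op_T])
    finally show ?thesis .
  qed
  have "(real p + 1) * ((1 - real p * \<epsilon>) * moment X T (Suc p) g)
      = (\<Sum>i\<le>p. (1 - real p * \<epsilon>) * moment X T (Suc p) g)" by simp
  also have "\<dots> \<le> (\<Sum>i\<le>p. mixed X X' T (X g) (p - i) i)" by (intro sum_mono summand) auto
  finally have "(real p + 1) * ((1 - real p * \<epsilon>) * moment X T (Suc p) g) / (1 + g \<bullet> X g) \<le> phi X p - phi X' p"
    unfolding diff using l0 by (intro divide_right_mono) auto
  moreover have "(real p + 1) * ((1 - real p * \<epsilon>) * moment X T (Suc p) g) / (1 + \<epsilon>)
      \<le> (real p + 1) * ((1 - real p * \<epsilon>) * moment X T (Suc p) g) / (1 + g \<bullet> X g)"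
    using l l0 m0 eps by (intro divide_left_mono mult_nonneg_nonneg mult_pos_pos) auto
  ultimately show ?thesis by (simp add: X'_def)
qed

text \<open>The largest eigenvalue of a positive operator is at most its trace, here for the power
  of order 2q + 1 of X^(1/2) T X^(1/2). The even index lets the word split symmetrically around a
  single \<open>T\<close>, which is then written as an integral.\<close>

lemma phi_dominates:
  assumes X: "psd_op X"
  shows "moment X T (Suc (2 * q)) g \<le> phi X (2 * q) * (g \<bullet> X g)"
proof -
  have ev: "moment X T (2 * q + j) h = moment X T j (((T \<circ> X) ^^ q) h)" for q j h
  proof (induction q arbitrary: h)
    case (Suc q)
    have "moment X T (2 * Suc q + j) h = moment X T (2 * q + j) (T (X h))"
      by (simp add: moment_shift[OF X psd_op_T])
    also have "\<dots> = moment X T j (((T \<circ> X) ^^ q) (T (X h)))" by (rule Suc)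
    finally show ?case unfolding funpow_Suc_right by (simp add: comp_def)
  qed simp
  have adj: "u \<bullet> X (((T \<circ> X) ^^ q) v) = ((T \<circ> X) ^^ q) u \<bullet> X v" for u v q
  proof (induction q arbitrary: v)
    case (Suc q)
    have "u \<bullet> X (((T \<circ> X) ^^ Suc q) v) = u \<bullet> X (((T \<circ> X) ^^ q) (T (X v)))"
      unfolding funpow_Suc_right by simp
    also have "\<dots> = ((T \<circ> X) ^^ q) u \<bullet> X (T (X v))" by (rule Suc)
    finally show ?case by (simp add: comp_def psd_opD(2)[OF X] psd_opD(2)[OF psd_op_T])
  qed simp
  let ?w = "((T \<circ> X) ^^ q) g"
  have "moment X T (Suc (2 * q)) g = moment X T 1 ?w" using ev[of q 1 g] by simp
  also have "\<dots> = T (X ?w) \<bullet> X ?w"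
    by (simp add: moment_def psd_opD(2)[OF X] psd_opD(2)[OF psd_op_T])
  also have "\<dots> = (\<integral>x. (k x \<bullet> X ?w) * (k x \<bullet> X ?w) \<partial>M)" by (rule T_inner)
  also have "\<dots> \<le> (\<integral>x. moment X T (2 * q) (k x) * (g \<bullet> X g) \<partial>M)"
  proof (intro integral_mono integrable_inner_mult)
    show "integrable M (\<lambda>x. moment X T (2 * q) (k x) * (g \<bullet> X g))"
      by (intro integrable_mult_left integrable_moment X)
    fix x
    have "(k x \<bullet> X ?w) * (k x \<bullet> X ?w) = (X (((T \<circ> X) ^^ q) (k x)) \<bullet> g)\<^sup>2"
      by (simp add: adj psd_opD(2)[OF X] power2_eq_square)
    also have "\<dots> \<le> (X (((T \<circ> X) ^^ q) (k x)) \<bullet> ((T \<circ> X) ^^ q) (k x)) * (X g \<bullet> g)"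
      by (rule psd_op_cauchy_schwarz[OF X])
    also have "X (((T \<circ> X) ^^ q) (k x)) \<bullet> ((T \<circ> X) ^^ q) (k x) = moment X T (2 * q) (k x)"
      using ev[of q 0 "k x"] by (simp add: moment_def inner_commute)
    finally show "(k x \<bullet> X ?w) * (k x \<bullet> X ?w) \<le> moment X T (2 * q) (k x) * (g \<bullet> X g)"
      by (simp add: comp_def inner_commute)
  qed
  finally show ?thesis by (simp add: phi_def)
qed

text \<open>The moments at \<open>S f\<close> start with the two forms to be compared:
  \<open>s 0\<close> belongs to \<open>S\<close> and \<open>s 1\<close> to \<open>T\<close>. Taking
  the root of order 2q + 1 through \<open>log_convex_power\<close> turns the trace bound into an
  operator inequality.\<close>

lemma T_le_of_phi_le:
  assumes X: "psd_op X" and inv: "X (S f) = f" and th: "0 \<le> \<theta>" and phi: "phi X (2 * q) \<le> \<theta> ^ Suc (2 * q)"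
  shows "T f \<bullet> f \<le> \<theta> * (S f \<bullet> f)"
proof -
  define s where "s i = moment X T i (S f)" for i
  have s0: "s 0 = S f \<bullet> f" and s1: "s 1 = T f \<bullet> f"
    using inv by (auto simp: s_def moment_def psd_opD(2)[OF X, symmetric] inner_commute)
  have nn: "0 \<le> s i" for i unfolding s_def by (rule moment_nonneg[OF X psd_op_T])
  have lc: "(s (Suc i))\<^sup>2 \<le> s i * s (Suc (Suc i))" for i unfolding s_def by (rule moment_log_convex[OF X psd_op_T])
  have alg: "a ^ Suc m * b * b ^ m = (a * b) ^ Suc m" for a b :: real and m
    by (induction m) (simp_all add: algebra_simps)
  have "s (Suc (2 * q)) \<le> phi X (2 * q) * s 0"
    using phi_dominates[OF X, of q "S f"] by (simp add: s_def moment_def)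
  also have "\<dots> \<le> \<theta> ^ Suc (2 * q) * s 0" using phi nn[of 0] by (rule mult_right_mono)
  finally have le: "s (Suc (2 * q)) \<le> \<theta> ^ Suc (2 * q) * s 0" .
  have "s 1 ^ Suc (2 * q) \<le> s (Suc (2 * q)) * s 0 ^ (2 * q)"
    by (rule log_convex_power[where s = s, OF nn lc])
  also have "\<dots> \<le> (\<theta> ^ Suc (2 * q) * s 0) * s 0 ^ (2 * q)" using le nn[of 0] by (intro mult_right_mono) auto
  also have "\<dots> = (\<theta> * s 0) ^ Suc (2 * q)" by (rule alg)
  finally have "s 1 \<le> \<theta> * s 0"
    by (rule power_le_imp_le_base) (use th nn[of 0] in simp)
  then show ?thesis by (simp only: s0 s1)
qed

lemma phi_0_le:
  assumes X: "psd_op X" and b: "\<And>u. X u \<bullet> u \<le> b * (norm u)\<^sup>2" "0 \<le> b"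
  shows "phi X 0 \<le> b * \<kappa>\<^sup>2"
proof -
  have "phi X 0 \<le> (\<integral>x. b * \<kappa>\<^sup>2 \<partial>M)"
    unfolding phi_def
  proof (intro integral_mono integrable_moment X)
    fix x assume x: "x \<in> space M"
    have "moment X T 0 (k x) \<le> b * (norm (k x))\<^sup>2" using b(1)[of "k x"] by (simp add: moment_def inner_commute)
    also have "\<dots> \<le> b * \<kappa>\<^sup>2" using k_bound[OF x] b by (intro mult_left_mono power_mono) auto
    finally show "moment X T 0 (k x) \<le> b * \<kappa>\<^sup>2" .
  qed simp
  then show ?thesis by (simp add: prob_space)
qed

text \<open>The inverse of \<open>c\<close> times the identity plus the sum of the rank-one
  operators of the first \<open>j\<close> observations, as \<open>resolvent_inverse\<close>
  confirms. The recursion makes measurability in the sample evident.\<close>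

primrec resolvent :: "real \<Rightarrow> (nat \<Rightarrow> 'a) \<Rightarrow> nat \<Rightarrow> 'h \<Rightarrow> 'h" where
  "resolvent c \<omega> 0 = (\<lambda>u. (1 / c) *\<^sub>R u)"
| "resolvent c \<omega> (Suc j) = rank_one_update (k (\<omega> j)) (resolvent c \<omega> j)"

lemma resolvent_upd: "j \<le> i \<Longrightarrow> resolvent c (fun_upd \<omega> i x) j = resolvent c \<omega> j"
  by (induction j) auto

lemma psd_op_resolvent:
  assumes "0 < c"
  shows "psd_op (resolvent c \<omega> j)" and "resolvent c \<omega> j u \<bullet> u \<le> (norm u)\<^sup>2 / c"
proof -
  have "psd_op (resolvent c \<omega> j) \<and> (\<forall>u. resolvent c \<omega> j u \<bullet> u \<le> (norm u)\<^sup>2 / c)"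
  proof (induction j)
    case 0
    then show ?case using assms
      by (auto simp: psd_op_def dot_square_norm intro!: bounded_linear_scaleR_right)
  next
    case (Suc j)
    then show ?case using psd_op_rank_one_update[of "resolvent c \<omega> j" "k (\<omega> j)"]
      by (auto intro: order_trans)
  qed
  then show "psd_op (resolvent c \<omega> j)" "resolvent c \<omega> j u \<bullet> u \<le> (norm u)\<^sup>2 / c" by auto
qed

lemma resolvent_inverse:
  assumes "0 < c"
  shows "resolvent c \<omega> j (c *\<^sub>R f + (\<Sum>i<j. (k (\<omega> i) \<bullet> f) *\<^sub>R k (\<omega> i))) = f"
proof (induction j)
  case (Suc j)
  then show ?case
    using rank_one_update_inverse[OF psd_op_resolvent(1)[OF assms], of \<omega> j
        "\<lambda>f. c *\<^sub>R f + (\<Sum>i<j. (k (\<omega> i) \<bullet> f) *\<^sub>R k (\<omega> i))" f "k (\<omega> j)"]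
    by (simp add: add.assoc)
qed (use assms in simp)

lemma measurable_resolvent:
  assumes N: "\<And>i. i < j \<Longrightarrow> (\<lambda>z. w z i) \<in> N \<rightarrow>\<^sub>M M" and [measurable]: "g \<in> borel_measurable N"
  shows "(\<lambda>z. resolvent c (w z) j (g z)) \<in> borel_measurable N"
  using assms
proof (induction j arbitrary: g)
  case (Suc j)
  have 1: "(\<lambda>z. resolvent c (w z) j (h z)) \<in> borel_measurable N" if "h \<in> borel_measurable N" for h
    using Suc that by simp
  have [measurable]: "(\<lambda>z. w z j) \<in> N \<rightarrow>\<^sub>M M" using Suc.prems by simp
  have m: "(\<lambda>z. k (w z j)) \<in> borel_measurable N" by measurable
  note [measurable] = m 1[OF m] 1[OF Suc.prems(2)]
  show ?case unfolding resolvent.simps rank_one_update_def using Suc.prems(2) by measurable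
qed simp

lemma T_continuous: "continuous_on UNIV T"
  by (intro bounded_linear.continuous_on[OF psd_opD(1)[OF psd_op_T]] continuous_on_id)

lemma measurable_moment_resolvent:
  assumes N: "\<And>i. i < j \<Longrightarrow> (\<lambda>z. w z i) \<in> N \<rightarrow>\<^sub>M M" and g: "g \<in> borel_measurable N"
  shows "(\<lambda>z. moment (resolvent c (w z) j) T p (g z)) \<in> borel_measurable N"
proof -
  have [measurable]: "T \<in> borel_measurable borel" by (rule borel_measurable_continuous_onI[OF T_continuous])
  have 1: "(\<lambda>z. ((T \<circ> resolvent c (w z) j) ^^ p) (g z)) \<in> borel_measurable N"
  proof (induction p)
    case (Suc p)
    have "(\<lambda>z. resolvent c (w z) j (((T \<circ> resolvent c (w z) j) ^^ p) (g z))) \<in> borel_measurable N"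
      by (rule measurable_resolvent[OF N Suc])
    then have "(\<lambda>z. T (resolvent c (w z) j (((T \<circ> resolvent c (w z) j) ^^ p) (g z)))) \<in> borel_measurable N"
      by measurable
    then show ?case unfolding funpow.simps comp_apply .
  qed (use g in simp)
  note [measurable] = measurable_resolvent[OF N 1, where c = c] g
  show ?thesis unfolding moment_def by measurable
qed

lemma measurable_phi_resolvent:
  assumes N: "\<And>i. i < j \<Longrightarrow> (\<lambda>z. w z i) \<in> N \<rightarrow>\<^sub>M M"
  shows "(\<lambda>z. phi (resolvent c (w z) j) p) \<in> borel_measurable N"
proof -
  have "(\<lambda>z. moment (resolvent c (w (fst z)) j) T p (k (snd z))) \<in> borel_measurable (N \<Otimes>\<^sub>M M)"
    using N by (intro measurable_moment_resolvent) (auto intro: measurable_compose[OF measurable_fst])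
  then show ?thesis unfolding phi_def
    by (intro borel_measurable_lebesgue_integral) (simp add: case_prod_beta')
qed

text \<open>All resolvents are at most \<open>1 / c\<close>, so \<epsilon> bounds every leverage
  \<open>k \<bullet> X k\<close>. The condition \<open>small\<close> makes the factor in
  \<open>phi_rank_one_update\<close> at least 1/2.\<close>

context
  fixes c \<epsilon> :: real and p :: nat
  assumes c: "0 < c" and eps: "\<epsilon> = \<kappa>\<^sup>2 / c" and small: "(real p + 1) * \<epsilon> \<le> 1 / 4" and p: "1 \<le> p"
begin

lemma phi_resolvent_step:
  assumes "\<omega> j \<in> space M"
  shows "phi (resolvent c \<omega> (Suc j)) p
    \<le> phi (resolvent c \<omega> j) p - (real p + 1) / 2 * moment (resolvent c \<omega> j) T (Suc p) (k (\<omega> j))"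
proof -
  let ?X = "resolvent c \<omega> j"
  have X: "psd_op ?X" by (rule psd_op_resolvent[OF c])
  have e0: "0 \<le> \<epsilon>" using c eps by simp
  have pe: "real p * \<epsilon> + \<epsilon> \<le> 1/4" using small by (simp add: algebra_simps)
  have "k (\<omega> j) \<bullet> ?X (k (\<omega> j)) \<le> (norm (k (\<omega> j)))\<^sup>2 / c"
    using psd_op_resolvent(2)[OF c, of \<omega> j "k (\<omega> j)"] by (simp add: inner_commute)
  also have "\<dots> \<le> \<epsilon>" unfolding eps using c k_bound[OF assms] by (intro divide_right_mono power_mono) auto
  finally have l: "k (\<omega> j) \<bullet> ?X (k (\<omega> j)) \<le> \<epsilon>" .
  have pe0: "0 \<le> real p * \<epsilon>" using e0 by simp
  have "1 / 2 \<le> (1 - real p * \<epsilon>) / (1 + \<epsilon>)" using e0 pe pe0 by (simp add: field_simps)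
  from mult_left_mono[OF this, of "real p + 1"]
  have "(real p + 1) / 2 \<le> (real p + 1) * ((1 - real p * \<epsilon>) / (1 + \<epsilon>))" by simp
  then have "(real p + 1) / 2 * moment ?X T (Suc p) (k (\<omega> j))
      \<le> (real p + 1) * ((1 - real p * \<epsilon>) / (1 + \<epsilon>)) * moment ?X T (Suc p) (k (\<omega> j))"
    by (rule mult_right_mono) (rule moment_nonneg[OF X psd_op_T])
  then show ?thesis
    using phi_rank_one_update[OF X l, of p] pe e0 by simp
qed

lemma phi_resolvent_bound:
  assumes "\<And>i. i < j \<Longrightarrow> \<omega> i \<in> space M"
  shows "phi (resolvent c \<omega> j) p \<le> \<epsilon> ^ Suc p"
  using assms
proof (induction j)
  case 0
  have "phi (resolvent c \<omega> 0) p \<le> (\<integral>x. \<epsilon> ^ Suc p \<partial>M)"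
    unfolding phi_def
  proof (intro integral_mono integrable_moment psd_op_resolvent c)
    fix x assume x: "x \<in> space M"
    have "moment (resolvent c \<omega> 0) T p (k x) \<le> (1 / c) * ((1 / c) * \<kappa>\<^sup>2) ^ p * (norm (k x))\<^sup>2"
      using c T_bound psd_op_resolvent[OF c, of \<omega> 0] by (intro moment_bound psd_op_T) auto
    also have "\<dots> \<le> (1 / c) * ((1 / c) * \<kappa>\<^sup>2) ^ p * \<kappa>\<^sup>2"
      using c k_bound[OF x] by (intro mult_left_mono power_mono) auto
    finally show "moment (resolvent c \<omega> 0) T p (k x) \<le> \<epsilon> ^ Suc p" by (simp add: eps mult.commute)
  qed simp
  then show ?case by (simp add: prob_space)
next
  case (Suc j)
  have "0 \<le> (real p + 1) / 2 * moment (resolvent c \<omega> j) T (Suc p) (k (\<omega> j))"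
    using moment_nonneg[OF psd_op_resolvent(1)[OF c] psd_op_T] by simp
  then show ?case using phi_resolvent_step[of \<omega> j] Suc by fastforce
qed

text \<open>The mean decrease per observation is (p + 1)/2 times the mean \<open>phi\<close> of
  index p + 1, which log-convexity bounds below in terms of index \<open>p\<close>. Up to factors
  this is a discrete form of y' = - y^(1 + 1/p), whose solutions decay like the p-th power of 1/j
  whatever the start. The tangent bound linearizes it along the rate to be proved.\<close>

lemma expectation_phi_resolvent:
  shows "integrable (PiM {..<j} (\<lambda>_. M)) (\<lambda>\<omega>. phi (resolvent c \<omega> j) p)"
    and "(\<integral>\<omega>. phi (resolvent c \<omega> j) p \<partial>PiM {..<j} (\<lambda>_. M)) \<le> (8 / (real j + 2 * (real p + 1))) ^ p"
proof -
  note M_space = prob_space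
  interpret product_prob_space "\<lambda>_. M" "UNIV :: nat set" by unfold_locales
  let ?Q = "\<lambda>j::nat. PiM {..<j} (\<lambda>_. M)"
  have e0: "0 \<le> \<epsilon>" using c eps by simp
  have e1: "\<epsilon> \<le> 1"
    using small mult_nonneg_nonneg[OF e0, of "real p"] by (simp only: distrib_right mult.commute[of "real p"]) linarith
  have eP: "\<epsilon> \<le> 1 / (4 * (real p + 1))" using small by (simp add: field_simps)
  have sp: "\<omega> i \<in> space M" if "\<omega> \<in> space (?Q j)" "i < j" for \<omega> i j
    using that by (auto simp: space_PiM)
  have meas: "(\<lambda>\<omega>. phi (resolvent c \<omega> j) q) \<in> borel_measurable (?Q j)" for j q
    by (rule measurable_phi_resolvent) simp
  have psd: "psd_op (resolvent c \<omega> j)" for \<omega> j by (rule psd_op_resolvent[OF c])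
  \<comment> \<open>\<open>phi\<close> stays nonnegative after a hypothetical further observation
    \<open>y\<close>. So the decrease that \<open>y\<close> would cause, at least the moment of
    order \<open>Suc p\<close> at \<open>k y\<close> because p \<ge> 1, does not exceed the present
    value; averaging over \<open>y\<close> gives the claim.\<close>
  have next_le: "phi (resolvent c \<omega> j) (Suc p) \<le> phi (resolvent c \<omega> j) p" for \<omega> j
  proof -
    have "phi (resolvent c \<omega> j) (Suc p) \<le> (\<integral>y. phi (resolvent c \<omega> j) p \<partial>M)"
      unfolding phi_def[of _ "Suc p"]
    proof (intro integral_mono integrable_moment psd)
      fix y assume y: "y \<in> space M"
      have "0 \<le> phi (resolvent c (fun_upd \<omega> j y) (Suc j)) p" by (rule phi_nonneg[OF psd])
      also have "\<dots> \<le> phi (resolvent c \<omega> j) p - (real p + 1) / 2 * moment (resolvent c \<omega> j) T (Suc p) (k y)"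
        using phi_resolvent_step[of "fun_upd \<omega> j y" j] y by (simp add: resolvent_upd del: resolvent.simps)
      finally have "(real p + 1) / 2 * moment (resolvent c \<omega> j) T (Suc p) (k y) \<le> phi (resolvent c \<omega> j) p" by simp
      moreover have "1 * moment (resolvent c \<omega> j) T (Suc p) (k y)
          \<le> (real p + 1) / 2 * moment (resolvent c \<omega> j) T (Suc p) (k y)"
        using p by (intro mult_right_mono moment_nonneg psd psd_op_T) auto
      ultimately show "moment (resolvent c \<omega> j) T (Suc p) (k y) \<le> phi (resolvent c \<omega> j) p" by linarith
    qed simp
    then show ?thesis by (simp add: M_space)
  qed
  have int: "integrable (?Q j) (\<lambda>\<omega>. phi (resolvent c \<omega> j) q)" if q: "q = p \<or> q = Suc p" for j q
  proof -
    interpret Q: prob_space "?Q j" by (intro prob_space_PiM) unfold_locales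
    show ?thesis
    proof (rule Q.integrable_const_bound[where B = "\<epsilon> ^ Suc p"])
      show "AE \<omega> in ?Q j. norm (phi (resolvent c \<omega> j) q) \<le> \<epsilon> ^ Suc p"
      proof (rule AE_I2)
        fix \<omega> assume \<omega>: "\<omega> \<in> space (?Q j)"
        have "phi (resolvent c \<omega> j) q \<le> phi (resolvent c \<omega> j) p" using q next_le by auto
        also have "\<dots> \<le> \<epsilon> ^ Suc p" by (rule phi_resolvent_bound) (rule sp[OF \<omega>])
        finally show "norm (phi (resolvent c \<omega> j) q) \<le> \<epsilon> ^ Suc p" using phi_nonneg[OF psd] by simp
      qed
    qed (rule meas)
  qed
  show "integrable (?Q j) (\<lambda>\<omega>. phi (resolvent c \<omega> j) p)" by (rule int) simp
  show "(\<integral>\<omega>. phi (resolvent c \<omega> j) p \<partial>?Q j) \<le> (8 / (real j + 2 * (real p + 1))) ^ p"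
  proof (induction j)
    case 0
    interpret Q: prob_space "?Q 0" by (intro prob_space_PiM) unfold_locales
    have "(\<integral>\<omega>. phi (resolvent c \<omega> 0) p \<partial>?Q 0) = phi (resolvent c undefined 0) p"
      using Q.prob_space by simp
    also have "\<dots> \<le> \<epsilon> ^ Suc p" by (rule phi_resolvent_bound) simp
    also have "\<dots> \<le> \<epsilon> ^ p" using e0 e1 by (simp add: mult_left_le_one_le)
    also have "\<dots> \<le> (8 / (real 0 + 2 * (real p + 1))) ^ p"
      by (rule power_mono[OF order_trans[OF eP]]) (use e0 in \<open>auto simp: field_simps\<close>)
    finally show ?case .
  next
    case (Suc j)
    interpret Q: prob_space "?Q j" by (intro prob_space_PiM) unfold_locales
    \<comment> \<open>The offset 2(p + 1) covers the start, where
      \<open>\<epsilon> \<le> 4 / (p + 1)\<close>, and keeps the coefficient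
      \<open>1 - (p + 1) / 2 * a\<close> nonnegative. \<open>a\<close> is half of the base 8/J of
      the claimed bound, so the constant left by the tangent consumes at most half of the linear
      decrease.\<close>
    define J where "J = real j + 2 * (real p + 1)"
    define a where "a = 4 / J"
    have J: "J > 0" "2 * (real p + 1) \<le> J" by (auto simp: J_def)
    let ?q = "\<integral>\<omega>. phi (resolvent c \<omega> j) p \<partial>?Q j"
    have "(\<integral>\<omega>. phi (resolvent c \<omega> (Suc j)) p \<partial>?Q (Suc j))
        = (\<integral>\<omega>. (\<integral>y. phi (resolvent c (fun_upd \<omega> j y) (Suc j)) p \<partial>M) \<partial>?Q j)"
      using int[of p "Suc j"] unfolding lessThan_Suc
      by (subst product_integral_insert) (simp_all del: resolvent.simps)
    also have "\<dots> \<le> (\<integral>\<omega>. (1 - (real p + 1) / 2 * a) * phi (resolvent c \<omega> j) p + (real p + 1) / 2 * a ^ Suc p \<partial>?Q j)"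
    proof (rule integral_mono')
      show "integrable (?Q j) (\<lambda>\<omega>. (1 - (real p + 1) / 2 * a) * phi (resolvent c \<omega> j) p + (real p + 1) / 2 * a ^ Suc p)"
        by (intro Bochner_Integration.integrable_add integrable_mult_right int) auto
      fix \<omega> assume \<omega>: "\<omega> \<in> space (?Q j)"
      have "(\<integral>y. phi (resolvent c (fun_upd \<omega> j y) (Suc j)) p \<partial>M)
          \<le> (\<integral>y. phi (resolvent c \<omega> j) p - (real p + 1) / 2 * moment (resolvent c \<omega> j) T (Suc p) (k y) \<partial>M)"
      proof (rule integral_mono')
        show "integrable M (\<lambda>y. phi (resolvent c \<omega> j) p - (real p + 1) / 2 * moment (resolvent c \<omega> j) T (Suc p) (k y))"
          by (intro Bochner_Integration.integrable_diff integrable_mult_right integrable_moment psd) auto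
        fix y assume y: "y \<in> space M"
        show "phi (resolvent c (fun_upd \<omega> j y) (Suc j)) p
          \<le> phi (resolvent c \<omega> j) p - (real p + 1) / 2 * moment (resolvent c \<omega> j) T (Suc p) (k y)"
          using phi_resolvent_step[of "fun_upd \<omega> j y" j] y by (simp add: resolvent_upd del: resolvent.simps)
        then show "0 \<le> phi (resolvent c \<omega> j) p - (real p + 1) / 2 * moment (resolvent c \<omega> j) T (Suc p) (k y)"
          using phi_nonneg[OF psd, of "fun_upd \<omega> j y" "Suc j" p] by linarith
      qed
      also have "\<dots> = phi (resolvent c \<omega> j) p - (real p + 1) / 2 * phi (resolvent c \<omega> j) (Suc p)"
        by (simp add: integrable_moment psd M_space phi_def)
      also have "\<dots> \<le> phi (resolvent c \<omega> j) p - (real p + 1) / 2 * (a * phi (resolvent c \<omega> j) p - a ^ Suc p * 1)"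
      proof -
        \<comment> \<open>The constant of the tangent carries \<open>phi\<close> of index 0, which
          is at most \<open>\<epsilon> \<le> 1\<close> for every sample.\<close>
        have "phi (resolvent c \<omega> j) 0 \<le> 1 / c * \<kappa>\<^sup>2"
          using psd_op_resolvent(2)[OF c] c by (intro phi_0_le psd) auto
        then have "a ^ Suc p * phi (resolvent c \<omega> j) 0 \<le> a ^ Suc p * 1"
          using e1 J by (intro mult_left_mono) (auto simp: a_def eps)
        moreover have "a * phi (resolvent c \<omega> j) p - a ^ Suc p * phi (resolvent c \<omega> j) 0 \<le> phi (resolvent c \<omega> j) (Suc p)"
          by (rule log_convex_tangent[where s = "phi (resolvent c \<omega> j)"])
            (use J in \<open>auto simp: a_def intro: phi_nonneg psd phi_log_convex\<close>)
        moreover have "0 \<le> (real p + 1) / 2" by simp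
        ultimately show ?thesis by (intro diff_left_mono mult_left_mono) linarith+
      qed
      also have "\<dots> = (1 - (real p + 1) / 2 * a) * phi (resolvent c \<omega> j) p + (real p + 1) / 2 * a ^ Suc p"
        by (simp add: algebra_simps)
      finally show "(\<integral>y. phi (resolvent c (fun_upd \<omega> j y) (Suc j)) p \<partial>M)
          \<le> (1 - (real p + 1) / 2 * a) * phi (resolvent c \<omega> j) p + (real p + 1) / 2 * a ^ Suc p" .
      have "(real p + 1) / 2 * a \<le> 1" using J by (simp add: a_def field_simps)
      then show "0 \<le> (1 - (real p + 1) / 2 * a) * phi (resolvent c \<omega> j) p + (real p + 1) / 2 * a ^ Suc p"
        using phi_nonneg[OF psd, of \<omega> j p] J
        by (intro add_nonneg_nonneg mult_nonneg_nonneg zero_le_power) (auto simp: a_def)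
    qed
    also have "\<dots> = (1 - (real p + 1) / 2 * a) * ?q + (real p + 1) / 2 * a ^ Suc p"
      using int[of p j] by (simp add: Q.prob_space)
    also have "\<dots> \<le> (1 - (real p + 1) / 2 * a) * (8 / J) ^ p + (real p + 1) / 2 * a ^ Suc p"
    proof -
      have "(real p + 1) / 2 * a \<le> 1" using J by (simp add: a_def field_simps)
      then show ?thesis using Suc by (intro add_right_mono mult_left_mono) (auto simp: J_def)
    qed
    also have "\<dots> \<le> (1 - real p / J) * (8 / J) ^ p"
    proof -
      have "a = 8 / J / 2" by (simp add: a_def)
      then have "a ^ p = (8 / J) ^ p / 2 ^ p" by (simp only: power_divide)
      also have "\<dots> \<le> (8 / J) ^ p / 2"
        using p J power_increasing[of 1 p "2::real"] by (intro divide_left_mono) auto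
      finally have "(real p + 1) / 2 * a * a ^ p \<le> (real p + 1) / 2 * a * ((8 / J) ^ p / 2)"
        using J by (intro mult_left_mono) (auto simp: a_def)
      then have "(1 - (real p + 1) / 2 * a) * (8 / J) ^ p + (real p + 1) / 2 * a ^ Suc p
          \<le> (1 - (real p + 1) / 4 * a) * (8 / J) ^ p" by (simp add: algebra_simps)
      also have "\<dots> \<le> (1 - real p / J) * (8 / J) ^ p"
        using J by (intro mult_right_mono) (auto simp: a_def field_simps)
      finally show ?thesis .
    qed
    \<comment> \<open>Bernoulli's inequality turns the relative decrease \<open>p / J\<close> into
      the change of base from 8/J to 8/(J + 1).\<close>
    also have "\<dots> \<le> (J / (J + 1)) ^ p * (8 / J) ^ p"
    proof -
      have "1 - real p / J \<le> 1 + real p * (- 1 / (J + 1))" using J by (simp add: field_simps)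
      also have "\<dots> \<le> (1 + - 1 / (J + 1)) ^ p"
        using J by (intro Bernoulli_inequality) (auto simp: field_simps)
      also have "1 + - 1 / (J + 1) = J / (J + 1)" using J by (simp add: field_simps)
      finally show ?thesis using J by (intro mult_right_mono) auto
    qed
    also have "\<dots> = (J / (J + 1) * (8 / J)) ^ p" by (rule power_mult_distrib[symmetric])
    also have "J / (J + 1) * (8 / J) = 8 / (J + 1)" using J by simp
    finally show ?case by (simp add: J_def add_ac)
  qed
qed

end

text \<open>Markov's inequality for \<open>phi\<close>, a trace that dominates a power of the operator norm.\<close>

lemma empirical_lower_bound:
  fixes n q :: nat
  assumes c: "0 < c" and small: "(2 * real q + 1) * \<kappa>\<^sup>2 / c \<le> 1 / 4" and q: "1 \<le> q" and n: "0 < n"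
  obtains G where "G \<in> sets (PiM {..<n} (\<lambda>_. M))"
    "measure (PiM {..<n} (\<lambda>_. M)) G \<ge> 1 - real n * exp (- (2 * real q))"
    "\<And>\<omega> f. \<omega> \<in> G \<Longrightarrow> T f \<bullet> f \<le> 8 * exp 1 / real n * (c * (norm f)\<^sup>2 + (\<Sum>j<n. (k (\<omega> j) \<bullet> f)\<^sup>2))"
proof -
  let ?Q = "PiM {..<n} (\<lambda>_. M)"
  interpret Q: prob_space ?Q by (intro prob_space_PiM) unfold_locales
  \<comment> \<open>The expectation of \<open>Z\<close> is at most \<open>(8 / n) ^ (2 * q)\<close>.
    The extra factor e per power leaves \<open>exp (- (2 * q))\<close> after Markov's inequality,
    and the one power of \<theta> in excess leaves a factor of order \<open>n\<close>.\<close>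
  define \<theta> where "\<theta> = 8 * exp 1 / real n"
  have th: "0 < \<theta>" using n by (simp add: \<theta>_def)
  define Z where "Z \<omega> = phi (resolvent c \<omega> n) (2 * q)" for \<omega>
  define G where "G = {\<omega> \<in> space ?Q. Z \<omega> \<le> \<theta> ^ Suc (2 * q)}"
  have small': "(real (2 * q) + 1) * (\<kappa>\<^sup>2 / c) \<le> 1 / 4" using small by simp
  note E = expectation_phi_resolvent[OF c refl small', where j = n, folded Z_def]
  have q2: "1 \<le> 2 * q" using q by simp
  have [measurable]: "Z \<in> borel_measurable ?Q" using E(1)[OF q2] by simp
  have Gm: "G \<in> sets ?Q" unfolding G_def by measurable
  have nn: "0 \<le> Z \<omega>" for \<omega> unfolding Z_def by (rule phi_nonneg[OF psd_op_resolvent(1)[OF c]])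
  have "measure ?Q (space ?Q - G) \<le> measure ?Q {\<omega> \<in> space ?Q. Z \<omega> \<ge> \<theta> ^ Suc (2 * q)}"
    by (intro Q.finite_measure_mono) (auto simp: G_def)
  also have "\<dots> \<le> (\<integral>\<omega>. Z \<omega> \<partial>?Q) / \<theta> ^ Suc (2 * q)"
    by (rule integral_Markov_inequality_measure[where A = "{}"])
      (use E(1)[OF q2] nn th in auto)
  also have "\<dots> \<le> (8 / real n) ^ (2 * q) / \<theta> ^ Suc (2 * q)"
  proof (intro divide_right_mono order_trans[OF E(2)[OF q2]] power_mono)
    show "8 / (real n + 2 * (real (2 * q) + 1)) \<le> 8 / real n" using n by (intro divide_left_mono) auto
  qed (use th in auto)
  also have "\<dots> = real n / (8 * exp 1) * exp (- (2 * real q))"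
  proof -
    have "\<theta> ^ Suc (2 * q) = (8 / real n) ^ (2 * q) * (8 / real n) * exp (2 * real q) * exp 1"
      unfolding \<theta>_def by (simp add: power_divide power_mult_distrib mult_ac flip: exp_of_nat_mult)
    then show ?thesis using n by (simp only: exp_minus) (simp add: field_simps)
  qed
  also have "\<dots> \<le> real n * exp (- (2 * real q))"
  proof (rule mult_right_mono)
    have "1 \<le> 8 * exp (1::real)" using one_le_exp_iff[of "1::real"] by linarith
    then show "real n / (8 * exp 1) \<le> real n" using n by (simp add: divide_le_eq)
  qed simp
  finally have "1 - real n * exp (- (2 * real q)) \<le> measure ?Q G"
    using Q.prob_compl[OF Gm] by simp
  moreover have "T f \<bullet> f \<le> 8 * exp 1 / real n * (c * (norm f)\<^sup>2 + (\<Sum>j<n. (k (\<omega> j) \<bullet> f)\<^sup>2))" if "\<omega> \<in> G" for \<omega> f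
  proof -
    let ?S = "\<lambda>f. c *\<^sub>R f + (\<Sum>i<n. (k (\<omega> i) \<bullet> f) *\<^sub>R k (\<omega> i))"
    have "T f \<bullet> f \<le> \<theta> * (?S f \<bullet> f)"
      by (rule T_le_of_phi_le[where S = ?S, OF psd_op_resolvent(1)[OF c] resolvent_inverse[OF c], where q = q])
        (use that th in \<open>auto simp: G_def Z_def\<close>)
    then show ?thesis
      by (simp add: \<theta>_def inner_simps inner_sum_left dot_square_norm power2_eq_square)
  qed
  ultimately show thesis using Gm that by blast
qed

end

section \<open>A Bernstein inequality in Hilbert space\<close>

lemma sinh_ge: "0 \<le> x \<Longrightarrow> x \<le> sinh (x::real)"
proof -
  assume "0 \<le> x"
  then have "sinh 0 - 0 \<le> sinh x - x"
    by (rule DERIV_nonneg_imp_nondecreasing)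
      (use cosh_real_ge_1 in \<open>fastforce intro!: derivative_eq_intros\<close>)
  then show ?thesis by simp
qed

text \<open>\<open>cosh\<close> is a power series with nonnegative coefficients in the square of its
  argument, hence convex in that square.\<close>

lemma cosh_le_convex_comb:
  fixes w u v t :: real
  assumes "w\<^sup>2 = (1 - t) * u\<^sup>2 + t * v\<^sup>2" "0 \<le> t" "t \<le> 1"
  shows "cosh w \<le> (1 - t) * cosh u + t * cosh v"
proof (rule sums_le)
  show "(\<lambda>n. if even n then w ^ n /\<^sub>R fact n else 0) sums cosh w" by (rule cosh_converges)
  show "(\<lambda>n. (1 - t) * (if even n then u ^ n /\<^sub>R fact n else 0)
          + t * (if even n then v ^ n /\<^sub>R fact n else 0)) sums ((1 - t) * cosh u + t * cosh v)"
    by (intro sums_add sums_mult cosh_converges)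
  fix n
  show "(if even n then w ^ n /\<^sub>R fact n else 0) \<le> (1 - t) * (if even n then u ^ n /\<^sub>R fact n else 0)
          + t * (if even n then v ^ n /\<^sub>R fact n else 0)"
  proof (cases "even n")
    case True
    then obtain m where m: "n = 2 * m" by (auto elim: evenE)
    have "(w\<^sup>2) ^ m \<le> (1 - t) * (u\<^sup>2) ^ m + t * (v\<^sup>2) ^ m"
    proof (cases "even m")
      case True
      then show ?thesis using convex_onD[OF convex_power_even[of m], of t "u\<^sup>2" "v\<^sup>2"] assms by simp
    next
      case False
      then show ?thesis using convex_onD[OF convex_power_odd[of m], of t "u\<^sup>2" "v\<^sup>2"] assms by simp
    qed
    then have "w ^ n \<le> (1 - t) * u ^ n + t * v ^ n" by (simp add: m power_mult)
    then have "w ^ n / fact n \<le> ((1 - t) * u ^ n + t * v ^ n) / fact n" by (rule divide_right_mono) simp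
    then show ?thesis using True by (simp add: divide_inverse algebra_simps)
  qed simp
qed

text \<open>For fixed norms both sides depend on \<open>a \<bullet> x\<close> only; the left-hand side is convex in it and the
  right-hand side affine, so that it suffices to compare them for parallel \<open>a\<close> and \<open>x\<close>.\<close>

lemma cosh_norm_add_le:
  fixes a x :: "'a::real_inner"
  shows "cosh (norm (a + x))
    \<le> cosh (norm a) * (exp (norm x) - norm x) + (a \<bullet> x) * (sinh (norm a) / norm a)"
proof (cases "a = 0 \<or> x = 0")
  case True
  have "cosh (norm x) \<le> exp (norm x) - norm x"
    using sinh_ge[of "norm x"] by (simp add: cosh_plus_sinh[symmetric])
  then show ?thesis using True by auto
next
  case False
  define A s c where "A = norm a" and "s = norm x" and "c = (a \<bullet> x) / (A * s)"
  have A: "A > 0" and s: "s > 0" using False by (auto simp: A_def s_def)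
  have ax: "a \<bullet> x = c * (A * s)" using A s by (simp add: c_def)
  have c: "\<bar>c\<bar> \<le> 1"
    using Cauchy_Schwarz_ineq2[of a x] A s by (simp add: c_def A_def s_def abs_mult divide_le_eq_1)
  \<comment> \<open>\<open>c\<close> is the cosine of the angle between \<open>a\<close> and
    \<open>x\<close>; the squared norm interpolates between its values for opposite and for equal
    directions.\<close>
  have "(norm (a + x))\<^sup>2 = (1 - (1 + c) / 2) * (A - s)\<^sup>2 + (1 + c) / 2 * (A + s)\<^sup>2"
    by (simp add: dot_norm[of a x, unfolded ax] A_def[symmetric] s_def[symmetric] field_simps power2_eq_square)
       (use ax dot_norm[of a x] in \<open>simp add: A_def s_def power2_eq_square field_simps\<close>)
  then have "cosh (norm (a + x)) \<le> (1 - (1 + c) / 2) * cosh (A - s) + (1 + c) / 2 * cosh (A + s)"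
    using c by (intro cosh_le_convex_comb) auto
  also have "\<dots> = cosh A * cosh s + c * sinh A * sinh s"
    by (simp add: cosh_add cosh_diff field_simps)
  \<comment> \<open>Replacing \<open>sinh s\<close> by \<open>s\<close> makes the term with
    \<open>c\<close> linear in \<open>x\<close>, so that it vanishes in the mean for centred
    summands. The difference is at most \<open>cosh A * (sinh s - s)\<close>, and
    \<open>cosh s + sinh s = exp s\<close>.\<close>
  also have "\<dots> \<le> cosh A * (exp s - s) + c * sinh A * s"
  proof -
    have "c * sinh A * (sinh s - s) \<le> 1 * cosh A * (sinh s - s)"
      using A c sinh_ge[of s] s cosh_plus_sinh[of A]
      by (intro mult_right_mono mult_mono) (auto simp: sinh_le_cosh_real less_imp_le)
    then show ?thesis by (simp add: algebra_simps cosh_plus_sinh[symmetric])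
  qed
  also have "c * sinh A * s = (a \<bullet> x) * (sinh A / A)" using A by (simp add: ax)
  finally show ?thesis by (simp add: A_def s_def)
qed

text \<open>Each new summand multiplies the expectation by at most
  \<open>1 + \<theta>\<^sup>2 * s\<close>: the linear term of \<open>cosh_norm_add_le\<close> has
  mean zero once the earlier summands are fixed, and \<open>\<theta> * B \<le> 1\<close> allows
  \<open>exp u - u \<le> 1 + u\<^sup>2\<close>.\<close>

lemma (in prob_space) cosh_norm_sum_iid:
  fixes X :: "'a \<Rightarrow> 'h::{real_inner,banach,second_countable_topology}"
  assumes [measurable]: "X \<in> borel_measurable M"
    and B: "\<And>x. x \<in> space M \<Longrightarrow> norm (X x) \<le> B" and mean: "\<And>u. (\<integral>x. X x \<bullet> u \<partial>M) = 0"
    and var: "(\<integral>x. (norm (X x))\<^sup>2 \<partial>M) \<le> s" and th: "0 \<le> \<theta>" "\<theta> * B \<le> 1"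
  shows "integrable (PiM {..<n} (\<lambda>_. M)) (\<lambda>\<omega>. cosh (\<theta> * norm (\<Sum>j<n. X (\<omega> j))))"
    and "(\<integral>\<omega>. cosh (\<theta> * norm (\<Sum>j<n. X (\<omega> j))) \<partial>PiM {..<n} (\<lambda>_. M)) \<le> exp (real n * \<theta>\<^sup>2 * s)"
proof -
  note M_space = prob_space and M_bound = integrable_const_bound
  interpret product_prob_space "\<lambda>_. M" "UNIV :: nat set" by unfold_locales
  let ?Q = "\<lambda>n::nat. PiM {..<n} (\<lambda>_. M)"
  let ?f = "\<lambda>n \<omega>. cosh (\<theta> * norm (\<Sum>j<n. X (\<omega> j)))"
  have s0: "0 \<le> s" using var by (rule order_trans[rotated]) (intro integral_nonneg_AE, simp)
  have norm_int: "integrable M (\<lambda>x. (norm (X x))\<^sup>2)"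
    by (rule M_bound[where B = "B\<^sup>2"]) (auto intro!: AE_I2 power_mono B)
  have inner_int: "integrable M (\<lambda>x. X x \<bullet> u)" for u
  proof (rule M_bound[where B = "B * norm u"])
    show "AE x in M. norm (X x \<bullet> u) \<le> B * norm u"
      by (rule AE_I2) (auto intro!: order_trans[OF Cauchy_Schwarz_ineq2] mult_right_mono B)
  qed simp
  have int: "integrable (?Q n) (?f n)" for n
  proof -
    interpret Q: prob_space "?Q n" by (intro prob_space_PiM) unfold_locales
    show ?thesis
    proof (rule Q.integrable_const_bound[where B = "cosh (\<theta> * (\<Sum>j<n. B))"])
      show "AE \<omega> in ?Q n. norm (?f n \<omega>) \<le> cosh (\<theta> * (\<Sum>j<n. B))"
      proof (rule AE_I2)
        fix \<omega> assume "\<omega> \<in> space (?Q n)"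
        then have "norm (\<Sum>j<n. X (\<omega> j)) \<le> (\<Sum>j<n. B)"
          by (intro sum_norm_le B) (auto simp: space_PiM)
        then show "norm (?f n \<omega>) \<le> cosh (\<theta> * (\<Sum>j<n. B))"
          using th order_trans[OF norm_ge_zero \<open>norm (\<Sum>j<n. X (\<omega> j)) \<le> (\<Sum>j<n. B)\<close>]
            by (simp add: cosh_real_nonneg_le_iff mult_left_mono)
      qed
      show "?f n \<in> borel_measurable (?Q n)"
        by (intro borel_measurable_continuous_on[where f = cosh and g = "\<lambda>\<omega>. \<theta> * norm (\<Sum>j<n. X (\<omega> j))"] continuous_on_cosh continuous_on_id) measurable
    qed
  qed
  show "integrable (?Q n) (?f n)" by (rule int)
  show "(\<integral>\<omega>. ?f n \<omega> \<partial>?Q n) \<le> exp (real n * \<theta>\<^sup>2 * s)"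
  proof (induction n)
    case 0
    interpret Q: prob_space "?Q 0" by (intro prob_space_PiM) unfold_locales
    show ?case using Q.prob_space by simp
  next
    case (Suc n)
    have "(\<integral>\<omega>. ?f (Suc n) \<omega> \<partial>?Q (Suc n)) = (\<integral>\<omega>. (\<integral>y. ?f (Suc n) (fun_upd \<omega> n y) \<partial>M) \<partial>?Q n)"
      using int[of "Suc n"] unfolding lessThan_Suc by (subst product_integral_insert) auto
    also have "\<dots> \<le> (\<integral>\<omega>. ?f n \<omega> * (1 + \<theta>\<^sup>2 * s) \<partial>?Q n)"
    proof (rule integral_mono')
      show "integrable (?Q n) (\<lambda>\<omega>. ?f n \<omega> * (1 + \<theta>\<^sup>2 * s))" using int by simp
      fix \<omega>
      let ?S = "\<Sum>j<n. X (\<omega> j)"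
      define d where "d = \<theta> * (\<theta> * (sinh (norm (\<theta> *\<^sub>R ?S)) / norm (\<theta> *\<^sub>R ?S)))"
      have "(\<integral>y. ?f (Suc n) (fun_upd \<omega> n y) \<partial>M)
          \<le> (\<integral>y. ?f n \<omega> * (1 + \<theta>\<^sup>2 * (norm (X y))\<^sup>2) + (X y \<bullet> ?S) * d \<partial>M)"
      proof (rule integral_mono')
        show "integrable M (\<lambda>y. ?f n \<omega> * (1 + \<theta>\<^sup>2 * (norm (X y))\<^sup>2) + (X y \<bullet> ?S) * d)"
          using norm_int inner_int by simp
        fix y assume y: "y \<in> space M"
        have tn: "0 \<le> \<theta> * norm (X y)" "\<theta> * norm (X y) \<le> 1"
          using th mult_left_mono[OF B[OF y] th(1)] by auto
        have "?f (Suc n) (fun_upd \<omega> n y) = cosh (norm (\<theta> *\<^sub>R ?S + \<theta> *\<^sub>R X y))"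
          using th by (simp flip: scaleR_add_right)
        also have "\<dots> \<le> cosh (norm (\<theta> *\<^sub>R ?S)) * (exp (norm (\<theta> *\<^sub>R X y)) - norm (\<theta> *\<^sub>R X y))
            + ((\<theta> *\<^sub>R ?S) \<bullet> (\<theta> *\<^sub>R X y)) * (sinh (norm (\<theta> *\<^sub>R ?S)) / norm (\<theta> *\<^sub>R ?S))"
          by (rule cosh_norm_add_le)
        also have "((\<theta> *\<^sub>R ?S) \<bullet> (\<theta> *\<^sub>R X y)) * (sinh (norm (\<theta> *\<^sub>R ?S)) / norm (\<theta> *\<^sub>R ?S)) = (X y \<bullet> ?S) * d"
          by (simp add: d_def inner_commute mult_ac)
        also have "exp (norm (\<theta> *\<^sub>R X y)) - norm (\<theta> *\<^sub>R X y) \<le> 1 + \<theta>\<^sup>2 * (norm (X y))\<^sup>2"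
          using exp_bound[OF tn] th by (simp add: power_mult_distrib)
        finally show "?f (Suc n) (fun_upd \<omega> n y) \<le> ?f n \<omega> * (1 + \<theta>\<^sup>2 * (norm (X y))\<^sup>2) + (X y \<bullet> ?S) * d"
          using th by (simp add: mult_left_mono)
        then show "0 \<le> ?f n \<omega> * (1 + \<theta>\<^sup>2 * (norm (X y))\<^sup>2) + (X y \<bullet> ?S) * d"
          using cosh_real_nonneg by (rule order_trans[rotated])
      qed
      also have "\<dots> = ?f n \<omega> * (1 + \<theta>\<^sup>2 * (\<integral>y. (norm (X y))\<^sup>2 \<partial>M))"
        using norm_int inner_int by (simp add: mean M_space)
      also have "\<dots> \<le> ?f n \<omega> * (1 + \<theta>\<^sup>2 * s)"
        using var by (intro mult_left_mono add_left_mono) auto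
      finally show "(\<integral>y. ?f (Suc n) (fun_upd \<omega> n y) \<partial>M) \<le> ?f n \<omega> * (1 + \<theta>\<^sup>2 * s)" .
      show "0 \<le> ?f n \<omega> * (1 + \<theta>\<^sup>2 * s)" using s0 by simp
    qed
    also have "\<dots> \<le> exp (real n * \<theta>\<^sup>2 * s) * (1 + \<theta>\<^sup>2 * s)" using Suc s0 by (simp add: mult_right_mono)
    also have "\<dots> \<le> exp (real n * \<theta>\<^sup>2 * s) * exp (\<theta>\<^sup>2 * s)" by (intro mult_left_mono exp_ge_add_one_self) auto
    also have "\<dots> = exp (real (Suc n) * \<theta>\<^sup>2 * s)" by (simp add: algebra_simps flip: exp_add)
    finally show ?case .
  qed
qed

text \<open>Markov's inequality for \<open>cosh\<close>. The choice of \<theta> makes the exponent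
  \<open>n * \<theta>\<^sup>2 * \<sigma>\<^sup>2\<close> equal to 1, which leaves an exponential
  tail in \<open>t\<close>; that suffices because \<open>t\<close> will be of order ln
  (1/\<delta>).\<close>

lemma (in prob_space) bernstein_norm_sum_iid:
  fixes X :: "'a \<Rightarrow> 'h::{real_inner,banach,second_countable_topology}"
  assumes X [measurable]: "X \<in> borel_measurable M"
    and B: "\<And>x. x \<in> space M \<Longrightarrow> norm (X x) \<le> B" and mean: "\<And>u. (\<integral>x. X x \<bullet> u \<partial>M) = 0"
    and var: "(\<integral>x. (norm (X x))\<^sup>2 \<partial>M) \<le> \<sigma>\<^sup>2" and sg: "0 < \<sigma>" and n: "0 < n" "B \<le> sqrt (real n) * \<sigma>"
  shows "measure (PiM {..<n} (\<lambda>_. M)) {\<omega> \<in> space (PiM {..<n} (\<lambda>_. M)). t * sqrt (real n) * \<sigma> \<le> norm (\<Sum>j<n. X (\<omega> j))}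
    \<le> 2 * exp (1 - t)"
proof -
  let ?Q = "PiM {..<n} (\<lambda>_. M)"
  interpret Q: prob_space ?Q by (intro prob_space_PiM) unfold_locales
  define \<theta> where "\<theta> = 1 / (sqrt (real n) * \<sigma>)"
  let ?N = "\<lambda>\<omega>. norm (\<Sum>j<n. X (\<omega> j))"
  have th: "0 < \<theta>" "\<theta> * B \<le> 1" "real n * \<theta>\<^sup>2 * \<sigma>\<^sup>2 = 1"
    using sg n by (auto simp: \<theta>_def field_simps power_mult_distrib)
  note E = cosh_norm_sum_iid[OF X B mean var less_imp_le[OF th(1)] th(2), of n]
  have "measure ?Q {\<omega> \<in> space ?Q. t * sqrt (real n) * \<sigma> \<le> ?N \<omega>}
      \<le> measure ?Q {\<omega> \<in> space ?Q. exp t / 2 \<le> cosh (\<theta> * ?N \<omega>)}"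
  proof (intro Q.finite_measure_mono subsetI CollectI conjI)
    show "{\<omega> \<in> space ?Q. exp t / 2 \<le> cosh (\<theta> * ?N \<omega>)} \<in> Q.events"
      using borel_measurable_integrable[OF E(1)] th by measurable
    fix \<omega> assume \<omega>: "\<omega> \<in> {\<omega> \<in> space ?Q. t * sqrt (real n) * \<sigma> \<le> ?N \<omega>}"
    then have "t \<le> \<theta> * ?N \<omega>" using sg n by (simp add: \<theta>_def field_simps)
    then have "exp t \<le> exp (\<theta> * ?N \<omega>)" by simp
    also have "\<dots> \<le> 2 * cosh (\<theta> * ?N \<omega>)" by (simp add: cosh_def)
    finally show "exp t / 2 \<le> cosh (\<theta> * ?N \<omega>)" by simp
  qed auto
  also have "\<dots> \<le> (\<integral>\<omega>. cosh (\<theta> * ?N \<omega>) \<partial>?Q) / (exp t / 2)"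
    by (rule integral_Markov_inequality_measure[where A = "{}"]) (use E(1) th in auto)
  also have "\<dots> \<le> exp 1 / (exp t / 2)"
    using E(2) th by (intro divide_right_mono) auto
  also have "\<dots> = 2 * exp (1 - t)" by (simp add: exp_diff)
  finally show ?thesis .
qed

section \<open>Gradient descent for a positive operator\<close>

text \<open>The norm of A^(1/2) x, expressed without the square root of the operator.\<close>

definition pnorm :: "('a::real_inner \<Rightarrow> 'a) \<Rightarrow> 'a \<Rightarrow> real" where
  "pnorm A x = sqrt (A x \<bullet> x)"

lemma pnorm_nonneg: "psd_op A \<Longrightarrow> 0 \<le> pnorm A x"
  by (simp add: pnorm_def psd_opD)

lemma pnorm_power2: "psd_op A \<Longrightarrow> (pnorm A x)\<^sup>2 = A x \<bullet> x"
  by (simp add: pnorm_def psd_opD)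

lemma pnorm_scaleR: "psd_op A \<Longrightarrow> pnorm A (c *\<^sub>R x) = \<bar>c\<bar> * pnorm A x"
  by (simp add: pnorm_def psd_opD real_sqrt_mult flip: power2_eq_square mult.assoc)

lemma pnorm_minus: "psd_op A \<Longrightarrow> pnorm A (- x) = pnorm A x"
  using pnorm_scaleR[of A "-1" x] by simp

lemma inner_le_pnorm:
  assumes "psd_op A"
  shows "A x \<bullet> y \<le> pnorm A x * pnorm A y"
  using real_sqrt_le_mono[OF psd_op_cauchy_schwarz[OF assms, of x y]]
  by (simp add: pnorm_def real_sqrt_mult)

lemma pnorm_triangle:
  assumes "psd_op A"
  shows "pnorm A (x + y) \<le> pnorm A x + pnorm A y"
proof (rule power2_le_imp_le)
  have "A y \<bullet> x = A x \<bullet> y" using psd_opD(2)[OF assms, of x y] by (simp add: inner_commute)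
  then have "(pnorm A (x + y))\<^sup>2 = (pnorm A x)\<^sup>2 + 2 * (A x \<bullet> y) + (pnorm A y)\<^sup>2"
    by (simp add: pnorm_power2 assms psd_opD[OF assms] inner_simps)
  also have "\<dots> \<le> (pnorm A x + pnorm A y)\<^sup>2"
    using inner_le_pnorm[OF assms, of x y] by (simp add: power2_sum)
  finally show "(pnorm A (x + y))\<^sup>2 \<le> (pnorm A x + pnorm A y)\<^sup>2" .
qed (simp add: pnorm_nonneg assms)

lemma pnorm_triangle_diff:
  assumes "psd_op A"
  shows "pnorm A (x - y) \<le> pnorm A x + pnorm A y"
  using pnorm_triangle[OF assms, of x "- y"] by (simp add: pnorm_minus assms)

lemma psd_op_add_scaleR:
  assumes "psd_op A" "0 \<le> lam"
  shows "psd_op (\<lambda>u. A u + lam *\<^sub>R u)"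
  using assms unfolding psd_op_def
  by (auto intro!: bounded_linear_add bounded_linear_scaleR_right simp: inner_simps)

lemma sum_inverse_sqrt: "(\<Sum>i<t. 1 / sqrt (real i + 1)) \<le> 2 * sqrt (real t)"
proof (induction t)
  case (Suc t)
  have "sqrt (real t) * sqrt (real t + 1) \<le> real t + 1 / 2"
    using arith_geo_mean_sqrt[of "real t" "real t + 1"] by (simp add: real_sqrt_mult[symmetric] field_simps)
  then have "1 \<le> 2 * (sqrt (real t + 1) - sqrt (real t)) * sqrt (real t + 1)"
    by (simp add: left_diff_distrib mult.assoc)
  then have "1 / sqrt (real t + 1) \<le> 2 * (sqrt (real t + 1) - sqrt (real t))"
    by (simp add: divide_le_eq)
  then show ?case using Suc by (simp add: add.commute)
qed simp

text \<open>\<open>step_size\<close> says that \<eta> times the square of \<open>A\<close> is at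
  most \<open>A\<close>, that is, \<eta> times the operator norm of \<open>A\<close> is at most 1,
  in terms of inner products alone.\<close>

locale gradient_iteration =
  fixes A :: "'h::real_inner \<Rightarrow> 'h" and \<eta> :: real
  assumes A: "psd_op A" and eta: "0 < \<eta>" and step_size: "\<And>u. \<eta> * (norm (A u))\<^sup>2 \<le> A u \<bullet> u"
begin

definition P :: "'h \<Rightarrow> 'h" where "P u = u - \<eta> *\<^sub>R A u"

text \<open>Gradient steps for the normal equation \<open>A x = v\<close>, started at 0. The result
  is a polynomial in \<open>A\<close> applied to \<open>v\<close>, whence the symmetry and the
  residual formulas below.\<close>

primrec iter :: "'h \<Rightarrow> nat \<Rightarrow> 'h" where
  "iter v 0 = 0"
| "iter v (Suc t) = P (iter v t) + \<eta> *\<^sub>R v"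

lemma P_linear: "P (x + y) = P x + P y" "P (x - y) = P x - P y" "P (c *\<^sub>R x) = c *\<^sub>R P x" "P 0 = 0"
  by (simp_all add: P_def psd_opD[OF A] algebra_simps)

lemma P_sym: "P x \<bullet> y = x \<bullet> P y"
  by (simp add: P_def inner_simps psd_opD(2)[OF A])

lemma Ppow_sym: "(P ^^ t) x \<bullet> y = x \<bullet> (P ^^ t) y"
proof (induction t arbitrary: y)
  case (Suc t)
  have "(P ^^ Suc t) x \<bullet> y = (P ^^ t) x \<bullet> P y" by (simp add: P_sym)
  also have "\<dots> = x \<bullet> (P ^^ t) (P y)" by (rule Suc)
  finally show ?case unfolding funpow_Suc_right by simp
qed simp

lemma iter_linear: "iter (x + y) t = iter x t + iter y t"
  by (induction t) (simp_all add: P_linear algebra_simps)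

lemma iter_eq_sum: "iter v t = \<eta> *\<^sub>R (\<Sum>s<t. (P ^^ s) v)"
proof (induction t)
  case (Suc t)
  have "P (\<Sum>s<t. (P ^^ s) v) = (\<Sum>s<t. (P ^^ Suc s) v)" for t
    by (induction t) (simp_all add: P_linear)
  then have "iter v (Suc t) = \<eta> *\<^sub>R ((P ^^ 0) v + (\<Sum>s<t. (P ^^ Suc s) v))"
    using Suc by (simp add: P_linear scaleR_add_right)
  also have "(P ^^ 0) v + (\<Sum>s<t. (P ^^ Suc s) v) = (\<Sum>s<Suc t. (P ^^ s) v)"
    by (rule sum.lessThan_Suc_shift[symmetric])
  finally show ?case .
qed simp

lemma iter_sym: "iter x t \<bullet> y = x \<bullet> iter y t"
  by (simp add: iter_eq_sum inner_sum_left inner_sum_right Ppow_sym)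

lemma A_iter: "A (iter v t) = v - (P ^^ t) v"
proof (induction t)
  case (Suc t)
  have P: "A (P u) = A u - \<eta> *\<^sub>R A (A u)" for u by (simp add: P_def psd_opD[OF A])
  have "A (iter v (Suc t)) = (v - (P ^^ t) v) - \<eta> *\<^sub>R A (v - (P ^^ t) v) + \<eta> *\<^sub>R A v"
    by (simp add: psd_opD[OF A] P Suc)
  also have "\<dots> = v - P ((P ^^ t) v)"
    by (simp add: P_def[of "(P ^^ t) v"] psd_opD[OF A] scaleR_diff_right)
  finally show ?case by simp
qed (simp add: psd_opD[OF A])

lemma iter_A: "iter (A f) t = f - (P ^^ t) f"
proof (induction t)
  case (Suc t)
  then show ?case by (simp add: P_linear) (simp add: P_def)
qed simp

lemma eta_A: "\<eta> * norm (A u) \<le> norm u"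
proof (cases "A u = 0")
  case False
  have "(\<eta> * norm (A u)) * norm (A u) \<le> norm u * norm (A u)"
    using step_size[of u] norm_cauchy_schwarz[of "A u" u] by (simp add: power2_eq_square mult_ac)
  then show ?thesis using False by simp
qed simp

lemma norm_P: "(norm (P u))\<^sup>2 \<le> (norm u)\<^sup>2 - \<eta> * (A u \<bullet> u)"
proof -
  have "(norm (P u))\<^sup>2 = (norm u)\<^sup>2 - 2 * \<eta> * (A u \<bullet> u) + \<eta> * (\<eta> * (norm (A u))\<^sup>2)"
    using inner_commute[of u "A u"] unfolding P_def power2_norm_eq_inner
    by (simp add: inner_diff_left inner_diff_right right_diff_distrib)
  also have "\<dots> \<le> (norm u)\<^sup>2 - 2 * \<eta> * (A u \<bullet> u) + \<eta> * (A u \<bullet> u)"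
    using step_size[of u] eta by simp
  finally show ?thesis by simp
qed

lemma norm_P_le: "norm (P u) \<le> norm u"
proof (rule power2_le_imp_le)
  have "0 \<le> \<eta> * (A u \<bullet> u)" using eta psd_opD(3)[OF A, of u] by simp
  then show "(norm (P u))\<^sup>2 \<le> (norm u)\<^sup>2" using norm_P[of u] by linarith
qed simp

lemma A_P_le: "A (P u) \<bullet> P u \<le> A u \<bullet> u"
proof -
  have "\<eta> * (A (A u) \<bullet> A u) \<le> (\<eta> * norm (A (A u))) * norm (A u)"
    using norm_cauchy_schwarz[of "A (A u)" "A u"] eta by (simp add: mult.assoc)
  also have "\<dots> \<le> norm (A u) * norm (A u)" using eta_A[of "A u"] by (intro mult_right_mono) auto
  finally have "\<eta> * (\<eta> * (A (A u) \<bullet> A u)) \<le> \<eta> * (A u \<bullet> A u)"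
    using eta by (intro mult_left_mono) (auto simp: norm_eq_sqrt_inner)
  moreover have "0 \<le> \<eta> * (A u \<bullet> A u)" using eta by simp
  moreover have "A (P u) \<bullet> P u = A u \<bullet> u - 2 * (\<eta> * (A u \<bullet> A u)) + \<eta> * (\<eta> * (A (A u) \<bullet> A u))"
    using psd_opD(2)[OF A, of "A u" u] inner_commute[of u "A (A u)"] psd_opD(2)[OF A, of "A u" "A u"]
    by (simp add: P_def psd_opD(6,7)[OF A] inner_diff_left inner_diff_right right_diff_distrib)
  ultimately show ?thesis by linarith
qed

lemma norm_Ppow_le: "norm ((P ^^ t) u) \<le> norm u"
  by (induction t) (auto intro: order_trans[OF norm_P_le])

text \<open>In each step the squared norm drops by at least \<eta> times the form of
  \<open>A\<close>, so the first t + 1 values of the form, times \<eta>, sum to at most the initial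
  squared norm. These values do not increase, hence the last one is at most their average.\<close>

lemma A_Ppow: "\<eta> * (real t + 1) * (A ((P ^^ t) u) \<bullet> (P ^^ t) u) \<le> (norm u)\<^sup>2"
proof -
  let ?a = "\<lambda>s. A ((P ^^ s) u) \<bullet> (P ^^ s) u"
  have mono: "?a t \<le> ?a s" if "s \<le> t" for s t
    using that by (induction t rule: dec_induct) (auto intro: order_trans[OF A_P_le])
  have "(norm ((P ^^ t) u))\<^sup>2 + \<eta> * (\<Sum>s<t. ?a s) \<le> (norm u)\<^sup>2" for t
  proof (induction t)
    case (Suc t)
    then show ?case using norm_P[of "(P ^^ t) u"] by (simp add: algebra_simps)
  qed simp
  from this[of "Suc t"] have "\<eta> * (\<Sum>s<Suc t. ?a s) \<le> (norm u)\<^sup>2"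
    using zero_le_power2[of "norm ((P ^^ Suc t) u)"] by linarith
  moreover have "(\<Sum>s<Suc t. ?a t) \<le> (\<Sum>s<Suc t. ?a s)" by (intro sum_mono mono) auto
  then have "\<eta> * ((real t + 1) * ?a t) \<le> \<eta> * (\<Sum>s<Suc t. ?a s)"
    using eta by (intro mult_left_mono) (auto simp: algebra_simps)
  ultimately show ?thesis by (simp add: mult.assoc)
qed

lemma pnorm_A_Ppow: "pnorm A ((P ^^ t) u) \<le> norm u / sqrt (\<eta> * (real t + 1))"
proof -
  have "A ((P ^^ t) u) \<bullet> (P ^^ t) u \<le> (norm u)\<^sup>2 / (\<eta> * (real t + 1))"
    using A_Ppow[of t u] eta by (subst pos_le_divide_eq) (simp_all add: mult_ac)
  from real_sqrt_le_mono[OF this] show ?thesis by (simp add: pnorm_def real_sqrt_divide)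
qed

section \<open>Bounds in the norm of the regularized operator\<close>

context
  fixes lam :: real
  assumes lam_pos: "0 < lam"
begin

definition B :: "'h \<Rightarrow> 'h" where "B u = A u + lam *\<^sub>R u"

lemma psd_op_B: "psd_op B"
  unfolding B_def[abs_def] using psd_op_add_scaleR[OF A] lam_pos by simp

lemma pnorm_B_power2: "(pnorm B u)\<^sup>2 = A u \<bullet> u + lam * (norm u)\<^sup>2"
  unfolding pnorm_power2[OF psd_op_B] by (simp add: B_def inner_simps dot_square_norm)

lemma norm_le_pnorm_B: "norm u \<le> pnorm B u / sqrt lam"
proof -
  have "norm u = sqrt (lam * (norm u)\<^sup>2) / sqrt lam" using lam_pos by (simp add: real_sqrt_mult)
  also have "\<dots> \<le> sqrt ((pnorm B u)\<^sup>2) / sqrt lam"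
    using lam_pos psd_opD(3)[OF A, of u] by (intro divide_right_mono real_sqrt_le_mono) (auto simp: pnorm_B_power2)
  finally show ?thesis by (simp add: pnorm_nonneg psd_op_B)
qed

lemma pnorm_B_P_le: "pnorm B (P u) \<le> pnorm B u"
proof (rule power2_le_imp_le)
  have "(norm (P u))\<^sup>2 \<le> (norm u)\<^sup>2" by (intro power_mono norm_P_le) simp
  then show "(pnorm B (P u))\<^sup>2 \<le> (pnorm B u)\<^sup>2"
    using A_P_le[of u] lam_pos by (auto simp: pnorm_B_power2 intro!: add_mono)
qed (rule pnorm_nonneg[OF psd_op_B])

lemma pnorm_B_Ppow_le: "pnorm B ((P ^^ t) u) \<le> pnorm B u"
  by (induction t) (auto intro: order_trans[OF pnorm_B_P_le])

lemma pnorm_B_iter_le: "pnorm B (iter u t) \<le> \<eta> * real t * pnorm B u"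
proof (induction t)
  case 0
  then show ?case by (simp add: pnorm_def)
next
  case (Suc t)
  have "pnorm B (iter u (Suc t)) \<le> pnorm B (P (iter u t)) + \<eta> * pnorm B u"
    using pnorm_triangle[OF psd_op_B, of "P (iter u t)" "\<eta> *\<^sub>R u"] eta by (simp add: pnorm_scaleR psd_op_B)
  also have "\<dots> \<le> \<eta> * real t * pnorm B u + \<eta> * pnorm B u"
    using pnorm_B_P_le[of "iter u t"] Suc by simp
  finally show ?case by (simp add: algebra_simps)
qed

text \<open>If g(A) is the polynomial behind \<open>iter\<close>, then (A + lam) g(A) = 1 - P^t +
  lam g(A), and each of the three terms has norm at most 1 with respect to \<open>pnorm B\<close>.
  As \<open>Q\<close> bounds \<open>v\<close> in the dual norm, the polynomial is moved from
  \<open>v\<close> to the other argument of the inner product.\<close>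

lemma pnorm_iter:
  assumes Q: "\<And>y. v \<bullet> y \<le> Q * pnorm B y" and Q0: "0 \<le> Q" and t: "\<eta> * real t * lam \<le> 1"
  shows "pnorm B (iter v t) \<le> 3 * Q"
proof -
  let ?b = "iter v t"
  let ?y = "?b - (P ^^ t) ?b + lam *\<^sub>R iter ?b t"
  have "(pnorm B ?b)\<^sup>2 = v \<bullet> ?y"
    unfolding pnorm_power2[OF psd_op_B]
    by (simp add: B_def A_iter inner_simps Ppow_sym iter_sym)
  also have "\<dots> \<le> Q * pnorm B ?y" by (rule Q)
  also have "pnorm B ?y \<le> (pnorm B ?b + pnorm B ((P ^^ t) ?b)) + lam * pnorm B (iter ?b t)"
    using pnorm_triangle[OF psd_op_B, of "?b - (P ^^ t) ?b" "lam *\<^sub>R iter ?b t"]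
      pnorm_triangle_diff[OF psd_op_B, of ?b "(P ^^ t) ?b"] lam_pos
    by (simp add: pnorm_scaleR psd_op_B)
  also have "\<dots> \<le> (pnorm B ?b + pnorm B ?b) + 1 * pnorm B ?b"
  proof (intro add_mono order_refl pnorm_B_Ppow_le)
    have "lam * pnorm B (iter ?b t) \<le> lam * (\<eta> * real t * pnorm B ?b)"
      using lam_pos by (intro mult_left_mono pnorm_B_iter_le) auto
    also have "\<dots> \<le> 1 * pnorm B ?b"
      using mult_right_mono[OF t pnorm_nonneg[OF psd_op_B, of ?b]] by (simp add: mult_ac)
    finally show "lam * pnorm B (iter ?b t) \<le> 1 * pnorm B ?b" .
  qed
  finally have "pnorm B ?b * pnorm B ?b \<le> (3 * Q) * pnorm B ?b"
    using Q0 by (simp add: power2_eq_square mult_left_mono)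
  then show ?thesis
    using pnorm_nonneg[OF psd_op_B, of ?b] Q0 by (cases "pnorm B ?b = 0") auto
qed

text \<open>The difference to \<open>f\<close> consists of the iteration driven by \<open>w\<close>
  alone and of the part \<open>(P ^^ t) f\<close> that is not yet learned. The second claim asks for
  \<open>t\<close> not too small, since only then has the form of \<open>A\<close> at
  \<open>(P ^^ t) f\<close> fallen to order \<open>lam\<close>; late iterates meet this
  condition.\<close>

lemma iter_error:
  assumes Q: "\<And>y. w \<bullet> y \<le> Q * pnorm B y" and Q0: "0 \<le> Q" and t: "\<eta> * real t * lam \<le> 1"
  shows "norm (iter (A f + w) t) \<le> 2 * norm f + 3 * Q / sqrt lam"
    and "1 \<le> 2 * lam * \<eta> * (real t + 1) \<Longrightarrow> pnorm B (iter (A f + w) t - f) \<le> 2 * sqrt lam * norm f + 3 * Q"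
proof -
  have eq: "iter (A f + w) t - f = iter w t - (P ^^ t) f"
    by (simp add: iter_linear iter_A)
  have "norm (iter w t) \<le> 3 * Q / sqrt lam"
    by (rule order_trans[OF norm_le_pnorm_B divide_right_mono[OF pnorm_iter[OF Q Q0 t]]]) (use lam_pos in auto)
  then show "norm (iter (A f + w) t) \<le> 2 * norm f + 3 * Q / sqrt lam"
    using norm_triangle_ineq[of "iter w t - (P ^^ t) f" f] norm_triangle_ineq4[of "iter w t" "(P ^^ t) f"]
      norm_Ppow_le[of t f] unfolding eq[symmetric] by simp
  assume t2: "1 \<le> 2 * lam * \<eta> * (real t + 1)"
  have "pnorm B ((P ^^ t) f) \<le> 2 * sqrt lam * norm f"
  proof (rule power2_le_imp_le)
    have "A ((P ^^ t) f) \<bullet> (P ^^ t) f * 1 \<le> A ((P ^^ t) f) \<bullet> (P ^^ t) f * (2 * lam * \<eta> * (real t + 1))"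
      using t2 by (intro mult_left_mono psd_opD(3)[OF A])
    also have "\<dots> = 2 * lam * (\<eta> * (real t + 1) * (A ((P ^^ t) f) \<bullet> (P ^^ t) f))" by (simp add: mult_ac)
    also have "\<dots> \<le> 2 * lam * (norm f)\<^sup>2" using lam_pos A_Ppow[of t f] by (intro mult_left_mono) auto
    finally have "A ((P ^^ t) f) \<bullet> (P ^^ t) f \<le> 2 * lam * (norm f)\<^sup>2" by simp
    moreover have "lam * (norm ((P ^^ t) f))\<^sup>2 \<le> lam * (norm f)\<^sup>2"
      using lam_pos by (intro mult_left_mono power_mono norm_Ppow_le) auto
    moreover have "0 \<le> lam * (norm f)\<^sup>2" using lam_pos by simp
    moreover have "(2 * sqrt lam * norm f)\<^sup>2 = 4 * (lam * (norm f)\<^sup>2)"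
      using lam_pos by (simp add: power_mult_distrib)
    ultimately show "(pnorm B ((P ^^ t) f))\<^sup>2 \<le> (2 * sqrt lam * norm f)\<^sup>2"
      unfolding pnorm_B_power2 by linarith
  qed (use lam_pos in simp)
  then show "pnorm B (iter (A f + w) t - f) \<le> 2 * sqrt lam * norm f + 3 * Q"
    using pnorm_triangle_diff[OF psd_op_B, of "iter w t" "(P ^^ t) f"] pnorm_iter[OF Q Q0 t]
    unfolding eq by linarith
qed

end

text \<open>By Duhamel's formula the forcing at time \<open>s\<close> is damped by
  \<open>t - Suc s\<close> further steps. In the norm of \<open>A\<close>, damping by i steps
  contributes a factor 1/sqrt(\<eta>(i + 1)), whose sum grows only like \<open>sqrt t\<close>; this
  saves \<open>sqrt (\<eta> * t)\<close> against the plain norm.\<close>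

lemma perturbed_iteration:
  assumes d0: "d 0 = 0" and step: "\<And>s. s < t \<Longrightarrow> d (Suc s) = P (d s) + \<eta> *\<^sub>R \<xi> s"
    and X: "\<And>s. s < t \<Longrightarrow> norm (\<xi> s) \<le> X" and X0: "0 \<le> X"
  shows "norm (d t) \<le> \<eta> * real t * X" and "pnorm A (d t) \<le> 2 * sqrt (\<eta> * real t) * X"
proof -
  have eq: "d u = \<eta> *\<^sub>R (\<Sum>s<u. (P ^^ (u - Suc s)) (\<xi> s))" if "u \<le> t" for u using that
  proof (induction u)
    case (Suc u)
    have Psum: "P (\<Sum>s\<in>S. f s) = (\<Sum>s\<in>S. P (f s))" if "finite S" for f :: "nat \<Rightarrow> 'h" and S
      using that by (induction S rule: finite_induct) (simp_all add: P_linear)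
    have "P ((P ^^ (u - Suc s)) x) = (P ^^ (u - s)) x" if "s < u" for s x
    proof -
      have "u - s = Suc (u - Suc s)" using that by simp
      then show ?thesis by simp
    qed
    then have "P (\<Sum>s<u. (P ^^ (u - Suc s)) (\<xi> s)) = (\<Sum>s<u. (P ^^ (u - s)) (\<xi> s))"
      by (simp add: Psum)
    then show ?case using Suc step[of u] by (simp add: P_linear scaleR_add_right)
  qed (simp add: d0)
  have "norm (d t) \<le> \<eta> * (\<Sum>s<t. norm ((P ^^ (t - Suc s)) (\<xi> s)))"
    using eta by (simp add: eq norm_sum mult_left_mono)
  also have "\<dots> \<le> \<eta> * (\<Sum>s<t. X)"
    using eta order_trans[OF norm_Ppow_le X] by (intro mult_left_mono sum_mono) auto
  finally show "norm (d t) \<le> \<eta> * real t * X" by (simp add: mult_ac)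
  have tri: "pnorm A (sum f S) \<le> (\<Sum>s\<in>S. pnorm A (f s))" if "finite S" for f :: "nat \<Rightarrow> 'h" and S
    using that
  proof (induction S rule: finite_induct)
    case (insert x F)
    then show ?case using pnorm_triangle[OF A, of "f x" "sum f F"] by simp
  qed (simp add: pnorm_def)
  have "pnorm A (d t) = \<eta> * pnorm A (\<Sum>s<t. (P ^^ (t - Suc s)) (\<xi> s))"
    using eta by (simp add: eq pnorm_scaleR A)
  also have "\<dots> \<le> \<eta> * (\<Sum>s<t. pnorm A ((P ^^ (t - Suc s)) (\<xi> s)))"
    using eta by (intro mult_left_mono tri) auto
  also have "\<dots> \<le> \<eta> * (\<Sum>s<t. X / sqrt (\<eta> * (real (t - Suc s) + 1)))"
  proof (intro mult_left_mono sum_mono)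
    fix s assume s: "s \<in> {..<t}"
    have "pnorm A ((P ^^ (t - Suc s)) (\<xi> s)) \<le> norm (\<xi> s) / sqrt (\<eta> * (real (t - Suc s) + 1))"
      by (rule pnorm_A_Ppow)
    also have "\<dots> \<le> X / sqrt (\<eta> * (real (t - Suc s) + 1))"
      using s X eta by (intro divide_right_mono) auto
    finally show "pnorm A ((P ^^ (t - Suc s)) (\<xi> s)) \<le> X / sqrt (\<eta> * (real (t - Suc s) + 1))" .
  qed (use eta in simp)
  also have "(\<Sum>s<t. X / sqrt (\<eta> * (real (t - Suc s) + 1))) = (\<Sum>i<t. X / sqrt (\<eta> * (real i + 1)))"
    by (rule sum.nat_diff_reindex)
  also have "\<eta> * \<dots> = sqrt \<eta> * X * (\<Sum>i<t. 1 / sqrt (real i + 1))"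
  proof -
    have "\<eta> * (X / sqrt (\<eta> * (real i + 1))) = sqrt \<eta> * X * (1 / sqrt (real i + 1))" for i
    proof -
      have "\<eta> * (X / sqrt (\<eta> * (real i + 1))) = (sqrt \<eta> * sqrt \<eta>) * (X / (sqrt \<eta> * sqrt (real i + 1)))"
        unfolding real_sqrt_mult using eta by simp
      also have "\<dots> = sqrt \<eta> * X * (1 / sqrt (real i + 1))"
        using eta by (simp add: divide_simps)
      finally show ?thesis .
    qed
    then show ?thesis by (simp only: sum_distrib_left)
  qed
  also have "\<dots> \<le> sqrt \<eta> * X * (2 * sqrt (real t))"
    using eta X0 by (intro mult_left_mono sum_inverse_sqrt) auto
  finally show "pnorm A (d t) \<le> 2 * sqrt (\<eta> * real t) * X" by (simp add: real_sqrt_mult mult_ac)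
qed

end

section \<open>Gradient descent with perturbed features\<close>

definition empirical_cov :: "nat \<Rightarrow> (nat \<Rightarrow> 'h::real_inner) \<Rightarrow> 'h \<Rightarrow> 'h" where
  "empirical_cov n k u = (1 / real n) *\<^sub>R (\<Sum>j<n. (k j \<bullet> u) *\<^sub>R k j)"

lemma empirical_cov_inner:
  "empirical_cov n k u \<bullet> v = (1 / real n) * (\<Sum>j<n. (k j \<bullet> u) * (k j \<bullet> v))"
  by (simp add: empirical_cov_def inner_sum_left)

lemma psd_op_empirical_cov: "psd_op (empirical_cov n k)"
  unfolding psd_op_def
proof (intro conjI allI)
  show "bounded_linear (empirical_cov n k)"
    unfolding empirical_cov_def[abs_def]
    by (intro bounded_linear_scaleR_right[THEN bounded_linear_compose] bounded_linear_sum
        bounded_linear_scaleR_left[THEN bounded_linear_compose] bounded_linear_inner_right)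
  show "empirical_cov n k x \<bullet> y = x \<bullet> empirical_cov n k y" for x y
    by (subst inner_commute[of x]) (simp add: empirical_cov_inner mult.commute)
  show "0 \<le> empirical_cov n k x \<bullet> x" for x
    by (simp add: empirical_cov_inner sum_nonneg)
qed

lemma pnorm_empirical_cov: "pnorm (empirical_cov n k) u = L2_set (\<lambda>j. k j \<bullet> u) {..<n} / sqrt (real n)"
  by (simp add: pnorm_def empirical_cov_inner L2_set_def real_sqrt_divide power2_eq_square)

lemma empirical_cov_bound:
  assumes "\<And>j. j < n \<Longrightarrow> norm (k j) \<le> \<kappa>"
  shows "empirical_cov n k u \<bullet> u \<le> \<kappa>\<^sup>2 * (norm u)\<^sup>2"
proof -
  have "(\<Sum>j<n. (k j \<bullet> u) * (k j \<bullet> u)) \<le> (\<Sum>j<n. \<kappa>\<^sup>2 * (norm u)\<^sup>2)"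
  proof (rule sum_mono)
    fix j assume "j \<in> {..<n}"
    then have "\<bar>k j \<bullet> u\<bar> \<le> \<kappa> * norm u"
      using Cauchy_Schwarz_ineq2[of "k j" u] mult_right_mono[OF assms[of j] norm_ge_zero[of u]] by simp
    from power_mono[OF this, of 2] show "(k j \<bullet> u) * (k j \<bullet> u) \<le> \<kappa>\<^sup>2 * (norm u)\<^sup>2"
      by (simp add: power2_eq_square mult_ac)
  qed
  then show ?thesis by (cases "n = 0") (simp_all add: empirical_cov_inner field_simps)
qed

text \<open>Cauchy-Schwarz for \<open>u\<close> and \<open>A u\<close> shows that the square of
  \<open>A\<close> is at most \<open>\<kappa>\<^sup>2\<close> times \<open>A\<close>.\<close>

lemma gradient_iteration_empirical_cov:
  assumes k: "\<And>j. j < n \<Longrightarrow> norm (k j) \<le> \<kappa>" and eta: "0 < \<eta>" "\<eta> * \<kappa>\<^sup>2 \<le> 1"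
  shows "gradient_iteration (empirical_cov n k) \<eta>"
proof
  show "psd_op (empirical_cov n k)" by (rule psd_op_empirical_cov)
  fix u
  let ?A = "empirical_cov n k"
  have "(norm (?A u))\<^sup>2 * (norm (?A u))\<^sup>2 \<le> (?A u \<bullet> u) * (?A (?A u) \<bullet> ?A u)"
    using psd_op_cauchy_schwarz[OF psd_op_empirical_cov, of n k u "?A u"]
    by (simp only: power2_norm_eq_inner) (simp only: power2_eq_square)
  also have "\<dots> \<le> (?A u \<bullet> u) * (\<kappa>\<^sup>2 * (norm (?A u))\<^sup>2)"
    by (intro mult_left_mono empirical_cov_bound k psd_opD(3)[OF psd_op_empirical_cov])
  finally have "(norm (?A u))\<^sup>2 * (norm (?A u))\<^sup>2 \<le> (\<kappa>\<^sup>2 * (?A u \<bullet> u)) * (norm (?A u))\<^sup>2"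
    by (simp add: mult_ac)
  then have "(norm (?A u))\<^sup>2 \<le> \<kappa>\<^sup>2 * (?A u \<bullet> u)"
  proof (cases "?A u = 0")
    case False
    then have "0 < (norm (?A u))\<^sup>2" by simp
    then show ?thesis using \<open>_ \<le> (\<kappa>\<^sup>2 * (?A u \<bullet> u)) * (norm (?A u))\<^sup>2\<close> mult_right_le_imp_le by blast
  qed simp
  then have "\<eta> * (norm (?A u))\<^sup>2 \<le> (\<eta> * \<kappa>\<^sup>2) * (?A u \<bullet> u)"
    using eta by (simp add: mult.assoc)
  also have "\<dots> \<le> 1 * (?A u \<bullet> u)"
    by (intro mult_right_mono eta psd_opD(3)[OF psd_op_empirical_cov])
  finally show "\<eta> * (norm (?A u))\<^sup>2 \<le> ?A u \<bullet> u" by simp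
qed (rule eta)

lemma gradient_descent_eq_iter:
  assumes gi: "gradient_iteration (empirical_cov n (\<lambda>j. k (fst (d j)))) \<eta>"
    and evl: "\<And>f j. j < n \<Longrightarrow> evl f (fst (d j)) = f \<bullet> k (fst (d j))"
  shows "gradient_descent evl k \<eta> n d t
    = gradient_iteration.iter (empirical_cov n (\<lambda>j. k (fst (d j)))) \<eta>
        ((1 / real n) *\<^sub>R (\<Sum>j<n. snd (d j) *\<^sub>R k (fst (d j)))) t"
proof -
  interpret gradient_iteration "empirical_cov n (\<lambda>j. k (fst (d j)))" \<eta> by (rule gi)
  show ?thesis
  proof (induction t)
    case (Suc t)
    let ?f = "gradient_descent evl k \<eta> n d t"
    have "(\<Sum>j<n. (evl ?f (fst (d j)) - snd (d j)) *\<^sub>R k (fst (d j)))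
        = (\<Sum>j<n. (k (fst (d j)) \<bullet> ?f) *\<^sub>R k (fst (d j))) - (\<Sum>j<n. snd (d j) *\<^sub>R k (fst (d j)))"
      by (simp add: evl scaleR_diff_left sum_subtractf inner_commute)
    then have "gradient_descent evl k \<eta> n d (Suc t)
        = P ?f + \<eta> *\<^sub>R ((1 / real n) *\<^sub>R (\<Sum>j<n. snd (d j) *\<^sub>R k (fst (d j))))"
      by (simp add: P_def empirical_cov_def scaleR_diff_right)
    then show ?case by (simp only: Suc iter.simps)
  qed simp
qed

lemma mean_le_root_mean_square:
  fixes a :: "nat \<Rightarrow> real"
  shows "(1 / real n) * (\<Sum>j<n. a j) \<le> sqrt ((1 / real n) * (\<Sum>j<n. (a j)\<^sup>2))"
proof (cases "n = 0")
  case False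
  have "(\<Sum>j<n. a j)\<^sup>2 \<le> real n * (\<Sum>j<n. (a j)\<^sup>2)"
    using Cauchy_Schwarz_ineq_sum[of "\<lambda>_. 1" a "{..<n}"] by simp
  then have "((1 / real n) * (\<Sum>j<n. a j))\<^sup>2 \<le> (1 / real n) * (\<Sum>j<n. (a j)\<^sup>2)"
    using False by (simp add: power_divide power2_eq_square field_simps)
  then show ?thesis by (rule real_le_rsqrt)
qed simp

text \<open>Both iterations are compared along the perturbed one: the difference \<open>d\<close> solves the
  iteration for \<open>k'\<close> with a forcing term controlled by the distance of \<open>k\<close> and \<open>k'\<close>. If that
  distance exceeds \<open>sqrt lam\<close> the crude bound in norm suffices.\<close>

lemma perturbed_gradient_descent:
  fixes k k' :: "nat \<Rightarrow> 'h::real_inner" and T :: "'h \<Rightarrow> 'h"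
  assumes n: "0 < n" and k: "\<And>j. j < n \<Longrightarrow> norm (k j) \<le> \<kappa>" and k': "\<And>j. j < n \<Longrightarrow> norm (k' j) \<le> \<kappa>"
    and eta: "0 < \<eta>" "\<eta> * \<kappa>\<^sup>2 \<le> 1" and y: "\<And>j. j < n \<Longrightarrow> \<bar>y j\<bar> \<le> M" and M: "0 \<le> M"
    and lam: "0 < lam" and t: "\<eta> * real t * lam \<le> 1"
    and T: "psd_op T" "\<And>f. T f \<bullet> f \<le> \<kappa>\<^sup>2 * (norm f)\<^sup>2" and C: "0 \<le> C"
    and low: "\<And>f. T f \<bullet> f \<le> C * (empirical_cov n k f \<bullet> f + lam * (norm f)\<^sup>2)"
    and F: "\<And>s. s \<le> t \<Longrightarrow> norm (gradient_iteration.iter (empirical_cov n k) \<eta>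
              ((1 / real n) *\<^sub>R (\<Sum>j<n. y j *\<^sub>R k j)) s) \<le> F"
  defines "q \<equiv> sqrt ((1 / real n) * (\<Sum>j<n. (norm (k' j - k j))\<^sup>2))"
  shows "pnorm T (gradient_iteration.iter (empirical_cov n k') \<eta> ((1 / real n) *\<^sub>R (\<Sum>j<n. y j *\<^sub>R k' j)) t
        - gradient_iteration.iter (empirical_cov n k) \<eta> ((1 / real n) *\<^sub>R (\<Sum>j<n. y j *\<^sub>R k j)) t)
      \<le> (M + 2 * \<kappa> * F) * (4 * sqrt C / sqrt lam * q + \<kappa> / (lam * sqrt lam) * q\<^sup>2)"
proof -
  interpret g: gradient_iteration "empirical_cov n k" \<eta> by (rule gradient_iteration_empirical_cov[OF k eta])
  interpret g': gradient_iteration "empirical_cov n k'" \<eta> by (rule gradient_iteration_empirical_cov[OF k' eta])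
  let ?A = "empirical_cov n k" and ?A' = "empirical_cov n k'"
  let ?v = "(1 / real n) *\<^sub>R (\<Sum>j<n. y j *\<^sub>R k j)" and ?v' = "(1 / real n) *\<^sub>R (\<Sum>j<n. y j *\<^sub>R k' j)"
  define d where "d s = g'.iter ?v' s - g.iter ?v s" for s
  \<comment> \<open>The forcing is evaluated at the unperturbed iterates, whose norms are bounded by
    \<open>F\<close>.\<close>
  define \<xi> where "\<xi> s = (?A (g.iter ?v s) - ?A' (g.iter ?v s)) + (?v' - ?v)" for s
  define X where "X = (M + 2 * \<kappa> * F) * q"
  have kap: "0 \<le> \<kappa>" using k[OF n] norm_ge_zero order_trans by blast
  have F0: "0 \<le> F" using F[of 0] by simp
  have q0: "0 \<le> q" by (simp add: q_def sum_nonneg)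
  have X0: "0 \<le> X" using M kap F0 q0 by (simp add: X_def)
  have avg: "(1 / real n) * (\<Sum>j<n. norm (k' j - k j)) \<le> q"
    unfolding q_def by (rule mean_le_root_mean_square)
  have cov_diff: "norm (?A u - ?A' u) \<le> 2 * \<kappa> * norm u * q" for u
  proof -
    have "?A u - ?A' u = (1 / real n) *\<^sub>R (\<Sum>j<n. (k j \<bullet> u) *\<^sub>R k j - (k' j \<bullet> u) *\<^sub>R k' j)"
      by (simp add: empirical_cov_def sum_subtractf scaleR_diff_right)
    then have "norm (?A u - ?A' u) = (1 / real n) * norm (\<Sum>j<n. (k j \<bullet> u) *\<^sub>R k j - (k' j \<bullet> u) *\<^sub>R k' j)"
      by simp
    also have "\<dots> \<le> (1 / real n) * (\<Sum>j<n. 2 * \<kappa> * norm u * norm (k' j - k j))"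
    proof (intro mult_left_mono sum_norm_le)
      fix j assume "j \<in> {..<n}"
      then have j: "norm (k j) \<le> \<kappa>" "norm (k' j) \<le> \<kappa>" using k k' by auto
      have "(k j \<bullet> u) *\<^sub>R k j - (k' j \<bullet> u) *\<^sub>R k' j = (k j \<bullet> u) *\<^sub>R (k j - k' j) + ((k j - k' j) \<bullet> u) *\<^sub>R k' j"
        by (simp add: algebra_simps inner_diff_left)
      then have "norm ((k j \<bullet> u) *\<^sub>R k j - (k' j \<bullet> u) *\<^sub>R k' j)
          \<le> \<bar>k j \<bullet> u\<bar> * norm (k j - k' j) + \<bar>(k j - k' j) \<bullet> u\<bar> * norm (k' j)"
        using norm_triangle_ineq[of "(k j \<bullet> u) *\<^sub>R (k j - k' j)" "((k j - k' j) \<bullet> u) *\<^sub>R k' j"] by simp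
      also have "\<dots> \<le> (\<kappa> * norm u) * norm (k j - k' j) + (norm (k j - k' j) * norm u) * \<kappa>"
        using j kap
        by (intro add_mono mult_mono order_trans[OF Cauchy_Schwarz_ineq2 mult_right_mono]) (auto simp: Cauchy_Schwarz_ineq2)
      finally show "norm ((k j \<bullet> u) *\<^sub>R k j - (k' j \<bullet> u) *\<^sub>R k' j) \<le> 2 * \<kappa> * norm u * norm (k' j - k j)"
        by (simp add: norm_minus_commute mult_ac)
    qed simp
    also have "\<dots> = 2 * \<kappa> * norm u * ((1 / real n) * (\<Sum>j<n. norm (k' j - k j)))"
      by (simp add: sum_distrib_left)
    also have "\<dots> \<le> 2 * \<kappa> * norm u * q" using kap by (intro mult_left_mono avg) auto
    finally show ?thesis .
  qed
  have v_diff: "norm (?v' - ?v) \<le> M * q"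
  proof -
    have "?v' - ?v = (1 / real n) *\<^sub>R (\<Sum>j<n. y j *\<^sub>R (k' j - k j))"
      by (simp add: sum_subtractf scaleR_diff_right)
    then have "norm (?v' - ?v) = (1 / real n) * norm (\<Sum>j<n. y j *\<^sub>R (k' j - k j))" by simp
    also have "\<dots> \<le> (1 / real n) * (\<Sum>j<n. M * norm (k' j - k j))"
      using y by (intro mult_left_mono sum_norm_le) (auto intro!: mult_right_mono)
    also have "\<dots> = M * ((1 / real n) * (\<Sum>j<n. norm (k' j - k j)))" by (simp add: sum_distrib_left)
    also have "\<dots> \<le> M * q" using M by (intro mult_left_mono avg)
    finally show ?thesis .
  qed
  have xi: "norm (\<xi> s) \<le> X" if "s < t" for s
  proof -
    have "norm (\<xi> s) \<le> 2 * \<kappa> * norm (g.iter ?v s) * q + M * q"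
      unfolding \<xi>_def by (rule norm_triangle_le) (intro add_mono cov_diff v_diff)
    also have "\<dots> \<le> 2 * \<kappa> * F * q + M * q"
      using F[of s] that kap q0 by (intro add_mono mult_right_mono mult_left_mono) auto
    finally show ?thesis by (simp add: X_def algebra_simps)
  qed
  have step: "d (Suc s) = g'.P (d s) + \<eta> *\<^sub>R \<xi> s" for s
    by (simp add: d_def \<xi>_def g'.P_linear) (simp add: g.P_def g'.P_def algebra_simps)
  have d0: "d 0 = 0" by (simp add: d_def)
  note pert = g'.perturbed_iteration[where d = d and t = t and \<xi> = \<xi> and X = X, OF d0 step xi X0]
  have et: "\<eta> * real t \<le> 1 / lam" using t lam by (simp add: field_simps)
  have d_norm: "norm (d t) \<le> X / lam"
    using pert(1) mult_right_mono[OF et X0] by simp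
  have "sqrt (\<eta> * real t) \<le> 1 / sqrt lam" using real_sqrt_le_mono[OF et] by (simp add: real_sqrt_divide)
  then have d_emp': "pnorm ?A' (d t) \<le> 2 * (1 / sqrt lam) * X"
    using pert(2) mult_right_mono[of "2 * sqrt (\<eta> * real t)" "2 * (1 / sqrt lam)" X] X0 by simp
  have d_T: "pnorm T (d t) \<le> X * (4 * sqrt C / sqrt lam + \<kappa> / (lam * sqrt lam) * q)"
  proof (cases "q \<le> sqrt lam")
    case True
    \<comment> \<open>The lower bound \<open>low\<close> concerns the unperturbed features, whereas
      the smoothing estimate holds for the perturbed ones. The exchange costs \<open>q\<close> times
      the plain norm, which is affordable as \<open>q \<le> sqrt lam\<close>.\<close>
    have "pnorm ?A (d t) \<le> pnorm ?A' (d t) + q * norm (d t)"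
    proof -
      have "L2_set (\<lambda>j. k j \<bullet> d t) {..<n} = L2_set (\<lambda>j. k' j \<bullet> d t + (k j - k' j) \<bullet> d t) {..<n}"
        by (simp add: inner_diff_left)
      also have "\<dots> \<le> L2_set (\<lambda>j. k' j \<bullet> d t) {..<n} + L2_set (\<lambda>j. (k j - k' j) \<bullet> d t) {..<n}"
        by (rule L2_set_triangle_ineq)
      also have "\<dots> \<le> L2_set (\<lambda>j. k' j \<bullet> d t) {..<n} + L2_set (\<lambda>j. norm (k' j - k j) * norm (d t)) {..<n}"
      proof (rule add_left_mono)
        have "((k j - k' j) \<bullet> d t)\<^sup>2 \<le> (norm (k' j - k j) * norm (d t))\<^sup>2" for j
          using Cauchy_Schwarz_ineq2[of "k j - k' j" "d t"] by (simp add: norm_minus_commute abs_le_square_iff[symmetric])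
        then show "L2_set (\<lambda>j. (k j - k' j) \<bullet> d t) {..<n} \<le> L2_set (\<lambda>j. norm (k' j - k j) * norm (d t)) {..<n}"
          unfolding L2_set_def by (intro real_sqrt_le_mono sum_mono)
      qed
      also have "L2_set (\<lambda>j. norm (k' j - k j) * norm (d t)) {..<n} = L2_set (\<lambda>j. norm (k' j - k j)) {..<n} * norm (d t)"
        by (rule L2_set_left_distrib[symmetric]) simp
      finally have "L2_set (\<lambda>j. k j \<bullet> d t) {..<n} / sqrt (real n)
         \<le> (L2_set (\<lambda>j. k' j \<bullet> d t) {..<n} + L2_set (\<lambda>j. norm (k' j - k j)) {..<n} * norm (d t)) / sqrt (real n)"
        by (rule divide_right_mono) (rule real_sqrt_ge_zero, rule of_nat_0_le_iff)
      moreover have "q = L2_set (\<lambda>j. norm (k' j - k j)) {..<n} / sqrt (real n)"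
        by (simp add: q_def L2_set_def real_sqrt_divide)
      ultimately show ?thesis by (simp add: pnorm_empirical_cov add_divide_distrib)
    qed
    also have "\<dots> \<le> 2 * (1 / sqrt lam) * X + sqrt lam * (X / lam)"
      using True d_norm d_emp' q0 lam X0 by (intro add_mono mult_mono) auto
    also have "sqrt lam * (X / lam) = X / sqrt lam"
      using lam by (simp add: real_div_sqrt field_simps)
    finally have dA: "pnorm ?A (d t) \<le> 3 * X / sqrt lam" by simp
    have "(pnorm T (d t))\<^sup>2 \<le> C * ((pnorm ?A (d t))\<^sup>2 + lam * (norm (d t))\<^sup>2)"
      using low[of "d t"] by (simp add: pnorm_power2 T psd_op_empirical_cov)
    also have "\<dots> \<le> C * ((3 * X / sqrt lam)\<^sup>2 + lam * (X / lam)\<^sup>2)"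
      using C lam dA d_norm pnorm_nonneg[OF psd_op_empirical_cov, of n k "d t"]
      by (intro mult_left_mono add_mono power_mono) auto
    also have "\<dots> = C * (10 * X\<^sup>2 / lam)"
      using lam by (simp add: power_divide power2_eq_square field_simps)
    also have "\<dots> \<le> C * (16 * X\<^sup>2 / lam)"
      using lam C by (intro mult_left_mono divide_right_mono) auto
    also have "\<dots> = (X * (4 * sqrt C / sqrt lam))\<^sup>2"
      using lam C by (simp add: power_mult_distrib power_divide)
    finally have "pnorm T (d t) \<le> X * (4 * sqrt C / sqrt lam)"
      by (rule power2_le_imp_le) (use X0 C lam in simp)
    also have "\<dots> \<le> X * (4 * sqrt C / sqrt lam + \<kappa> / (lam * sqrt lam) * q)"
      using X0 kap lam q0 by (intro mult_left_mono) auto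
    finally show ?thesis .
  next
    case False
    have "pnorm T (d t) \<le> sqrt (\<kappa>\<^sup>2 * (norm (d t))\<^sup>2)" unfolding pnorm_def by (intro real_sqrt_le_mono T)
    also have "\<dots> = \<kappa> * norm (d t)" using kap by (simp add: real_sqrt_mult)
    also have "\<dots> \<le> \<kappa> * (X / lam)" using kap d_norm by (intro mult_left_mono)
    \<comment> \<open>The inserted factor is at least 1 in this case. Since \<open>X\<close> already
      contains \<open>q\<close>, it produces a term in \<open>q\<^sup>2\<close>, whose mean can be
      controlled.\<close>
    also have "\<dots> \<le> \<kappa> * (X / lam) * (q / sqrt lam)"
    proof -
      have "1 \<le> q / sqrt lam" using False lam by simp
      moreover have "0 \<le> \<kappa> * (X / lam)" using kap X0 lam by simp
      ultimately show ?thesis using mult_left_mono[of 1 "q / sqrt lam" "\<kappa> * (X / lam)"] by simp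
    qed
    also have "\<dots> \<le> X * (4 * sqrt C / sqrt lam + \<kappa> / (lam * sqrt lam) * q)"
      using X0 lam C by (simp add: field_simps)
    finally show ?thesis .
  qed
  also have "\<dots> = (M + 2 * \<kappa> * F) * (4 * sqrt C / sqrt lam * q + \<kappa> / (lam * sqrt lam) * q\<^sup>2)"
    by (simp add: X_def algebra_simps power2_eq_square add_divide_distrib)
  finally show ?thesis by (simp only: d_def)
qed

text \<open>Deterministic core: randomness will enter through \<open>low\<close>, \<open>Q\<close>
  and \<open>q\<close> only. The first line of the bound is the error of gradient descent on the
  exact features, the rest is the cost of replacing them.\<close>

lemma two_stage_gradient_descent:
  fixes k k' :: "nat \<Rightarrow> 'h::real_inner" and T :: "'h \<Rightarrow> 'h"
  assumes n: "0 < n" and k: "\<And>j. j < n \<Longrightarrow> norm (k j) \<le> \<kappa>" and k': "\<And>j. j < n \<Longrightarrow> norm (k' j) \<le> \<kappa>"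
    and eta: "0 < \<eta>" "\<eta> * \<kappa>\<^sup>2 \<le> 1" and y: "\<And>j. j < n \<Longrightarrow> \<bar>y j\<bar> \<le> M" and M: "0 \<le> M"
    and lam: "0 < lam" and t: "\<eta> * real t * lam \<le> 1" "1 \<le> 2 * lam * \<eta> * (real t + 1)"
    and T: "psd_op T" "\<And>f. T f \<bullet> f \<le> \<kappa>\<^sup>2 * (norm f)\<^sup>2" and C: "0 \<le> C"
    and low: "\<And>f. T f \<bullet> f \<le> C * (empirical_cov n k f \<bullet> f + lam * (norm f)\<^sup>2)"
    and Q: "\<And>u. ((1 / real n) *\<^sub>R (\<Sum>j<n. (y j - k j \<bullet> f) *\<^sub>R k j)) \<bullet> u
              \<le> Q * sqrt (empirical_cov n k u \<bullet> u + lam * (norm u)\<^sup>2)" and Q0: "0 \<le> Q"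
  defines "q \<equiv> sqrt ((1 / real n) * (\<Sum>j<n. (norm (k' j - k j))\<^sup>2))"
  shows "pnorm T (gradient_iteration.iter (empirical_cov n k') \<eta> ((1 / real n) *\<^sub>R (\<Sum>j<n. y j *\<^sub>R k' j)) t - f)
      \<le> sqrt C * (2 * sqrt lam * norm f + 3 * Q)
        + (M + 2 * \<kappa> * (2 * norm f + 3 * Q / sqrt lam))
            * (4 * sqrt C / sqrt lam * q + \<kappa> / (lam * sqrt lam) * q\<^sup>2)"
proof -
  interpret g: gradient_iteration "empirical_cov n k" \<eta> by (rule gradient_iteration_empirical_cov[OF k eta])
  let ?A = "empirical_cov n k"
  let ?v = "(1 / real n) *\<^sub>R (\<Sum>j<n. y j *\<^sub>R k j)"
  let ?w = "(1 / real n) *\<^sub>R (\<Sum>j<n. (y j - k j \<bullet> f) *\<^sub>R k j)"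
  let ?f' = "gradient_iteration.iter (empirical_cov n k') \<eta> ((1 / real n) *\<^sub>R (\<Sum>j<n. y j *\<^sub>R k' j)) t"
  have v: "?v = ?A f + ?w"
    by (simp add: empirical_cov_def scaleR_diff_left sum_subtractf flip: scaleR_add_right)
  have pB: "pnorm (g.B lam) u = sqrt (?A u \<bullet> u + lam * (norm u)\<^sup>2)" for u
    using g.pnorm_B_power2[OF lam, of u] pnorm_nonneg[OF g.psd_op_B[OF lam], of u] by (metis real_sqrt_unique)
  note Q' = Q[folded pB]
  have F: "norm (g.iter ?v s) \<le> 2 * norm f + 3 * Q / sqrt lam" if "s \<le> t" for s
  proof -
    have "\<eta> * real s * lam \<le> \<eta> * real t * lam" using that eta lam by simp
    then show ?thesis unfolding v using t by (intro g.iter_error(1)[OF lam Q' Q0]) linarith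
  qed
  have "pnorm T (g.iter ?v t - f) \<le> sqrt C * pnorm (g.B lam) (g.iter ?v t - f)"
    using real_sqrt_le_mono[OF low[of "g.iter ?v t - f"]] unfolding pB by (simp add: pnorm_def real_sqrt_mult)
  also have "\<dots> \<le> sqrt C * (2 * sqrt lam * norm f + 3 * Q)"
    unfolding v using C by (intro mult_left_mono g.iter_error(2)[OF lam Q' Q0 t]) auto
  finally have "pnorm T (g.iter ?v t - f) \<le> sqrt C * (2 * sqrt lam * norm f + 3 * Q)" .
  moreover have "pnorm T (?f' - g.iter ?v t) \<le> (M + 2 * \<kappa> * (2 * norm f + 3 * Q / sqrt lam))
            * (4 * sqrt C / sqrt lam * q + \<kappa> / (lam * sqrt lam) * q\<^sup>2)"
    unfolding q_def by (rule perturbed_gradient_descent[OF n k k' eta y M lam t(1) T C low F])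
  moreover have "pnorm T (?f' - f) \<le> pnorm T (?f' - g.iter ?v t) + pnorm T (g.iter ?v t - f)"
    using pnorm_triangle[OF T(1), of "?f' - g.iter ?v t" "g.iter ?v t - f"] by simp
  ultimately show ?thesis by linarith
qed

text \<open>For odd \<open>T\<close> the weights of the tail average add up to \<open>1 + 1 / T\<close>, hence the last term.\<close>

lemma tail_average_error:
  fixes S :: "'h::real_inner \<Rightarrow> 'l::real_inner"
  assumes S: "linear S" and T: "0 < T"
    and err: "\<And>t. T div 2 < t \<Longrightarrow> t \<le> T \<Longrightarrow> norm (S (gradient_descent evl k \<eta> n d t) - g) \<le> e"
  shows "norm (S (tail_average evl k \<eta> n d T) - g) \<le> 2 * e + norm g / real T"
proof -
  let ?I = "{T div 2 + 1..T}" and ?f = "gradient_descent evl k \<eta> n d"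
  define w where "w = 2 / real T * real (card ?I)"
  have card: "real (card ?I) = real T - real (T div 2)" by simp
  have half: "real T - 1 \<le> 2 * real (T div 2)" "2 * real (T div 2) \<le> real T" by linarith+
  have w: "w = (2 * real T - 2 * real (T div 2)) / real T" using T unfolding w_def card by (simp add: field_simps)
  have w1: "0 \<le> w - 1" using T half by (simp add: w field_simps)
  have w2: "w - 1 \<le> 1 / real T"
  proof -
    have "w - 1 = (real T - 2 * real (T div 2)) / real T" using T by (simp add: w field_simps)
    also have "\<dots> \<le> 1 / real T" using half by (intro divide_right_mono) auto
    finally show ?thesis .
  qed
  note w1 = w1 w2
  have "1 / real T \<le> 1" using T by simp
  then have w2: "w \<le> 2" using w1 by linarith
  have e0: "0 \<le> e" using order_trans[OF norm_ge_zero err[of T]] T by simp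
  have "S (tail_average evl k \<eta> n d T) - g = (2 / real T) *\<^sub>R (\<Sum>t\<in>?I. S (?f t) - g) + (w - 1) *\<^sub>R g"
    by (simp add: tail_average_def linear_cmul[OF S] linear_sum[OF S] sum_subtractf scaleR_diff_right
        scaleR_diff_left w_def sum_constant_scaleR del: card_atLeastAtMost)
  then have "norm (S (tail_average evl k \<eta> n d T) - g)
      \<le> norm ((2 / real T) *\<^sub>R (\<Sum>t\<in>?I. S (?f t) - g)) + norm ((w - 1) *\<^sub>R g)"
    by (simp only: norm_triangle_ineq)
  also have "\<dots> \<le> (2 / real T) * (\<Sum>t\<in>?I. e) + (1 / real T) * norm g"
  proof (rule add_mono)
    have "norm (\<Sum>t\<in>?I. S (?f t) - g) \<le> (\<Sum>t\<in>?I. e)" using err by (intro sum_norm_le) auto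
    then show "norm ((2 / real T) *\<^sub>R (\<Sum>t\<in>?I. S (?f t) - g)) \<le> (2 / real T) * (\<Sum>t\<in>?I. e)"
      using T by (simp add: divide_right_mono)
    show "norm ((w - 1) *\<^sub>R g) \<le> (1 / real T) * norm g"
      using mult_right_mono[OF w1(2) norm_ge_zero[of g]] w1(1) by simp
  qed
  also have "(2 / real T) * (\<Sum>t\<in>?I. e) = w * e" by (simp add: w_def)
  also have "w * e \<le> 2 * e" using w2 e0 by (intro mult_right_mono)
  finally show ?thesis by simp
qed

section \<open>Orthonormal expansions\<close>

definition orthonormal_set :: "'a::real_inner set \<Rightarrow> bool" where
  "orthonormal_set B \<longleftrightarrow> (\<forall>b\<in>B. norm b = 1) \<and> pairwise orthogonal B"

lemma orthonormal_setD:
  assumes "orthonormal_set B" "b \<in> B" "b' \<in> B"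
  shows "b \<bullet> b' = (if b = b' then 1 else 0)"
  using assms by (auto simp: orthonormal_set_def pairwise_def orthogonal_def norm_eq_1)

lemma orthonormal_set_subset: "orthonormal_set B \<Longrightarrow> F \<subseteq> B \<Longrightarrow> orthonormal_set F"
  by (auto simp: orthonormal_set_def pairwise_def)

lemma norm_orthonormal_sum:
  assumes "orthonormal_set F" "finite F"
  shows "(norm (\<Sum>e\<in>F. c e *\<^sub>R e))\<^sup>2 = (\<Sum>e\<in>F. (c e)\<^sup>2)"
proof -
  have "(norm (\<Sum>e\<in>F. c e *\<^sub>R e))\<^sup>2 = (\<Sum>e\<in>F. \<Sum>e'\<in>F. c e * (c e' * (e' \<bullet> e)))"
    by (simp add: power2_norm_eq_inner inner_sum_left inner_sum_right sum_distrib_left)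
  also have "\<dots> = (\<Sum>e\<in>F. \<Sum>e'\<in>F. if e' = e then (c e)\<^sup>2 else 0)"
    by (intro sum.cong refl) (auto simp: orthonormal_setD[OF assms(1)] power2_eq_square)
  also have "\<dots> = (\<Sum>e\<in>F. (c e)\<^sup>2)" using assms(2) by simp
  finally show ?thesis .
qed

lemma bessel:
  assumes "orthonormal_set B" "finite F" "F \<subseteq> B"
  shows "(\<Sum>e\<in>F. (x \<bullet> e)\<^sup>2) \<le> (norm x)\<^sup>2"
proof -
  let ?p = "\<Sum>e\<in>F. (x \<bullet> e) *\<^sub>R e"
  have F: "orthonormal_set F" by (rule orthonormal_set_subset[OF assms(1,3)])
  have "0 \<le> (norm (x - ?p))\<^sup>2" by simp
  also have "\<dots> = (norm x)\<^sup>2 - 2 * (x \<bullet> ?p) + (norm ?p)\<^sup>2"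
    by (simp add: power2_norm_eq_inner inner_diff_left inner_diff_right inner_commute)
  also have "x \<bullet> ?p = (\<Sum>e\<in>F. (x \<bullet> e)\<^sup>2)" by (simp add: inner_sum_right power2_eq_square)
  also have "(norm ?p)\<^sup>2 = (\<Sum>e\<in>F. (x \<bullet> e)\<^sup>2)" by (rule norm_orthonormal_sum[OF F assms(2)])
  finally show ?thesis by simp
qed

text \<open>By Pythagoras, enlarging a finite index set changes the partial sum by the root of the
  added squared coefficients. Square summability thus makes the net of finite partial sums Cauchy,
  and completeness gives the limit.\<close>

lemma summable_orthonormal:
  fixes B :: "'a::{real_inner,banach} set"
  assumes B: "orthonormal_set B" and C: "\<And>F. finite F \<Longrightarrow> F \<subseteq> B \<Longrightarrow> (\<Sum>e\<in>F. (c e)\<^sup>2) \<le> C"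
  shows "(\<lambda>e. c e *\<^sub>R e) summable_on B"
proof -
  let ?f = "\<lambda>e. c e *\<^sub>R e"
  have "(\<lambda>e. (c e)\<^sup>2) summable_on B"
    using C by (intro nonneg_bdd_above_summable_on) (auto simp: bdd_above_def)
  then obtain s where s: "((\<lambda>e. (c e)\<^sup>2) has_sum s) B" by (auto simp: summable_on_def)
  have "\<exists>P. eventually P (finite_subsets_at_top B) \<and> (\<forall>F1 F2. P F1 \<and> P F2 \<longrightarrow> dist (sum ?f F1) (sum ?f F2) < e)"
    if e: "e > 0" for e
  proof -
    obtain F0 where F0: "finite F0" "F0 \<subseteq> B" and d: "dist (\<Sum>e\<in>F0. (c e)\<^sup>2) s \<le> (e / 4)\<^sup>2"
      using has_sum_finite_approximation[OF s, of "(e / 4)\<^sup>2"] e by auto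
    define P where "P F \<longleftrightarrow> finite F \<and> F0 \<subseteq> F \<and> F \<subseteq> B" for F
    have near: "dist (sum ?f F) (sum ?f F0) \<le> e / 4" if "P F" for F
    proof -
      have F: "finite F" "F0 \<subseteq> F" "F \<subseteq> B" using that by (auto simp: P_def)
      have "(norm (sum ?f F - sum ?f F0))\<^sup>2 = (norm (sum ?f (F - F0)))\<^sup>2"
        using F by (simp add: sum_diff)
      also have "\<dots> = (\<Sum>e\<in>F - F0. (c e)\<^sup>2)"
        using F by (intro norm_orthonormal_sum orthonormal_set_subset[OF B]) auto
      also have "\<dots> = (\<Sum>e\<in>F. (c e)\<^sup>2) - (\<Sum>e\<in>F0. (c e)\<^sup>2)" using F by (simp add: sum_diff)
      also have "\<dots> \<le> (e / 4)\<^sup>2"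
        using finite_sum_le_has_sum[OF s F(1) F(3)] d by (simp add: dist_real_def)
      finally have "norm (sum ?f F - sum ?f F0) \<le> e / 4" by (rule power2_le_imp_le) (use e in simp)
      then show ?thesis by (simp add: dist_norm)
    qed
    have "eventually P (finite_subsets_at_top B)"
      unfolding eventually_finite_subsets_at_top P_def using F0 by auto
    moreover have "dist (sum ?f F1) (sum ?f F2) < e" if "P F1" "P F2" for F1 F2
      using near[OF that(1)] near[OF that(2)] dist_triangle2[of "sum ?f F1" "sum ?f F2" "sum ?f F0"] e by linarith
    ultimately show ?thesis by blast
  qed
  then have "cauchy_filter (filtermap (sum ?f) (finite_subsets_at_top B))"
    by (simp add: cauchy_filter_metric_filtermap)
  then obtain l where "(sum ?f \<longlongrightarrow> l) (finite_subsets_at_top B)"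
    using complete_uniform[where S="UNIV::'a set"] complete_UNIV[where 'a='a] by (force simp add: filterlim_def)
  then show ?thesis using summable_on_def has_sum_def by blast
qed

lemma summable_bessel:
  fixes B :: "'a::{real_inner,banach} set"
  assumes "orthonormal_set B"
  shows "(\<lambda>e. (x \<bullet> e) *\<^sub>R e) summable_on B"
  by (rule summable_orthonormal[OF assms bessel[OF assms]])

lemma has_sum_orthonormal_inner:
  assumes B: "orthonormal_set B" and y: "((\<lambda>e. c e *\<^sub>R e) has_sum y) B" and b: "b \<in> B"
  shows "y \<bullet> b = c b"
proof -
  have "((\<lambda>e. (c e *\<^sub>R e) \<bullet> b) has_sum y \<bullet> b) B"
    by (rule has_sum_bounded_linear[OF bounded_linear_inner_left y])
  moreover have "((\<lambda>e. (c e *\<^sub>R e) \<bullet> b) has_sum c b) B"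
    by (rule has_sum_finite_neutralI[where B = "{b}"])
      (use b in \<open>auto simp: orthonormal_setD[OF B]\<close>)
  ultimately show ?thesis by (rule has_sum_unique)
qed

lemma orthonormal_basis_set: "orthonormal_basis B \<Longrightarrow> orthonormal_set B"
  by (simp add: orthonormal_basis_def orthonormal_set_def)

lemma orthonormal_basis_zero:
  fixes B :: "'a::{real_inner,banach} set"
  assumes B: "orthonormal_basis B" and x: "\<And>e. e \<in> B \<Longrightarrow> x \<bullet> e = 0"
  shows "x = 0"
proof -
  let ?H = "{y. x \<bullet> y = 0}"
  have "closed ?H" by (rule closed_Collect_eq) (intro continuous_intros)+
  moreover have "span B \<subseteq> ?H"
    by (rule span_minimal) (use x in \<open>auto simp: subspace_def inner_add_right\<close>)
  ultimately have "closure (span B) \<subseteq> ?H" by (simp add: closure_minimal)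
  moreover have "closure (span B) = UNIV" using B by (simp add: orthonormal_basis_def)
  ultimately have "x \<in> ?H" by blast
  then show ?thesis by simp
qed

text \<open>The series converges by Bessel's inequality, and its limit minus \<open>x\<close> is
  orthogonal to the whole basis.\<close>

lemma orthonormal_basis_expansion:
  fixes B :: "'a::{real_inner,banach} set"
  assumes B: "orthonormal_basis B"
  shows "((\<lambda>e. (x \<bullet> e) *\<^sub>R e) has_sum x) B"
proof -
  note S = orthonormal_basis_set[OF B]
  obtain y where y: "((\<lambda>e. (x \<bullet> e) *\<^sub>R e) has_sum y) B"
    using summable_bessel[OF S, of x] unfolding summable_on_def by blast
  have "y - x = 0"
    by (rule orthonormal_basis_zero[OF B])
      (simp add: inner_diff_left has_sum_orthonormal_inner[OF S y])
  then show ?thesis using y by simp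
qed

lemma parseval:
  fixes B :: "'a::{real_inner,banach} set"
  assumes B: "orthonormal_basis B"
  shows "((\<lambda>e. (x \<bullet> e) * (y \<bullet> e)) has_sum x \<bullet> y) B"
  using has_sum_bounded_linear[OF bounded_linear_inner_right[of y] orthonormal_basis_expansion[OF B, of x]]
  by (simp add: inner_commute)

lemma parseval_norm:
  fixes B :: "'a::{real_inner,banach} set"
  assumes B: "orthonormal_basis B"
  shows "((\<lambda>e. (x \<bullet> e)\<^sup>2) has_sum (norm x)\<^sup>2) B"
  using parseval[OF B, of x x] by (simp add: power2_eq_square power2_norm_eq_inner[symmetric] dot_square_norm)

lemma orthonormal_basis_eqI:
  fixes B :: "'a::{real_inner,banach} set"
  assumes B: "orthonormal_basis B" and "\<And>e. e \<in> B \<Longrightarrow> x \<bullet> e = y \<bullet> e"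
  shows "x = y"
  using orthonormal_basis_zero[OF B, of "x - y"] assms(2) by (simp add: inner_diff_left)

section \<open>The spectral theorem for compact positive operators\<close>

definition compact_op :: "('a::real_normed_vector \<Rightarrow> 'b::real_normed_vector) \<Rightarrow> bool" where
  "compact_op A \<longleftrightarrow> (\<forall>x::nat \<Rightarrow> 'a. bounded (range x) \<longrightarrow> (\<exists>r l. strict_mono r \<and> (\<lambda>n. A (x (r n))) \<longlonglongrightarrow> l))"

definition eigenvector :: "('a::real_vector \<Rightarrow> 'a) \<Rightarrow> 'a \<Rightarrow> bool" where
  "eigenvector A e \<longleftrightarrow> (\<exists>\<sigma>. A e = \<sigma> *\<^sub>R e)"

text \<open>A maximizer of the quadratic form on the unit sphere of an invariant subspace is an
  eigenvector; compactness makes a maximizing sequence converge.\<close>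

lemma compact_psd_eigenvector:
  fixes A :: "'a::{real_inner,banach} \<Rightarrow> 'a"
  assumes A: "psd_op A" and cpt: "compact_op A" and W: "subspace W" "closed W" and inv: "\<And>w. w \<in> W \<Longrightarrow> A w \<in> W"
    and y: "y \<in> W" "y \<noteq> 0"
  obtains w where "w \<in> W" "norm w = 1" "eigenvector A w"
proof -
  define Q where "Q = {A w \<bullet> w | w. w \<in> W \<and> norm w = 1}"
  define s where "s = Sup Q"
  define y1 where "y1 = (1 / norm y) *\<^sub>R y"
  have y1: "y1 \<in> W" "norm y1 = 1" using y W(1) by (auto simp: y1_def subspace_scale)
  obtain K where K: "0 \<le> K" "\<And>x. norm (A x) \<le> norm x * K"
    using bounded_linear.nonneg_bounded[OF psd_opD(1)[OF A]] by auto
  have "bdd_above Q"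
  proof (rule bdd_aboveI)
    fix q assume "q \<in> Q"
    then obtain w where w: "norm w = 1" "q = A w \<bullet> w" by (auto simp: Q_def)
    show "q \<le> K" using norm_cauchy_schwarz[of "A w" w] K(2)[of w] w by simp
  qed
  then have le1: "A w \<bullet> w \<le> s" if "w \<in> W" "norm w = 1" for w
    unfolding s_def using that by (intro cSup_upper) (auto simp: Q_def)
  have s0: "0 \<le> s" using le1[OF y1] psd_opD(3)[OF A, of y1] by linarith
  have le: "A w \<bullet> w \<le> s * (norm w)\<^sup>2" if w: "w \<in> W" for w
  proof (cases "w = 0")
    case False
    have "A ((1 / norm w) *\<^sub>R w) \<bullet> ((1 / norm w) *\<^sub>R w) \<le> s"
      using w W(1) False by (intro le1) (auto simp: subspace_scale)
    then show ?thesis using False by (simp add: psd_opD[OF A] field_simps power2_eq_square)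
  qed (simp add: psd_opD[OF A])
  \<comment> \<open>Cauchy-Schwarz on the invariant subspace. With it
    \<open>A w - s *\<^sub>R w\<close> is small as soon as \<open>A w \<bullet> w\<close> is close
    to \<open>s\<close> for a unit vector \<open>w\<close>, so a maximizing sequence consists of
    approximate eigenvectors.\<close>
  have sq: "(norm (A w))\<^sup>2 \<le> s * (A w \<bullet> w)" if w: "w \<in> W" for w
  proof (cases "A w = 0")
    case False
    have "(A w \<bullet> A w)\<^sup>2 \<le> (A w \<bullet> w) * (A (A w) \<bullet> A w)" by (rule psd_op_cauchy_schwarz[OF A])
    also have "\<dots> \<le> (A w \<bullet> w) * (s * (norm (A w))\<^sup>2)"
      using le[OF inv[OF w]] by (intro mult_left_mono psd_opD(3)[OF A])
    finally have "(norm (A w))\<^sup>2 * (norm (A w))\<^sup>2 \<le> (s * (A w \<bullet> w)) * (norm (A w))\<^sup>2"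
      by (simp add: dot_square_norm power2_eq_square mult_ac)
    moreover have "0 < (norm (A w))\<^sup>2" using False by simp
    ultimately show ?thesis using mult_right_le_imp_le by blast
  qed (simp add: psd_opD[OF A])
  show thesis
  proof (cases "s = 0")
    case True
    then have "A y1 = 0" using sq[OF y1(1)] by simp
    then have "eigenvector A y1" unfolding eigenvector_def by (intro exI[of _ 0]) simp
    then show thesis using y1 that by blast
  next
    case False
    then have s: "s > 0" using s0 by simp
    have "\<exists>w. w \<in> W \<and> norm w = 1 \<and> s - 1 / real (Suc n) < A w \<bullet> w" for n
    proof -
      have "s - 1 / real (Suc n) < Sup Q" by (simp add: s_def)
      moreover have "Q \<noteq> {}" using y1 by (auto simp: Q_def)
      ultimately obtain q where "q \<in> Q" "s - 1 / real (Suc n) < q" using less_cSupD by blast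
      then show ?thesis by (auto simp: Q_def)
    qed
    then obtain w where w: "\<And>n. w n \<in> W" "\<And>n. norm (w n) = 1" "\<And>n. s - 1 / real (Suc n) < A (w n) \<bullet> w n"
      by metis
    have "bounded (range w)" unfolding bounded_iff using w(2) by (intro exI[of _ 1]) auto
    then obtain r l where r: "strict_mono r" and l: "(\<lambda>n. A (w (r n))) \<longlonglongrightarrow> l"
      using cpt unfolding compact_op_def by blast
    have small: "(norm (A (w n) - s *\<^sub>R w n))\<^sup>2 \<le> s * (1 / real (Suc n))" for n
    proof -
      have "(norm (A (w n) - s *\<^sub>R w n))\<^sup>2 = (norm (A (w n)))\<^sup>2 - 2 * s * (A (w n) \<bullet> w n) + s * s * (norm (w n))\<^sup>2"
        using inner_commute[of "w n" "A (w n)"]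
        by (simp add: power2_norm_eq_inner inner_diff_left inner_diff_right right_diff_distrib)
      also have "\<dots> \<le> s * (s - A (w n) \<bullet> w n)"
        using sq[OF w(1), of n] by (simp add: w(2) algebra_simps)
      also have "\<dots> \<le> s * (1 / real (Suc n))" using s w(3)[of n] by (intro mult_left_mono) auto
      finally show ?thesis .
    qed
    have "(\<lambda>n. (norm (A (w n) - s *\<^sub>R w n))\<^sup>2) \<longlonglongrightarrow> 0"
    proof (rule tendsto_sandwich[OF _ _ tendsto_const])
      show "(\<lambda>n. s * (1 / real (Suc n))) \<longlonglongrightarrow> 0"
        using tendsto_mult[OF tendsto_const[of s] LIMSEQ_Suc[OF lim_1_over_n]] by simp
    qed (use small in auto)
    then have "(\<lambda>n. norm (A (w n) - s *\<^sub>R w n)) \<longlonglongrightarrow> 0"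
      using tendsto_real_sqrt[of _ 0] by fastforce
    then have "(\<lambda>n. A (w n) - s *\<^sub>R w n) \<longlonglongrightarrow> 0" by (rule tendsto_norm_zero_cancel)
    from LIMSEQ_subseq_LIMSEQ[OF this r]
    have z: "(\<lambda>n. A (w (r n)) - s *\<^sub>R w (r n)) \<longlonglongrightarrow> 0" by (simp add: comp_def)
    \<comment> \<open>Compactness gives convergence of the images only; division by \<open>s\<close>
      recovers convergence of the vectors.\<close>
    have "(\<lambda>n. (1 / s) *\<^sub>R (A (w (r n)) - (A (w (r n)) - s *\<^sub>R w (r n)))) \<longlonglongrightarrow> (1 / s) *\<^sub>R (l - 0)"
      by (intro tendsto_intros l z)
    then have wl: "(\<lambda>n. w (r n)) \<longlonglongrightarrow> (1 / s) *\<^sub>R l" using s by simp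
    let ?w = "(1 / s) *\<^sub>R l"
    have "?w \<in> W" using closed_sequentially[OF W(2) _ wl] w(1) by blast
    moreover have "norm ?w = 1"
    proof -
      have "(\<lambda>n. norm (w (r n))) \<longlonglongrightarrow> norm ?w" by (rule tendsto_norm[OF wl])
      then have "(\<lambda>n. 1) \<longlonglongrightarrow> norm ?w" by (simp only: w(2))
      then show ?thesis using LIMSEQ_unique tendsto_const by blast
    qed
    moreover have "A ?w = l"
      using LIMSEQ_unique[OF bounded_linear.tendsto[OF psd_opD(1)[OF A] wl] l] by simp
    then have "A ?w = s *\<^sub>R ?w" using s by simp
    then have "eigenvector A ?w" unfolding eigenvector_def by blast
    ultimately show thesis using that by blast
  qed
qed

text \<open>Zorn's lemma gives a maximal orthonormal set of eigenvectors. If its span were not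
  dense, its orthogonal complement would be a nonzero closed invariant subspace and would contain a
  further unit eigenvector.\<close>

lemma compact_psd_eigenbasis:
  fixes A :: "'a::{real_inner,banach} \<Rightarrow> 'a"
  assumes A: "psd_op A" and cpt: "compact_op A"
  obtains B where "orthonormal_basis B" "\<And>e. e \<in> B \<Longrightarrow> eigenvector A e"
proof -
  define \<O> where "\<O> = {B. orthonormal_set B \<and> (\<forall>e\<in>B. eigenvector A e)}"
  have "\<exists>M\<in>\<O>. \<forall>X\<in>\<O>. M \<subseteq> X \<longrightarrow> X = M"
  proof (rule subset_Zorn')
    fix \<C> assume C: "subset.chain \<O> \<C>"
    have on: "orthonormal_set X" and ev: "\<forall>e\<in>X. eigenvector A e" if "X \<in> \<C>" for X
      using C that by (auto simp: subset_chain_def \<O>_def)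
    have "orthogonal a b" if ab: "a \<in> \<Union>\<C>" "b \<in> \<Union>\<C>" "a \<noteq> b" for a b
    proof -
      obtain X Y where X: "X \<in> \<C>" "a \<in> X" and Y: "Y \<in> \<C>" "b \<in> Y" using ab by blast
      then have "X \<subseteq> Y \<or> Y \<subseteq> X" using C by (auto simp: subset_chain_def)
      then obtain Z where "Z \<in> \<C>" "a \<in> Z" "b \<in> Z" using X Y by blast
      then show ?thesis using on[of Z] ab by (auto simp: orthonormal_set_def pairwise_def)
    qed
    then show "\<Union>\<C> \<in> \<O>"
      using on ev by (auto simp: \<O>_def orthonormal_set_def pairwise_def)
  qed
  then obtain B where B: "B \<in> \<O>" and max: "\<And>X. X \<in> \<O> \<Longrightarrow> B \<subseteq> X \<Longrightarrow> X = B" by blast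
  have on: "orthonormal_set B" and ev: "\<And>e. e \<in> B \<Longrightarrow> eigenvector A e" using B by (auto simp: \<O>_def)
  have "closure (span B) = UNIV"
  proof (rule ccontr)
    assume "closure (span B) \<noteq> UNIV"
    then obtain x where x: "x \<notin> closure (span B)" by auto
    obtain p where p: "((\<lambda>e. (x \<bullet> e) *\<^sub>R e) has_sum p) B"
      using summable_bessel[OF on, of x] unfolding summable_on_def by blast
    have "p \<in> closure (span B)"
    proof (rule Lim_in_closed_set[OF closed_closure])
      show "(sum (\<lambda>e. (x \<bullet> e) *\<^sub>R e) \<longlongrightarrow> p) (finite_subsets_at_top B)"
        using p by (simp add: has_sum_def)
      show "\<forall>\<^sub>F F in finite_subsets_at_top B. (\<Sum>e\<in>F. (x \<bullet> e) *\<^sub>R e) \<in> closure (span B)"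
      proof (rule eventually_finite_subsets_at_top_weakI)
        fix F assume "F \<subseteq> B"
        then have "(\<Sum>e\<in>F. (x \<bullet> e) *\<^sub>R e) \<in> span B"
          by (intro span_sum span_scale span_base) auto
        then show "(\<Sum>e\<in>F. (x \<bullet> e) *\<^sub>R e) \<in> closure (span B)" using closure_subset by blast
      qed
    qed simp
    then have y: "x - p \<noteq> 0" using x by auto
    define W where "W = {w. \<forall>b\<in>B. w \<bullet> b = 0}"
    have W: "subspace W" by (auto simp: W_def subspace_def inner_add_left)
    have "W = (\<Inter>b\<in>B. {w. w \<bullet> b = 0})" by (auto simp: W_def)
    moreover have "closed {w. w \<bullet> b = 0}" for b :: 'a
      by (rule closed_Collect_eq) (intro continuous_intros)+
    ultimately have Wc: "closed W" by auto
    have yW: "x - p \<in> W"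
      by (auto simp: W_def inner_diff_left has_sum_orthonormal_inner[OF on p])
    have inv: "A w \<in> W" if "w \<in> W" for w
      unfolding W_def
    proof (intro CollectI ballI)
      fix b assume b: "b \<in> B"
      obtain \<sigma> where "A b = \<sigma> *\<^sub>R b" using ev[OF b] by (auto simp: eigenvector_def)
      then show "A w \<bullet> b = 0" using that b by (simp add: psd_opD(2)[OF A] W_def)
    qed
    obtain w where w: "w \<in> W" "norm w = 1" "eigenvector A w"
      using compact_psd_eigenvector[OF A cpt W Wc inv yW y] by blast
    have "insert w B \<in> \<O>"
      using w on ev unfolding \<O>_def orthonormal_set_def
      by (auto simp: pairwise_insert W_def orthogonal_def inner_commute)
    then have "w \<in> B" using max by blast
    then show False using w by (auto simp: W_def norm_eq_1)
  qed
  then show thesis using on ev that by (auto simp: orthonormal_basis_def orthonormal_set_def)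
qed

section \<open>Spectral calculus\<close>

text \<open>The same choice term as in \<open>op_powr\<close>, so that both calculi agree by
  unfolding.\<close>

definition eigenbasis :: "('a::{real_inner,banach} \<Rightarrow> 'a) \<Rightarrow> 'a set" where
  "eigenbasis A = (SOME B. orthonormal_basis B \<and> (\<forall>e\<in>B. \<exists>\<sigma>. A e = \<sigma> *\<^sub>R e))"

definition spectral_fun :: "(real \<Rightarrow> real) \<Rightarrow> ('a::{real_inner,banach} \<Rightarrow> 'a) \<Rightarrow> 'a \<Rightarrow> 'a" where
  "spectral_fun g A x = (\<Sum>\<^sub>\<infinity>e\<in>eigenbasis A. (g (A e \<bullet> e) * (x \<bullet> e)) *\<^sub>R e)"

lemma op_powr_eq_spectral_fun: "op_powr A r = spectral_fun (\<lambda>s. s powr r) A"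
  by (rule ext) (simp add: op_powr_def spectral_fun_def eigenbasis_def)

locale compact_psd =
  fixes A :: "'a::{real_inner,banach} \<Rightarrow> 'a"
  assumes psd: "psd_op A" and cpt: "compact_op A"
begin

lemma eigenbasis:
  shows "orthonormal_basis (eigenbasis A)" and "e \<in> eigenbasis A \<Longrightarrow> \<exists>\<sigma>. A e = \<sigma> *\<^sub>R e"
proof -
  have "\<exists>B. orthonormal_basis B \<and> (\<forall>e\<in>B. \<exists>\<sigma>. A e = \<sigma> *\<^sub>R e)"
    using compact_psd_eigenbasis[OF psd cpt] by (metis eigenvector_def)
  from someI_ex[OF this] show "orthonormal_basis (eigenbasis A)" "e \<in> eigenbasis A \<Longrightarrow> \<exists>\<sigma>. A e = \<sigma> *\<^sub>R e"
    unfolding eigenbasis_def[symmetric] by auto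
qed

lemma norm_eigenbasis: "e \<in> eigenbasis A \<Longrightarrow> norm e = 1"
  using eigenbasis(1) by (simp add: orthonormal_basis_def)

lemma A_eigenbasis: "e \<in> eigenbasis A \<Longrightarrow> A e = (A e \<bullet> e) *\<^sub>R e"
  using eigenbasis(2)[of e] norm_eigenbasis[of e] by (auto simp: norm_eq_1)

lemma A_inner: "e \<in> eigenbasis A \<Longrightarrow> A x \<bullet> e = (A e \<bullet> e) * (x \<bullet> e)"
  using A_eigenbasis[of e] by (simp add: psd_opD(2)[OF psd]) (metis inner_scaleR_right)

lemma eigenvalue_nonneg: "0 \<le> A e \<bullet> e"
  by (rule psd_opD[OF psd])

lemmas eq_basisI = orthonormal_basis_eqI[OF eigenbasis(1)]

context
  fixes g :: "real \<Rightarrow> real" and b :: real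
  assumes g: "\<And>e. e \<in> eigenbasis A \<Longrightarrow> \<bar>g (A e \<bullet> e)\<bar> \<le> b" and b: "0 \<le> b"
begin

lemma spectral_fun_has_sum:
  "((\<lambda>e. (g (A e \<bullet> e) * (x \<bullet> e)) *\<^sub>R e) has_sum spectral_fun g A x) (eigenbasis A)"
  unfolding spectral_fun_def
proof (rule has_sum_infsum, rule summable_orthonormal[OF orthonormal_basis_set[OF eigenbasis(1)]])
  fix F assume F: "finite F" "F \<subseteq> eigenbasis A"
  have "(\<Sum>e\<in>F. (g (A e \<bullet> e) * (x \<bullet> e))\<^sup>2) \<le> (\<Sum>e\<in>F. b\<^sup>2 * (x \<bullet> e)\<^sup>2)"
  proof (rule sum_mono)
    fix e assume "e \<in> F"
    then have "(g (A e \<bullet> e))\<^sup>2 \<le> b\<^sup>2" using g[of e] F b by (auto simp: abs_le_square_iff[symmetric])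
    then show "(g (A e \<bullet> e) * (x \<bullet> e))\<^sup>2 \<le> b\<^sup>2 * (x \<bullet> e)\<^sup>2"
      by (simp add: power_mult_distrib mult_right_mono)
  qed
  also have "\<dots> = b\<^sup>2 * (\<Sum>e\<in>F. (x \<bullet> e)\<^sup>2)" by (simp add: sum_distrib_left)
  also have "\<dots> \<le> b\<^sup>2 * (norm x)\<^sup>2"
    by (intro mult_left_mono bessel[OF orthonormal_basis_set[OF eigenbasis(1)] F]) simp
  finally show "(\<Sum>e\<in>F. (g (A e \<bullet> e) * (x \<bullet> e))\<^sup>2) \<le> b\<^sup>2 * (norm x)\<^sup>2" .
qed

lemma spectral_fun_inner: "e \<in> eigenbasis A \<Longrightarrow> spectral_fun g A x \<bullet> e = g (A e \<bullet> e) * (x \<bullet> e)"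
  by (rule has_sum_orthonormal_inner[OF orthonormal_basis_set[OF eigenbasis(1)] spectral_fun_has_sum])

lemma norm_spectral_fun_has_sum:
  "((\<lambda>e. (g (A e \<bullet> e))\<^sup>2 * (x \<bullet> e)\<^sup>2) has_sum (norm (spectral_fun g A x))\<^sup>2) (eigenbasis A)"
  using parseval_norm[OF eigenbasis(1), of "spectral_fun g A x"]
  by (subst has_sum_cong[where g = "\<lambda>e. (spectral_fun g A x \<bullet> e)\<^sup>2"]) (auto simp: spectral_fun_inner power_mult_distrib)

lemma norm_spectral_fun_le: "norm (spectral_fun g A x) \<le> b * norm x"
proof (rule power2_le_imp_le)
  have "((\<lambda>e. b\<^sup>2 * (x \<bullet> e)\<^sup>2) has_sum b\<^sup>2 * (norm x)\<^sup>2) (eigenbasis A)"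
    by (intro has_sum_cmult_right parseval_norm eigenbasis)
  then have "(norm (spectral_fun g A x))\<^sup>2 \<le> b\<^sup>2 * (norm x)\<^sup>2"
    using g b by (intro has_sum_mono[OF norm_spectral_fun_has_sum])
      (auto intro!: mult_right_mono simp: abs_le_square_iff[symmetric])
  then show "(norm (spectral_fun g A x))\<^sup>2 \<le> (b * norm x)\<^sup>2" by (simp add: power_mult_distrib)
qed (use b in simp)

lemma bounded_linear_spectral_fun: "bounded_linear (spectral_fun g A)"
proof (rule bounded_linear_intro[where K = b])
  show "spectral_fun g A (x + y) = spectral_fun g A x + spectral_fun g A y" for x y
    by (rule eq_basisI) (simp add: spectral_fun_inner inner_add_left distrib_left)
  show "spectral_fun g A (c *\<^sub>R x) = c *\<^sub>R spectral_fun g A x" for c x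
    by (rule eq_basisI) (simp add: spectral_fun_inner)
  show "norm (spectral_fun g A x) \<le> norm x * b" for x
    using norm_spectral_fun_le by (simp add: mult.commute)
qed

lemma spectral_fun_sym: "spectral_fun g A x \<bullet> y = x \<bullet> spectral_fun g A y"
proof -
  have "((\<lambda>e. g (A e \<bullet> e) * (x \<bullet> e) * (y \<bullet> e)) has_sum spectral_fun g A x \<bullet> y) (eigenbasis A)"
    using parseval[OF eigenbasis(1), of "spectral_fun g A x" y]
    by (subst has_sum_cong[where g = "\<lambda>e. (spectral_fun g A x \<bullet> e) * (y \<bullet> e)"]) (auto simp: spectral_fun_inner)
  moreover have "((\<lambda>e. g (A e \<bullet> e) * (x \<bullet> e) * (y \<bullet> e)) has_sum x \<bullet> spectral_fun g A y) (eigenbasis A)"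
    using parseval[OF eigenbasis(1), of x "spectral_fun g A y"]
    by (subst has_sum_cong[where g = "\<lambda>e. (x \<bullet> e) * (spectral_fun g A y \<bullet> e)"]) (auto simp: spectral_fun_inner)
  ultimately show ?thesis by (rule has_sum_unique)
qed

end

lemma eigenvalue_bound: obtains K where "0 < K" "\<And>e. e \<in> eigenbasis A \<Longrightarrow> A e \<bullet> e \<le> K"
proof -
  obtain K where K: "0 < K" "\<And>x. norm (A x) \<le> norm x * K"
    using bounded_linear.pos_bounded[OF psd_opD(1)[OF psd]] by auto
  show thesis
  proof (rule that[OF K(1)])
    fix e assume "e \<in> eigenbasis A"
    then show "A e \<bullet> e \<le> K"
      using norm_cauchy_schwarz[of "A e" e] K(2)[of e] norm_eigenbasis[of e] by simp
  qed
qed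

text \<open>Tikhonov regularization: \<open>g\<close> is (A + lam)^(-1) A^r h. On eigenvalues s the
  claims become \<open>lam * s powr r / (s + lam) \<le> lam powr r\<close> and s^(1 + 2r) / (s +
  lam)^2 \<le> lam^(2r - 1); for s > lam the latter uses that 2r - 1 is not positive.\<close>

lemma bias:
  assumes lam: "0 < lam" and r: "0 < r" "r \<le> 1 / 2"
  obtains g where "norm (A g - op_powr A r h) \<le> lam powr r * norm h"
    "A g \<bullet> g \<le> (lam powr (r - 1 / 2) * norm h)\<^sup>2"
proof -
  obtain K where K: "0 < K" "\<And>e. e \<in> eigenbasis A \<Longrightarrow> A e \<bullet> e \<le> K" by (rule eigenvalue_bound) blast
  have powr_le: "(A e \<bullet> e) powr r \<le> K powr r" if "e \<in> eigenbasis A" for e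
    using K(2)[OF that] eigenvalue_nonneg r by (intro powr_mono2) auto
  have b1: "\<bar>(A e \<bullet> e) powr r\<bar> \<le> K powr r" if "e \<in> eigenbasis A" for e using powr_le[OF that] by simp
  have b2: "\<bar>(A e \<bullet> e) powr r / (A e \<bullet> e + lam)\<bar> \<le> K powr r / lam" if "e \<in> eigenbasis A" for e
    using powr_le[OF that] eigenvalue_nonneg[of e] lam by (auto intro!: frac_le)
  define g where "g = spectral_fun (\<lambda>s. s powr r / (s + lam)) A h"
  have gi: "g \<bullet> e = (A e \<bullet> e) powr r / (A e \<bullet> e + lam) * (h \<bullet> e)" if "e \<in> eigenbasis A" for e
    unfolding g_def using that lam K(1) spectral_fun_inner[where g = "\<lambda>s. s powr r / (s + lam)", OF b2] by auto
  have fi: "op_powr A r h \<bullet> e = (A e \<bullet> e) powr r * (h \<bullet> e)" if "e \<in> eigenbasis A" for e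
    unfolding op_powr_eq_spectral_fun using that spectral_fun_inner[where g = "\<lambda>s. s powr r", OF b1] by auto
  show thesis
  proof (rule that[of g])
    have arith: "s * (p / (s + lam) * c) - p * c = - (lam * p / (s + lam) * c)" if "0 < s + lam" for s p c :: real
    proof -
      have "s / (s + lam) - 1 = - (lam / (s + lam))" using that by (simp add: field_simps)
      then have "(s / (s + lam) - 1) * (p * c) = - (lam / (s + lam)) * (p * c)" by (rule arg_cong)
      then show ?thesis by (simp add: algebra_simps)
    qed
    have coef: "lam * s powr r / (s + lam) \<le> lam powr r" if s: "0 \<le> s" for s
    proof (cases "s \<le> lam")
      case True
      have "lam * s powr r / (s + lam) \<le> lam * lam powr r / lam"
        using s True lam r by (intro frac_le mult_left_mono powr_mono2) auto
      then show ?thesis using lam by simp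
    next
      case False
      have "lam * s powr r / (s + lam) \<le> lam * s powr r / s"
        using s False lam by (intro divide_left_mono) auto
      also have "\<dots> = lam * s powr (r - 1)" using False lam by (simp add: powr_diff)
      also have "\<dots> \<le> lam * lam powr (r - 1)"
        using False lam r by (intro mult_left_mono powr_mono2') auto
      also have "\<dots> = lam powr r" using lam by (simp add: powr_diff)
      finally show ?thesis .
    qed
    have "(norm (A g - op_powr A r h))\<^sup>2 \<le> (lam powr r)\<^sup>2 * (norm h)\<^sup>2"
    proof (rule has_sum_mono[OF parseval_norm[OF eigenbasis(1)] has_sum_cmult_right[OF parseval_norm[OF eigenbasis(1)]]])
      fix e assume e: "e \<in> eigenbasis A"
      let ?s = "A e \<bullet> e"
      have s: "0 \<le> ?s" "0 < ?s + lam" using eigenvalue_nonneg[of e] lam by auto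
      have "(A g - op_powr A r h) \<bullet> e = - (lam * ?s powr r / (?s + lam) * (h \<bullet> e))"
        using arith[OF s(2)] by (simp only: inner_diff_left A_inner[OF e, of g] gi[OF e] fi[OF e])
      then have "((A g - op_powr A r h) \<bullet> e)\<^sup>2 = (lam * ?s powr r / (?s + lam))\<^sup>2 * (h \<bullet> e)\<^sup>2"
        by (simp only: power2_minus power_mult_distrib[of _ "h \<bullet> e"])
      also have "\<dots> \<le> (lam powr r)\<^sup>2 * (h \<bullet> e)\<^sup>2"
        using coef[OF s(1)] s lam by (intro mult_right_mono power_mono) auto
      finally show "((A g - op_powr A r h) \<bullet> e)\<^sup>2 \<le> (lam powr r)\<^sup>2 * (h \<bullet> e)\<^sup>2" .
    qed
    then have "(norm (A g - op_powr A r h))\<^sup>2 \<le> (lam powr r * norm h)\<^sup>2" by (simp add: power_mult_distrib)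
    then show "norm (A g - op_powr A r h) \<le> lam powr r * norm h" by (rule power2_le_imp_le) simp
    have coef2: "s * (s powr r / (s + lam))\<^sup>2 \<le> (lam powr (r - 1 / 2))\<^sup>2" if s: "0 \<le> s" for s
    proof -
      have lp: "(lam powr (r - 1 / 2))\<^sup>2 = lam powr (2 * r - 1)"
        using lam by (simp add: power2_eq_square flip: powr_add)
      have sp: "(s powr r)\<^sup>2 = s powr (2 * r)" by (simp add: power2_eq_square flip: powr_add)
      show ?thesis
      proof (cases "s \<le> lam")
        case True
        have "s * (s powr r / (s + lam))\<^sup>2 \<le> lam * (lam powr r / lam)\<^sup>2"
          using s True lam r by (intro mult_mono power_mono frac_le powr_mono2) auto
        also have "\<dots> = lam powr (2 * r - 1)"
          using lam by (simp add: power_divide powr_diff power2_eq_square flip: powr_add)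
        finally show ?thesis by (simp add: lp)
      next
        case False
        have "s * (s powr r / (s + lam))\<^sup>2 \<le> s * (s powr r / s)\<^sup>2"
          using s False lam by (intro mult_left_mono power_mono divide_left_mono) auto
        also have "\<dots> = s powr (2 * r - 1)"
          using False lam by (simp add: power_divide powr_diff power2_eq_square flip: powr_add)
        also have "\<dots> \<le> lam powr (2 * r - 1)" using False lam r by (intro powr_mono2') auto
        finally show ?thesis by (simp add: lp)
      qed
    qed
    have "A g \<bullet> g \<le> (lam powr (r - 1 / 2))\<^sup>2 * (norm h)\<^sup>2"
    proof (rule has_sum_mono[OF parseval[OF eigenbasis(1)] has_sum_cmult_right[OF parseval_norm[OF eigenbasis(1)]]])
      fix e assume e: "e \<in> eigenbasis A"
      let ?s = "A e \<bullet> e"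
      have "(A g \<bullet> e) * (g \<bullet> e) = (?s * (?s powr r / (?s + lam))\<^sup>2) * (h \<bullet> e)\<^sup>2"
        by (simp only: A_inner[OF e, of g] gi[OF e]) (simp add: power2_eq_square)
      also have "\<dots> \<le> (lam powr (r - 1 / 2))\<^sup>2 * (h \<bullet> e)\<^sup>2"
        by (intro mult_right_mono coef2 eigenvalue_nonneg) simp
      finally show "(A g \<bullet> e) * (g \<bullet> e) \<le> (lam powr (r - 1 / 2))\<^sup>2 * (h \<bullet> e)\<^sup>2" .
    qed
    then show "A g \<bullet> g \<le> (lam powr (r - 1 / 2) * norm h)\<^sup>2" by (simp add: power_mult_distrib)
  qed
qed

section \<open>The inverse square root of the regularized operator\<close>

context
  fixes lam :: real
  assumes lam: "0 < lam"
begin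

definition J :: "'a \<Rightarrow> 'a" where "J = spectral_fun (\<lambda>s. 1 / sqrt (s + lam)) A"

lemma J_coef: "\<bar>1 / sqrt (A e \<bullet> e + lam)\<bar> \<le> 1 / sqrt lam"
  using eigenvalue_nonneg[of e] lam by (auto intro!: divide_left_mono)

lemma J_inner: "e \<in> eigenbasis A \<Longrightarrow> J x \<bullet> e = (x \<bullet> e) / sqrt (A e \<bullet> e + lam)"
  unfolding J_def using spectral_fun_inner[where g = "\<lambda>s. 1 / sqrt (s + lam)", OF J_coef] lam by simp

lemma bounded_linear_J: "bounded_linear J"
  unfolding J_def using bounded_linear_spectral_fun[where g = "\<lambda>s. 1 / sqrt (s + lam)", OF J_coef] lam by simp

lemma J_sym: "J x \<bullet> y = x \<bullet> J y"
  unfolding J_def using spectral_fun_sym[where g = "\<lambda>s. 1 / sqrt (s + lam)", OF J_coef] lam by simp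

lemma norm_J_le: "norm (J x) \<le> norm x / sqrt lam"
  unfolding J_def using norm_spectral_fun_le[where g = "\<lambda>s. 1 / sqrt (s + lam)", OF J_coef] lam by simp

lemma norm_J_has_sum: "((\<lambda>e. (x \<bullet> e)\<^sup>2 / (A e \<bullet> e + lam)) has_sum (norm (J x))\<^sup>2) (eigenbasis A)"
proof -
  have "(1 / sqrt (A e \<bullet> e + lam))\<^sup>2 = 1 / (A e \<bullet> e + lam)" for e
    using eigenvalue_nonneg[of e] lam by (simp add: power_divide)
  then show ?thesis
    unfolding J_def using norm_spectral_fun_has_sum[where g = "\<lambda>s. 1 / sqrt (s + lam)", OF J_coef, of x] lam by simp
qed

lemma J_J: "J (J (A y + lam *\<^sub>R y)) = y"
proof (rule eq_basisI)
  fix e assume e: "e \<in> eigenbasis A"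
  have "0 < A e \<bullet> e + lam" using eigenvalue_nonneg[of e] lam by simp
  then show "J (J (A y + lam *\<^sub>R y)) \<bullet> e = y \<bullet> e"
    by (simp only: J_inner[OF e] inner_add_left A_inner[OF e, of y])
      (simp add: field_simps flip: distrib_right)
qed

text \<open>Duality between the norms given by (A + lam)^(-1/2) and (A + lam)^(1/2). A bound on
  \<open>J\<close> applied to the noise becomes a bound on the noise as a functional, the form that
  gradient descent needs.\<close>

lemma inner_le_J: "x \<bullet> y \<le> norm (J x) * sqrt (A y \<bullet> y + lam * (norm y)\<^sup>2)"
proof -
  let ?z = "A y + lam *\<^sub>R y"
  have "x \<bullet> y = J x \<bullet> J ?z" using J_J[of y] by (simp add: J_sym)
  also have "\<dots> \<le> norm (J x) * norm (J ?z)" by (rule norm_cauchy_schwarz)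
  also have "norm (J ?z) = sqrt (A y \<bullet> y + lam * (norm y)\<^sup>2)"
  proof -
    have "(norm (J ?z))\<^sup>2 = J (J ?z) \<bullet> ?z" by (simp add: power2_norm_eq_inner J_sym)
    also have "\<dots> = A y \<bullet> y + lam * (norm y)\<^sup>2"
      by (simp only: J_J) (simp add: inner_add_right inner_commute dot_square_norm)
    finally show ?thesis by (metis norm_ge_zero real_sqrt_unique)
  qed
  finally show ?thesis .
qed

end

end

section \<open>Covariance operators and effective dimension\<close>

text \<open>Distinct members have distance sqrt 2, so approximation within 1/2 from a countable
  dense set is injective. Countability lets sums over an eigenbasis be exhausted by a sequence, as
  dominated convergence requires.\<close>

lemma countable_orthonormal_set:
  fixes B :: "'a::{real_inner,second_countable_topology} set"
  assumes B: "orthonormal_set B"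
  shows "countable B"
proof -
  obtain D :: "'a set" where D: "countable D" "\<And>X. open X \<Longrightarrow> X \<noteq> {} \<Longrightarrow> \<exists>d\<in>D. d \<in> X"
    using countable_dense_exists by blast
  have "\<exists>d\<in>D. d \<in> ball b (1 / 2)" for b by (rule D(2)) auto
  then obtain d where d: "\<And>b. d b \<in> D" "\<And>b. dist b (d b) < 1 / 2" by (metis mem_ball)
  have "inj_on d B"
  proof (rule inj_onI, rule ccontr)
    fix x y assume xy: "x \<in> B" "y \<in> B" "d x = d y" "x \<noteq> y"
    have "dist x y < 1" using dist_triangle2[of x y "d x"] d(2)[of x] d(2)[of y] xy by simp
    then have "(norm (x - y))\<^sup>2 < 1" by (simp add: dist_norm abs_square_less_1)
    moreover have "(norm (x - y))\<^sup>2 = 2"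
      using xy orthonormal_setD[OF B] by (simp add: power2_norm_eq_inner inner_diff_left inner_diff_right)
    ultimately show False by simp
  qed
  moreover have "countable (d ` B)" using D(1) d(1) by (auto intro: countable_subset)
  ultimately show ?thesis using countable_image_inj_on by blast
qed

lemma compact_op_compose:
  fixes A :: "'a::real_normed_vector \<Rightarrow> 'b::real_normed_vector" and C :: "'b \<Rightarrow> 'c::real_normed_vector"
  assumes "compact_op A" "bounded_linear C"
  shows "compact_op (C \<circ> A)"
  unfolding compact_op_def
proof (intro allI impI)
  fix x :: "nat \<Rightarrow> 'a" assume "bounded (range x)"
  then obtain r l where "strict_mono r" "(\<lambda>n. A (x (r n))) \<longlonglongrightarrow> l"
    using assms(1) unfolding compact_op_def by blast
  then show "\<exists>r l. strict_mono r \<and> (\<lambda>n. (C \<circ> A) (x (r n))) \<longlonglongrightarrow> l"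
    using bounded_linear.tendsto[OF assms(2), of "\<lambda>n. A (x (r n))" l] unfolding comp_def by blast
qed

lemma compact_op_precompose:
  fixes A :: "'b::real_normed_vector \<Rightarrow> 'c::real_normed_vector" and C :: "'a::real_normed_vector \<Rightarrow> 'b"
  assumes "compact_op A" "bounded_linear C"
  shows "compact_op (A \<circ> C)"
  unfolding compact_op_def
proof (intro allI impI)
  fix x :: "nat \<Rightarrow> 'a" assume b: "bounded (range x)"
  have "bounded (range (\<lambda>n. C (x n)))"
    using bounded_linear_image[OF b assms(2)] by (simp add: image_image)
  then show "\<exists>r l. strict_mono r \<and> (\<lambda>n. (A \<circ> C) (x (r n))) \<longlonglongrightarrow> l"
    using assms(1) unfolding compact_op_def comp_def by blast
qed

lemma has_sum_finite_sum:
  fixes f :: "'i \<Rightarrow> 'a \<Rightarrow> 'b::topological_comm_monoid_add"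
  assumes "finite F" "\<And>i. i \<in> F \<Longrightarrow> (f i has_sum s i) A"
  shows "((\<lambda>x. \<Sum>i\<in>F. f i x) has_sum (\<Sum>i\<in>F. s i)) A"
  using assms by (induction F rule: finite_induct) (auto intro!: has_sum_add)

text \<open>Diagonal extraction on a countable dense set, extended to all \<open>x\<close> by the
  uniform bound on the norms. Division by \<open>1 + norm x\<close> makes the functions bounded
  uniformly in \<open>x\<close>, as \<open>function_convergent_subsequence\<close> demands.\<close>

lemma weakly_convergent_subsequence:
  fixes f :: "nat \<Rightarrow> 'h::{real_inner,second_countable_topology}"
  assumes C: "\<And>n. norm (f n) \<le> C"
  obtains r where "strict_mono (r :: nat \<Rightarrow> nat)" "\<And>x. convergent (\<lambda>n. f (r n) \<bullet> x)"
proof -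
  obtain D :: "'h set" where D: "countable D" "\<And>X. open X \<Longrightarrow> X \<noteq> {} \<Longrightarrow> \<exists>d\<in>D. d \<in> X"
    using countable_dense_exists by blast
  have C0: "0 \<le> C" using C[of 0] norm_ge_zero order_trans by blast
  have bound: "norm ((f n \<bullet> x) / (1 + norm x)) \<le> C" for n x
  proof -
    have pos: "0 < 1 + norm x" by (rule add_pos_nonneg) auto
    have "\<bar>f n \<bullet> x\<bar> \<le> C * (1 + norm x)"
      using Cauchy_Schwarz_ineq2[of "f n" x] mult_mono[OF C[of n], of "norm x" "1 + norm x"] C0 by simp
    then show ?thesis using pos by (simp add: pos_divide_le_eq abs_of_pos)
  qed
  obtain r :: "nat \<Rightarrow> nat" where r: "strict_mono r"
    and lim: "\<And>x. x \<in> D \<Longrightarrow> \<exists>l. (\<lambda>n. (f (r n) \<bullet> x) / (1 + norm x)) \<longlonglongrightarrow> l"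
    using function_convergent_subsequence[of D "\<lambda>n x. (f n \<bullet> x) / (1 + norm x)" C] D(1) bound by blast
  have "convergent (\<lambda>n. f (r n) \<bullet> x)" for x
  proof (rule Cauchy_convergent, rule CauchyI)
    fix e :: real assume e: "0 < e"
    have "0 < e / (4 * (C + 1))" using e C0 by (intro divide_pos_pos) auto
    then have "\<exists>d\<in>D. d \<in> ball x (e / (4 * (C + 1)))" by (intro D(2)) auto
    then obtain d where d: "d \<in> D" "dist x d < e / (4 * (C + 1))" by auto
    obtain l where "(\<lambda>n. (f (r n) \<bullet> d) / (1 + norm d)) \<longlonglongrightarrow> l" using lim[OF d(1)] by blast
    from tendsto_mult_left[OF this, of "1 + norm d"]
    have "(\<lambda>n. f (r n) \<bullet> d) \<longlonglongrightarrow> (1 + norm d) * l"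
      using add_pos_nonneg[OF zero_less_one norm_ge_zero[of d]] by simp
    then have "Cauchy (\<lambda>n. f (r n) \<bullet> d)" by (rule LIMSEQ_imp_Cauchy)
    from CauchyD[OF this, of "e / 2"] e obtain m where m: "\<And>i j. i \<ge> m \<Longrightarrow> j \<ge> m \<Longrightarrow> norm (f (r i) \<bullet> d - f (r j) \<bullet> d) < e / 2"
      by auto
    have near: "\<bar>f (r i) \<bullet> (x - d)\<bar> < e / 4" for i
    proof -
      have "\<bar>f (r i) \<bullet> (x - d)\<bar> \<le> norm (f (r i)) * norm (x - d)" by (rule Cauchy_Schwarz_ineq2)
      also have "\<dots> \<le> (C + 1) * norm (x - d)" using C[of "r i"] by (intro mult_right_mono) auto
      also have "\<dots> < (C + 1) * (e / (4 * (C + 1)))"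
        using d(2) C0 by (intro mult_strict_left_mono) (auto simp: dist_norm)
      also have "\<dots> = e / 4" using C0 by (simp add: divide_simps)
      finally show ?thesis .
    qed
    show "\<exists>M. \<forall>m\<ge>M. \<forall>n\<ge>M. norm (f (r m) \<bullet> x - f (r n) \<bullet> x) < e"
    proof (intro exI allI impI)
      fix i j assume "m \<le> i" "m \<le> j"
      then have "\<bar>f (r i) \<bullet> d - f (r j) \<bullet> d\<bar> < e / 2" using m by simp
      then show "norm (f (r i) \<bullet> x - f (r j) \<bullet> x) < e"
        using near[of i] near[of j] by (simp add: inner_diff_right abs_if split: if_splits)
    qed
  qed
  then show thesis using that r by blast
qed

locale covariance_factor = bounded_random_vector M k \<kappa>
  for M :: "'a measure" and k :: "'a \<Rightarrow> 'h::{real_inner,banach,second_countable_topology}" and \<kappa> +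
  fixes S :: "'h \<Rightarrow> 'l::{real_inner,banach}" and Sa :: "'l \<Rightarrow> 'h"
  assumes S: "bounded_linear S" and adj: "\<And>f g. S f \<bullet> g = f \<bullet> Sa g" and S_inner: "\<And>f g. S f \<bullet> S g = T f \<bullet> g"
begin

lemma Sa_S: "Sa (S f) = T f"
  using adj[of _ "S f"] S_inner[of _ f] psd_opD(2)[OF psd_op_T]
  by (metis inner_commute vector_eq_ldot)

lemma Sa_inner: "Sa g \<bullet> f = S f \<bullet> g"
  by (subst inner_commute) (simp only: adj)

lemma norm_S: "(norm (S f))\<^sup>2 = T f \<bullet> f"
  by (simp add: power2_norm_eq_inner S_inner)

lemma bounded_linear_Sa: "bounded_linear Sa"
proof -
  obtain K where K: "0 \<le> K" "\<And>f. norm (S f) \<le> norm f * K"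
    using bounded_linear.nonneg_bounded[OF S] by auto
  show ?thesis
  proof (rule bounded_linear_intro[where K = K])
    show "Sa (x + y) = Sa x + Sa y" for x y
      by (subst vector_eq_ldot[symmetric]) (simp add: inner_add_right flip: adj)
    show "Sa (c *\<^sub>R x) = c *\<^sub>R Sa x" for c x
      by (subst vector_eq_ldot[symmetric]) (simp flip: adj)
    show "norm (Sa x) \<le> norm x * K" for x
    proof (cases "Sa x = 0")
      case False
      have "norm (Sa x) * norm (Sa x) = S (Sa x) \<bullet> x" by (simp add: adj dot_square_norm power2_eq_square)
      also have "\<dots> \<le> norm (S (Sa x)) * norm x" by (rule norm_cauchy_schwarz)
      also have "\<dots> \<le> (norm (Sa x) * K) * norm x" by (intro mult_right_mono K) simp
      finally have "norm (Sa x) * norm (Sa x) \<le> (norm x * K) * norm (Sa x)" by (simp add: mult_ac)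
      then show ?thesis using False by simp
    qed (use K in simp)
  qed
qed

text \<open>Along a weakly convergent subsequence the functions \<open>f \<bullet> k x\<close>
  converge at every \<open>x\<close> and are uniformly bounded, hence converge in mean square. The
  mean square of \<open>f \<bullet> k x\<close> is the squared norm of \<open>S f\<close>, so the
  images are Cauchy.\<close>

lemma compact_op_S: "compact_op S"
  unfolding compact_op_def
proof (intro allI impI)
  fix f :: "nat \<Rightarrow> 'h" assume "bounded (range f)"
  then obtain C where C: "\<And>n. norm (f n) \<le> C" by (auto simp: bounded_iff)
  obtain r where r: "strict_mono (r :: nat \<Rightarrow> nat)" "\<And>x. convergent (\<lambda>n. f (r n) \<bullet> x)"
    by (rule weakly_convergent_subsequence[where f = f, OF C]) blast
  define h where "h x = lim (\<lambda>n. f (r n) \<bullet> k x)" for x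
  have h: "(\<lambda>n. f (r n) \<bullet> k x) \<longlonglongrightarrow> h x" for x
    unfolding h_def using r(2) by (simp add: convergent_LIMSEQ_iff)
  have hm [measurable]: "h \<in> borel_measurable M"
    by (rule borel_measurable_LIMSEQ_real[OF h]) simp
  have fb: "\<bar>f (r n) \<bullet> k x\<bar> \<le> C * \<kappa>" if "x \<in> space M" for n x
    by (rule order_trans[OF Cauchy_Schwarz_ineq2])
      (intro mult_mono C k_bound that norm_ge_zero order_trans[OF norm_ge_zero C[of n]])
  have hb: "\<bar>h x\<bar> \<le> C * \<kappa>" if "x \<in> space M" for x
    using tendsto_rabs[OF h[of x]] by (rule LIMSEQ_le_const2) (use fb[OF that] in auto)
  define d where "d n = (\<integral>x. (f (r n) \<bullet> k x - h x)\<^sup>2 \<partial>M)" for n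
  have db: "(f (r n) \<bullet> k x - h x)\<^sup>2 \<le> (2 * C * \<kappa>)\<^sup>2" if "x \<in> space M" for n x
    using fb[OF that, of n] hb[OF that] by (intro abs_le_square_iff[THEN iffD1]) auto
  have di: "integrable M (\<lambda>x. (f (r n) \<bullet> k x - h x)\<^sup>2)" for n
    by (rule integrable_const_bound[where B = "(2 * C * \<kappa>)\<^sup>2"]) (auto intro!: AE_I2 db)
  have "(\<lambda>n. \<integral>x. (f (r n) \<bullet> k x - h x)\<^sup>2 \<partial>M) \<longlonglongrightarrow> (\<integral>x. 0 \<partial>M)"
  proof (rule integral_dominated_convergence[where w = "\<lambda>_. (2 * C * \<kappa>)\<^sup>2"])
    show "AE x in M. (\<lambda>n. (f (r n) \<bullet> k x - h x)\<^sup>2) \<longlonglongrightarrow> 0"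
    proof (rule AE_I2)
      fix x
      have "(\<lambda>n. (f (r n) \<bullet> k x - h x)\<^sup>2) \<longlonglongrightarrow> (h x - h x)\<^sup>2" by (intro tendsto_intros h)
      then show "(\<lambda>n. (f (r n) \<bullet> k x - h x)\<^sup>2) \<longlonglongrightarrow> 0" by simp
    qed
    show "AE x in M. norm ((f (r n) \<bullet> k x - h x)\<^sup>2) \<le> (2 * C * \<kappa>)\<^sup>2" for n
      by (rule AE_I2) (use db in auto)
  qed auto
  then have d0: "d \<longlonglongrightarrow> 0" by (simp add: d_def[abs_def])
  have dist_le: "(norm (S (f (r i)) - S (f (r j))))\<^sup>2 \<le> 2 * d i + 2 * d j" for i j
  proof -
    have "(norm (S (f (r i)) - S (f (r j))))\<^sup>2 = T (f (r i) - f (r j)) \<bullet> (f (r i) - f (r j))"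
      by (simp add: linear_diff[OF bounded_linear.linear[OF S], symmetric] norm_S)
    also have "\<dots> = (\<integral>x. (k x \<bullet> (f (r i) - f (r j))) * (k x \<bullet> (f (r i) - f (r j))) \<partial>M)" by (rule T_inner)
    also have "\<dots> \<le> (\<integral>x. 2 * (f (r i) \<bullet> k x - h x)\<^sup>2 + 2 * (f (r j) \<bullet> k x - h x)\<^sup>2 \<partial>M)"
    proof (intro integral_mono integrable_inner_mult)
      show "integrable M (\<lambda>x. 2 * (f (r i) \<bullet> k x - h x)\<^sup>2 + 2 * (f (r j) \<bullet> k x - h x)\<^sup>2)"
        using di by simp
      fix x
      define a b where "a = f (r i) \<bullet> k x - h x" and "b = f (r j) \<bullet> k x - h x"
      have "k x \<bullet> (f (r i) - f (r j)) = a - b" by (simp add: a_def b_def inner_diff_right inner_commute)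
      moreover have "(a - b) * (a - b) \<le> 2 * a\<^sup>2 + 2 * b\<^sup>2"
        using zero_le_power2[of "a + b"] by (simp add: power2_eq_square algebra_simps)
      ultimately show "(k x \<bullet> (f (r i) - f (r j))) * (k x \<bullet> (f (r i) - f (r j)))
          \<le> 2 * (f (r i) \<bullet> k x - h x)\<^sup>2 + 2 * (f (r j) \<bullet> k x - h x)\<^sup>2"
        by (simp add: a_def b_def)
    qed
    also have "\<dots> = 2 * d i + 2 * d j" using di by (simp add: d_def)
    finally show ?thesis .
  qed
  have "Cauchy (\<lambda>n. S (f (r n)))"
  proof (rule CauchyI)
    fix e :: real assume e: "0 < e"
    then obtain N where N: "\<And>n. n \<ge> N \<Longrightarrow> norm (d n - 0) < e\<^sup>2 / 4"
      using LIMSEQ_D[OF d0, of "e\<^sup>2 / 4"] by auto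
    show "\<exists>M. \<forall>m\<ge>M. \<forall>n\<ge>M. norm (S (f (r m)) - S (f (r n))) < e"
    proof (intro exI allI impI)
      fix i j assume "N \<le> i" "N \<le> j"
      then have "(norm (S (f (r i)) - S (f (r j))))\<^sup>2 < e\<^sup>2"
        using N[of i] N[of j] dist_le[of i j] by (simp add: abs_if split: if_splits)
      then show "norm (S (f (r i)) - S (f (r j))) < e" by (rule power2_less_imp_less) (use e in simp)
    qed
  qed
  then obtain l where "(\<lambda>n. S (f (r n))) \<longlonglongrightarrow> l" using Cauchy_convergent convergent_def by blast
  then show "\<exists>r l. strict_mono r \<and> (\<lambda>n. S (f (r n))) \<longlonglongrightarrow> l" using r(1) by blast
qed

definition L :: "'l \<Rightarrow> 'l" where "L g = S (Sa g)"

lemma compact_psd_T: "compact_psd T"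
proof
  show "compact_op T"
    using compact_op_compose[OF compact_op_S bounded_linear_Sa] by (simp add: comp_def Sa_S)
qed (rule psd_op_T)

lemma compact_psd_L: "compact_psd L"
proof
  show "compact_op L"
    using compact_op_precompose[OF compact_op_S bounded_linear_Sa] by (simp add: comp_def L_def[abs_def])
  have "bounded_linear L"
    unfolding L_def[abs_def] by (intro bounded_linear_compose[OF S] bounded_linear_Sa)
  moreover have Lxy: "L x \<bullet> y = Sa x \<bullet> Sa y" for x y by (simp only: L_def adj)
  have "L x \<bullet> y = x \<bullet> L y" for x y by (simp only: Lxy inner_commute[of x "L y"] inner_commute[of "Sa x"])
  moreover have "0 \<le> L x \<bullet> x" for x by (simp only: Lxy inner_ge_zero)
  ultimately show "psd_op L" unfolding psd_op_def by blast
qed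

sublocale cT: compact_psd T by (rule compact_psd_T)

lemma sum_eigenvalues_le:
  assumes "finite F" "F \<subseteq> eigenbasis T"
  shows "(\<Sum>b\<in>F. T b \<bullet> b) \<le> \<kappa>\<^sup>2"
proof -
  have "(\<Sum>b\<in>F. T b \<bullet> b) = (\<integral>x. (\<Sum>b\<in>F. (k x \<bullet> b) * (k x \<bullet> b)) \<partial>M)"
    by (simp add: T_inner integrable_inner_mult)
  also have "\<dots> \<le> (\<integral>x. \<kappa>\<^sup>2 \<partial>M)"
  proof (rule integral_mono)
    fix x assume x: "x \<in> space M"
    have "(\<Sum>b\<in>F. (k x \<bullet> b) * (k x \<bullet> b)) \<le> (norm (k x))\<^sup>2"
      using bessel[OF orthonormal_basis_set[OF cT.eigenbasis(1)] assms, of "k x"] by (simp add: power2_eq_square)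
    also have "\<dots> \<le> \<kappa>\<^sup>2" using k_bound[OF x] by (intro power_mono) auto
    finally show "(\<Sum>b\<in>F. (k x \<bullet> b) * (k x \<bullet> b)) \<le> \<kappa>\<^sup>2" .
  qed (auto intro: integrable_inner_mult)
  finally show ?thesis by (simp add: prob_space)
qed

context
  fixes lam :: real
  assumes lam: "0 < lam"
begin

abbreviation "J \<equiv> cT.J lam"

text \<open>Push-through identity: \<open>J \<circ> J\<close> inverts T + lam, and the left-hand
  side is S (T + lam) (T + lam)^(-1) Sa applied to \<open>y\<close>.\<close>

lemma L_S_J_J: "L (S (J (J (Sa y)))) + lam *\<^sub>R S (J (J (Sa y))) = L y"
proof -
  have "T (J (J z)) + lam *\<^sub>R J (J z) = z" for z
  proof (rule cT.eq_basisI)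
    fix e assume e: "e \<in> eigenbasis T"
    have pos: "0 < T e \<bullet> e + lam" using cT.eigenvalue_nonneg[of e] lam by simp
    have "(T (J (J z)) + lam *\<^sub>R J (J z)) \<bullet> e = (T e \<bullet> e + lam) * (J (J z) \<bullet> e)"
      by (simp only: inner_add_left cT.A_inner[OF e, of "J (J z)"] inner_scaleR_left distrib_right)
    also have "J (J z) \<bullet> e = z \<bullet> e / (T e \<bullet> e + lam)"
      using pos by (simp only: cT.J_inner[OF lam e] divide_divide_eq_left real_sqrt_mult_self abs_of_pos)
    also have "(T e \<bullet> e + lam) * \<dots> = z \<bullet> e" using pos by simp
    finally show "(T (J (J z)) + lam *\<^sub>R J (J z)) \<bullet> e = z \<bullet> e" .
  qed
  from arg_cong[OF this[of "Sa y"], of S] show ?thesis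
    by (simp add: L_def Sa_S linear_add[OF bounded_linear.linear[OF S]] linear_cmul[OF bounded_linear.linear[OF S]])
qed

text \<open>Woodbury's identity. As \<open>inv\<close> chooses a preimage, injectivity is shown
  along with one explicit preimage.\<close>

lemma resolvent_L: "inv (\<lambda>h. L h + lam *\<^sub>R h) y = (1 / lam) *\<^sub>R (y - S (J (J (Sa y))))"
proof -
  interpret cL: compact_psd L by (rule compact_psd_L)
  show ?thesis
  proof (rule inv_f_eq)
    show "inj (\<lambda>h. L h + lam *\<^sub>R h)"
    proof (rule injI)
      fix x y assume "L x + lam *\<^sub>R x = L y + lam *\<^sub>R y"
      then have "L (x - y) + lam *\<^sub>R (x - y) = 0"
        by (simp add: psd_opD[OF cL.psd] algebra_simps)
      then have "(L (x - y) + lam *\<^sub>R (x - y)) \<bullet> (x - y) = 0" by simp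
      then have "L (x - y) \<bullet> (x - y) + lam * (norm (x - y))\<^sup>2 = 0"
        by (simp only: inner_add_left inner_scaleR_left dot_square_norm)
      then have "lam * (norm (x - y))\<^sup>2 \<le> 0" using psd_opD(3)[OF cL.psd, of "x - y"] by linarith
      then show "x = y" using lam by (simp add: mult_le_0_iff)
    qed
    have "L y = L (S (J (J (Sa y)))) + lam *\<^sub>R S (J (J (Sa y)))" by (rule L_S_J_J[symmetric])
    then show "L ((1 / lam) *\<^sub>R (y - S (J (J (Sa y))))) + lam *\<^sub>R (1 / lam) *\<^sub>R (y - S (J (J (Sa y)))) = y"
      using lam by (simp add: psd_opD[OF cL.psd])
  qed
qed

text \<open>\<open>op_trace\<close> sums over a chosen basis, and an infinite sum that does not
  converge would silently be 0. Convergence is therefore part of the claim; it follows by bounding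
  finite partial sums by \<open>\<kappa>\<^sup>2 / lam\<close> after exchanging the sums over the
  two bases.\<close>

lemma effective_dim_has_sum:
  obtains B where "orthonormal_basis B" "((\<lambda>e. (norm (J (Sa e)))\<^sup>2) has_sum effective_dim L lam) B"
proof -
  interpret cL: compact_psd L by (rule compact_psd_L)
  define B :: "'l set" where "B = (SOME B. orthonormal_basis B)"
  have B: "orthonormal_basis B" unfolding B_def by (rule someI_ex) (use cL.eigenbasis(1) in blast)
  have LR: "(L \<circ> inv (\<lambda>h. L h + lam *\<^sub>R h)) y = S (J (J (Sa y)))" for y
  proof -
    have "L y - L (S (J (J (Sa y)))) = lam *\<^sub>R S (J (J (Sa y)))"
      using L_S_J_J[of y] by (simp add: algebra_simps)
    then show ?thesis using lam by (simp add: resolvent_L psd_opD[OF cL.psd])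
  qed
  have eq: "effective_dim L lam = (\<Sum>\<^sub>\<infinity>e\<in>B. (norm (J (Sa e)))\<^sup>2)"
    unfolding effective_dim_def op_trace_def B_def[symmetric]
    by (simp only: LR adj) (simp add: cT.J_sym[OF lam] power2_norm_eq_inner)
  have "(\<lambda>e. (norm (J (Sa e)))\<^sup>2) summable_on B"
  proof (rule nonneg_bdd_above_summable_on)
    show "bdd_above (sum (\<lambda>e. (norm (J (Sa e)))\<^sup>2) ` {F. F \<subseteq> B \<and> finite F})"
    proof (rule bdd_aboveI2)
      fix G assume "G \<in> {F. F \<subseteq> B \<and> finite F}"
      then have G: "finite G" "G \<subseteq> B" by auto
      have "((\<lambda>b. \<Sum>e\<in>G. (Sa e \<bullet> b)\<^sup>2 / (T b \<bullet> b + lam)) has_sum (\<Sum>e\<in>G. (norm (J (Sa e)))\<^sup>2)) (eigenbasis T)"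
        by (intro has_sum_finite_sum cT.norm_J_has_sum lam G)
      then show "(\<Sum>e\<in>G. (norm (J (Sa e)))\<^sup>2) \<le> \<kappa>\<^sup>2 / lam"
      proof (rule has_sum_le_finite_sums)
        fix F assume F: "finite F" "F \<subseteq> eigenbasis T"
        have "(\<Sum>b\<in>F. \<Sum>e\<in>G. (Sa e \<bullet> b)\<^sup>2 / (T b \<bullet> b + lam)) \<le> (\<Sum>b\<in>F. T b \<bullet> b / lam)"
        proof (rule sum_mono)
          fix b
          have "(\<Sum>e\<in>G. (Sa e \<bullet> b)\<^sup>2 / (T b \<bullet> b + lam)) = (\<Sum>e\<in>G. (S b \<bullet> e)\<^sup>2) / (T b \<bullet> b + lam)"
            by (simp only: sum_divide_distrib Sa_inner)
          also have "\<dots> \<le> (norm (S b))\<^sup>2 / (T b \<bullet> b + lam)"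
            using cT.eigenvalue_nonneg[of b] lam
            by (intro divide_right_mono bessel[OF orthonormal_basis_set[OF B] G]) auto
          also have "\<dots> \<le> T b \<bullet> b / lam"
            using cT.eigenvalue_nonneg[of b] lam by (simp add: norm_S frac_le)
          finally show "(\<Sum>e\<in>G. (Sa e \<bullet> b)\<^sup>2 / (T b \<bullet> b + lam)) \<le> T b \<bullet> b / lam" .
        qed
        also have "\<dots> \<le> \<kappa>\<^sup>2 / lam"
          using sum_eigenvalues_le[OF F] lam by (simp add: divide_right_mono flip: sum_divide_distrib)
        finally show "(\<Sum>b\<in>F. \<Sum>e\<in>G. (Sa e \<bullet> b)\<^sup>2 / (T b \<bullet> b + lam)) \<le> \<kappa>\<^sup>2 / lam" .
      qed
    qed
  qed simp
  then have "((\<lambda>e. (norm (J (Sa e)))\<^sup>2) has_sum effective_dim L lam) B" unfolding eq by (rule has_sum_infsum)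
  then show thesis using B that by blast
qed

text \<open>Half of the cyclicity of the trace: the traces of T (T + lam)^(-1) and of L (L +
  lam)^(-1) are the same double sum of
  \<open>(Sa e \<bullet> b)\<^sup>2 / (T b \<bullet> b + lam)\<close>, taken in different
  orders.\<close>

lemma sum_le_effective_dim:
  assumes F: "finite F" "F \<subseteq> eigenbasis T"
  shows "(\<Sum>b\<in>F. T b \<bullet> b / (T b \<bullet> b + lam)) \<le> effective_dim L lam"
proof -
  obtain B where B: "orthonormal_basis B" and eff: "((\<lambda>e. (norm (J (Sa e)))\<^sup>2) has_sum effective_dim L lam) B"
    by (rule effective_dim_has_sum)
  have "((\<lambda>e. \<Sum>b\<in>F. (1 / (T b \<bullet> b + lam)) * (S b \<bullet> e)\<^sup>2) has_sum (\<Sum>b\<in>F. (1 / (T b \<bullet> b + lam)) * (norm (S b))\<^sup>2)) B"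
    by (intro has_sum_finite_sum has_sum_cmult_right parseval_norm B F)
  then have "((\<lambda>e. \<Sum>b\<in>F. (Sa e \<bullet> b)\<^sup>2 / (T b \<bullet> b + lam)) has_sum (\<Sum>b\<in>F. T b \<bullet> b / (T b \<bullet> b + lam))) B"
    by (simp add: norm_S Sa_inner)
  then show ?thesis
  proof (rule has_sum_mono[OF _ eff])
    fix e
    show "(\<Sum>b\<in>F. (Sa e \<bullet> b)\<^sup>2 / (T b \<bullet> b + lam)) \<le> (norm (J (Sa e)))\<^sup>2"
      using cT.eigenvalue_nonneg lam
      by (intro finite_sum_le_has_sum[OF cT.norm_J_has_sum[OF lam] F] divide_nonneg_nonneg add_nonneg_nonneg) auto
  qed
qed

text \<open>The mean is the trace of (T + lam)^(-1) T. Initial segments of the countable eigenbasis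
  reduce it to \<open>sum_le_effective_dim\<close> by dominated convergence.\<close>

lemma expectation_norm_J_le:
  shows "integrable M (\<lambda>x. (norm (J (k x)))\<^sup>2)" and "(\<integral>x. (norm (J (k x)))\<^sup>2 \<partial>M) \<le> effective_dim L lam"
proof -
  let ?E = "eigenbasis T"
  define F where "F n = {b \<in> ?E. to_nat_on ?E b < n}" for n
  have cnt: "countable ?E"
    by (rule countable_orthonormal_set[OF orthonormal_basis_set[OF cT.eigenbasis(1)]])
  have fin: "finite (F n)" for n
  proof (rule finite_imageD)
    show "finite (to_nat_on ?E ` F n)" by (rule finite_subset[of _ "{..<n}"]) (auto simp: F_def)
    show "inj_on (to_nat_on ?E) (F n)"
      by (rule inj_on_subset[OF inj_on_to_nat_on[OF cnt]]) (auto simp: F_def)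
  qed
  have sub: "F n \<subseteq> ?E" for n by (auto simp: F_def)
  have Flim: "filterlim F (finite_subsets_at_top ?E) sequentially"
    unfolding filterlim_finite_subsets_at_top
  proof (intro allI impI)
    fix X assume X: "finite X \<and> X \<subseteq> ?E"
    have "X \<subseteq> F n" if "n \<ge> Suc (Max (to_nat_on ?E ` X))" for n
    proof
      fix b assume b: "b \<in> X"
      then have "to_nat_on ?E b \<le> Max (to_nat_on ?E ` X)" using X by (intro Max_ge) auto
      then have "to_nat_on ?E b < n" using that by linarith
      then show "b \<in> F n" using b X by (auto simp: F_def)
    qed
    then show "\<forall>\<^sub>F n in sequentially. finite (F n) \<and> X \<subseteq> F n \<and> F n \<subseteq> ?E"
      using fin sub by (auto simp: eventually_sequentially)
  qed
  have Jm [measurable]: "(\<lambda>x. J (k x)) \<in> borel_measurable M"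
    by (rule borel_measurable_continuous_on[OF bounded_linear.continuous_on[OF cT.bounded_linear_J[OF lam] continuous_on_id]]) simp
  have Jb: "(norm (J (k x)))\<^sup>2 \<le> \<kappa>\<^sup>2 / lam" if "x \<in> space M" for x
  proof -
    have "norm (J (k x)) \<le> \<kappa> / sqrt lam"
      by (rule order_trans[OF cT.norm_J_le[OF lam]]) (use k_bound[OF that] lam in \<open>simp add: divide_right_mono\<close>)
    from power_mono[OF this, of 2] show ?thesis using lam by (simp add: power_divide)
  qed
  show "integrable M (\<lambda>x. (norm (J (k x)))\<^sup>2)"
    by (rule integrable_const_bound[where B = "\<kappa>\<^sup>2 / lam"]) (auto intro!: AE_I2 Jb)
  have "(\<lambda>n. \<integral>x. (\<Sum>b\<in>F n. (k x \<bullet> b)\<^sup>2 / (T b \<bullet> b + lam)) \<partial>M) \<longlonglongrightarrow> (\<integral>x. (norm (J (k x)))\<^sup>2 \<partial>M)"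
  proof (rule integral_dominated_convergence[where w = "\<lambda>_. \<kappa>\<^sup>2 / lam"])
    show "AE x in M. (\<lambda>n. \<Sum>b\<in>F n. (k x \<bullet> b)\<^sup>2 / (T b \<bullet> b + lam)) \<longlonglongrightarrow> (norm (J (k x)))\<^sup>2"
      using filterlim_compose[OF cT.norm_J_has_sum[OF lam, unfolded has_sum_def] Flim] by (intro AE_I2)
    show "AE x in M. norm (\<Sum>b\<in>F n. (k x \<bullet> b)\<^sup>2 / (T b \<bullet> b + lam)) \<le> \<kappa>\<^sup>2 / lam" for n
    proof (rule AE_I2)
      fix x assume x: "x \<in> space M"
      have "0 \<le> T b \<bullet> b + lam" for b using cT.eigenvalue_nonneg[of b] lam by simp
      then have nn: "0 \<le> (k x \<bullet> b)\<^sup>2 / (T b \<bullet> b + lam)" for b by simp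
      have "(\<Sum>b\<in>F n. (k x \<bullet> b)\<^sup>2 / (T b \<bullet> b + lam)) \<le> (norm (J (k x)))\<^sup>2"
        by (rule finite_sum_le_has_sum[OF cT.norm_J_has_sum[OF lam] fin sub nn])
      then show "norm (\<Sum>b\<in>F n. (k x \<bullet> b)\<^sup>2 / (T b \<bullet> b + lam)) \<le> \<kappa>\<^sup>2 / lam"
        using Jb[OF x] sum_nonneg[where A = "F n", OF nn] by simp
    qed
  qed auto
  moreover have "(\<integral>x. (\<Sum>b\<in>F n. (k x \<bullet> b)\<^sup>2 / (T b \<bullet> b + lam)) \<partial>M) \<le> effective_dim L lam" for n
  proof -
    have "(\<integral>x. (\<Sum>b\<in>F n. (k x \<bullet> b)\<^sup>2 / (T b \<bullet> b + lam)) \<partial>M) = (\<Sum>b\<in>F n. T b \<bullet> b / (T b \<bullet> b + lam))"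
      by (simp add: T_inner integrable_inner_mult power2_eq_square)
    then show ?thesis using sum_le_effective_dim[OF fin sub] by simp
  qed
  ultimately show "(\<integral>x. (norm (J (k x)))\<^sup>2 \<partial>M) \<le> effective_dim L lam"
    by (intro LIMSEQ_le_const2) auto
qed

end

end

section \<open>First-stage sampling error\<close>

text \<open>Keeps the sampling analysis free of mean embeddings: \<open>M\<close> is the law of a
  labelled point, \<open>Y\<close> its label and \<open>fr\<close> the regression function at the
  point. \<open>F\<close> represents the regression function in the target space, to which
  \<open>risk\<close> ties \<open>fr\<close>.\<close>

locale regression = covariance_factor M k \<kappa> S Sa
  for M :: "'a measure" and k :: "'a \<Rightarrow> 'h::{real_inner,banach,second_countable_topology}" and \<kappa>
    and S :: "'h \<Rightarrow> 'l::{real_inner,banach}" and Sa +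
  fixes Y fr :: "'a \<Rightarrow> real" and b :: real and F h :: 'l and r R :: real
  assumes Y_measurable [measurable]: "Y \<in> borel_measurable M" and fr_measurable [measurable]: "fr \<in> borel_measurable M"
    and Y_bound: "\<And>z. z \<in> space M \<Longrightarrow> \<bar>Y z\<bar> \<le> b" and fr_bound: "\<And>z. z \<in> space M \<Longrightarrow> \<bar>fr z\<bar> \<le> b"
    and noise_mean: "\<And>u. (\<integral>z. (Y z - fr z) * (k z \<bullet> u) \<partial>M) = 0"
    and risk: "\<And>f. (norm (S f - F))\<^sup>2 = (\<integral>z. (fr z - k z \<bullet> f)\<^sup>2 \<partial>M)"
    and source: "F = op_powr L r h" "norm h \<le> R" "0 < r" "r \<le> 1 / 2"
begin

text \<open>\<open>bias\<close> for \<open>L\<close>, pulled back by \<open>f = Sa g\<close>: then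
  \<open>S f = L g\<close>, and the squared norm of \<open>f\<close> is
  \<open>L g \<bullet> g\<close>.\<close>

lemma approximation:
  assumes lam: "0 < lam"
  obtains f where "norm (S f - F) \<le> R * lam powr r" "norm f \<le> R * lam powr (r - 1 / 2)"
proof -
  interpret cL: compact_psd L by (rule compact_psd_L)
  obtain g where g: "norm (L g - F) \<le> lam powr r * norm h" "L g \<bullet> g \<le> (lam powr (r - 1 / 2) * norm h)\<^sup>2"
    using cL.bias[OF lam source(3,4), of h] unfolding source(1) by blast
  show thesis
  proof (rule that[of "Sa g"])
    show "norm (S (Sa g) - F) \<le> R * lam powr r"
      using g(1) mult_left_mono[OF source(2), of "lam powr r"] by (simp add: L_def mult.commute)
    have "(norm (Sa g))\<^sup>2 = L g \<bullet> g" by (simp add: power2_norm_eq_inner L_def adj)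
    also have "\<dots> \<le> (lam powr (r - 1 / 2) * norm h)\<^sup>2" by (rule g)
    finally have "norm (Sa g) \<le> lam powr (r - 1 / 2) * norm h" by (rule power2_le_imp_le) simp
    then show "norm (Sa g) \<le> R * lam powr (r - 1 / 2)"
      using mult_left_mono[OF source(2), of "lam powr (r - 1 / 2)"] by (simp add: mult.commute)
  qed
qed

lemma b_nonneg: "0 \<le> b"
proof -
  obtain x where "x \<in> space M" using not_empty by blast
  then show ?thesis using Y_bound[of x] by linarith
qed

text \<open>Bernstein for the vectors \<open>J lam ((Y z - fr z) *\<^sub>R k z)\<close>, whose
  second moment is at most \<open>(2 * b)\<^sup>2\<close> times the effective dimension. The
  condition \<open>\<kappa>\<^sup>2 / lam \<le> real n * N\<close> makes their uniform bound
  admissible.\<close>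

lemma noise_event:
  assumes lam: "0 < lam" and N: "0 < N" "effective_dim L lam \<le> N" and n: "0 < n" "\<kappa>\<^sup>2 / lam \<le> real n * N" and b0: "0 < b"
  obtains G where "G \<in> sets (PiM {..<n} (\<lambda>_. M))" "measure (PiM {..<n} (\<lambda>_. M)) G \<ge> 1 - 2 * exp (1 - t)"
    "\<And>\<omega>. \<omega> \<in> G \<Longrightarrow> norm (J lam ((1 / real n) *\<^sub>R (\<Sum>j<n. (Y (\<omega> j) - fr (\<omega> j)) *\<^sub>R k (\<omega> j))))
        \<le> t * (2 * b * sqrt N) / sqrt (real n)"
proof -
  let ?Q = "PiM {..<n} (\<lambda>_. M)"
  interpret Q: prob_space ?Q by (intro prob_space_PiM) unfold_locales
  note Jlin = bounded_linear.linear[OF cT.bounded_linear_J[OF lam]]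
  define X where "X z = J lam ((Y z - fr z) *\<^sub>R k z)" for z
  have X_eq: "X z = (Y z - fr z) *\<^sub>R J lam (k z)" for z unfolding X_def by (rule linear_cmul[OF Jlin])
  have Jm [measurable]: "(\<lambda>x. J lam (k x)) \<in> borel_measurable M"
    by (rule borel_measurable_continuous_on[OF bounded_linear.continuous_on[OF cT.bounded_linear_J[OF lam] continuous_on_id]]) simp
  have Xm [measurable]: "X \<in> borel_measurable M" unfolding X_eq[abs_def] by measurable
  have Yf: "\<bar>Y z - fr z\<bar> \<le> 2 * b" if "z \<in> space M" for z using Y_bound[OF that] fr_bound[OF that] by linarith
  have XB: "norm (X z) \<le> 2 * b * (\<kappa> / sqrt lam)" if z: "z \<in> space M" for z
  proof -
    have "norm (J lam (k z)) \<le> \<kappa> / sqrt lam"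
      by (rule order_trans[OF cT.norm_J_le[OF lam]]) (use k_bound[OF z] lam in \<open>simp add: divide_right_mono\<close>)
    then show ?thesis unfolding X_eq norm_scaleR using Yf[OF z] b_nonneg by (intro mult_mono) auto
  qed
  have mean: "(\<integral>z. X z \<bullet> u \<partial>M) = 0" for u
    using noise_mean[of "J lam u"] by (simp add: X_eq cT.J_sym[OF lam])
  have var: "(\<integral>z. (norm (X z))\<^sup>2 \<partial>M) \<le> (2 * b * sqrt N)\<^sup>2"
  proof -
    have "(\<integral>z. (norm (X z))\<^sup>2 \<partial>M) \<le> (\<integral>z. (2 * b)\<^sup>2 * (norm (J lam (k z)))\<^sup>2 \<partial>M)"
    proof (rule integral_mono')
      show "integrable M (\<lambda>z. (2 * b)\<^sup>2 * (norm (J lam (k z)))\<^sup>2)"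
        by (intro integrable_mult_right expectation_norm_J_le lam)
      fix z assume z: "z \<in> space M"
      have "\<bar>Y z - fr z\<bar>\<^sup>2 \<le> (2 * b)\<^sup>2" using Yf[OF z] by (intro power_mono) auto
      then show "(norm (X z))\<^sup>2 \<le> (2 * b)\<^sup>2 * (norm (J lam (k z)))\<^sup>2"
        unfolding X_eq norm_scaleR power_mult_distrib[of "\<bar>_\<bar>"] by (rule mult_right_mono) simp
    qed simp
    also have "\<dots> = (2 * b)\<^sup>2 * (\<integral>z. (norm (J lam (k z)))\<^sup>2 \<partial>M)" by simp
    also have "\<dots> \<le> (2 * b)\<^sup>2 * N"
      using expectation_norm_J_le(2)[OF lam] N by (intro mult_left_mono) auto
    finally show ?thesis using N by (simp add: power_mult_distrib)
  qed
  have B: "2 * b * (\<kappa> / sqrt lam) \<le> sqrt (real n) * (2 * b * sqrt N)"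
  proof -
    have "\<kappa> / sqrt lam \<le> sqrt (real n) * sqrt N"
      using real_sqrt_le_mono[OF n(2)] kappa_nonneg by (simp add: real_sqrt_divide real_sqrt_mult)
    from mult_left_mono[OF this, of "2 * b"] show ?thesis using b0 by (simp add: mult_ac)
  qed
  define G where "G = {\<omega> \<in> space ?Q. norm (\<Sum>j<n. X (\<omega> j)) < t * sqrt (real n) * (2 * b * sqrt N)}"
  have Gm: "G \<in> sets ?Q" unfolding G_def by measurable
  have "measure ?Q (space ?Q - G) \<le> 2 * exp (1 - t)"
  proof -
    have "space ?Q - G = {\<omega> \<in> space ?Q. t * sqrt (real n) * (2 * b * sqrt N) \<le> norm (\<Sum>j<n. X (\<omega> j))}"
      by (auto simp: G_def)
    then show ?thesis using bernstein_norm_sum_iid[OF Xm XB mean var _ n(1) B, of t] b0 N(1) by simp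
  qed
  then have "measure ?Q G \<ge> 1 - 2 * exp (1 - t)" using Q.prob_compl[OF Gm] by simp
  moreover have "norm (J lam ((1 / real n) *\<^sub>R (\<Sum>j<n. (Y (\<omega> j) - fr (\<omega> j)) *\<^sub>R k (\<omega> j))))
        \<le> t * (2 * b * sqrt N) / sqrt (real n)" if "\<omega> \<in> G" for \<omega>
  proof -
    have "norm (J lam ((1 / real n) *\<^sub>R (\<Sum>j<n. (Y (\<omega> j) - fr (\<omega> j)) *\<^sub>R k (\<omega> j))))
        = norm (\<Sum>j<n. X (\<omega> j)) / real n"
      by (simp add: linear_cmul[OF Jlin] linear_sum[OF Jlin] X_eq)
    also have "\<dots> \<le> t * sqrt (real n) * (2 * b * sqrt N) / real n"
      using that by (intro divide_right_mono) (auto simp: G_def)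
    also have "\<dots> = t * (2 * b * sqrt N) * (sqrt (real n) / real n)" by simp
    also have "sqrt (real n) / real n = 1 / sqrt (real n)" using n(1) by (simp add: real_div_sqrt field_simps)
    finally show ?thesis by simp
  qed
  ultimately show thesis using Gm that by blast
qed

text \<open>The squared misfit of \<open>f\<close> has mean at most
  \<open>(R * lam powr r)\<^sup>2\<close>, and Bernstein keeps its sample average below twice that.
  Its uniform bound involves the norm of \<open>f\<close>, which may grow as \<open>lam\<close>
  decreases; \<open>big\<close> limits this growth.\<close>

lemma approximation_event:
  assumes f: "norm (S f - F) \<le> R * lam powr r" and lam: "0 < lam" and R: "0 < R" and n: "0 < n" and t: "1 \<le> t"
    and big: "(b + \<kappa> * norm f)\<^sup>2 * t\<^sup>2 \<le> real n * (R * lam powr r)\<^sup>2" and b0: "0 < b"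
  obtains G where "G \<in> sets (PiM {..<n} (\<lambda>_. M))" "measure (PiM {..<n} (\<lambda>_. M)) G \<ge> 1 - 2 * exp (1 - t)"
    "\<And>\<omega>. \<omega> \<in> G \<Longrightarrow> (1 / real n) * (\<Sum>j<n. (fr (\<omega> j) - k (\<omega> j) \<bullet> f)\<^sup>2) \<le> 2 * (R * lam powr r)\<^sup>2"
proof -
  let ?Q = "PiM {..<n} (\<lambda>_. M)"
  interpret Q: prob_space ?Q by (intro prob_space_PiM) unfold_locales
  define a where "a = (R * lam powr r)\<^sup>2"
  define B where "B = (b + \<kappa> * norm f)\<^sup>2"
  define Z where "Z z = (fr z - k z \<bullet> f)\<^sup>2" for z
  define m where "m = (\<integral>z. Z z \<partial>M)"
  have a0: "0 < a" using R lam by (simp add: a_def)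
  have Zm [measurable]: "Z \<in> borel_measurable M" unfolding Z_def[abs_def] by measurable
  have Z0: "0 \<le> Z z" for z by (simp add: Z_def)
  have ZB: "Z z \<le> B" if z: "z \<in> space M" for z
  proof -
    have "\<bar>fr z - k z \<bullet> f\<bar> \<le> b + \<kappa> * norm f"
      using fr_bound[OF z] abs_inner_k[OF z, of f] by linarith
    from power_mono[OF this, of 2] show ?thesis by (simp add: Z_def B_def)
  qed
  have Zi: "integrable M Z" by (rule integrable_const_bound[where B = B]) (auto intro!: AE_I2 ZB simp: Z0)
  have Z2i: "integrable M (\<lambda>z. (Z z)\<^sup>2)"
    by (rule integrable_const_bound[where B = "B\<^sup>2"]) (auto intro!: AE_I2 power_mono ZB simp: Z0)
  have m0: "0 \<le> m" unfolding m_def by (simp add: Z0)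
  have ma: "m \<le> a"
    using power_mono[OF f norm_ge_zero, of 2] by (simp add: m_def Z_def[abs_def] a_def flip: risk)
  have "0 \<le> B" by (simp add: B_def)
  have mB: "m \<le> B"
  proof -
    have "m \<le> (\<integral>z. B \<partial>M)" unfolding m_def by (rule integral_mono) (use Zi ZB in auto)
    then show ?thesis by (simp add: prob_space)
  qed
  have mean: "(\<integral>z. (Z z - m) \<bullet> u \<partial>M) = 0" for u :: real
    using Zi by (simp add: m_def prob_space)
  \<comment> \<open>This \<sigma> makes the deviation \<open>t * sqrt n * \<sigma>\<close> equal to
    \<open>a * n\<close>, so that the average may exceed its mean by at most
    \<open>a\<close>.\<close>
  have sg: "0 < a * sqrt (real n) / t" using a0 n t by simp
  have big': "B * t\<^sup>2 \<le> real n * a" using big by (simp add: a_def B_def)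
  have tt: "t \<le> t\<^sup>2" using t by (simp add: power2_eq_square)
  \<comment> \<open>\<open>Z\<close> takes values between 0 and \<open>B\<close>, so its second
    moment is at most \<open>B\<close> times its mean, and the mean is at most
    \<open>a\<close>.\<close>
  have var: "(\<integral>z. (norm (Z z - m))\<^sup>2 \<partial>M) \<le> (a * sqrt (real n) / t)\<^sup>2"
  proof -
    have "(\<integral>z. (norm (Z z - m))\<^sup>2 \<partial>M) = (\<integral>z. (Z z)\<^sup>2 - 2 * m * Z z + m\<^sup>2 \<partial>M)"
      by (intro Bochner_Integration.integral_cong) (auto simp: power2_diff)
    also have "\<dots> = (\<integral>z. (Z z)\<^sup>2 \<partial>M) - m\<^sup>2"
      using Zi Z2i by (simp add: prob_space m_def[symmetric] power2_eq_square)
    also have "\<dots> \<le> (\<integral>z. B * Z z \<partial>M)"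
    proof -
      have "(\<integral>z. (Z z)\<^sup>2 \<partial>M) \<le> (\<integral>z. B * Z z \<partial>M)"
        using Zi Z2i by (intro integral_mono) (auto simp: power2_eq_square intro!: mult_right_mono ZB Z0)
      then show ?thesis using zero_le_power2[of m] by linarith
    qed
    also have "\<dots> = B * m" by (simp add: m_def)
    also have "\<dots> \<le> (real n * a / t\<^sup>2) * a"
      using ma m0 big' t \<open>0 \<le> B\<close> a0 by (intro mult_mono) (auto simp: pos_le_divide_eq)
    also have "\<dots> = (a * sqrt (real n) / t)\<^sup>2" by (simp add: power_divide power_mult_distrib power2_eq_square)
    finally show ?thesis .
  qed
  have nB: "norm (Z z - m) \<le> B" if "z \<in> space M" for z
    using ZB[OF that] Z0[of z] m0 mB by (simp add: abs_le_iff)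
  have Bn: "B \<le> sqrt (real n) * (a * sqrt (real n) / t)"
  proof -
    have "B * t \<le> B * t\<^sup>2" using tt \<open>0 \<le> B\<close> by (rule mult_left_mono)
    then have "B \<le> real n * a / t" using big' t by (simp add: pos_le_divide_eq)
    then show ?thesis by (simp add: mult_ac flip: real_sqrt_mult)
  qed
  define G where "G = {\<omega> \<in> space ?Q. norm (\<Sum>j<n. Z (\<omega> j) - m) < t * sqrt (real n) * (a * sqrt (real n) / t)}"
  have Gm: "G \<in> sets ?Q" unfolding G_def by measurable
  have "measure ?Q (space ?Q - G) \<le> 2 * exp (1 - t)"
  proof -
    have "space ?Q - G = {\<omega> \<in> space ?Q. t * sqrt (real n) * (a * sqrt (real n) / t) \<le> norm (\<Sum>j<n. Z (\<omega> j) - m)}"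
      by (auto simp: G_def)
    then show ?thesis
      using bernstein_norm_sum_iid[of "\<lambda>z. Z z - m", OF _ nB mean var sg n Bn, of t] by simp
  qed
  then have "measure ?Q G \<ge> 1 - 2 * exp (1 - t)" using Q.prob_compl[OF Gm] by simp
  moreover have "(1 / real n) * (\<Sum>j<n. (fr (\<omega> j) - k (\<omega> j) \<bullet> f)\<^sup>2) \<le> 2 * (R * lam powr r)\<^sup>2" if "\<omega> \<in> G" for \<omega>
  proof -
    have "t * sqrt (real n) * (a * sqrt (real n) / t) = a * real n" using t by simp
    then have "(\<Sum>j<n. Z (\<omega> j)) - real n * m < a * real n"
      using that by (auto simp: G_def sum_subtractf abs_less_iff)
    moreover have "real n * m \<le> real n * a" using ma by (intro mult_left_mono) auto
    ultimately have "(\<Sum>j<n. Z (\<omega> j)) \<le> 2 * (a * real n)" by (simp add: mult.commute[of "real n"])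
    then show ?thesis using n by (simp add: Z_def a_def field_simps)
  qed
  ultimately show thesis using Gm that by blast
qed

text \<open>The residual of \<open>f\<close> splits into misfit and label noise. Cauchy-Schwarz over
  the sample bounds the misfit directly by the empirical form. The noise is bounded in terms of
  \<open>T\<close> plus \<open>lam\<close>, and the lower bound for the empirical covariance
  transfers this at the price of the factor 8e + 1 under the root.\<close>

lemma first_stage_event:
  assumes lam: "0 < lam" and R: "0 < R" and b0: "0 < b" and N: "0 < N" "effective_dim L lam \<le> N"
    and n: "0 < n" "\<kappa>\<^sup>2 \<le> real n * lam * N" and t: "1 \<le> t" and q: "1 \<le> q"
    and f: "norm (S f - F) \<le> R * lam powr r"
    and big: "(b + \<kappa> * norm f)\<^sup>2 * t\<^sup>2 \<le> real n * (R * lam powr r)\<^sup>2"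
    and small: "(2 * real q + 1) * \<kappa>\<^sup>2 / (real n * lam) \<le> 1 / 4"
  obtains G where "G \<in> sets (PiM {..<n} (\<lambda>_. M))"
    "measure (PiM {..<n} (\<lambda>_. M)) G \<ge> 1 - (4 * exp (1 - t) + real n * exp (- (2 * real q)))"
    "\<And>\<omega> u. \<omega> \<in> G \<Longrightarrow> T u \<bullet> u \<le> 8 * exp 1 * (empirical_cov n (\<lambda>j. k (\<omega> j)) u \<bullet> u + lam * (norm u)\<^sup>2)"
    "\<And>\<omega> u. \<omega> \<in> G \<Longrightarrow> ((1 / real n) *\<^sub>R (\<Sum>j<n. (Y (\<omega> j) - k (\<omega> j) \<bullet> f) *\<^sub>R k (\<omega> j))) \<bullet> u
      \<le> (sqrt 2 * (R * lam powr r) + sqrt (8 * exp 1 + 1) * (t * (2 * b * sqrt N) / sqrt (real n)))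
          * sqrt (empirical_cov n (\<lambda>j. k (\<omega> j)) u \<bullet> u + lam * (norm u)\<^sup>2)"
proof -
  let ?Q = "PiM {..<n} (\<lambda>_. M)"
  interpret Q: prob_space ?Q by (intro prob_space_PiM) unfold_locales
  have n2: "\<kappa>\<^sup>2 / lam \<le> real n * N" using n lam by (simp add: pos_divide_le_eq mult_ac)
  obtain G1 where G1: "G1 \<in> sets ?Q" "measure ?Q G1 \<ge> 1 - real n * exp (- (2 * real q))"
    "\<And>\<omega> u. \<omega> \<in> G1 \<Longrightarrow> T u \<bullet> u \<le> 8 * exp 1 / real n * ((real n * lam) * (norm u)\<^sup>2 + (\<Sum>j<n. (k (\<omega> j) \<bullet> u)\<^sup>2))"
    by (rule empirical_lower_bound[OF _ small q n(1)]) (use n lam in auto)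
  obtain G2 where G2: "G2 \<in> sets ?Q" "measure ?Q G2 \<ge> 1 - 2 * exp (1 - t)"
    "\<And>\<omega>. \<omega> \<in> G2 \<Longrightarrow> norm (J lam ((1 / real n) *\<^sub>R (\<Sum>j<n. (Y (\<omega> j) - fr (\<omega> j)) *\<^sub>R k (\<omega> j))))
        \<le> t * (2 * b * sqrt N) / sqrt (real n)"
    using noise_event[OF lam N n(1) n2 b0, of t] by blast
  obtain G3 where G3: "G3 \<in> sets ?Q" "measure ?Q G3 \<ge> 1 - 2 * exp (1 - t)"
    "\<And>\<omega>. \<omega> \<in> G3 \<Longrightarrow> (1 / real n) * (\<Sum>j<n. (fr (\<omega> j) - k (\<omega> j) \<bullet> f)\<^sup>2) \<le> 2 * (R * lam powr r)\<^sup>2"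
    using approximation_event[OF f lam R n(1) t big b0] by blast
  define G where "G = G1 \<inter> G2 \<inter> G3"
  have Gm: "G \<in> sets ?Q" using G1 G2 G3 by (simp add: G_def)
  have "measure ?Q (space ?Q - G) \<le> measure ?Q ((space ?Q - G1) \<union> ((space ?Q - G2) \<union> (space ?Q - G3)))"
    using G1 G2 G3 by (intro Q.finite_measure_mono) (auto simp: G_def)
  also have "\<dots> \<le> measure ?Q (space ?Q - G1) + (measure ?Q (space ?Q - G2) + measure ?Q (space ?Q - G3))"
    using G1 G2 G3 by (intro order_trans[OF measure_Un_le] add_left_mono measure_Un_le) auto
  also have "\<dots> \<le> real n * exp (- (2 * real q)) + (2 * exp (1 - t) + 2 * exp (1 - t))"
    using G1 G2 G3 by (simp add: Q.prob_compl)
  finally have prob: "measure ?Q G \<ge> 1 - (4 * exp (1 - t) + real n * exp (- (2 * real q)))"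
    using Q.prob_compl[OF Gm] by simp
  have low: "T u \<bullet> u \<le> 8 * exp 1 * (empirical_cov n (\<lambda>j. k (\<omega> j)) u \<bullet> u + lam * (norm u)\<^sup>2)" if "\<omega> \<in> G" for \<omega> u
  proof -
    have "T u \<bullet> u \<le> 8 * exp 1 / real n * ((real n * lam) * (norm u)\<^sup>2 + (\<Sum>j<n. (k (\<omega> j) \<bullet> u)\<^sup>2))"
      by (rule G1) (use that in \<open>simp add: G_def\<close>)
    also have "\<dots> = 8 * exp 1 * (empirical_cov n (\<lambda>j. k (\<omega> j)) u \<bullet> u + lam * (norm u)\<^sup>2)"
      using n by (simp add: empirical_cov_inner power2_eq_square field_simps)
    finally show ?thesis .
  qed
  have Q: "((1 / real n) *\<^sub>R (\<Sum>j<n. (Y (\<omega> j) - k (\<omega> j) \<bullet> f) *\<^sub>R k (\<omega> j))) \<bullet> u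
      \<le> (sqrt 2 * (R * lam powr r) + sqrt (8 * exp 1 + 1) * (t * (2 * b * sqrt N) / sqrt (real n)))
          * sqrt (empirical_cov n (\<lambda>j. k (\<omega> j)) u \<bullet> u + lam * (norm u)\<^sup>2)" if w: "\<omega> \<in> G" for \<omega> u
  proof -
    let ?A = "empirical_cov n (\<lambda>j. k (\<omega> j))"
    let ?e = "\<lambda>j. fr (\<omega> j) - k (\<omega> j) \<bullet> f"
    let ?v = "(1 / real n) *\<^sub>R (\<Sum>j<n. (Y (\<omega> j) - fr (\<omega> j)) *\<^sub>R k (\<omega> j))"
    define D where "D = ?A u \<bullet> u + lam * (norm u)\<^sup>2"
    have A0: "0 \<le> ?A u \<bullet> u" by (rule psd_opD[OF psd_op_empirical_cov])
    have D0: "0 \<le> D" "?A u \<bullet> u \<le> D" "lam * (norm u)\<^sup>2 \<le> D" using A0 lam by (auto simp: D_def)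
    have "(1 / real n) *\<^sub>R (\<Sum>j<n. (Y (\<omega> j) - k (\<omega> j) \<bullet> f) *\<^sub>R k (\<omega> j)) = (1 / real n) *\<^sub>R (\<Sum>j<n. ?e j *\<^sub>R k (\<omega> j)) + ?v"
      by (simp add: algebra_simps sum.distrib sum_subtractf flip: scaleR_add_right)
    then have split: "((1 / real n) *\<^sub>R (\<Sum>j<n. (Y (\<omega> j) - k (\<omega> j) \<bullet> f) *\<^sub>R k (\<omega> j))) \<bullet> u
        = (1 / real n) * (\<Sum>j<n. ?e j * (k (\<omega> j) \<bullet> u)) + ?v \<bullet> u"
      by (simp add: inner_add_left inner_sum_left)
    have "(1 / real n) * (\<Sum>j<n. ?e j * (k (\<omega> j) \<bullet> u)) \<le> sqrt 2 * (R * lam powr r) * sqrt D"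
    proof -
      have "(\<Sum>j<n. ?e j * (k (\<omega> j) \<bullet> u))\<^sup>2 \<le> (\<Sum>j<n. (?e j)\<^sup>2) * (\<Sum>j<n. (k (\<omega> j) \<bullet> u)\<^sup>2)"
        by (rule Cauchy_Schwarz_ineq_sum)
      then have "((1 / real n) * (\<Sum>j<n. ?e j * (k (\<omega> j) \<bullet> u)))\<^sup>2
          \<le> ((1 / real n) * (\<Sum>j<n. (?e j)\<^sup>2)) * ((1 / real n) * (\<Sum>j<n. (k (\<omega> j) \<bullet> u)\<^sup>2))"
        by (simp add: power_divide power2_eq_square divide_right_mono)
      also have "\<dots> \<le> (2 * (R * lam powr r)\<^sup>2) * D"
      proof (rule mult_mono)
        show "(1 / real n) * (\<Sum>j<n. (?e j)\<^sup>2) \<le> 2 * (R * lam powr r)\<^sup>2"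
          by (rule G3) (use w in \<open>simp add: G_def\<close>)
        show "(1 / real n) * (\<Sum>j<n. (k (\<omega> j) \<bullet> u)\<^sup>2) \<le> D"
          using D0(2) by (simp add: empirical_cov_inner power2_eq_square)
      qed (auto intro!: divide_nonneg_nonneg sum_nonneg)
      also have "\<dots> = (sqrt 2 * (R * lam powr r) * sqrt D)\<^sup>2" using D0 by (simp add: power_mult_distrib)
      finally show ?thesis by (rule power2_le_imp_le) (use R D0 in simp)
    qed
    moreover have "?v \<bullet> u \<le> sqrt (8 * exp 1 + 1) * (t * (2 * b * sqrt N) / sqrt (real n)) * sqrt D"
    proof -
      have "?v \<bullet> u \<le> norm (J lam ?v) * sqrt (T u \<bullet> u + lam * (norm u)\<^sup>2)" by (rule cT.inner_le_J[OF lam])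
      also have "\<dots> \<le> (t * (2 * b * sqrt N) / sqrt (real n)) * sqrt ((8 * exp 1 + 1) * D)"
      proof (intro mult_mono real_sqrt_le_mono)
        show "norm (J lam ?v) \<le> t * (2 * b * sqrt N) / sqrt (real n)"
          by (rule G2) (use w in \<open>simp add: G_def\<close>)
        show "T u \<bullet> u + lam * (norm u)\<^sup>2 \<le> (8 * exp 1 + 1) * D"
          using low[OF w, of u] D0 by (simp add: D_def distrib_right)
      qed (use t b0 N psd_opD(3)[OF psd_op_T, of u] lam in auto)
      finally show ?thesis by (simp add: real_sqrt_mult mult_ac)
    qed
    ultimately show ?thesis unfolding split D_def[symmetric] by (simp add: distrib_right)
  qed
  show thesis by (rule that[OF Gm prob low Q])
qed

end

section \<open>Independent samples\<close>

text \<open>It suffices to test on rectangles, where the product measure is a finite product of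
  evaluations \<open>emeasure x (E i)\<close>, each measurable in \<open>x\<close>.\<close>

lemma measurable_PiM_prob_algebra:
  assumes I: "finite I"
  shows "(\<lambda>x. PiM I (\<lambda>_. x)) \<in> prob_algebra M \<rightarrow>\<^sub>M prob_algebra (PiM I (\<lambda>_. M))"
proof (rule measurable_prob_algebra_generated[OF sets_PiM Int_stable_prod_algebra prod_algebra_sets_into_space])
  fix x assume "x \<in> space (prob_algebra M)"
  then have x: "prob_space x" "sets x = sets M" by (auto simp: space_prob_algebra)
  show "prob_space (PiM I (\<lambda>_. x))" using x by (intro prob_space_PiM)
  show "sets (PiM I (\<lambda>_. x)) = sets (PiM I (\<lambda>_. M))" using x by (intro sets_PiM_cong) auto
next
  fix A assume "A \<in> prod_algebra I (\<lambda>_. M)"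
  then obtain E where E: "A = Pi\<^sub>E I E" "\<And>i. i \<in> I \<Longrightarrow> E i \<in> sets M"
    by (auto simp: prod_algebra_eq_finite[OF I])
  have "(\<lambda>x. \<Prod>i\<in>I. emeasure x (E i)) \<in> borel_measurable (prob_algebra M)"
    using E(2) by (intro borel_measurable_prod_ennreal measurable_emeasure_subprob_algebra[THEN measurable_compose[OF measurable_prob_algebraD[OF measurable_ident]], simplified comp_def id_def])
  then show "(\<lambda>x. emeasure (PiM I (\<lambda>_. x)) A) \<in> borel_measurable (prob_algebra M)"
  proof (rule measurable_cong[THEN iffD1, rotated])
    fix x assume "x \<in> space (prob_algebra M)"
    then have x: "prob_space x" "sets x = sets M" by (auto simp: space_prob_algebra)
    interpret prob_space x by (rule x)
    interpret product_sigma_finite "\<lambda>_. x" by unfold_locales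
    show "(\<Prod>i\<in>I. emeasure x (E i)) = emeasure (PiM I (\<lambda>_. x)) A"
      using emeasure_PiM[OF I, of E] E x by simp
  qed
qed

lemma (in prob_space) second_moment_sum_iid:
  fixes X :: "'a \<Rightarrow> 'h::{real_inner,banach,second_countable_topology}"
  assumes [measurable]: "X \<in> borel_measurable M"
    and B: "\<And>x. x \<in> space M \<Longrightarrow> norm (X x) \<le> B" and mean: "\<And>u. (\<integral>x. X x \<bullet> u \<partial>M) = 0"
    and var: "(\<integral>x. (norm (X x))\<^sup>2 \<partial>M) \<le> s"
  shows "integrable (PiM {..<n} (\<lambda>_. M)) (\<lambda>\<omega>. (norm (\<Sum>j<n. X (\<omega> j)))\<^sup>2)"
    and "(\<integral>\<omega>. (norm (\<Sum>j<n. X (\<omega> j)))\<^sup>2 \<partial>PiM {..<n} (\<lambda>_. M)) \<le> real n * s"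
proof -
  note M_space = prob_space and M_bound = integrable_const_bound
  interpret product_prob_space "\<lambda>_. M" "UNIV :: nat set" by unfold_locales
  let ?Q = "\<lambda>n::nat. PiM {..<n} (\<lambda>_. M)"
  let ?f = "\<lambda>n \<omega>. (norm (\<Sum>j<n. X (\<omega> j)))\<^sup>2"
  have norm_int: "integrable M (\<lambda>x. (norm (X x))\<^sup>2)"
    by (rule M_bound[where B = "B\<^sup>2"]) (auto intro!: AE_I2 power_mono B)
  have inner_int: "integrable M (\<lambda>x. X x \<bullet> u)" for u
  proof (rule M_bound[where B = "B * norm u"])
    show "AE x in M. norm (X x \<bullet> u) \<le> B * norm u"
      by (rule AE_I2) (auto intro!: order_trans[OF Cauchy_Schwarz_ineq2] mult_right_mono B)
  qed simp
  have int: "integrable (?Q n) (?f n)" for n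
  proof -
    interpret Q: prob_space "?Q n" by (intro prob_space_PiM) unfold_locales
    show ?thesis
    proof (rule Q.integrable_const_bound[where B = "(\<Sum>j<n. B)\<^sup>2"])
      show "AE \<omega> in ?Q n. norm (?f n \<omega>) \<le> (\<Sum>j<n. B)\<^sup>2"
      proof (rule AE_I2)
        fix \<omega> assume "\<omega> \<in> space (?Q n)"
        then have "norm (\<Sum>j<n. X (\<omega> j)) \<le> (\<Sum>j<n. B)"
          by (intro sum_norm_le B) (auto simp: space_PiM)
        from power_mono[OF this, of 2] show "norm (?f n \<omega>) \<le> (\<Sum>j<n. B)\<^sup>2" by simp
      qed
    qed measurable
  qed
  show "integrable (?Q n) (?f n)" by (rule int)
  show "(\<integral>\<omega>. ?f n \<omega> \<partial>?Q n) \<le> real n * s"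
  proof (induction n)
    case 0
    show ?case by simp
  next
    case (Suc n)
    interpret Q: prob_space "?Q n" by (intro prob_space_PiM) unfold_locales
    have "(\<integral>\<omega>. ?f (Suc n) \<omega> \<partial>?Q (Suc n)) = (\<integral>\<omega>. (\<integral>y. ?f (Suc n) (fun_upd \<omega> n y) \<partial>M) \<partial>?Q n)"
      using int[of "Suc n"] unfolding lessThan_Suc by (subst product_integral_insert) auto
    also have "\<dots> = (\<integral>\<omega>. ?f n \<omega> + (\<integral>y. (norm (X y))\<^sup>2 \<partial>M) \<partial>?Q n)"
    proof (rule Bochner_Integration.integral_cong[OF refl])
      fix \<omega>
      let ?S = "\<Sum>j<n. X (\<omega> j)"
      have "(\<integral>y. ?f (Suc n) (fun_upd \<omega> n y) \<partial>M) = (\<integral>y. ?f n \<omega> + 2 * (X y \<bullet> ?S) + (norm (X y))\<^sup>2 \<partial>M)"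
        by (simp add: power2_norm_eq_inner inner_add_left inner_add_right inner_commute algebra_simps)
      also have "\<dots> = ?f n \<omega> + (\<integral>y. (norm (X y))\<^sup>2 \<partial>M)"
        using norm_int inner_int[of ?S] by (simp add: mean M_space)
      finally show "(\<integral>y. ?f (Suc n) (fun_upd \<omega> n y) \<partial>M) = ?f n \<omega> + (\<integral>y. (norm (X y))\<^sup>2 \<partial>M)" .
    qed
    also have "\<dots> = (\<integral>\<omega>. ?f n \<omega> \<partial>?Q n) + (\<integral>y. (norm (X y))\<^sup>2 \<partial>M)"
      using int[of n] Q.prob_space by simp
    also have "\<dots> \<le> real n * s + s" using Suc var by simp
    finally show ?case by (simp add: algebra_simps)
  qed
qed

locale bounded_feature_map =
  fixes \<Phi> :: "'x::topological_space \<Rightarrow> 'g::{real_inner,banach,second_countable_topology}" and \<gamma> :: real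
  assumes Phi_measurable [measurable]: "\<Phi> \<in> borel_measurable borel" and Phi_bound: "\<And>s. (norm (\<Phi> s))\<^sup>2 \<le> \<gamma>\<^sup>2"
begin

lemma norm_Phi: "norm (\<Phi> s) \<le> \<bar>\<gamma>\<bar>"
  using Phi_bound[of s] by (simp add: abs_le_square_iff[symmetric])

lemma mean_embedding_measurable: "mean_embedding \<Phi> \<in> prob_algebra borel \<rightarrow>\<^sub>M borel"
  unfolding mean_embedding_def[abs_def] prob_algebra_def
  by (intro measurable_restrict_space1) measurable

lemma mean_embedding_in: "x \<in> space (prob_algebra borel) \<Longrightarrow> mean_embedding \<Phi> x \<in> mean_embeddings \<Phi>"
  by (auto simp: mean_embeddings_def space_prob_algebra)

text \<open>The empirical mean is the mean embedding of the empirical distribution, taken as the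
  image of the uniform law on indices so that repeated points count with multiplicity. Hence it lies
  in the set on which \<open>K\<close> and its Hoelder bound are given.\<close>

lemma empirical_mean_in:
  fixes s :: "nat \<Rightarrow> 'x"
  assumes "0 < N"
  shows "(1 / real N) *\<^sub>R (\<Sum>i<N. \<Phi> (s i)) \<in> mean_embeddings \<Phi>"
proof -
  define p where "p = measure_pmf (pmf_of_set {..<N})"
  define \<nu> where "\<nu> = distr p borel s"
  have ne: "{..<N} \<noteq> {}" using assms by auto
  have sm [measurable]: "s \<in> p \<rightarrow>\<^sub>M borel" by (simp add: p_def)
  have "prob_space \<nu>" unfolding \<nu>_def p_def by (intro prob_space.prob_space_distr) (simp_all add: measure_pmf.prob_space_axioms)
  moreover have "sets \<nu> = sets borel" by (simp add: \<nu>_def)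
  moreover have "mean_embedding \<Phi> \<nu> = (1 / real N) *\<^sub>R (\<Sum>i<N. \<Phi> (s i))"
  proof -
    have "mean_embedding \<Phi> \<nu> = (\<integral>i. \<Phi> (s i) \<partial>p)"
      unfolding mean_embedding_def \<nu>_def by (subst integral_distr) measurable
    also have "\<dots> = (\<Sum>i<N. pmf (pmf_of_set {..<N}) i *\<^sub>R \<Phi> (s i))"
      unfolding p_def using ne by (intro integral_measure_pmf) (auto simp: set_pmf_of_set)
    also have "\<dots> = (1 / real N) *\<^sub>R (\<Sum>i<N. \<Phi> (s i))"
      using ne by (simp add: pmf_of_set scaleR_sum_right)
    finally show ?thesis .
  qed
  ultimately show ?thesis unfolding mean_embeddings_def by (metis (mono_tags, lifting) image_eqI mem_Collect_eq)
qed

lemma empirical_mean_error: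
  assumes x: "x \<in> space (prob_algebra borel)" and N: "0 < N"
  shows "(\<integral>s. (norm ((1 / real N) *\<^sub>R (\<Sum>i<N. \<Phi> (s i)) - mean_embedding \<Phi> x))\<^sup>2 \<partial>PiM {..<N} (\<lambda>_. x)) \<le> \<gamma>\<^sup>2 / real N"
    and "integrable (PiM {..<N} (\<lambda>_. x)) (\<lambda>s. (norm ((1 / real N) *\<^sub>R (\<Sum>i<N. \<Phi> (s i)) - mean_embedding \<Phi> x))\<^sup>2)"
proof -
  interpret prob_space x using x by (simp add: space_prob_algebra)
  have [measurable_cong]: "sets x = sets borel" using x by (simp add: space_prob_algebra)
  let ?m = "mean_embedding \<Phi> x"
  define X where "X s = \<Phi> s - ?m" for s
  have int: "integrable x \<Phi>"
    by (rule integrable_const_bound[where B = "\<bar>\<gamma>\<bar>"]) (auto intro!: AE_I2 norm_Phi)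
  have int2: "integrable x (\<lambda>s. (norm (\<Phi> s))\<^sup>2)"
    by (rule integrable_const_bound[where B = "\<gamma>\<^sup>2"]) (auto intro!: AE_I2 Phi_bound)
  have inner: "(\<integral>s. \<Phi> s \<bullet> u \<partial>x) = ?m \<bullet> u" for u
    unfolding mean_embedding_def by (rule integral_inner_left) (use int in auto)
  have Xm: "X \<in> borel_measurable x" unfolding X_def[abs_def] by measurable
  have XB: "norm (X s) \<le> \<bar>\<gamma>\<bar> + norm ?m" for s
    unfolding X_def using norm_triangle_ineq4[of "\<Phi> s" ?m] norm_Phi[of s] by linarith
  have inner_int: "integrable x (\<lambda>s. \<Phi> s \<bullet> u)" for u using int by simp
  have mean: "(\<integral>s. X s \<bullet> u \<partial>x) = 0" for u
    using inner_int[of u] by (simp add: X_def inner_diff_left inner prob_space)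
  have var: "(\<integral>s. (norm (X s))\<^sup>2 \<partial>x) \<le> \<gamma>\<^sup>2"
  proof -
    have "(\<integral>s. (norm (X s))\<^sup>2 \<partial>x) = (\<integral>s. (norm (\<Phi> s))\<^sup>2 - 2 * (\<Phi> s \<bullet> ?m) + (norm ?m)\<^sup>2 \<partial>x)"
      by (intro Bochner_Integration.integral_cong)
        (auto simp: X_def power2_norm_eq_inner inner_diff_left inner_diff_right inner_commute)
    also have "\<dots> = (\<integral>s. (norm (\<Phi> s))\<^sup>2 \<partial>x) - (norm ?m)\<^sup>2"
      using int2 inner_int[of ?m] by (simp add: inner prob_space power2_norm_eq_inner)
    also have "\<dots> \<le> (\<integral>s. \<gamma>\<^sup>2 \<partial>x)"
    proof -
      have "(\<integral>s. (norm (\<Phi> s))\<^sup>2 \<partial>x) \<le> (\<integral>s. \<gamma>\<^sup>2 \<partial>x)" by (intro integral_mono int2 Phi_bound) simp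
      then show ?thesis using zero_le_power2[of "norm ?m"] by linarith
    qed
    finally show ?thesis by (simp add: prob_space)
  qed
  have eq: "(norm ((1 / real N) *\<^sub>R (\<Sum>i<N. \<Phi> (s i)) - ?m))\<^sup>2 = (norm (\<Sum>i<N. X (s i)))\<^sup>2 / (real N)\<^sup>2" for s
  proof -
    have "(1 / real N) *\<^sub>R (\<Sum>i<N. \<Phi> (s i)) - ?m = (1 / real N) *\<^sub>R (\<Sum>i<N. X (s i))"
      using N by (simp add: X_def sum_subtractf scaleR_diff_right sum_constant_scaleR)
    then show ?thesis by (simp add: power_divide)
  qed
  note E = second_moment_sum_iid[OF Xm XB mean var, of N]
  show "integrable (PiM {..<N} (\<lambda>_. x)) (\<lambda>s. (norm ((1 / real N) *\<^sub>R (\<Sum>i<N. \<Phi> (s i)) - ?m))\<^sup>2)"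
    unfolding eq using E(1) by simp
  have "(\<integral>s. (norm (\<Sum>i<N. X (s i)))\<^sup>2 / (real N)\<^sup>2 \<partial>PiM {..<N} (\<lambda>_. x)) \<le> real N * \<gamma>\<^sup>2 / (real N)\<^sup>2"
    using E(2) by (simp add: divide_right_mono)
  also have "\<dots> = \<gamma>\<^sup>2 / real N" using N by (simp add: power2_eq_square)
  finally show "(\<integral>s. (norm ((1 / real N) *\<^sub>R (\<Sum>i<N. \<Phi> (s i)) - ?m))\<^sup>2 \<partial>PiM {..<N} (\<lambda>_. x)) \<le> \<gamma>\<^sup>2 / real N"
    unfolding eq .
qed

end

text \<open>Concavity of the power, with the tangent at \<open>c\<close> written out. Taking
  expectations with \<open>c\<close> the bound on the mean of \<open>z\<close> gives Jensen's
  inequality in the form needed.\<close>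

lemma powr_le_tangent:
  fixes a c z :: real
  assumes "0 < a" "a \<le> 1" "0 < c" "0 \<le> z"
  shows "z powr a \<le> (1 - a) * c powr a + a * (c powr a / c) * z"
proof (cases "z = 0")
  case False
  have "z powr a * c powr (1 - a) \<le> a * z + (1 - a) * c"
    using assms False by (intro Youngs_inequality_0) auto
  then have "z powr a \<le> (a * z + (1 - a) * c) / c powr (1 - a)" using assms by (simp add: pos_le_divide_eq)
  also have "\<dots> = (a * z + (1 - a) * c) * (c powr a / c)" using assms by (simp add: powr_diff)
  also have "\<dots> = (1 - a) * c powr a + a * (c powr a / c) * z"
    using assms by (simp add: algebra_simps add_divide_distrib)
  finally show ?thesis .
qed (use assms in simp)

section \<open>Two-stage sampling\<close>

locale two_stage_sampling = prob_space \<tau>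
  for \<tau> :: "('x::topological_space measure \<times> real) measure" +
  fixes Y :: "real set" and N :: nat
  assumes sets_tau [measurable_cong]: "sets \<tau> = sets (prob_algebra borel \<Otimes>\<^sub>M restrict_space borel Y)"
begin

abbreviation "\<Lambda> \<equiv> two_stage_law \<tau> N"

text \<open>The inner kernel of \<open>two_stage_law\<close>, named so that the law becomes the
  \<open>bind\<close> of a measurable probability kernel.\<close>

definition draws :: "('x measure \<times> real) \<Rightarrow> (('x measure \<times> real) \<times> (nat \<Rightarrow> 'x)) measure" where
  "draws z = distr (PiM {..<N} (\<lambda>_. fst z)) (\<tau> \<Otimes>\<^sub>M PiM {..<N} (\<lambda>_. borel)) (\<lambda>s. (z, s))"

lemma draws_measurable: "draws \<in> \<tau> \<rightarrow>\<^sub>M prob_algebra (\<tau> \<Otimes>\<^sub>M PiM {..<N} (\<lambda>_. borel))"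
  unfolding draws_def
proof (rule measurable_distr_prob_space2)
  have "fst \<in> \<tau> \<rightarrow>\<^sub>M prob_algebra borel" by measurable
  then show "(\<lambda>z. PiM {..<N} (\<lambda>_. fst z)) \<in> \<tau> \<rightarrow>\<^sub>M prob_algebra (PiM {..<N} (\<lambda>_. borel))"
    by (rule measurable_compose) (rule measurable_PiM_prob_algebra, simp)
qed (simp add: case_prod_beta')

lemma law_eq: "\<Lambda> = \<tau> \<bind> draws"
  by (simp add: two_stage_law_def draws_def[abs_def] case_prod_beta')

lemma sets_law [measurable_cong]: "sets \<Lambda> = sets (\<tau> \<Otimes>\<^sub>M PiM {..<N} (\<lambda>_. borel))"
  unfolding law_eq by (rule sets_bind_measurable[OF measurable_prob_algebraD[OF draws_measurable] not_empty])

lemma prob_space_law: "prob_space \<Lambda>"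
  unfolding law_eq
  by (rule prob_space_bind'[OF _ draws_measurable]) (simp add: space_prob_algebra prob_space_axioms)

lemma fst_tau: "z \<in> space \<tau> \<Longrightarrow> fst z \<in> space (prob_algebra borel)"
  using sets_eq_imp_space_eq[OF sets_tau] by (auto simp: space_pair_measure)

lemma nn_integral_law:
  assumes f: "f \<in> borel_measurable (\<tau> \<Otimes>\<^sub>M PiM {..<N} (\<lambda>_. borel))"
  shows "(\<integral>\<^sup>+w. f w \<partial>\<Lambda>) = (\<integral>\<^sup>+z. (\<integral>\<^sup>+s. f (z, s) \<partial>PiM {..<N} (\<lambda>_. fst z)) \<partial>\<tau>)"
proof -
  have "(\<integral>\<^sup>+w. f w \<partial>\<Lambda>) = (\<integral>\<^sup>+z. (\<integral>\<^sup>+w. f w \<partial>draws z) \<partial>\<tau>)"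
    unfolding law_eq by (rule nn_integral_bind[OF f measurable_prob_algebraD[OF draws_measurable]])
  also have "\<dots> = (\<integral>\<^sup>+z. (\<integral>\<^sup>+s. f (z, s) \<partial>PiM {..<N} (\<lambda>_. fst z)) \<partial>\<tau>)"
  proof (rule nn_integral_cong)
    fix z assume z: "z \<in> space \<tau>"
    have "sets (fst z) = sets borel" using fst_tau[OF z] by (simp add: space_prob_algebra)
    then have "sets (PiM {..<N} (\<lambda>_. fst z)) = sets (PiM {..<N} (\<lambda>_. borel))" by (intro sets_PiM_cong) auto
    then have "(\<lambda>s. (z, s)) \<in> PiM {..<N} (\<lambda>_. fst z) \<rightarrow>\<^sub>M \<tau> \<Otimes>\<^sub>M PiM {..<N} (\<lambda>_. borel)"
      using measurable_Pair1'[OF z] by (simp cong: measurable_cong_sets)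
    then show "(\<integral>\<^sup>+w. f w \<partial>draws z) = (\<integral>\<^sup>+s. f (z, s) \<partial>PiM {..<N} (\<lambda>_. fst z))"
      unfolding draws_def by (rule nn_integral_distr) (use f in simp)
  qed
  finally show ?thesis .
qed

lemma distr_law_fst: "distr \<Lambda> \<tau> fst = \<tau>"
proof (rule measure_eqI)
  fix A assume "A \<in> sets (distr \<Lambda> \<tau> fst)"
  then have A [measurable]: "A \<in> sets \<tau>" by simp
  have m: "fst \<in> \<Lambda> \<rightarrow>\<^sub>M \<tau>" by measurable
  have "emeasure (distr \<Lambda> \<tau> fst) A = (\<integral>\<^sup>+z. indicator A z \<partial>distr \<Lambda> \<tau> fst)" by simp
  also have "\<dots> = (\<integral>\<^sup>+w. indicator A (fst w) \<partial>\<Lambda>)" by (rule nn_integral_distr[OF m]) simp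
  also have "\<dots> = (\<integral>\<^sup>+z. (\<integral>\<^sup>+s. indicator A z \<partial>PiM {..<N} (\<lambda>_. fst z)) \<partial>\<tau>)"
    by (subst nn_integral_law) auto
  also have "\<dots> = (\<integral>\<^sup>+z. indicator A z \<partial>\<tau>)"
  proof (rule nn_integral_cong)
    fix z assume "z \<in> space \<tau>"
    then have "prob_space (PiM {..<N} (\<lambda>_. fst z))"
      using fst_tau by (intro prob_space_PiM) (auto simp: space_prob_algebra)
    then show "(\<integral>\<^sup>+s. indicator A z \<partial>PiM {..<N} (\<lambda>_. fst z)) = indicator A z"
      by (simp add: prob_space.emeasure_space_1)
  qed
  finally show "emeasure (distr \<Lambda> \<tau> fst) A = emeasure \<tau> A" by simp
qed simp

text \<open>\<open>g\<close> depends on the first stage only and leaves the inner integral over the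
  draws as a factor.\<close>

lemma nn_integral_law_mult_le:
  assumes g [measurable]: "g \<in> borel_measurable \<tau>" and f [measurable]: "f \<in> borel_measurable (\<tau> \<Otimes>\<^sub>M PiM {..<N} (\<lambda>_. borel))"
    and le: "\<And>z. z \<in> space \<tau> \<Longrightarrow> (\<integral>\<^sup>+s. f (z, s) \<partial>PiM {..<N} (\<lambda>_. fst z)) \<le> b"
  shows "(\<integral>\<^sup>+w. g (fst w) * f w \<partial>\<Lambda>) \<le> b * (\<integral>\<^sup>+w. g (fst w) \<partial>\<Lambda>)"
proof -
  have "(\<integral>\<^sup>+w. g (fst w) * f w \<partial>\<Lambda>) = (\<integral>\<^sup>+z. (\<integral>\<^sup>+s. g z * f (z, s) \<partial>PiM {..<N} (\<lambda>_. fst z)) \<partial>\<tau>)"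
    by (subst nn_integral_law) auto
  also have "\<dots> \<le> (\<integral>\<^sup>+z. b * g z \<partial>\<tau>)"
  proof (rule nn_integral_mono)
    fix z assume z: "z \<in> space \<tau>"
    have "sets (fst z) = sets borel" using fst_tau[OF z] by (simp add: space_prob_algebra)
    then have s [measurable_cong]: "sets (PiM {..<N} (\<lambda>_. fst z)) = sets (PiM {..<N} (\<lambda>_. borel))" by (intro sets_PiM_cong) auto
    have "(\<lambda>s. f (z, s)) \<in> borel_measurable (PiM {..<N} (\<lambda>_. borel))"
      by (rule measurable_compose[OF measurable_Pair1'[OF z] f])
    then have "(\<integral>\<^sup>+s. g z * f (z, s) \<partial>PiM {..<N} (\<lambda>_. fst z)) = g z * (\<integral>\<^sup>+s. f (z, s) \<partial>PiM {..<N} (\<lambda>_. fst z))"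
      by (intro nn_integral_cmult) (simp cong: measurable_cong_sets add: s)
    also have "\<dots> \<le> g z * b" by (intro mult_left_mono le z) simp
    finally show "(\<integral>\<^sup>+s. g z * f (z, s) \<partial>PiM {..<N} (\<lambda>_. fst z)) \<le> b * g z" by (simp add: mult.commute)
  qed
  also have "\<dots> = b * (\<integral>\<^sup>+z. g z \<partial>\<tau>)" by (rule nn_integral_cmult) simp
  also have "(\<integral>\<^sup>+z. g z \<partial>\<tau>) = (\<integral>\<^sup>+z. g z \<partial>distr \<Lambda> \<tau> fst)" by (simp only: distr_law_fst)
  also have "\<dots> = (\<integral>\<^sup>+w. g (fst w) \<partial>\<Lambda>)" by (subst nn_integral_distr) auto
  finally show ?thesis .
qed

text \<open>The second-stage draws at index \<open>j\<close> integrate out even in the presence of an arbitrary function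
  of all first-stage data: fix the other indices and disintegrate the law at \<open>j\<close>.\<close>

lemma nn_integral_sample_mult_le:
  assumes j: "j < n"
    and g [measurable]: "g \<in> borel_measurable (PiM {..<n} (\<lambda>_. \<tau>))"
    and f [measurable]: "f \<in> borel_measurable (\<tau> \<Otimes>\<^sub>M PiM {..<N} (\<lambda>_. borel))"
    and le: "\<And>z. z \<in> space \<tau> \<Longrightarrow> (\<integral>\<^sup>+s. f (z, s) \<partial>PiM {..<N} (\<lambda>_. fst z)) \<le> b"
  shows "(\<integral>\<^sup>+\<omega>. g (\<lambda>i\<in>{..<n}. fst (\<omega> i)) * f (\<omega> j) \<partial>two_stage_sample \<tau> n N)
    \<le> b * (\<integral>\<^sup>+\<omega>. g (\<lambda>i\<in>{..<n}. fst (\<omega> i)) \<partial>two_stage_sample \<tau> n N)"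
proof -
  interpret L: prob_space \<Lambda> by (rule prob_space_law)
  interpret product_prob_space "\<lambda>_. \<Lambda>" "UNIV :: nat set" by unfold_locales
  let ?J = "{..<n} - {j}"
  let ?h = "\<lambda>\<omega>. (\<lambda>i\<in>{..<n}. fst (\<omega> i))"
  have ins: "insert j ?J = {..<n}" using j by auto
  have hm [measurable]: "?h \<in> PiM {..<n} (\<lambda>_. \<Lambda>) \<rightarrow>\<^sub>M PiM {..<n} (\<lambda>_. \<tau>)"
    by (rule measurable_restrict) measurable
  have gm: "(\<lambda>\<omega>. g (?h \<omega>)) \<in> borel_measurable (PiM {..<n} (\<lambda>_. \<Lambda>))" by measurable
  have "f \<in> borel_measurable \<Lambda>" using f by (simp cong: measurable_cong_sets add: sets_law)
  then have fm [measurable]: "(\<lambda>\<omega>. f (\<omega> j)) \<in> borel_measurable (PiM {..<n} (\<lambda>_. \<Lambda>))"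
    using j by (intro measurable_compose[OF measurable_component_singleton]) auto
  have gf: "(\<lambda>\<omega>. g (?h \<omega>) * f (\<omega> j)) \<in> borel_measurable (PiM (insert j ?J) (\<lambda>_. \<Lambda>))"
    unfolding ins by measurable
  have gm': "(\<lambda>\<omega>. g (?h \<omega>)) \<in> borel_measurable (PiM (insert j ?J) (\<lambda>_. \<Lambda>))"
    unfolding ins by (rule gm)
  have upd: "(\<lambda>(x, y). fun_upd x j y) \<in> PiM ?J (\<lambda>_. \<Lambda>) \<Otimes>\<^sub>M \<Lambda> \<rightarrow>\<^sub>M PiM (insert j ?J) (\<lambda>_. \<Lambda>)"
    unfolding case_prod_beta' by (rule measurable_fun_upd[where J = ?J]) auto
  have "(\<integral>\<^sup>+\<omega>. g (?h \<omega>) * f (\<omega> j) \<partial>PiM {..<n} (\<lambda>_. \<Lambda>))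
      = (\<integral>\<^sup>+x. (\<integral>\<^sup>+y. g (?h (fun_upd x j y)) * f y \<partial>\<Lambda>) \<partial>PiM ?J (\<lambda>_. \<Lambda>))"
    using product_nn_integral_insert[OF _ _ gf] unfolding ins by simp
  also have "\<dots> \<le> (\<integral>\<^sup>+x. b * (\<integral>\<^sup>+y. g (?h (fun_upd x j y)) \<partial>\<Lambda>) \<partial>PiM ?J (\<lambda>_. \<Lambda>))"
  proof (rule nn_integral_mono)
    fix x assume x: "x \<in> space (PiM ?J (\<lambda>_. \<Lambda>))"
    \<comment> \<open>With the other indices frozen in \<open>x\<close>, the first-stage factor is a
      function of the pair at index \<open>j\<close> alone.\<close>
    define G where "G z = g (\<lambda>i\<in>{..<n}. if i = j then z else fst (x i))" for z
    have "(\<lambda>z. \<lambda>i\<in>{..<n}. if i = j then z else fst (x i)) \<in> \<tau> \<rightarrow>\<^sub>M PiM {..<n} (\<lambda>_. \<tau>)"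
    proof (rule measurable_restrict)
      fix i assume i: "i \<in> {..<n}"
      show "(\<lambda>z. if i = j then z else fst (x i)) \<in> \<tau> \<rightarrow>\<^sub>M \<tau>"
      proof (cases "i = j")
        case False
        then have "x i \<in> space \<Lambda>" using x i by (auto simp: space_PiM)
        then have "fst (x i) \<in> space \<tau>"
          using sets_eq_imp_space_eq[OF sets_law] by (auto simp: space_pair_measure)
        then show ?thesis using False by simp
      qed simp
    qed
    then have Gm: "G \<in> borel_measurable \<tau>" unfolding G_def[abs_def] by (rule measurable_compose[OF _ g])
    have eq: "g (?h (fun_upd x j y)) = G (fst y)" for y
      unfolding G_def by (rule arg_cong[where f = g]) (auto simp: restrict_def)
    show "(\<integral>\<^sup>+y. g (?h (fun_upd x j y)) * f y \<partial>\<Lambda>) \<le> b * (\<integral>\<^sup>+y. g (?h (fun_upd x j y)) \<partial>\<Lambda>)"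
      unfolding eq by (rule nn_integral_law_mult_le[OF Gm f le])
  qed
  also have "\<dots> = b * (\<integral>\<^sup>+x. (\<integral>\<^sup>+y. g (?h (fun_upd x j y)) \<partial>\<Lambda>) \<partial>PiM ?J (\<lambda>_. \<Lambda>))"
  proof (rule nn_integral_cmult)
    have "(\<lambda>(x, y). g (?h (fun_upd x j y))) \<in> borel_measurable (PiM ?J (\<lambda>_. \<Lambda>) \<Otimes>\<^sub>M \<Lambda>)"
      using measurable_compose[OF upd gm'] by (simp add: case_prod_beta')
    then show "(\<lambda>x. \<integral>\<^sup>+y. g (?h (fun_upd x j y)) \<partial>\<Lambda>) \<in> borel_measurable (PiM ?J (\<lambda>_. \<Lambda>))"
      by (rule L.borel_measurable_nn_integral)
  qed
  also have "(\<integral>\<^sup>+x. (\<integral>\<^sup>+y. g (?h (fun_upd x j y)) \<partial>\<Lambda>) \<partial>PiM ?J (\<lambda>_. \<Lambda>)) = (\<integral>\<^sup>+\<omega>. g (?h \<omega>) \<partial>PiM {..<n} (\<lambda>_. \<Lambda>))"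
    using product_nn_integral_insert[OF _ _ gm'] unfolding ins by simp
  finally show ?thesis unfolding two_stage_sample_def .
qed

end

section \<open>Square integrable functions and conditional laws\<close>

lemma integrable_mult_square_integrable:
  assumes "f \<in> square_integrable_funs M" "g \<in> square_integrable_funs M"
  shows "integrable M (\<lambda>x. f x * g x)"
proof (rule Bochner_Integration.integrable_bound)
  show "integrable M (\<lambda>x. (f x)\<^sup>2 + (g x)\<^sup>2)" using assms by (auto simp: square_integrable_funs_def)
  show "(\<lambda>x. f x * g x) \<in> borel_measurable M" using assms by (auto simp: square_integrable_funs_def)
  have "\<bar>f x * g x\<bar> \<le> (f x)\<^sup>2 + (g x)\<^sup>2" for x
    using sum_squares_bound[of "\<bar>f x\<bar>" "\<bar>g x\<bar>"] mult_nonneg_nonneg[OF abs_ge_zero[of "f x"] abs_ge_zero[of "g x"]]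
    unfolding abs_mult power2_abs by linarith
  then show "AE x in M. norm (f x * g x) \<le> norm ((f x)\<^sup>2 + (g x)\<^sup>2)" by (intro AE_I2) simp
qed

lemma square_integrable_funs_add:
  assumes "f \<in> square_integrable_funs M" "g \<in> square_integrable_funs M"
  shows "(\<lambda>x. f x + c * g x) \<in> square_integrable_funs M"
proof -
  have "integrable M (\<lambda>x. (f x)\<^sup>2 + 2 * c * (f x * g x) + c\<^sup>2 * (g x)\<^sup>2)"
    using assms integrable_mult_square_integrable[OF assms] by (auto simp: square_integrable_funs_def)
  moreover have "(f x)\<^sup>2 + 2 * c * (f x * g x) + c\<^sup>2 * (g x)\<^sup>2 = (f x + c * g x)\<^sup>2" for x
    by (simp add: power2_eq_square algebra_simps)
  ultimately show ?thesis using assms by (auto simp: square_integrable_funs_def)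
qed

lemma is_L2_inner:
  assumes "is_L2 M cls" "f \<in> square_integrable_funs M" "g \<in> square_integrable_funs M"
  shows "cls f \<bullet> cls g = (\<integral>x. f x * g x \<partial>M)"
  using assms by (auto simp: is_L2_def)

text \<open>The difference of the two sides is orthogonal to every class, and by surjectivity of
  \<open>cls\<close> it is itself a class, hence 0.\<close>

lemma is_L2_linear:
  assumes L2: "is_L2 M cls" and f: "f \<in> square_integrable_funs M" and g: "g \<in> square_integrable_funs M"
  shows "cls (\<lambda>x. f x + c * g x) = cls f + c *\<^sub>R cls g"
proof -
  let ?h = "\<lambda>x. f x + c * g x"
  have h: "?h \<in> square_integrable_funs M" by (rule square_integrable_funs_add[OF f g])
  have eq: "(cls ?h - (cls f + c *\<^sub>R cls g)) \<bullet> cls u = 0" if u: "u \<in> square_integrable_funs M" for u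
  proof -
    have "(\<integral>x. ?h x * u x \<partial>M) = (\<integral>x. f x * u x \<partial>M) + c * (\<integral>x. g x * u x \<partial>M)"
      using integrable_mult_square_integrable[OF f u] integrable_mult_square_integrable[OF g u]
      by (simp add: distrib_right mult.assoc)
    then show ?thesis
      by (simp add: inner_diff_left inner_add_left is_L2_inner[OF L2 h u] is_L2_inner[OF L2 f u] is_L2_inner[OF L2 g u])
  qed
  have "cls ` square_integrable_funs M = UNIV" using L2 by (simp only: is_L2_def)
  then have "cls ?h - (cls f + c *\<^sub>R cls g) \<in> cls ` square_integrable_funs M" by (simp only: UNIV_I)
  then obtain u where u: "u \<in> square_integrable_funs M" "cls u = cls ?h - (cls f + c *\<^sub>R cls g)"
    by (rule imageE) simp
  show ?thesis using eq[OF u(1)] unfolding u(2) by simp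
qed

lemma is_L2_dist:
  assumes L2: "is_L2 M cls" and f: "f \<in> square_integrable_funs M" and g: "g \<in> square_integrable_funs M"
  shows "(norm (cls f - cls g))\<^sup>2 = (\<integral>x. (f x - g x)\<^sup>2 \<partial>M)"
proof -
  have "(norm (cls f - cls g))\<^sup>2 = cls (\<lambda>x. f x + (- 1) * g x) \<bullet> cls (\<lambda>x. f x + (- 1) * g x)"
    unfolding is_L2_linear[OF L2 f g] by (simp add: power2_norm_eq_inner)
  also have "\<dots> = (\<integral>x. (f x - g x)\<^sup>2 \<partial>M)"
    using is_L2_inner[OF L2 square_integrable_funs_add[OF f g, of "- 1"] square_integrable_funs_add[OF f g, of "- 1"]]
    by (simp add: power2_eq_square)
  finally show ?thesis .
qed

lemma (in prob_space) bounded_square_integrable: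
  assumes "f \<in> borel_measurable M" "\<And>x. x \<in> space M \<Longrightarrow> \<bar>f x\<bar> \<le> b"
  shows "f \<in> square_integrable_funs M"
  unfolding square_integrable_funs_def
proof (intro CollectI conjI assms(1))
  show "integrable M (\<lambda>x. (f x)\<^sup>2)"
  proof (rule integrable_const_bound[where B = "b\<^sup>2"])
    have "(f x)\<^sup>2 \<le> b\<^sup>2" if "x \<in> space M" for x
      using power_mono[OF assms(2)[OF that] abs_ge_zero, of 2] by simp
    then show "AE x in M. norm ((f x)\<^sup>2) \<le> b\<^sup>2" by (intro AE_I2) simp
  qed (use assms(1) in simp)
qed

text \<open>\<open>is_conditional_law\<close> prescribes \<rho> on rectangles. They generate the
  product sigma-algebra and are stable under intersection, so \<rho> is its marginal composed with
  the conditional kernel.\<close>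

lemma conditional_law_bind:
  assumes \<rho>: "prob_space \<rho>" "sets \<rho> = sets (MX \<Otimes>\<^sub>M MY)" and c: "is_conditional_law MX MY \<rho> cond"
  shows "\<rho> = distr \<rho> MX fst \<bind> (\<lambda>m. distr (cond m) (MX \<Otimes>\<^sub>M MY) (Pair m))"
    and "(\<lambda>m. distr (cond m) (MX \<Otimes>\<^sub>M MY) (Pair m)) \<in> MX \<rightarrow>\<^sub>M prob_algebra (MX \<Otimes>\<^sub>M MY)"
proof -
  interpret prob_space \<rho> by (rule \<rho>)
  note [measurable_cong] = \<rho>(2)
  let ?X = "distr \<rho> MX fst"
  let ?k = "\<lambda>m. distr (cond m) (MX \<Otimes>\<^sub>M MY) (Pair m)"
  have fst: "fst \<in> \<rho> \<rightarrow>\<^sub>M MX" by measurable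
  interpret X: prob_space ?X by (rule prob_space_distr[OF fst])
  have cm: "cond \<in> MX \<rightarrow>\<^sub>M prob_algebra MY" using c by (simp add: is_conditional_law_def)
  show km: "?k \<in> MX \<rightarrow>\<^sub>M prob_algebra (MX \<Otimes>\<^sub>M MY)"
    by (rule measurable_distr_prob_space2[OF cm]) simp
  have Xin: "?X \<in> space (prob_algebra MX)" by (simp add: space_prob_algebra X.prob_space_axioms)
  show "\<rho> = ?X \<bind> ?k"
  proof (rule measure_eqI_generator_eq[OF Int_stable_pair_measure_generator[of MX MY],
        where \<Omega> = "space MX \<times> space MY" and A = "\<lambda>_. space MX \<times> space MY"])
    show "{a \<times> b |a b. a \<in> sets MX \<and> b \<in> sets MY} \<subseteq> Pow (space MX \<times> space MY)"
      by (rule pair_measure_closed)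
    show "sets \<rho> = sigma_sets (space MX \<times> space MY) {a \<times> b |a b. a \<in> sets MX \<and> b \<in> sets MY}"
      by (simp add: \<rho>(2) sets_pair_measure)
    show "sets (?X \<bind> ?k) = sigma_sets (space MX \<times> space MY) {a \<times> b |a b. a \<in> sets MX \<and> b \<in> sets MY}"
      using sets_bind'[OF Xin km] by (simp add: sets_pair_measure)
    fix D assume "D \<in> {a \<times> b |a b. a \<in> sets MX \<and> b \<in> sets MY}"
    then obtain A B where D: "D = A \<times> B" and AB [measurable]: "A \<in> sets MX" "B \<in> sets MY" by auto
    have mB: "(\<lambda>m. measure (cond m) B) \<in> borel_measurable MX"
      using measurable_compose[OF measurable_prob_algebraD[OF cm] measurable_measure_subprob_algebra[OF AB(2)]] .
    have "emeasure (?X \<bind> ?k) D = (\<integral>\<^sup>+m. emeasure (?k m) D \<partial>?X)"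
      by (rule emeasure_bind_prob_algebra[OF Xin km]) (simp add: D)
    also have "\<dots> = (\<integral>\<^sup>+m. ennreal (indicator A m * measure (cond m) B) \<partial>?X)"
    proof (rule nn_integral_cong)
      fix m assume "m \<in> space ?X"
      then have m: "m \<in> space MX" by simp
      have cs: "cond m \<in> space (prob_algebra MY)" by (rule measurable_space[OF cm m])
      then interpret C: prob_space "cond m" by (simp add: space_prob_algebra)
      have sc [measurable_cong]: "sets (cond m) = sets MY" using cs by (simp add: space_prob_algebra)
      have "Pair m \<in> cond m \<rightarrow>\<^sub>M MX \<Otimes>\<^sub>M MY" using m by measurable
      then have "emeasure (?k m) D = emeasure (cond m) (Pair m -` D \<inter> space (cond m))"
        by (rule emeasure_distr) (simp add: D)
      also have "Pair m -` D \<inter> space (cond m) = (if m \<in> A then B else {})"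
        using sets.sets_into_space[OF AB(2)] sets_eq_imp_space_eq[OF sc] by (auto simp: D)
      finally show "emeasure (?k m) D = ennreal (indicator A m * measure (cond m) B)"
        by (simp add: C.emeasure_eq_measure)
    qed
    also have "\<dots> = ennreal (\<integral>m. indicator A m * measure (cond m) B \<partial>?X)"
    proof (rule nn_integral_eq_integral)
      show "integrable ?X (\<lambda>m. indicator A m * measure (cond m) B)"
      proof (rule X.integrable_const_bound[where B = 1])
        show "AE m in ?X. norm (indicator A m * measure (cond m) B) \<le> 1"
        proof (rule AE_I2)
          fix m assume "m \<in> space ?X"
          then have "cond m \<in> space (prob_algebra MY)" using measurable_space[OF cm, of m] by simp
          then show "norm (indicator A m * measure (cond m) B :: real) \<le> 1"
            by (auto simp: space_prob_algebra indicator_def intro: prob_space.prob_le_1)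
        qed
      qed (use mB in simp)
    qed simp
    also have "(\<integral>m. indicator A m * measure (cond m) B \<partial>?X) = measure \<rho> D"
      using c by (simp add: is_conditional_law_def D set_lebesgue_integral_def)
    finally show "emeasure \<rho> D = emeasure (?X \<bind> ?k) D" by (simp add: emeasure_eq_measure)
  qed (auto simp: emeasure_eq_measure)
qed

text \<open>The defining property of the regression function, tested against bounded functions of
  the first component. It makes the label noise orthogonal to all features.\<close>

lemma conditional_mean:
  fixes g :: "'a \<Rightarrow> real"
  assumes \<rho>: "prob_space \<rho>" "sets \<rho> = sets (MX \<Otimes>\<^sub>M restrict_space borel Y)"
    and c: "is_conditional_law MX (restrict_space borel Y) \<rho> cond"
    and Y: "\<And>y. y \<in> Y \<Longrightarrow> \<bar>y\<bar> \<le> b" and g [measurable]: "g \<in> borel_measurable MX"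
    and gb: "\<And>m. m \<in> space MX \<Longrightarrow> \<bar>g m\<bar> \<le> B"
  shows "(\<integral>z. snd z * g (fst z) \<partial>\<rho>) = (\<integral>z. (\<integral>y. y \<partial>cond (fst z)) * g (fst z) \<partial>\<rho>)"
proof -
  let ?MY = "restrict_space borel Y :: real measure"
  note bind = conditional_law_bind[OF \<rho> c]
  interpret prob_space \<rho> by (rule \<rho>)
  note [measurable_cong] = \<rho>(2)
  have cm: "cond \<in> MX \<rightarrow>\<^sub>M prob_algebra ?MY" using c by (simp add: is_conditional_law_def)
  have fst: "fst \<in> \<rho> \<rightarrow>\<^sub>M MX" by measurable
  interpret X: prob_space "distr \<rho> MX fst" by (rule prob_space_distr[OF fst])
  have ym [measurable]: "(\<lambda>y. y) \<in> borel_measurable ?MY" by (rule measurable_restrict_space1) simp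
  have fm: "(\<lambda>z. snd z * g (fst z)) \<in> borel_measurable (MX \<Otimes>\<^sub>M ?MY)" by measurable
  have mm: "(\<lambda>m. \<integral>y. y \<partial>cond m) \<in> borel_measurable MX"
    using measurable_compose[OF measurable_prob_algebraD[OF cm] integral_measurable_subprob_algebra[OF ym]] .
  have km: "(\<lambda>m. distr (cond m) (MX \<Otimes>\<^sub>M ?MY) (Pair m)) \<in> distr \<rho> MX fst \<rightarrow>\<^sub>M subprob_algebra (MX \<Otimes>\<^sub>M ?MY)"
    using measurable_prob_algebraD[OF bind(2)] by simp
  have "(\<integral>z. snd z * g (fst z) \<partial>\<rho>)
      = (\<integral>z. snd z * g (fst z) \<partial>(distr \<rho> MX fst \<bind> (\<lambda>m. distr (cond m) (MX \<Otimes>\<^sub>M ?MY) (Pair m))))"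
    by (subst bind(1)) (rule refl)
  also have "\<dots> = (\<integral>m. (\<integral>z. snd z * g (fst z) \<partial>distr (cond m) (MX \<Otimes>\<^sub>M ?MY) (Pair m)) \<partial>distr \<rho> MX fst)"
  proof (rule integral_bind[OF fm _ km, where B = "b * B" and B' = 1])
    fix z assume "z \<in> space (MX \<Otimes>\<^sub>M ?MY)"
    then have z: "fst z \<in> space MX" "snd z \<in> Y" by (auto simp: space_pair_measure space_restrict_space)
    then have "\<bar>snd z\<bar> * \<bar>g (fst z)\<bar> \<le> b * B"
      using Y[OF z(2)] gb[OF z(1)] by (intro mult_mono) auto
    then show "\<bar>snd z * g (fst z)\<bar> \<le> b * B" by (simp add: abs_mult)
  next
    show "finite_measure (distr \<rho> MX fst)" by unfold_locales
    show "AE m in distr \<rho> MX fst. emeasure (distr (cond m) (MX \<Otimes>\<^sub>M ?MY) (Pair m))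
        (space (distr (cond m) (MX \<Otimes>\<^sub>M ?MY) (Pair m))) \<le> ennreal 1"
    proof (rule AE_I2)
      fix m assume "m \<in> space (distr \<rho> MX fst)"
      then have "distr (cond m) (MX \<Otimes>\<^sub>M ?MY) (Pair m) \<in> space (prob_algebra (MX \<Otimes>\<^sub>M ?MY))"
        using measurable_space[OF bind(2), of m] by simp
      then have "prob_space (distr (cond m) (MX \<Otimes>\<^sub>M ?MY) (Pair m))" by (simp only: space_prob_algebra mem_Collect_eq)
      from prob_space.emeasure_space_1[OF this]
      show "emeasure (distr (cond m) (MX \<Otimes>\<^sub>M ?MY) (Pair m))
        (space (distr (cond m) (MX \<Otimes>\<^sub>M ?MY) (Pair m))) \<le> ennreal 1" by simp
    qed
  qed
  also have "\<dots> = (\<integral>m. (\<integral>y. y \<partial>cond m) * g m \<partial>distr \<rho> MX fst)"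
  proof (rule Bochner_Integration.integral_cong[OF refl])
    fix m assume "m \<in> space (distr \<rho> MX fst)"
    then have m: "m \<in> space MX" by simp
    have cs: "cond m \<in> space (prob_algebra ?MY)" by (rule measurable_space[OF cm m])
    have sc [measurable_cong]: "sets (cond m) = sets ?MY" using cs by (simp add: space_prob_algebra)
    have "Pair m \<in> cond m \<rightarrow>\<^sub>M MX \<Otimes>\<^sub>M ?MY" using m by measurable
    then show "(\<integral>z. snd z * g (fst z) \<partial>distr (cond m) (MX \<Otimes>\<^sub>M ?MY) (Pair m)) = (\<integral>y. y \<partial>cond m) * g m"
      by (subst integral_distr) (use fm in auto)
  qed
  also have "\<dots> = (\<integral>z. (\<integral>y. y \<partial>cond (fst z)) * g (fst z) \<partial>\<rho>)"
    by (rule integral_distr[OF fst]) (use mm g in measurable)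
  finally show ?thesis .
qed

text \<open>The part of \<open>G\<close> where the conditional expectation exceeds \<open>c\<close>
  belongs to \<open>F\<close>, so \<open>le\<close> applies to it, and integration over it shows
  that it is null.\<close>

lemma (in prob_space) prob_real_cond_exp_le:
  assumes sub: "subalgebra M F" and Z: "integrable M Z" and G: "G \<in> sets F"
    and le: "\<And>A. A \<in> sets F \<Longrightarrow> A \<subseteq> G \<Longrightarrow> (\<integral>\<omega>. indicator A \<omega> * Z \<omega> \<partial>M) \<le> c * prob A"
  shows "prob G \<le> prob {\<omega> \<in> space M. real_cond_exp M F Z \<omega> \<le> c}"
proof -
  interpret finite_measure_subalgebra M F by unfold_locales (rule sub)
  let ?E = "real_cond_exp M F Z"
  have FM: "A \<in> sets F \<Longrightarrow> A \<in> events" for A using sub by (auto simp: subalgebra_def)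
  have sp: "space F = space M" using sub by (simp add: subalgebra_def)
  have Em [measurable]: "?E \<in> borel_measurable F" by simp
  have Em': "?E \<in> borel_measurable M" using measurable_from_subalg[OF sub Em] .
  define B where "B = {\<omega> \<in> space F. c < ?E \<omega>} \<inter> G"
  have B: "B \<in> sets F" unfolding B_def using G by measurable
  have Ei: "integrable M ?E" by (rule real_cond_exp_int(1)[OF Z])
  have "(\<integral>\<omega>. indicator B \<omega> * ?E \<omega> \<partial>M) = (\<integral>\<omega>. indicator B \<omega> * Z \<omega> \<partial>M)"
    using real_cond_exp_intA[OF Z B] by (simp add: set_lebesgue_integral_def)
  also have "\<dots> \<le> c * prob B" by (rule le[OF B]) (auto simp: B_def)
  also have "c * prob B = (\<integral>\<omega>. indicator B \<omega> * c \<partial>M)"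
    using FM[OF B] by (simp add: mult.commute)
  finally have EB: "(\<integral>\<omega>. indicator B \<omega> * ?E \<omega> \<partial>M) \<le> (\<integral>\<omega>. indicator B \<omega> * c \<partial>M)" .
  have iE: "integrable M (\<lambda>\<omega>. indicator B \<omega> * ?E \<omega>)"
    using integrable_real_mult_indicator[OF FM[OF B] Ei] by (simp add: mult.commute)
  have ic: "integrable M (\<lambda>\<omega>. indicator B \<omega> * c)"
    using FM[OF B] by (intro integrable_mult_left integrable_real_indicator) (auto simp: emeasure_eq_measure)
  have "(\<integral>\<omega>. indicator B \<omega> * ?E \<omega> - indicator B \<omega> * c \<partial>M) \<le> 0"
    using Bochner_Integration.integral_diff[OF iE ic] EB by linarith
  moreover have nn: "0 \<le> indicator B \<omega> * ?E \<omega> - indicator B \<omega> * c" for \<omega>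
    by (auto simp: B_def indicator_def)
  ultimately have "(\<integral>\<omega>. indicator B \<omega> * ?E \<omega> - indicator B \<omega> * c \<partial>M) = 0"
    by (intro antisym integral_nonneg_AE) auto
  moreover have "integrable M (\<lambda>\<omega>. indicator B \<omega> * ?E \<omega> - indicator B \<omega> * c)"
    by (rule Bochner_Integration.integrable_diff[OF iE ic])
  ultimately have "AE \<omega> in M. indicator B \<omega> * ?E \<omega> - indicator B \<omega> * c = 0"
    using integral_nonneg_eq_0_iff_AE nn by blast
  then have "AE \<omega> in M. \<omega> \<notin> B" by eventually_elim (auto simp: B_def)
  then have "prob G = prob (G - B)"
    using FM[OF G] FM[OF B] by (intro measure_eq_AE) (auto elim: eventually_mono)
  also have "\<dots> \<le> prob {\<omega> \<in> space M. ?E \<omega> \<le> c}"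
    using Em' sets.sets_into_space[OF FM[OF G]] by (intro finite_measure_mono) (auto simp: B_def sp)
  finally show ?thesis .
qed

section \<open>Distribution regression\<close>

lemma one_le_ln: "3 \<le> n \<Longrightarrow> 1 \<le> ln (real n)"
proof -
  assume n: "3 \<le> n"
  then have "exp 1 \<le> real n" using e_less_272 by linarith
  then show ?thesis using n by (simp add: ln_ge_iff)
qed

text \<open>\<kappa> and \<gamma> are given through their squares and may be negative, which is why
  the general locales are entered with \<open>\<bar>\<kappa>\<bar>\<close> as the bound on the
  features.\<close>

locale distribution_regression =
  fixes G :: "'x::topological_space \<Rightarrow> 'x \<Rightarrow> real"
    and evG :: "'g::{real_inner,banach,second_countable_topology} \<Rightarrow> 'x \<Rightarrow> real"
    and \<Phi> :: "'x \<Rightarrow> 'g"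
    and P :: "'g set"
    and K :: "'g \<Rightarrow> 'g \<Rightarrow> real"
    and evK :: "'h::{real_inner,banach,second_countable_topology} \<Rightarrow> 'g \<Rightarrow> real"
    and \<Psi> :: "'g \<Rightarrow> 'h"
    and M :: real and Y :: "real set"
    and \<rho> :: "('g \<times> real) measure" and \<rho>\<mu> :: "'g measure"
    and cond :: "'g \<Rightarrow> real measure" and f\<rho> :: "'g \<Rightarrow> real"
    and cls :: "('g \<Rightarrow> real) \<Rightarrow> 'l::{real_inner,banach}"
    and SK :: "'h \<Rightarrow> 'l" and LK :: "'l \<Rightarrow> 'l"
    and \<tau> :: "('x measure \<times> real) measure"
    and \<gamma> \<kappa> \<alpha> L r R \<nu> c\<nu> :: real
    and h\<rho> :: 'l
  assumes M: "M > 0" and Y: "Y \<subseteq> {-M..M}"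
    and mercer: "mercer_kernel G" and rkhs_G: "is_rkhs UNIV G evG \<Phi>"
    and P: "P = mean_embeddings \<Phi>"
    and rkhs_K: "is_rkhs P K evK \<Psi>"
    and prob_rho: "prob_space \<rho>"
    and sets_rho [measurable_cong]: "sets \<rho> = sets (restrict_space borel P \<Otimes>\<^sub>M restrict_space borel Y)"
    and \<rho>\<mu>: "\<rho>\<mu> = distr \<rho> (restrict_space borel P) fst"
    and cond: "is_conditional_law (restrict_space borel P) (restrict_space borel Y) \<rho> cond"
    and f\<rho>: "f\<rho> = (\<lambda>m. \<integral>y. y \<partial>cond m)"
    and L2: "is_L2 \<rho>\<mu> cls"
    and SK: "SK = (\<lambda>f. cls (evK f))"
    and LK: "LK = SK \<circ> adjoint SK"
    and prob_tau: "prob_space \<tau>"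
    and sets_tau: "sets \<tau> = sets (prob_algebra borel \<Otimes>\<^sub>M restrict_space borel Y)"
    and distr_tau: "distr \<tau> (restrict_space borel P \<Otimes>\<^sub>M restrict_space borel Y)
           (\<lambda>(x, y). (mean_embedding \<Phi> x, y)) = \<rho>"
    and i_G: "bdd_above (range (\<lambda>s. G s s))" "(SUP s. G s s) = \<gamma>\<^sup>2"
    and i_K: "bdd_above ((\<lambda>m. K m m) ` P)" "(SUP m\<in>P. K m m) = \<kappa>\<^sup>2"
    and hoelder: "0 < \<alpha>" "\<alpha> \<le> 1" "L > 0"
            "\<And>m1 m2. m1 \<in> P \<Longrightarrow> m2 \<in> P \<Longrightarrow> norm (\<Psi> m1 - \<Psi> m2) \<le> L * norm (m1 - m2) powr \<alpha>"
    and source: "0 < r" "r \<le> 1 / 2" "cls f\<rho> = op_powr LK r h\<rho>" "norm h\<rho> \<le> R"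
    and capacity: "0 < \<nu>" "\<nu> \<le> 1" "\<And>lam. lam > 0 \<Longrightarrow> effective_dim LK lam \<le> c\<nu> * lam powr (-\<nu>)"
begin

section \<open>Features, inclusion operator and regression function of the model\<close>

lemma Phi_inner: "\<Phi> s \<bullet> \<Phi> t = G s t"
proof -
  have "evG (\<Phi> s) t = G s t" "evG (\<Phi> s) t = \<Phi> s \<bullet> \<Phi> t" using rkhs_G unfolding is_rkhs_def by blast+
  then show ?thesis by simp
qed

text \<open>The squared distance of two features is \<open>G u u - 2 * G u s + G s s\<close>, which
  tends to 0 as \<open>u\<close> tends to \<open>s\<close>. Continuity provides the measurability
  behind mean embeddings.\<close>

lemma Phi_continuous: "continuous_on UNIV \<Phi>"
  unfolding continuous_on_def
proof
  fix s
  have cont: "continuous_on UNIV (\<lambda>(s, t). G s t)" using mercer by (simp add: mercer_kernel_def)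
  have G: "((\<lambda>u. G (f u) (g u)) \<longlongrightarrow> G (f s) (g s)) (at s within UNIV)"
    if "continuous_on UNIV f" "continuous_on UNIV g" for f g :: "'x \<Rightarrow> 'x"
    using continuous_on_compose2[OF cont continuous_on_Pair[OF that]] by (auto simp: continuous_on_def)
  have "((\<lambda>u. G u u - 2 * G u s + G s s) \<longlongrightarrow> G s s - 2 * G s s + G s s) (at s within UNIV)"
    by (intro tendsto_intros G[where f = "\<lambda>u. u" and g = "\<lambda>u. u"] G[where f = "\<lambda>u. u" and g = "\<lambda>u. s"] continuous_intros)
  moreover have "G u u - 2 * G u s + G s s = (norm (\<Phi> u - \<Phi> s))\<^sup>2" for u
    by (simp add: power2_norm_eq_inner inner_diff_left inner_diff_right Phi_inner[symmetric] inner_commute)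
  ultimately have "((\<lambda>u. (norm (\<Phi> u - \<Phi> s))\<^sup>2) \<longlongrightarrow> 0) (at s within UNIV)" by simp
  from tendsto_real_sqrt[OF this] have "((\<lambda>u. norm (\<Phi> u - \<Phi> s)) \<longlongrightarrow> 0) (at s within UNIV)" by simp
  then have "((\<lambda>u. \<Phi> u - \<Phi> s) \<longlongrightarrow> 0) (at s within UNIV)" by (rule tendsto_norm_zero_cancel)
  then show "(\<Phi> \<longlongrightarrow> \<Phi> s) (at s within UNIV)" by (rule Lim_null[THEN iffD2])
qed

sublocale feat: bounded_feature_map \<Phi> \<gamma>
proof
  show "\<Phi> \<in> borel_measurable borel" by (rule borel_measurable_continuous_onI[OF Phi_continuous])
  fix s
  have "G s s \<le> (SUP s. G s s)" by (rule cSUP_upper[OF _ i_G(1)]) simp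
  then show "(norm (\<Phi> s))\<^sup>2 \<le> \<gamma>\<^sup>2" by (simp add: power2_norm_eq_inner Phi_inner i_G(2))
qed

lemma evK_eq: "m \<in> P \<Longrightarrow> evK f m = f \<bullet> \<Psi> m"
  using rkhs_K unfolding is_rkhs_def by blast

lemma Psi_continuous: "continuous_on P \<Psi>"
  unfolding continuous_on_def
proof
  fix m assume m: "m \<in> P"
  have 1: "((\<lambda>u. norm (u - m)) \<longlongrightarrow> norm (m - m)) (at m within P)" by (intro tendsto_intros)
  then have "((\<lambda>u. norm (u - m) powr \<alpha>) \<longlongrightarrow> 0 powr \<alpha>) (at m within P)"
    using hoelder(1) by (intro tendsto_powr') auto
  then have lim: "((\<lambda>u. L * norm (u - m) powr \<alpha>) \<longlongrightarrow> 0) (at m within P)"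
    using tendsto_mult_left[of _ "0 powr \<alpha>" _ L] by simp
  have "((\<lambda>u. \<Psi> u - \<Psi> m) \<longlongrightarrow> 0) (at m within P)"
    by (rule Lim_null_comparison[OF _ lim]) (use hoelder(4) m in \<open>auto simp: eventually_at_filter\<close>)
  then show "(\<Psi> \<longlongrightarrow> \<Psi> m) (at m within P)" by (rule Lim_null[THEN iffD2])
qed

lemma Psi_measurable [measurable]: "\<Psi> \<in> borel_measurable (restrict_space borel P)"
  by (rule borel_measurable_continuous_on_restrict[OF Psi_continuous])

lemma norm_Psi: "m \<in> P \<Longrightarrow> norm (\<Psi> m) \<le> \<bar>\<kappa>\<bar>"
proof -
  assume m: "m \<in> P"
  have "evK (\<Psi> m) m = K m m" using rkhs_K m unfolding is_rkhs_def by blast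
  then have "(norm (\<Psi> m))\<^sup>2 = K m m" by (simp add: evK_eq[OF m] power2_norm_eq_inner)
  also have "\<dots> \<le> \<kappa>\<^sup>2" using cSUP_upper[OF m i_K(1)] by (simp add: i_K(2))
  finally show ?thesis by (simp add: abs_le_square_iff[symmetric])
qed

lemma space_rho: "space \<rho> = P \<times> Y"
  using sets_eq_imp_space_eq[OF sets_rho] by (simp add: space_pair_measure space_restrict_space)

lemma fst_rho [measurable]: "fst \<in> \<rho> \<rightarrow>\<^sub>M restrict_space borel P" by measurable

lemma prob_rhomu: "prob_space \<rho>\<mu>"
  unfolding \<rho>\<mu> by (rule prob_space.prob_space_distr[OF prob_rho fst_rho])

lemma space_rhomu: "space \<rho>\<mu> = P" "sets \<rho>\<mu> = sets (restrict_space borel P)"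
  by (simp_all add: \<rho>\<mu> space_restrict_space)

lemma evK_square_integrable: "evK f \<in> square_integrable_funs \<rho>\<mu>"
proof (rule prob_space.bounded_square_integrable[OF prob_rhomu])
  have "(\<lambda>m. f \<bullet> \<Psi> m) \<in> borel_measurable \<rho>\<mu>"
    using Psi_measurable by (simp add: \<rho>\<mu>)
  then show "evK f \<in> borel_measurable \<rho>\<mu>"
    by (rule measurable_cong[THEN iffD1, rotated]) (simp add: space_rhomu evK_eq)
  fix m assume "m \<in> space \<rho>\<mu>"
  then have m: "m \<in> P" by (simp add: space_rhomu)
  show "\<bar>evK f m\<bar> \<le> norm f * \<bar>\<kappa>\<bar>"
    unfolding evK_eq[OF m] by (rule order_trans[OF Cauchy_Schwarz_ineq2]) (intro mult_left_mono norm_Psi m norm_ge_zero)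
qed

sublocale brv: bounded_random_vector \<rho> "\<lambda>z. \<Psi> (fst z)" "\<bar>\<kappa>\<bar>"
proof (rule bounded_random_vector.intro[OF prob_rho], unfold_locales)
  show "(\<lambda>z. \<Psi> (fst z)) \<in> borel_measurable \<rho>" by (rule measurable_compose[OF fst_rho Psi_measurable])
  show "norm (\<Psi> (fst z)) \<le> \<bar>\<kappa>\<bar>" if "z \<in> space \<rho>" for z
    using that by (intro norm_Psi) (auto simp: space_rho)
qed

lemma integral_rhomu:
  assumes "g \<in> borel_measurable \<rho>\<mu>"
  shows "(\<integral>m. g m \<partial>\<rho>\<mu>) = (\<integral>z. (g (fst z) :: real) \<partial>\<rho>)"
  unfolding \<rho>\<mu> by (rule integral_distr[OF fst_rho]) (use assms in \<open>simp add: \<rho>\<mu>\<close>)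

lemma SK_inner: "SK f \<bullet> SK g = brv.T f \<bullet> g"
proof -
  have m: "evK f \<in> borel_measurable \<rho>\<mu>" for f using evK_square_integrable by (simp add: square_integrable_funs_def)
  have "SK f \<bullet> SK g = (\<integral>m. evK f m * evK g m \<partial>\<rho>\<mu>)"
    unfolding SK by (rule is_L2_inner[OF L2 evK_square_integrable evK_square_integrable])
  also have "\<dots> = (\<integral>z. evK f (fst z) * evK g (fst z) \<partial>\<rho>)"
    by (rule integral_rhomu) (intro borel_measurable_times m)
  also have "\<dots> = (\<integral>z. (\<Psi> (fst z) \<bullet> f) * (\<Psi> (fst z) \<bullet> g) \<partial>\<rho>)"
    by (rule Bochner_Integration.integral_cong) (auto simp: space_rho evK_eq inner_commute)
  finally show ?thesis by (simp add: brv.T_inner)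
qed

lemma SK_bounded_linear: "bounded_linear SK"
proof -
  have lin: "SK (f + c *\<^sub>R g) = SK f + c *\<^sub>R SK g" for f g c
  proof -
    have "SK f + c *\<^sub>R SK g = cls (\<lambda>m. evK f m + c * evK g m)"
      unfolding SK by (rule is_L2_linear[OF L2 evK_square_integrable evK_square_integrable, symmetric])
    also have "\<dots> = SK (f + c *\<^sub>R g)"
    proof -
      have sq: "(\<lambda>m. evK f m + c * evK g m) \<in> square_integrable_funs \<rho>\<mu>"
        by (rule square_integrable_funs_add[OF evK_square_integrable evK_square_integrable])
      have "(norm (cls (\<lambda>m. evK f m + c * evK g m) - SK (f + c *\<^sub>R g)))\<^sup>2
          = (\<integral>m. (evK f m + c * evK g m - evK (f + c *\<^sub>R g) m)\<^sup>2 \<partial>\<rho>\<mu>)"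
        unfolding SK by (rule is_L2_dist[OF L2 sq evK_square_integrable])
      also have "\<dots> = (\<integral>m. 0 \<partial>\<rho>\<mu>)"
        by (rule Bochner_Integration.integral_cong) (auto simp: space_rhomu evK_eq inner_add_left)
      finally show ?thesis by simp
    qed
    finally show ?thesis by simp
  qed
  have SK0: "SK 0 = 0" using lin[of 0 1 0] by simp
  show ?thesis
  proof (rule bounded_linear_intro[where K = "\<bar>\<kappa>\<bar>"])
    show "SK (f + g) = SK f + SK g" for f g using lin[of f 1 g] by simp
    show "SK (c *\<^sub>R f) = c *\<^sub>R SK f" for c f using lin[of 0 c f] SK0 by simp
    show "norm (SK f) \<le> norm f * \<bar>\<kappa>\<bar>" for f
    proof (rule power2_le_imp_le)
      have "(norm (SK f))\<^sup>2 = brv.T f \<bullet> f" by (simp add: power2_norm_eq_inner SK_inner)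
      also have "\<dots> \<le> norm (brv.T f) * norm f" by (rule norm_cauchy_schwarz)
      also have "\<dots> \<le> (\<bar>\<kappa>\<bar>\<^sup>2 * norm f) * norm f" by (intro mult_right_mono brv.T_bound) simp
      finally show "(norm (SK f))\<^sup>2 \<le> (norm f * \<bar>\<kappa>\<bar>)\<^sup>2" by (simp add: power_mult_distrib power2_eq_square mult_ac)
    qed simp
  qed
qed

text \<open>\<open>adjoint\<close> is a choice operator, so an adjoint has to be exhibited: with
  \<open>g\<close> the class of \<open>u\<close>, the Bochner integral of
  \<open>u m *\<^sub>R \<Psi> m\<close> represents the functional. It exists because the features
  are bounded and \<open>u\<close> is integrable.\<close>

lemma adjoint_SK: "SK f \<bullet> g = f \<bullet> adjoint SK g"
proof -
  have ex: "\<exists>v. \<forall>f. SK f \<bullet> g = f \<bullet> v" for g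
  proof -
    have "cls ` square_integrable_funs \<rho>\<mu> = UNIV" using L2 by (simp only: is_L2_def)
    then have "g \<in> cls ` square_integrable_funs \<rho>\<mu>" by (simp only: UNIV_I)
    then obtain u where u: "u \<in> square_integrable_funs \<rho>\<mu>" "g = cls u" by blast
    interpret \<mu>: prob_space \<rho>\<mu> by (rule prob_rhomu)
    have um [measurable]: "u \<in> borel_measurable \<rho>\<mu>" using u by (simp add: square_integrable_funs_def)
    have Pm [measurable]: "\<Psi> \<in> borel_measurable \<rho>\<mu>" using Psi_measurable by (simp add: \<rho>\<mu>)
    have "(\<lambda>m. 1) \<in> square_integrable_funs \<rho>\<mu>" by (rule \<mu>.bounded_square_integrable[where b = 1]) auto
    from integrable_mult_square_integrable[OF u(1) this] have ui: "integrable \<rho>\<mu> u" by simp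
    have int: "integrable \<rho>\<mu> (\<lambda>m. u m *\<^sub>R \<Psi> m)"
    proof (rule Bochner_Integration.integrable_bound)
      show "integrable \<rho>\<mu> (\<lambda>m. \<bar>\<kappa>\<bar> * u m)" using ui by simp
      show "AE m in \<rho>\<mu>. norm (u m *\<^sub>R \<Psi> m) \<le> norm (\<bar>\<kappa>\<bar> * u m)"
      proof (rule AE_I2)
        fix m assume "m \<in> space \<rho>\<mu>"
        then have "norm (\<Psi> m) * \<bar>u m\<bar> \<le> \<bar>\<kappa>\<bar> * \<bar>u m\<bar>"
          by (intro mult_right_mono norm_Psi) (auto simp: space_rhomu)
        then show "norm (u m *\<^sub>R \<Psi> m) \<le> norm (\<bar>\<kappa>\<bar> * u m)" by (simp add: abs_mult mult.commute)
      qed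
    qed measurable
    have "SK f \<bullet> g = f \<bullet> (\<integral>m. u m *\<^sub>R \<Psi> m \<partial>\<rho>\<mu>)" for f
    proof -
      have "SK f \<bullet> g = (\<integral>m. evK f m * u m \<partial>\<rho>\<mu>)"
        unfolding SK u(2) by (rule is_L2_inner[OF L2 evK_square_integrable u(1)])
      also have "\<dots> = (\<integral>m. f \<bullet> (u m *\<^sub>R \<Psi> m) \<partial>\<rho>\<mu>)"
        by (rule Bochner_Integration.integral_cong) (auto simp: space_rhomu evK_eq)
      also have "\<dots> = f \<bullet> (\<integral>m. u m *\<^sub>R \<Psi> m \<partial>\<rho>\<mu>)"
        by (rule integral_inner_right) (use int in auto)
      finally show ?thesis .
    qed
    then show ?thesis by blast
  qed
  then have "\<exists>f'. \<forall>f g. SK f \<bullet> g = f \<bullet> f' g" by metis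
  from someI_ex[OF this] show ?thesis unfolding adjoint_def by blast
qed

sublocale cf: covariance_factor \<rho> "\<lambda>z. \<Psi> (fst z)" "\<bar>\<kappa>\<bar>" SK "adjoint SK"
  by (rule covariance_factor.intro[OF brv.bounded_random_vector_axioms covariance_factor_axioms.intro])
    (rule SK_bounded_linear adjoint_SK SK_inner)+

lemma LK_eq: "cf.L = LK"
  by (rule ext) (simp add: cf.L_def LK)

lemma f\<rho>_measurable: "f\<rho> \<in> borel_measurable (restrict_space borel P)"
proof -
  have cm: "cond \<in> restrict_space borel P \<rightarrow>\<^sub>M prob_algebra (restrict_space borel Y)"
    using cond by (simp add: is_conditional_law_def)
  have "(\<lambda>y. y) \<in> borel_measurable (restrict_space borel Y :: real measure)" by (rule measurable_restrict_space1) simp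
  from measurable_compose[OF measurable_prob_algebraD[OF cm] integral_measurable_subprob_algebra[OF this]]
  show ?thesis unfolding f\<rho> .
qed

lemma f\<rho>_bound: "m \<in> P \<Longrightarrow> \<bar>f\<rho> m\<bar> \<le> M"
proof -
  assume m: "m \<in> P"
  have cm: "cond \<in> restrict_space borel P \<rightarrow>\<^sub>M prob_algebra (restrict_space borel Y)"
    using cond by (simp add: is_conditional_law_def)
  have cs: "cond m \<in> space (prob_algebra (restrict_space borel Y))"
    by (rule measurable_space[OF cm]) (simp add: m space_restrict_space)
  then interpret C: prob_space "cond m" by (simp add: space_prob_algebra)
  have sc: "sets (cond m) = sets (restrict_space borel Y)" using cs by (simp add: space_prob_algebra)
  have sp: "space (cond m) = Y" using sets_eq_imp_space_eq[OF sc] by (simp add: space_restrict_space)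
  have ym: "(\<lambda>y. y) \<in> borel_measurable (cond m)"
    using sc by (simp cong: measurable_cong_sets) (rule measurable_restrict_space1, simp)
  have Yb: "\<bar>y\<bar> \<le> M" if "y \<in> space (cond m)" for y using that Y by (auto simp: sp abs_le_iff)
  have int: "integrable (cond m) (\<lambda>y. \<bar>y\<bar>)"
    by (rule C.integrable_const_bound[where B = M]) (use Yb ym in \<open>auto intro!: AE_I2\<close>)
  have "\<bar>f\<rho> m\<bar> \<le> (\<integral>y. \<bar>y\<bar> \<partial>cond m)" unfolding f\<rho> by (rule integral_abs_bound)
  also have "\<dots> \<le> (\<integral>y. M \<partial>cond m)" using int Yb by (intro integral_mono) auto
  finally show ?thesis by (simp add: C.prob_space)
qed

lemma f\<rho>_square_integrable: "f\<rho> \<in> square_integrable_funs \<rho>\<mu>"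
  by (rule prob_space.bounded_square_integrable[OF prob_rhomu, where b = M])
    (use f\<rho>_measurable f\<rho>_bound in \<open>auto simp: space_rhomu \<rho>\<mu> space_restrict_space\<close>)

lemma norm_cls_f\<rho>: "norm (cls f\<rho>) \<le> M"
proof (rule power2_le_imp_le)
  interpret \<mu>: prob_space \<rho>\<mu> by (rule prob_rhomu)
  have "(norm (cls f\<rho>))\<^sup>2 = (\<integral>m. f\<rho> m * f\<rho> m \<partial>\<rho>\<mu>)"
    by (simp only: power2_norm_eq_inner is_L2_inner[OF L2 f\<rho>_square_integrable f\<rho>_square_integrable])
  also have "\<dots> \<le> (\<integral>m. M\<^sup>2 \<partial>\<rho>\<mu>)"
  proof (rule integral_mono)
    show "integrable \<rho>\<mu> (\<lambda>m. f\<rho> m * f\<rho> m)"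
      by (rule integrable_mult_square_integrable[OF f\<rho>_square_integrable f\<rho>_square_integrable])
    fix m assume "m \<in> space \<rho>\<mu>"
    from power_mono[OF f\<rho>_bound abs_ge_zero, of m 2] this show "f\<rho> m * f\<rho> m \<le> M\<^sup>2"
      by (simp add: space_rhomu power2_eq_square)
  qed simp
  finally show "(norm (cls f\<rho>))\<^sup>2 \<le> M\<^sup>2" by (simp add: \<mu>.prob_space)
qed (use M in simp)

sublocale reg: regression \<rho> "\<lambda>z. \<Psi> (fst z)" "\<bar>\<kappa>\<bar>" SK "adjoint SK" snd "\<lambda>z. f\<rho> (fst z)" M "cls f\<rho>" h\<rho> r R
proof unfold_locales
  have "snd \<in> \<rho> \<rightarrow>\<^sub>M restrict_space borel Y" by measurable
  moreover have "(\<lambda>y. y) \<in> borel_measurable (restrict_space borel Y :: real measure)"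
    by (rule measurable_restrict_space1) simp
  ultimately have "(\<lambda>z. snd z) \<in> borel_measurable \<rho>" by (rule measurable_compose)
  then show sm: "snd \<in> borel_measurable \<rho>" .
  show fm: "(\<lambda>z. f\<rho> (fst z)) \<in> borel_measurable \<rho>" by (rule measurable_compose[OF fst_rho f\<rho>_measurable])
  show sb: "\<bar>snd z\<bar> \<le> M" if "z \<in> space \<rho>" for z using that Y by (auto simp: space_rho abs_le_iff)
  show fb: "\<bar>f\<rho> (fst z)\<bar> \<le> M" if "z \<in> space \<rho>" for z using that f\<rho>_bound by (auto simp: space_rho)
  show "(\<integral>z. (snd z - f\<rho> (fst z)) * (\<Psi> (fst z) \<bullet> u) \<partial>\<rho>) = 0" for u
  proof -
    have gm: "(\<lambda>m. \<Psi> m \<bullet> u) \<in> borel_measurable (restrict_space borel P)" by measurable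
    have gb: "\<bar>\<Psi> m \<bullet> u\<bar> \<le> \<bar>\<kappa>\<bar> * norm u" if "m \<in> space (restrict_space borel P)" for m
      using norm_Psi[of m] that
      by (intro order_trans[OF Cauchy_Schwarz_ineq2] mult_right_mono) (auto simp: space_restrict_space)
    have Yb: "\<And>y. y \<in> Y \<Longrightarrow> \<bar>y\<bar> \<le> M" using Y by (auto simp: abs_le_iff)
    have eq: "(\<integral>z. snd z * (\<Psi> (fst z) \<bullet> u) \<partial>\<rho>) = (\<integral>z. f\<rho> (fst z) * (\<Psi> (fst z) \<bullet> u) \<partial>\<rho>)"
      using conditional_mean[OF prob_rho sets_rho cond Yb gm gb] by (simp add: f\<rho>)
    have int: "integrable \<rho> (\<lambda>z. w z * (\<Psi> (fst z) \<bullet> u))"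
      if "w \<in> borel_measurable \<rho>" "\<And>z. z \<in> space \<rho> \<Longrightarrow> \<bar>w z\<bar> \<le> M" for w
    proof (rule brv.integrable_const_bound[where B = "M * (\<bar>\<kappa>\<bar> * norm u)"])
      show "AE z in \<rho>. norm (w z * (\<Psi> (fst z) \<bullet> u)) \<le> M * (\<bar>\<kappa>\<bar> * norm u)"
        using that(2) gb M by (intro AE_I2) (auto simp: abs_mult space_rho space_restrict_space intro!: mult_mono)
      show "(\<lambda>z. w z * (\<Psi> (fst z) \<bullet> u)) \<in> borel_measurable \<rho>"
        using that(1) by measurable
    qed
    show ?thesis
      using int[OF sm sb] int[OF fm fb] eq by (simp add: left_diff_distrib)
  qed
  show "(norm (SK f - cls f\<rho>))\<^sup>2 = (\<integral>z. (f\<rho> (fst z) - \<Psi> (fst z) \<bullet> f)\<^sup>2 \<partial>\<rho>)" for f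
  proof -
    have m1: "evK f \<in> borel_measurable \<rho>\<mu>" using evK_square_integrable by (simp add: square_integrable_funs_def)
    have m2: "f\<rho> \<in> borel_measurable \<rho>\<mu>" using f\<rho>_square_integrable by (simp add: square_integrable_funs_def)
    have "(norm (SK f - cls f\<rho>))\<^sup>2 = (\<integral>m. (evK f m - f\<rho> m)\<^sup>2 \<partial>\<rho>\<mu>)"
      unfolding SK by (rule is_L2_dist[OF L2 evK_square_integrable f\<rho>_square_integrable])
    also have "\<dots> = (\<integral>z. (evK f (fst z) - f\<rho> (fst z))\<^sup>2 \<partial>\<rho>)"
      by (rule integral_rhomu) (intro borel_measurable_power borel_measurable_diff m1 m2)
    also have "\<dots> = (\<integral>z. (f\<rho> (fst z) - \<Psi> (fst z) \<bullet> f)\<^sup>2 \<partial>\<rho>)"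
      by (rule Bochner_Integration.integral_cong) (auto simp: space_rho evK_eq inner_commute power2_commute)
    finally show ?thesis .
  qed
  show "cls f\<rho> = op_powr cf.L r h\<rho>" unfolding LK_eq by (rule source)
qed (rule source)+

text \<open>Jensen for the power \<alpha>, through the tangent at \<open>g / N\<close>, a bound for
  the mean squared error of the empirical embedding. A separate \<open>g\<close> stands in for
  \<open>\<gamma>\<^sup>2\<close> because the tangent needs a positive base point even when \<gamma>
  is 0.\<close>

lemma second_moment_embedding:
  assumes z: "z \<in> space \<tau>" and N: "0 < N" and g: "0 < g" "\<gamma>\<^sup>2 \<le> g"
  shows "(\<integral>\<^sup>+s. ennreal ((norm (\<Psi> ((1 / real N) *\<^sub>R (\<Sum>i<N. \<Phi> (s i))) - \<Psi> (mean_embedding \<Phi> (fst z))))\<^sup>2)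
           \<partial>PiM {..<N} (\<lambda>_. fst z)) \<le> ennreal (L\<^sup>2 * (g / real N) powr \<alpha>)"
proof -
  have x: "fst z \<in> space (prob_algebra borel)"
    using z sets_eq_imp_space_eq[OF sets_tau] by (auto simp: space_pair_measure)
  let ?Q = "PiM {..<N} (\<lambda>_. fst z)"
  interpret Q: prob_space ?Q using x by (intro prob_space_PiM) (simp add: space_prob_algebra)
  let ?m = "mean_embedding \<Phi> (fst z)"
  define E where "E s = (norm ((1 / real N) *\<^sub>R (\<Sum>i<N. \<Phi> (s i)) - ?m))\<^sup>2" for s :: "nat \<Rightarrow> 'x"
  define c where "c = g / real N"
  define p where "p = c powr \<alpha>"
  have c: "0 < c" using g N by (simp add: c_def)
  have p: "0 < p" using c by (simp add: p_def)
  have Ei: "integrable ?Q E" and Eb: "(\<integral>s. E s \<partial>?Q) \<le> c"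
    using feat.empirical_mean_error[OF x N] divide_right_mono[OF g(2), of "real N"] by (auto simp: E_def[abs_def] c_def)
  have E0: "0 \<le> E s" for s by (simp add: E_def)
  define W where "W s = L\<^sup>2 * ((1 - \<alpha>) * p + \<alpha> * (p / c) * E s)" for s
  have W0: "0 \<le> W s" for s using hoelder c p E0[of s] by (simp add: W_def)
  have Wi: "integrable ?Q W" unfolding W_def[abs_def] using Ei by simp
  have "(norm (\<Psi> ((1 / real N) *\<^sub>R (\<Sum>i<N. \<Phi> (s i))) - \<Psi> ?m))\<^sup>2 \<le> W s" for s
  proof -
    let ?d = "norm ((1 / real N) *\<^sub>R (\<Sum>i<N. \<Phi> (s i)) - ?m)"
    have "norm (\<Psi> ((1 / real N) *\<^sub>R (\<Sum>i<N. \<Phi> (s i))) - \<Psi> ?m) \<le> L * ?d powr \<alpha>"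
      unfolding P by (rule hoelder(4)[unfolded P]) (use feat.empirical_mean_in[OF N] feat.mean_embedding_in[OF x] in auto)
    from power_mono[OF this norm_ge_zero, of 2]
    have "(norm (\<Psi> ((1 / real N) *\<^sub>R (\<Sum>i<N. \<Phi> (s i))) - \<Psi> ?m))\<^sup>2 \<le> L\<^sup>2 * (?d powr \<alpha>)\<^sup>2"
      by (simp add: power_mult_distrib)
    also have "(?d powr \<alpha>)\<^sup>2 = E s powr \<alpha>"
      by (simp add: E_def power2_eq_square powr_mult)
    also have "L\<^sup>2 * E s powr \<alpha> \<le> W s"
      unfolding W_def p_def by (intro mult_left_mono powr_le_tangent hoelder c E0) simp
    finally show ?thesis .
  qed
  then have "(\<integral>\<^sup>+s. ennreal ((norm (\<Psi> ((1 / real N) *\<^sub>R (\<Sum>i<N. \<Phi> (s i))) - \<Psi> ?m))\<^sup>2) \<partial>?Q) \<le> (\<integral>\<^sup>+s. ennreal (W s) \<partial>?Q)"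
    by (intro nn_integral_mono ennreal_leI)
  also have "\<dots> = ennreal (\<integral>s. W s \<partial>?Q)" by (rule nn_integral_eq_integral[OF Wi]) (simp add: W0)
  also have "(\<integral>s. W s \<partial>?Q) = L\<^sup>2 * ((1 - \<alpha>) * p + \<alpha> * (p / c) * (\<integral>s. E s \<partial>?Q))"
    unfolding W_def using Ei by (simp add: Q.prob_space)
  also have "ennreal \<dots> \<le> ennreal (L\<^sup>2 * ((1 - \<alpha>) * p + \<alpha> * (p / c) * c))"
    using Eb hoelder c p by (intro ennreal_leI mult_left_mono add_left_mono) auto
  also have "L\<^sup>2 * ((1 - \<alpha>) * p + \<alpha> * (p / c) * c) = L\<^sup>2 * p" using c by (simp add: algebra_simps)
  finally show ?thesis by (simp add: p_def c_def)
qed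

definition embed :: "'x measure \<times> real \<Rightarrow> 'g \<times> real" where
  "embed z = (mean_embedding \<Phi> (fst z), snd z)"

lemma embed_measurable: "embed \<in> \<tau> \<rightarrow>\<^sub>M \<rho>"
proof -
  note [measurable_cong] = sets_tau
  have "fst \<in> \<tau> \<rightarrow>\<^sub>M prob_algebra borel" by measurable
  then have "(\<lambda>z. mean_embedding \<Phi> (fst z)) \<in> \<tau> \<rightarrow>\<^sub>M borel" by (rule measurable_compose[OF _ feat.mean_embedding_measurable])
  moreover have "mean_embedding \<Phi> (fst z) \<in> P" if "z \<in> space \<tau>" for z
    using that sets_eq_imp_space_eq[OF sets_tau] unfolding P by (intro feat.mean_embedding_in) (auto simp: space_pair_measure)
  ultimately have [measurable]: "(\<lambda>z. mean_embedding \<Phi> (fst z)) \<in> \<tau> \<rightarrow>\<^sub>M restrict_space borel P"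
    by (intro measurable_restrict_space2) auto
  show ?thesis unfolding embed_def[abs_def] by measurable
qed

lemma distr_embed: "distr \<tau> \<rho> embed = \<rho>"
proof -
  have "distr \<tau> \<rho> embed = distr \<tau> (restrict_space borel P \<Otimes>\<^sub>M restrict_space borel Y) (\<lambda>(x, y). (mean_embedding \<Phi> x, y))"
    by (intro distr_cong) (auto simp: sets_rho embed_def)
  then show ?thesis by (simp add: distr_tau)
qed

lemma first_stage_data_eq: "first_stage_data \<Phi> n \<omega> = (\<lambda>j\<in>{..<n}. embed (fst (\<omega> j)))"
  by (simp add: first_stage_data_def embed_def)

section \<open>The two-stage sample and the sigma-algebra of its first stage\<close>

context
  fixes n N :: nat
begin

interpretation ts: two_stage_sampling \<tau> Y N
  by (rule two_stage_sampling.intro[OF prob_tau two_stage_sampling_axioms.intro[OF sets_tau]])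

interpretation law: prob_space ts.\<Lambda> by (rule ts.prob_space_law)

abbreviation "Smp \<equiv> two_stage_sample \<tau> n N"

lemma prob_Smp: "prob_space Smp"
  unfolding two_stage_sample_def by (intro prob_space_PiM law.prob_space_axioms)

interpretation smp: prob_space Smp by (rule prob_Smp)

lemma component_measurable: "j < n \<Longrightarrow> (\<lambda>\<omega>. \<omega> j) \<in> Smp \<rightarrow>\<^sub>M \<tau> \<Otimes>\<^sub>M PiM {..<N} (\<lambda>_. borel)"
  unfolding two_stage_sample_def
  using measurable_component_singleton[of j "{..<n}" "\<lambda>_. ts.\<Lambda>"] by (simp cong: measurable_cong_sets add: ts.sets_law)

lemma data_measurable: "first_stage_data \<Phi> n \<in> Smp \<rightarrow>\<^sub>M PiM {..<n} (\<lambda>_. \<rho>)"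
proof -
  have "(\<lambda>\<omega>. \<lambda>j\<in>{..<n}. embed (fst (\<omega> j))) \<in> Smp \<rightarrow>\<^sub>M PiM {..<n} (\<lambda>_. \<rho>)"
  proof (rule measurable_restrict)
    fix j assume "j \<in> {..<n}"
    then have [measurable]: "(\<lambda>\<omega>. \<omega> j) \<in> Smp \<rightarrow>\<^sub>M \<tau> \<Otimes>\<^sub>M PiM {..<N} (\<lambda>_. borel)" by (intro component_measurable) simp
    have "(\<lambda>\<omega>. fst (\<omega> j)) \<in> Smp \<rightarrow>\<^sub>M \<tau>" by measurable
    then show "(\<lambda>\<omega>. embed (fst (\<omega> j))) \<in> Smp \<rightarrow>\<^sub>M \<rho>" by (rule measurable_compose[OF _ embed_measurable])
  qed
  then show ?thesis by (simp add: first_stage_data_eq[abs_def])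
qed

text \<open>The second-stage draws integrate out, and embedding turns \<tau> into \<rho>. Events
  found for independent draws from \<rho> can thus be pulled back to the two-stage sample with the
  same probability.\<close>

lemma distr_data: "distr Smp (PiM {..<n} (\<lambda>_. \<rho>)) (first_stage_data \<Phi> n) = PiM {..<n} (\<lambda>_. \<rho>)"
proof -
  have fm: "fst \<in> ts.\<Lambda> \<rightarrow>\<^sub>M \<tau>" by (simp cong: measurable_cong_sets add: ts.sets_law)
  have m: "(\<lambda>w. embed (fst w)) \<in> ts.\<Lambda> \<rightarrow>\<^sub>M \<rho>" by (rule measurable_compose[OF fm embed_measurable])
  have "distr ts.\<Lambda> \<rho> (\<lambda>w. embed (fst w)) = distr (distr ts.\<Lambda> \<tau> fst) \<rho> embed"
    by (subst distr_distr[OF embed_measurable fm]) (simp add: comp_def)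
  also have "\<dots> = \<rho>" by (simp add: ts.distr_law_fst distr_embed)
  finally have d: "distr ts.\<Lambda> \<rho> (\<lambda>w. embed (fst w)) = \<rho>" .
  have "distr (PiM {..<n} (\<lambda>_. ts.\<Lambda>)) (PiM {..<n} (\<lambda>_. \<rho>)) (compose {..<n} (\<lambda>w. embed (fst w)))
      = PiM {..<n} (\<lambda>_. distr ts.\<Lambda> \<rho> (\<lambda>w. embed (fst w)))"
    by (rule distr_PiM_finite_prob_space') (use m law.prob_space_axioms prob_rho in auto)
  moreover have "compose {..<n} (\<lambda>w. embed (fst w)) = first_stage_data \<Phi> n"
    by (rule ext) (simp add: compose_def first_stage_data_eq)
  ultimately show ?thesis by (simp add: d two_stage_sample_def)
qed

lemma subalgebra_data:
  "subalgebra Smp (vimage_algebra (space Smp) (first_stage_data \<Phi> n) (PiM {..<n} (\<lambda>_. \<rho>)))" (is "subalgebra _ ?F")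
  and sets_data: "sets (vimage_algebra (space Smp) (first_stage_data \<Phi> n) (PiM {..<n} (\<lambda>_. \<rho>)))
    = {first_stage_data \<Phi> n -` A \<inter> space Smp | A. A \<in> sets (PiM {..<n} (\<lambda>_. \<rho>))}"
proof -
  have "first_stage_data \<Phi> n \<in> space Smp \<rightarrow> space (PiM {..<n} (\<lambda>_. \<rho>))" using measurable_space[OF data_measurable] by blast
  from sets_vimage_algebra2[OF this]
  show *: "sets ?F = {first_stage_data \<Phi> n -` A \<inter> space Smp | A. A \<in> sets (PiM {..<n} (\<lambda>_. \<rho>))}" .
  show "subalgebra Smp ?F"
    unfolding subalgebra_def * using measurable_sets[OF data_measurable] by auto
qed

lemma cond_exp_zero: "measure Smp {\<omega> \<in> space Smp. cond_exp_given_first_stage \<Phi> \<tau> \<rho> n N (\<lambda>_. 0) \<omega> \<le> 0} = 1"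
proof -
  have "measure Smp (space Smp) \<le> measure Smp {\<omega> \<in> space Smp. cond_exp_given_first_stage \<Phi> \<tau> \<rho> n N (\<lambda>_. 0) \<omega> \<le> 0}"
    unfolding cond_exp_given_first_stage_def
    by (rule smp.prob_real_cond_exp_le[OF subalgebra_data]) (use sets.top[of "vimage_algebra (space Smp) (first_stage_data \<Phi> n) (PiM {..<n} (\<lambda>_. \<rho>))"] in auto)
  then show ?thesis using smp.prob_le_1 by (simp add: smp.prob_space antisym)
qed

section \<open>The error of the tail average and its conditional mean\<close>

context
  fixes T :: nat and \<eta> lam :: real
  assumes n: "0 < n" and N: "0 < N" and T: "0 < T" and eta: "0 < \<eta>" "\<eta> * \<kappa>\<^sup>2 \<le> 1" and lam: "\<eta> * real T * lam = 1"
begin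

definition emp_point :: "(nat \<Rightarrow> ('x measure \<times> real) \<times> (nat \<Rightarrow> 'x)) \<Rightarrow> nat \<Rightarrow> 'g" where
  "emp_point \<omega> j = (1 / real N) *\<^sub>R (\<Sum>i<N. \<Phi> (snd (\<omega> j) i))"

lemma emp_point_in: "emp_point \<omega> j \<in> P"
  unfolding emp_point_def P by (rule feat.empirical_mean_in[OF N])

lemma second_stage_data_eq: "second_stage_data \<Phi> N \<omega> j = (emp_point \<omega> j, snd (fst (\<omega> j)))"
  by (simp add: second_stage_data_def emp_point_def)

lemma emp_Psi_measurable:
  assumes "(\<lambda>z. w z) \<in> A \<rightarrow>\<^sub>M \<tau> \<Otimes>\<^sub>M PiM {..<N} (\<lambda>_. borel)"
  shows "(\<lambda>z. \<Psi> ((1 / real N) *\<^sub>R (\<Sum>i<N. \<Phi> (snd (w z) i)))) \<in> borel_measurable A"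
proof -
  note [measurable] = assms
  have "(\<lambda>z. \<Phi> (snd (w z) i)) \<in> borel_measurable A" if "i < N" for i
  proof -
    have "(\<lambda>z. snd (w z)) \<in> A \<rightarrow>\<^sub>M PiM {..<N} (\<lambda>_. borel)" by measurable
    then have "(\<lambda>z. snd (w z) i) \<in> A \<rightarrow>\<^sub>M borel"
      by (rule measurable_compose) (rule measurable_component_singleton, use that in simp)
    then show ?thesis by (rule measurable_compose[OF _ feat.Phi_measurable])
  qed
  then have "(\<lambda>z. (1 / real N) *\<^sub>R (\<Sum>i<N. \<Phi> (snd (w z) i))) \<in> borel_measurable A"
    by (intro borel_measurable_scaleR borel_measurable_sum) auto
  then have "(\<lambda>z. (1 / real N) *\<^sub>R (\<Sum>i<N. \<Phi> (snd (w z) i))) \<in> A \<rightarrow>\<^sub>M restrict_space borel P"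
    using feat.empirical_mean_in[OF N] by (intro measurable_restrict_space2) (auto simp: P)
  then show ?thesis by (rule measurable_compose[OF _ Psi_measurable])
qed

lemma embed_Psi_measurable: "(\<lambda>z. \<Psi> (mean_embedding \<Phi> (fst z))) \<in> borel_measurable \<tau>"
  using measurable_compose[OF measurable_compose[OF embed_measurable fst_rho] Psi_measurable] by (simp add: embed_def)

definition q2 :: "(nat \<Rightarrow> ('x measure \<times> real) \<times> (nat \<Rightarrow> 'x)) \<Rightarrow> real" where
  "q2 \<omega> = (1 / real n) * (\<Sum>j<n. (norm (\<Psi> (emp_point \<omega> j) - \<Psi> (mean_embedding \<Phi> (fst (fst (\<omega> j))))))\<^sup>2)"

lemma draw_diff_measurable:
  "(\<lambda>w. (norm (\<Psi> ((1 / real N) *\<^sub>R (\<Sum>i<N. \<Phi> (snd w i))) - \<Psi> (mean_embedding \<Phi> (fst (fst w)))))\<^sup>2)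
    \<in> borel_measurable (\<tau> \<Otimes>\<^sub>M PiM {..<N} (\<lambda>_. borel))"
proof -
  have [measurable]: "(\<lambda>w. \<Psi> ((1 / real N) *\<^sub>R (\<Sum>i<N. \<Phi> (snd w i)))) \<in> borel_measurable (\<tau> \<Otimes>\<^sub>M PiM {..<N} (\<lambda>_. borel))"
    by (rule emp_Psi_measurable) simp
  have [measurable]: "(\<lambda>w. \<Psi> (mean_embedding \<Phi> (fst (fst w)))) \<in> borel_measurable (\<tau> \<Otimes>\<^sub>M PiM {..<N} (\<lambda>_. borel))"
    by (rule measurable_compose[OF measurable_fst embed_Psi_measurable])
  show ?thesis by measurable
qed

lemma q2_measurable: "q2 \<in> borel_measurable Smp"
proof -
  have "(\<lambda>\<omega>. (norm (\<Psi> (emp_point \<omega> j) - \<Psi> (mean_embedding \<Phi> (fst (fst (\<omega> j))))))\<^sup>2) \<in> borel_measurable Smp" if "j < n" for j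
    using measurable_compose[OF component_measurable[OF that] draw_diff_measurable] by (simp add: emp_point_def)
  then show ?thesis unfolding q2_def[abs_def] by (intro borel_measurable_times borel_measurable_sum) auto
qed

lemma space_Smp_component:
  assumes "\<omega> \<in> space Smp" "j < n"
  shows "fst (\<omega> j) \<in> space \<tau>" "mean_embedding \<Phi> (fst (fst (\<omega> j))) \<in> P" "snd (fst (\<omega> j)) \<in> Y"
proof -
  have "\<omega> j \<in> space (\<tau> \<Otimes>\<^sub>M PiM {..<N} (\<lambda>_. borel))" by (rule measurable_space[OF component_measurable[OF assms(2)] assms(1)])
  then show *: "fst (\<omega> j) \<in> space \<tau>" by (auto simp: space_pair_measure)
  from measurable_space[OF embed_measurable this]
  show "mean_embedding \<Phi> (fst (fst (\<omega> j))) \<in> P" "snd (fst (\<omega> j)) \<in> Y" by (auto simp: embed_def space_rho)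
qed

lemma q2_nonneg: "0 \<le> q2 \<omega>" by (simp add: q2_def sum_nonneg)

lemma q2_bound: "\<omega> \<in> space Smp \<Longrightarrow> q2 \<omega> \<le> (2 * \<bar>\<kappa>\<bar>)\<^sup>2"
proof -
  assume \<omega>: "\<omega> \<in> space Smp"
  have "(\<Sum>j<n. (norm (\<Psi> (emp_point \<omega> j) - \<Psi> (mean_embedding \<Phi> (fst (fst (\<omega> j))))))\<^sup>2) \<le> (\<Sum>j<n. (2 * \<bar>\<kappa>\<bar>)\<^sup>2)"
  proof (intro sum_mono power_mono)
    fix j assume j: "j \<in> {..<n}"
    show "norm (\<Psi> (emp_point \<omega> j) - \<Psi> (mean_embedding \<Phi> (fst (fst (\<omega> j))))) \<le> 2 * \<bar>\<kappa>\<bar>"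
      using norm_triangle_ineq4[of "\<Psi> (emp_point \<omega> j)" "\<Psi> (mean_embedding \<Phi> (fst (fst (\<omega> j))))"]
        norm_Psi[OF emp_point_in, of \<omega> j] norm_Psi[OF space_Smp_component(2)[OF \<omega>, of j]] j by simp
  qed simp
  then show ?thesis using n by (simp add: q2_def field_simps)
qed

text \<open>Each summand of \<open>q2\<close> is handled by
  \<open>nn_integral_sample_mult_le\<close>, with the indicator of \<open>A\<close> as first-stage
  factor. This is a bound on the conditional mean of \<open>q2\<close>, in the integrated form that
  \<open>prob_real_cond_exp_le\<close> takes.\<close>

lemma integral_q2_le:
  assumes C: "C \<in> sets (PiM {..<n} (\<lambda>_. \<rho>))" and g: "0 < g" "\<gamma>\<^sup>2 \<le> g"
  defines "A \<equiv> first_stage_data \<Phi> n -` C \<inter> space Smp"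
  shows "(\<integral>\<omega>. indicator A \<omega> * q2 \<omega> \<partial>Smp) \<le> L\<^sup>2 * (g / real N) powr \<alpha> * measure Smp A"
proof -
  define b where "b = L\<^sup>2 * (g / real N) powr \<alpha>"
  have b0: "0 \<le> b" by (simp add: b_def)
  have Am: "A \<in> sets Smp" unfolding A_def by (rule measurable_sets[OF data_measurable C])
  define d where "d w = (norm (\<Psi> ((1 / real N) *\<^sub>R (\<Sum>i<N. \<Phi> (snd w i))) - \<Psi> (mean_embedding \<Phi> (fst (fst w)))))\<^sup>2"
    for w :: "('x measure \<times> real) \<times> (nat \<Rightarrow> 'x)"
  have dm: "(\<lambda>w. ennreal (d w)) \<in> borel_measurable (\<tau> \<Otimes>\<^sub>M PiM {..<N} (\<lambda>_. borel))"
    unfolding d_def by (rule measurable_compose[OF draw_diff_measurable measurable_ennreal])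
  \<comment> \<open>\<open>A\<close> is an event in the embedded data, so its indicator is a
    measurable function of the first-stage pairs.\<close>
  define h where "h z = (indicator C (\<lambda>j\<in>{..<n}. embed (z j)) :: ennreal)" for z
  have "(\<lambda>z. \<lambda>j\<in>{..<n}. embed (z j)) \<in> PiM {..<n} (\<lambda>_. \<tau>) \<rightarrow>\<^sub>M PiM {..<n} (\<lambda>_. \<rho>)"
  proof (rule measurable_restrict)
    fix j assume "j \<in> {..<n}"
    then have "(\<lambda>z. z j) \<in> PiM {..<n} (\<lambda>_. \<tau>) \<rightarrow>\<^sub>M \<tau>" by (rule measurable_component_singleton)
    then show "(\<lambda>z. embed (z j)) \<in> PiM {..<n} (\<lambda>_. \<tau>) \<rightarrow>\<^sub>M \<rho>" by (rule measurable_compose[OF _ embed_measurable])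
  qed
  then have hm: "h \<in> borel_measurable (PiM {..<n} (\<lambda>_. \<tau>))"
    unfolding h_def[abs_def] by (rule measurable_compose) (use C in simp)
  have hA: "h (\<lambda>i\<in>{..<n}. fst (\<omega> i)) = indicator A \<omega>" if "\<omega> \<in> space Smp" for \<omega>
  proof -
    have "(\<lambda>j\<in>{..<n}. embed ((\<lambda>i\<in>{..<n}. fst (\<omega> i)) j)) = first_stage_data \<Phi> n \<omega>"
      unfolding first_stage_data_eq by (rule restrict_ext) simp
    then show ?thesis using that by (simp add: h_def A_def indicator_def)
  qed
  have j: "(\<integral>\<^sup>+\<omega>. indicator A \<omega> * ennreal (d (\<omega> j)) \<partial>Smp) \<le> ennreal b * emeasure Smp A" if "j < n" for j
  proof -
    have "(\<integral>\<^sup>+\<omega>. h (\<lambda>i\<in>{..<n}. fst (\<omega> i)) * ennreal (d (\<omega> j)) \<partial>Smp) \<le> ennreal b * (\<integral>\<^sup>+\<omega>. h (\<lambda>i\<in>{..<n}. fst (\<omega> i)) \<partial>Smp)"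
    proof (rule ts.nn_integral_sample_mult_le[OF that hm dm])
      fix z assume "z \<in> space \<tau>"
      then show "(\<integral>\<^sup>+s. ennreal (d (z, s)) \<partial>PiM {..<N} (\<lambda>_. fst z)) \<le> ennreal b"
        using second_moment_embedding[OF _ N g, of z] by (simp add: d_def b_def)
    qed
    moreover have "(\<integral>\<^sup>+\<omega>. h (\<lambda>i\<in>{..<n}. fst (\<omega> i)) * ennreal (d (\<omega> j)) \<partial>Smp) = (\<integral>\<^sup>+\<omega>. indicator A \<omega> * ennreal (d (\<omega> j)) \<partial>Smp)"
      by (rule nn_integral_cong) (simp only: hA)
    moreover have "(\<integral>\<^sup>+\<omega>. h (\<lambda>i\<in>{..<n}. fst (\<omega> i)) \<partial>Smp) = (\<integral>\<^sup>+\<omega>. indicator A \<omega> \<partial>Smp)"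
      by (rule nn_integral_cong) (simp only: hA)
    ultimately show ?thesis using Am by simp
  qed
  have dj: "(\<lambda>\<omega>. d (\<omega> j)) \<in> borel_measurable Smp" if "j < n" for j
    unfolding d_def by (rule measurable_compose[OF component_measurable[OF that] draw_diff_measurable])
  have "(\<integral>\<^sup>+\<omega>. ennreal (indicator A \<omega> * q2 \<omega>) \<partial>Smp)
      = (\<integral>\<^sup>+\<omega>. ennreal (1 / real n) * (\<Sum>j<n. indicator A \<omega> * ennreal (d (\<omega> j))) \<partial>Smp)"
  proof (rule nn_integral_cong)
    fix \<omega>
    have "q2 \<omega> = (1 / real n) * (\<Sum>j<n. d (\<omega> j))" by (simp add: q2_def d_def emp_point_def)
    moreover have d0: "0 \<le> d w" for w by (simp add: d_def)
    moreover have "0 \<le> (\<Sum>j<n. d (\<omega> j))" by (intro sum_nonneg d0)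
    ultimately have "ennreal (q2 \<omega>) = ennreal (1 / real n) * (\<Sum>j<n. ennreal (d (\<omega> j)))"
      by (simp only: sum_ennreal) (rule ennreal_mult, auto)
    then have "ennreal (indicator A \<omega> * q2 \<omega>) = ennreal (1 / real n) * (indicator A \<omega> * (\<Sum>j<n. ennreal (d (\<omega> j))))"
      by (cases "\<omega> \<in> A") simp_all
    then show "ennreal (indicator A \<omega> * q2 \<omega>) = ennreal (1 / real n) * (\<Sum>j<n. indicator A \<omega> * ennreal (d (\<omega> j)))"
      by (simp add: sum_distrib_left)
  qed
  also have "\<dots> = ennreal (1 / real n) * (\<Sum>j<n. (\<integral>\<^sup>+\<omega>. indicator A \<omega> * ennreal (d (\<omega> j)) \<partial>Smp))"
  proof -
    have m: "(\<lambda>\<omega>. indicator A \<omega> * ennreal (d (\<omega> j))) \<in> borel_measurable Smp" if "j < n" for j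
      using Am measurable_compose[OF dj[OF that] measurable_ennreal] by (intro borel_measurable_times_ennreal) auto
    show ?thesis
      by (subst nn_integral_cmult, intro borel_measurable_sum m, simp, subst nn_integral_sum[OF m], simp, rule refl)
  qed
  also have "\<dots> \<le> ennreal (1 / real n) * (\<Sum>j<n. ennreal b * emeasure Smp A)"
    by (intro mult_left_mono sum_mono j) auto
  also have "\<dots> = ennreal (b * measure Smp A)"
    using n b0 by (simp add: smp.emeasure_eq_measure ennreal_mult[symmetric] ennreal_of_nat_eq_real_of_nat)
  finally have le: "(\<integral>\<^sup>+\<omega>. ennreal (indicator A \<omega> * q2 \<omega>) \<partial>Smp) \<le> ennreal (b * measure Smp A)" .
  have "(\<integral>\<omega>. indicator A \<omega> * q2 \<omega> \<partial>Smp) = enn2real (\<integral>\<^sup>+\<omega>. ennreal (indicator A \<omega> * q2 \<omega>) \<partial>Smp)"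
    using Am q2_measurable q2_nonneg by (intro integral_eq_nn_integral) auto
  also have "\<dots> \<le> b * measure Smp A"
    using enn2real_mono[OF le] b0 by simp
  finally show ?thesis by (simp add: b_def)
qed

definition err :: "(nat \<Rightarrow> ('x measure \<times> real) \<times> (nat \<Rightarrow> 'x)) \<Rightarrow> real" where
  "err \<omega> = norm (SK (tail_average evK \<Psi> \<eta> n (second_stage_data \<Phi> N \<omega>) T) - cls f\<rho>)"

lemma gradient_descent_measurable:
  "(\<lambda>\<omega>. gradient_descent evK \<Psi> \<eta> n (second_stage_data \<Phi> N \<omega>) t) \<in> borel_measurable Smp"
proof (induction t)
  case (Suc t)
  let ?f = "\<lambda>\<omega>. gradient_descent evK \<Psi> \<eta> n (second_stage_data \<Phi> N \<omega>) t"
  have summand: "(\<lambda>\<omega>. (evK (?f \<omega>) (emp_point \<omega> j) - snd (fst (\<omega> j))) *\<^sub>R \<Psi> (emp_point \<omega> j)) \<in> borel_measurable Smp"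
    if "j < n" for j
  proof -
    have P: "(\<lambda>\<omega>. \<Psi> (emp_point \<omega> j)) \<in> borel_measurable Smp"
      unfolding emp_point_def by (rule emp_Psi_measurable[OF component_measurable[OF that]])
    have "(\<lambda>\<omega>. fst (\<omega> j)) \<in> Smp \<rightarrow>\<^sub>M \<tau>" using measurable_compose[OF component_measurable[OF that] measurable_fst] .
    from measurable_compose[OF measurable_compose[OF this embed_measurable] reg.Y_measurable]
    have y: "(\<lambda>\<omega>. snd (fst (\<omega> j))) \<in> borel_measurable Smp" by (simp add: embed_def)
    show ?thesis unfolding evK_eq[OF emp_point_in]
      by (intro borel_measurable_scaleR borel_measurable_diff borel_measurable_inner P y Suc)
  qed
  have step: "gradient_descent evK \<Psi> \<eta> n (second_stage_data \<Phi> N \<omega>) (Suc t)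
      = ?f \<omega> - (\<eta> * (1 / real n)) *\<^sub>R (\<Sum>j<n. (evK (?f \<omega>) (emp_point \<omega> j) - snd (fst (\<omega> j))) *\<^sub>R \<Psi> (emp_point \<omega> j))" for \<omega>
    using second_stage_data_eq[of \<omega>] by (simp only: gradient_descent.simps) simp
  show ?case unfolding step
    by (intro borel_measurable_diff Suc borel_measurable_scaleR borel_measurable_const borel_measurable_sum summand) simp
qed simp

lemma err_measurable: "err \<in> borel_measurable Smp"
proof -
  have "(\<lambda>\<omega>. tail_average evK \<Psi> \<eta> n (second_stage_data \<Phi> N \<omega>) T) \<in> borel_measurable Smp"
    unfolding tail_average_def
    by (intro borel_measurable_scaleR borel_measurable_const borel_measurable_sum gradient_descent_measurable)
  moreover have "continuous_on UNIV (\<lambda>x. norm (SK x - cls f\<rho>))"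
    by (intro continuous_intros bounded_linear.continuous_on[OF SK_bounded_linear])
  ultimately show ?thesis unfolding err_def[abs_def]
    using borel_measurable_continuous_on[of "\<lambda>x. norm (SK x - cls f\<rho>)"] by blast
qed

lemma gi: "gradient_iteration (empirical_cov n (\<lambda>j. \<Psi> (emp_point \<omega> j))) \<eta>"
  by (rule gradient_iteration_empirical_cov[where \<kappa> = "\<bar>\<kappa>\<bar>"]) (use eta norm_Psi[OF emp_point_in] in auto)

lemma gradient_descent_eq:
  "gradient_descent evK \<Psi> \<eta> n (second_stage_data \<Phi> N \<omega>) t
    = gradient_iteration.iter (empirical_cov n (\<lambda>j. \<Psi> (emp_point \<omega> j))) \<eta>
        ((1 / real n) *\<^sub>R (\<Sum>j<n. snd (fst (\<omega> j)) *\<^sub>R \<Psi> (emp_point \<omega> j))) t"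
  using gradient_descent_eq_iter[where d = "second_stage_data \<Phi> N \<omega>" and k = \<Psi> and evl = evK and n = n and \<eta> = \<eta> and t = t]
    gi[of \<omega>] evK_eq[OF emp_point_in] by (simp add: second_stage_data_eq)

lemma Y_le: "\<omega> \<in> space Smp \<Longrightarrow> j < n \<Longrightarrow> \<bar>snd (fst (\<omega> j))\<bar> \<le> M"
  using space_Smp_component(3)[of \<omega> j] Y by (auto simp: abs_le_iff)

text \<open>A crude bound growing with \<open>\<eta> * T\<close>; it only makes the conditional
  expectation of \<open>err\<close> meaningful.\<close>

lemma err_integrable: "integrable Smp err"
proof (rule smp.integrable_const_bound)
  show "err \<in> borel_measurable Smp" by (rule err_measurable)
  define e where "e = \<bar>\<kappa>\<bar> * (\<eta> * real T * (M * \<bar>\<kappa>\<bar>)) + norm (cls f\<rho>)"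
  show "AE \<omega> in Smp. norm (err \<omega>) \<le> 2 * e + norm (cls f\<rho>) / real T"
  proof (rule AE_I2)
    fix \<omega> assume \<omega>: "\<omega> \<in> space Smp"
    let ?v = "(1 / real n) *\<^sub>R (\<Sum>j<n. snd (fst (\<omega> j)) *\<^sub>R \<Psi> (emp_point \<omega> j))"
    interpret gi: gradient_iteration "empirical_cov n (\<lambda>j. \<Psi> (emp_point \<omega> j))" \<eta> by (rule gi)
    have "norm ?v \<le> (1 / real n) * (\<Sum>j<n. M * \<bar>\<kappa>\<bar>)"
    proof -
      have "norm (\<Sum>j<n. snd (fst (\<omega> j)) *\<^sub>R \<Psi> (emp_point \<omega> j)) \<le> (\<Sum>j<n. M * \<bar>\<kappa>\<bar>)"
        using Y_le[OF \<omega>] norm_Psi[OF emp_point_in] M by (intro sum_norm_le) (auto intro!: mult_mono)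
      from mult_left_mono[OF this, of "1 / real n"] show ?thesis by simp
    qed
    then have v: "norm ?v \<le> M * \<bar>\<kappa>\<bar>" using n by simp
    have "norm (SK (gradient_descent evK \<Psi> \<eta> n (second_stage_data \<Phi> N \<omega>) t) - cls f\<rho>) \<le> e" if t: "t \<le> T" for t
    proof -
      have "norm (gi.iter ?v t) \<le> \<eta> * real t * (M * \<bar>\<kappa>\<bar>)"
        by (rule gi.perturbed_iteration(1)[where \<xi> = "\<lambda>_. ?v"]) (use v M in auto)
      also have "\<dots> \<le> \<eta> * real T * (M * \<bar>\<kappa>\<bar>)" using t eta M by (intro mult_right_mono) auto
      finally have 1: "norm (gi.iter ?v t) \<le> \<eta> * real T * (M * \<bar>\<kappa>\<bar>)" .
      have "norm (SK (gi.iter ?v t)) \<le> \<bar>\<kappa>\<bar> * norm (gi.iter ?v t)"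
      proof (rule power2_le_imp_le)
        have "(norm (SK (gi.iter ?v t)))\<^sup>2 = brv.T (gi.iter ?v t) \<bullet> gi.iter ?v t" by (rule cf.norm_S)
        also have "\<dots> \<le> norm (brv.T (gi.iter ?v t)) * norm (gi.iter ?v t)" by (rule norm_cauchy_schwarz)
        also have "\<dots> \<le> (\<bar>\<kappa>\<bar>\<^sup>2 * norm (gi.iter ?v t)) * norm (gi.iter ?v t)" by (intro mult_right_mono brv.T_bound) simp
        finally show "(norm (SK (gi.iter ?v t)))\<^sup>2 \<le> (\<bar>\<kappa>\<bar> * norm (gi.iter ?v t))\<^sup>2"
          by (simp add: power_mult_distrib power2_eq_square mult_ac)
      qed simp
      also have "\<dots> \<le> \<bar>\<kappa>\<bar> * (\<eta> * real T * (M * \<bar>\<kappa>\<bar>))" by (rule mult_left_mono[OF 1]) simp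
      finally show ?thesis
        unfolding e_def gradient_descent_eq using norm_triangle_ineq4[of "SK (gi.iter ?v t)" "cls f\<rho>"] by linarith
    qed
    then show "norm (err \<omega>) \<le> 2 * e + norm (cls f\<rho>) / real T"
      unfolding err_def real_norm_def abs_norm_cancel
      by (intro tail_average_error[OF bounded_linear.linear[OF SK_bounded_linear] T]) auto
  qed
qed

text \<open>Only \<open>q2\<close> has a controlled conditional expectation, so its square root is replaced by its tangent
  at \<open>b\<close>.\<close>

lemma sample_bound:
  assumes Gs: "Gs \<in> sets (PiM {..<n} (\<lambda>_. \<rho>))" and C: "0 \<le> C" and Q0: "0 \<le> Q"
    and low: "\<And>d u. d \<in> Gs \<Longrightarrow> brv.T u \<bullet> u \<le> C * (empirical_cov n (\<lambda>j. \<Psi> (fst (d j))) u \<bullet> u + lam * (norm u)\<^sup>2)"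
    and Q: "\<And>d u. d \<in> Gs \<Longrightarrow> ((1 / real n) *\<^sub>R (\<Sum>j<n. (snd (d j) - \<Psi> (fst (d j)) \<bullet> f) *\<^sub>R \<Psi> (fst (d j)))) \<bullet> u
        \<le> Q * sqrt (empirical_cov n (\<lambda>j. \<Psi> (fst (d j))) u \<bullet> u + lam * (norm u)\<^sup>2)"
    and ef: "norm (SK f - cls f\<rho>) \<le> ef" and g: "0 < g" "\<gamma>\<^sup>2 \<le> g"
  defines "b \<equiv> L\<^sup>2 * (g / real N) powr \<alpha>"
  shows "measure (PiM {..<n} (\<lambda>_. \<rho>)) Gs
    \<le> measure Smp {\<omega> \<in> space Smp. cond_exp_given_first_stage \<Phi> \<tau> \<rho> n N err \<omega>
        \<le> 2 * (ef + sqrt C * (2 * sqrt lam * norm f + 3 * Q)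
            + (M + 2 * \<bar>\<kappa>\<bar> * (2 * norm f + 3 * Q / sqrt lam)) * (4 * sqrt C / sqrt lam * sqrt b + \<bar>\<kappa>\<bar> / (lam * sqrt lam) * b))
          + M / real T}"
proof -
  let ?D = "first_stage_data \<Phi> n"
  let ?R = "PiM {..<n} (\<lambda>_. \<rho>)"
  define F where "F = vimage_algebra (space Smp) ?D ?R"
  have lam0: "0 < lam"
  proof (rule ccontr)
    assume "\<not> 0 < lam"
    then have "\<eta> * real T * lam \<le> 0" using eta T by (intro mult_nonneg_nonpos) auto
    then show False using lam by simp
  qed
  have b0: "0 < b" using g N hoelder(3) by (simp add: b_def)
  define c0 where "c0 = M + 2 * \<bar>\<kappa>\<bar> * (2 * norm f + 3 * Q / sqrt lam)"
  define u0 where "u0 = 2 * (ef + sqrt C * (2 * sqrt lam * norm f + 3 * Q)) + M / real T"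
  define c1 where "c1 = 2 * c0 * (4 * sqrt C / sqrt lam)"
  define c2 where "c2 = 2 * c0 * (\<bar>\<kappa>\<bar> / (lam * sqrt lam))"
  have c0: "0 \<le> c0" using M Q0 lam0 by (simp add: c0_def)
  have c12: "0 \<le> c1" "0 \<le> c2" using c0 C lam0 by (simp_all add: c1_def c2_def)
  have sub: "subalgebra Smp F" unfolding F_def by (rule subalgebra_data)
  have sF: "sets F = {?D -` A \<inter> space Smp | A. A \<in> sets ?R}" unfolding F_def by (rule sets_data)
  define G' where "G' = ?D -` Gs \<inter> space Smp"
  have G'F: "G' \<in> sets F" using Gs by (auto simp: sF G'_def)
  have meas: "measure ?R Gs = measure Smp G'"
  proof -
    have "measure ?R Gs = measure (distr Smp ?R ?D) Gs" by (simp add: distr_data)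
    also have "\<dots> = measure Smp G'" unfolding G'_def by (rule measure_distr[OF data_measurable Gs])
    finally show ?thesis .
  qed
  have pt: "err \<omega> \<le> u0 + c1 * sqrt (q2 \<omega>) + c2 * q2 \<omega>" if \<omega>: "\<omega> \<in> G'" for \<omega>
  proof -
    have sp: "\<omega> \<in> space Smp" and d: "?D \<omega> \<in> Gs" using \<omega> by (auto simp: G'_def)
    let ?k = "\<lambda>j. \<Psi> (mean_embedding \<Phi> (fst (fst (\<omega> j))))" and ?k' = "\<lambda>j. \<Psi> (emp_point \<omega> j)" and ?y = "\<lambda>j. snd (fst (\<omega> j))"
    have Dj: "?D \<omega> j = (mean_embedding \<Phi> (fst (fst (\<omega> j))), ?y j)" if "j < n" for j
      using that by (simp add: first_stage_data_def)
    have covD: "empirical_cov n (\<lambda>j. \<Psi> (fst (?D \<omega> j))) u = empirical_cov n ?k u" for u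
      by (simp add: empirical_cov_def Dj)
    have vD: "(\<Sum>j<n. (snd (?D \<omega> j) - \<Psi> (fst (?D \<omega> j)) \<bullet> f) *\<^sub>R \<Psi> (fst (?D \<omega> j))) = (\<Sum>j<n. (?y j - ?k j \<bullet> f) *\<^sub>R ?k j)"
      by (intro sum.cong) (auto simp: Dj)
    note low' = low[OF d, unfolded covD] and Q' = Q[OF d, unfolded covD vD]
    have kb: "norm (?k j) \<le> \<bar>\<kappa>\<bar>" if "j < n" for j by (rule norm_Psi[OF space_Smp_component(2)[OF sp that]])
    have k'b: "norm (?k' j) \<le> \<bar>\<kappa>\<bar>" for j by (rule norm_Psi[OF emp_point_in])
    have Tb: "brv.T u \<bullet> u \<le> \<bar>\<kappa>\<bar>\<^sup>2 * (norm u)\<^sup>2" for u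
    proof -
      have "brv.T u \<bullet> u \<le> norm (brv.T u) * norm u" by (rule norm_cauchy_schwarz)
      also have "\<dots> \<le> (\<bar>\<kappa>\<bar>\<^sup>2 * norm u) * norm u" by (intro mult_right_mono brv.T_bound) simp
      finally show ?thesis by (simp add: power2_eq_square mult_ac)
    qed
    have "err \<omega> \<le> 2 * (ef + (sqrt C * (2 * sqrt lam * norm f + 3 * Q)
        + c0 * (4 * sqrt C / sqrt lam * sqrt (q2 \<omega>) + \<bar>\<kappa>\<bar> / (lam * sqrt lam) * (sqrt (q2 \<omega>))\<^sup>2))) + norm (cls f\<rho>) / real T"
      unfolding err_def
    proof (rule tail_average_error[OF bounded_linear.linear[OF SK_bounded_linear] T])
      fix t assume t: "T div 2 < t" "t \<le> T"
      let ?gd = "gradient_descent evK \<Psi> \<eta> n (second_stage_data \<Phi> N \<omega>) t"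
      have t1: "\<eta> * real t * lam \<le> 1"
        using mult_right_mono[OF mult_left_mono[of "real t" "real T" \<eta>], of lam] t eta lam lam0 by simp
      \<comment> \<open>Holds for odd \<open>T\<close> as well, since \<open>t\<close> exceeds
        \<open>T div 2\<close>. It yields the lower bound on \<open>t\<close> under which the bias
        is small.\<close>
      have "T \<le> 2 * (t + 1)" using t by arith
      then have "real T \<le> real (2 * (t + 1))" by (rule of_nat_mono)
      then have "real T \<le> 2 * (real t + 1)" by simp
      then have "lam * \<eta> * real T \<le> lam * \<eta> * (2 * (real t + 1))" using lam0 eta by (intro mult_left_mono) auto
      then have t2: "1 \<le> 2 * lam * \<eta> * (real t + 1)" using lam by (simp add: mult_ac)
      have "pnorm brv.T (?gd - f) \<le> sqrt C * (2 * sqrt lam * norm f + 3 * Q)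
        + c0 * (4 * sqrt C / sqrt lam * sqrt (q2 \<omega>) + \<bar>\<kappa>\<bar> / (lam * sqrt lam) * (sqrt (q2 \<omega>))\<^sup>2)"
        unfolding gradient_descent_eq c0_def q2_def
        by (rule two_stage_gradient_descent[OF n kb k'b eta(1) _ Y_le[OF sp] _ lam0 t1 t2 brv.psd_op_T Tb C low' Q' Q0])
          (use eta M in auto)
      moreover have "norm (SK ?gd - SK f) = pnorm brv.T (?gd - f)"
        unfolding pnorm_def cf.norm_S[symmetric] linear_diff[OF bounded_linear.linear[OF SK_bounded_linear]] by simp
      moreover have "norm (SK ?gd - cls f\<rho>) \<le> norm (SK ?gd - SK f) + norm (SK f - cls f\<rho>)"
        using norm_triangle_ineq[of "SK ?gd - SK f" "SK f - cls f\<rho>"] by simp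
      ultimately show "norm (SK ?gd - cls f\<rho>) \<le> ef + (sqrt C * (2 * sqrt lam * norm f + 3 * Q)
        + c0 * (4 * sqrt C / sqrt lam * sqrt (q2 \<omega>) + \<bar>\<kappa>\<bar> / (lam * sqrt lam) * (sqrt (q2 \<omega>))\<^sup>2))"
        using ef by linarith
    qed
    also have "norm (cls f\<rho>) / real T \<le> M / real T" by (rule divide_right_mono[OF norm_cls_f\<rho>]) simp
    finally show ?thesis
      using q2_nonneg[of \<omega>] by (simp add: u0_def c1_def c2_def algebra_simps)
  qed
  have sqi: "integrable Smp (\<lambda>\<omega>. sqrt (q2 \<omega>))"
  proof (rule smp.integrable_const_bound[where B = "2 * \<bar>\<kappa>\<bar>"])
    show "AE \<omega> in Smp. norm (sqrt (q2 \<omega>)) \<le> 2 * \<bar>\<kappa>\<bar>"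
      using q2_bound q2_nonneg by (intro AE_I2) (auto intro!: real_le_lsqrt)
  qed (use q2_measurable in measurable)
  have qi: "integrable Smp q2"
    by (rule smp.integrable_const_bound[where B = "(2 * \<bar>\<kappa>\<bar>)\<^sup>2"]) (use q2_measurable q2_bound q2_nonneg in auto)
  have "measure Smp G' \<le> measure Smp {\<omega> \<in> space Smp. real_cond_exp Smp F err \<omega> \<le> u0 + c1 * sqrt b + c2 * b}"
  proof (rule smp.prob_real_cond_exp_le[OF sub err_integrable G'F])
    fix A assume A: "A \<in> sets F" "A \<subseteq> G'"
    then obtain C' where C': "C' \<in> sets ?R" "A = ?D -` C' \<inter> space Smp" by (auto simp: sF)
    have Am: "A \<in> sets Smp" using A sub by (auto simp: subalgebra_def)
    let ?I = "\<lambda>\<omega>. indicator A \<omega> :: real"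
    have iI: "integrable Smp ?I" using Am by (intro integrable_real_indicator) (auto simp: smp.emeasure_eq_measure)
    have iIf: "integrable Smp (\<lambda>\<omega>. ?I \<omega> * h \<omega>)" if "integrable Smp h" for h
      using integrable_real_mult_indicator[OF Am that] by (simp add: mult.commute)
    have q2A: "(\<integral>\<omega>. ?I \<omega> * q2 \<omega> \<partial>Smp) \<le> b * measure Smp A"
      unfolding C'(2) b_def by (rule integral_q2_le[OF C'(1) g])
    have "(\<integral>\<omega>. ?I \<omega> * err \<omega> \<partial>Smp)
        \<le> (\<integral>\<omega>. (u0 + c1 * (sqrt b / 2)) * ?I \<omega> + (c1 / (2 * sqrt b) + c2) * (?I \<omega> * q2 \<omega>) \<partial>Smp)"
    proof (rule integral_mono)
      show "integrable Smp (\<lambda>\<omega>. ?I \<omega> * err \<omega>)" by (rule iIf[OF err_integrable])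
      show "integrable Smp (\<lambda>\<omega>. (u0 + c1 * (sqrt b / 2)) * ?I \<omega> + (c1 / (2 * sqrt b) + c2) * (?I \<omega> * q2 \<omega>))"
        using iI iIf[OF qi] by (intro Bochner_Integration.integrable_add integrable_mult_right)
      fix \<omega> assume "\<omega> \<in> space Smp"
      show "?I \<omega> * err \<omega> \<le> (u0 + c1 * (sqrt b / 2)) * ?I \<omega> + (c1 / (2 * sqrt b) + c2) * (?I \<omega> * q2 \<omega>)"
      proof (cases "\<omega> \<in> A")
        case True
        have "sqrt (q2 \<omega>) \<le> sqrt b / 2 + q2 \<omega> / (2 * sqrt b)"
        proof -
          have "sqrt b * sqrt (q2 \<omega>) \<le> (b + q2 \<omega>) / 2"
            using arith_geo_mean_sqrt[of b "q2 \<omega>"] b0 q2_nonneg by (simp add: real_sqrt_mult)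
          then have "sqrt (q2 \<omega>) \<le> ((b + q2 \<omega>) / 2) / sqrt b" using b0 by (simp add: pos_le_divide_eq mult.commute)
          also have "\<dots> = b / sqrt b / 2 + q2 \<omega> / (2 * sqrt b)" by (simp add: add_divide_distrib)
          finally show ?thesis using b0 by (simp add: real_div_sqrt)
        qed
        from mult_left_mono[OF this c12(1)] have "c1 * sqrt (q2 \<omega>) \<le> c1 * (sqrt b / 2) + c1 / (2 * sqrt b) * q2 \<omega>"
          by (simp add: distrib_left)
        then have "err \<omega> \<le> (u0 + c1 * (sqrt b / 2)) + (c1 / (2 * sqrt b) + c2) * q2 \<omega>"
          using pt[of \<omega>] True A(2) by (auto simp: distrib_right)
        then show ?thesis using True by simp
      qed simp
    qed
    also have "\<dots> = (u0 + c1 * (sqrt b / 2)) * measure Smp A + (c1 / (2 * sqrt b) + c2) * (\<integral>\<omega>. ?I \<omega> * q2 \<omega> \<partial>Smp)"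
      using iI iIf[OF qi] Am by simp
    also have "\<dots> \<le> (u0 + c1 * (sqrt b / 2)) * measure Smp A + (c1 / (2 * sqrt b) + c2) * (b * measure Smp A)"
      using c12 b0 by (intro add_left_mono mult_left_mono q2A) auto
    \<comment> \<open>\<open>b\<close> is both the base point of the tangent and the bound for the
      mean of \<open>q2\<close>, so the two halves of the tangent recombine to
      \<open>sqrt b\<close>.\<close>
    also have "\<dots> = (u0 + c1 * sqrt b + c2 * b) * measure Smp A"
    proof -
      have "c1 / (2 * sqrt b) * b = c1 * (sqrt b / 2)" using b0 by (simp add: field_simps flip: power2_eq_square)
      then have "(c1 / (2 * sqrt b) + c2) * (b * m) = (c1 * (sqrt b / 2) + c2 * b) * m" for m
        by (simp only: distrib_right mult.assoc[symmetric])
      then show ?thesis by (simp only:) (simp add: algebra_simps)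
    qed
    finally show "(\<integral>\<omega>. ?I \<omega> * err \<omega> \<partial>Smp) \<le> (u0 + c1 * sqrt b + c2 * b) * measure Smp A" .
  qed
  moreover have "u0 + c1 * sqrt b + c2 * b = 2 * (ef + sqrt C * (2 * sqrt lam * norm f + 3 * Q)
            + c0 * (4 * sqrt C / sqrt lam * sqrt b + \<bar>\<kappa>\<bar> / (lam * sqrt lam) * b)) + M / real T"
    by (simp add: u0_def c1_def c2_def algebra_simps)
  ultimately show ?thesis
    unfolding meas cond_exp_given_first_stage_def F_def[symmetric] c0_def[symmetric] by simp
qed

end

end

section \<open>Rates\<close>

text \<open>The failure probability is split in halves: \<open>t = 1 + ln (8 / \<delta>)\<close>
  makes \<open>4 * exp (1 - t)\<close> equal to \<open>\<delta> / 2\<close>, and \<open>q\<close> of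
  size ln n leaves at most \<open>1 / n \<le> \<delta> / 2\<close> for the covariance bound. The
  condition \<open>rate\<close> says that M sqrt(lam^(-\<nu>) / n), the size of the noise, is at
  most R lam^r, the size of the bias.\<close>

lemma first_stage_rate:
  fixes lam \<delta> :: real and n :: nat
  assumes R: "0 < R" and \<delta>: "0 < \<delta>" "\<delta> \<le> 1" and lam: "0 < lam" "lam \<le> 1"
    and n: "3 \<le> n" "2 / \<delta> \<le> real n" and rate: "M\<^sup>2 \<le> R\<^sup>2 * lam powr (2 * r + \<nu>) * real n"
    and t: "t = 1 + ln (8 / \<delta>)"
    and big: "4 * t\<^sup>2 * lam powr \<nu> \<le> 1" "4 * \<kappa>\<^sup>2 * t\<^sup>2 \<le> real n * lam"
    and small: "4 * \<kappa>\<^sup>2 * (2 * ln (real n) + 3) \<le> real n * lam"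
  defines "Q \<equiv> (sqrt 2 + 2 * sqrt (8 * exp 1 + 1) * sqrt (max c\<nu> 1)) * (t * (R * lam powr r))"
  obtains f Gs where "norm (SK f - cls f\<rho>) \<le> R * lam powr r" "norm f \<le> R * lam powr (r - 1 / 2)"
    "Gs \<in> sets (PiM {..<n} (\<lambda>_. \<rho>))" "measure (PiM {..<n} (\<lambda>_. \<rho>)) Gs \<ge> 1 - \<delta>"
    "\<And>d u. d \<in> Gs \<Longrightarrow> brv.T u \<bullet> u \<le> 8 * exp 1 * (empirical_cov n (\<lambda>j. \<Psi> (fst (d j))) u \<bullet> u + lam * (norm u)\<^sup>2)"
    "\<And>d u. d \<in> Gs \<Longrightarrow> ((1 / real n) *\<^sub>R (\<Sum>j<n. (snd (d j) - \<Psi> (fst (d j)) \<bullet> f) *\<^sub>R \<Psi> (fst (d j)))) \<bullet> u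
        \<le> Q * sqrt (empirical_cov n (\<lambda>j. \<Psi> (fst (d j))) u \<bullet> u + lam * (norm u)\<^sup>2)"
proof -
  \<comment> \<open>The maximum with 1 keeps this bound on the effective dimension at least 1,
    whatever the value of \<open>c\<nu>\<close>, because lam \<le> 1.\<close>
  define N' where "N' = max c\<nu> 1 * lam powr (- \<nu>)"
  define q where "q = nat \<lceil>ln (real n)\<rceil>"
  define x where "x = R * lam powr r"
  have n0: "0 < n" "0 < real n" using n by auto
  have nl: "0 < real n * lam" using n0 lam by simp
  have x0: "0 < x" using R lam by (simp add: x_def)
  have t1: "1 \<le> t" using \<delta> by (simp add: t)
  have ln1: "1 \<le> ln (real n)" by (rule one_le_ln[OF n(1)])
  have q: "1 \<le> q" "ln (real n) \<le> real q" "real q \<le> ln (real n) + 1" using ln1 by (auto simp: q_def) linarith+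
  obtain f where f: "norm (SK f - cls f\<rho>) \<le> R * lam powr r" "norm f \<le> R * lam powr (r - 1 / 2)"
    by (rule reg.approximation[OF lam(1)])
  have lamr: "lam powr (r - 1 / 2) * sqrt lam = lam powr r"
    using lam by (simp add: powr_half_sqrt[symmetric] powr_add[symmetric])
  have N'0: "0 < N'" "effective_dim cf.L lam \<le> N'" "1 \<le> N'"
  proof -
    show "0 < N'" using lam by (simp add: N'_def)
    have "c\<nu> * lam powr (- \<nu>) \<le> N'" unfolding N'_def by (intro mult_right_mono) auto
    then show "effective_dim cf.L lam \<le> N'" unfolding LK_eq using capacity(3)[OF lam(1)] by linarith
    have "1 \<le> lam powr (- \<nu>)" using lam capacity by (simp add: powr_minus one_le_inverse_iff powr_le1)
    from mult_mono[of 1 "max c\<nu> 1" 1, OF _ this] show "1 \<le> N'" by (simp add: N'_def)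
  qed
  have c1: "\<bar>\<kappa>\<bar>\<^sup>2 \<le> real n * lam * N'"
  proof -
    have "\<bar>\<kappa>\<bar>\<^sup>2 * 1 \<le> \<kappa>\<^sup>2 * (4 * t\<^sup>2)"
      using one_le_power[OF t1, of 2] by (intro mult_mono) auto
    also have "\<dots> \<le> real n * lam * 1" using big(2) by (simp add: mult_ac)
    also have "\<dots> \<le> real n * lam * N'" using N'0 nl by (intro mult_left_mono) auto
    finally show ?thesis by simp
  qed
  have noise: "M\<^sup>2 * N' \<le> max c\<nu> 1 * x\<^sup>2 * real n"
  proof -
    have "M\<^sup>2 * N' \<le> (R\<^sup>2 * lam powr (2 * r + \<nu>) * real n) * N'" by (intro mult_right_mono rate) (use N'0 in simp)
    also have "\<dots> = max c\<nu> 1 * (R\<^sup>2 * (lam powr (2 * r + \<nu>) * lam powr (- \<nu>))) * real n" by (simp add: N'_def mult_ac)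
    also have "lam powr (2 * r + \<nu>) * lam powr (- \<nu>) = (lam powr r)\<^sup>2"
      using lam by (simp add: powr_add[symmetric] power2_eq_square)
    finally show ?thesis by (simp add: x_def power_mult_distrib)
  qed
  have c2: "(M + \<bar>\<kappa>\<bar> * norm f)\<^sup>2 * t\<^sup>2 \<le> real n * (R * lam powr r)\<^sup>2"
  proof -
    have Mt: "2 * (M * t) \<le> sqrt (real n) * x"
    proof (rule power2_le_imp_le)
      have "(2 * (M * t))\<^sup>2 = M\<^sup>2 * (4 * t\<^sup>2)" by (simp add: power_mult_distrib)
      also have "\<dots> \<le> R\<^sup>2 * lam powr (2 * r + \<nu>) * real n * (4 * t\<^sup>2)" by (intro mult_right_mono rate) simp
      also have "\<dots> = R\<^sup>2 * (lam powr r)\<^sup>2 * real n * (4 * t\<^sup>2 * lam powr \<nu>)"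
        using lam by (simp add: powr_add power2_eq_square flip: mult_2 powr_add)
      also have "\<dots> \<le> R\<^sup>2 * (lam powr r)\<^sup>2 * real n * 1" by (intro mult_left_mono big) simp
      finally show "(2 * (M * t))\<^sup>2 \<le> (sqrt (real n) * x)\<^sup>2" by (simp add: x_def power_mult_distrib mult_ac)
    qed (use x0 in simp)
    have ft: "2 * (\<bar>\<kappa>\<bar> * norm f * t) \<le> sqrt (real n) * x"
    proof -
      have "2 * (\<bar>\<kappa>\<bar> * t) \<le> sqrt (real n * lam)"
        by (rule real_le_rsqrt) (use big(2) in \<open>simp add: power_mult_distrib\<close>)
      then have "2 * (\<bar>\<kappa>\<bar> * t) * norm f \<le> sqrt (real n * lam) * (R * lam powr (r - 1 / 2))"
        using f(2) t1 lam by (intro mult_mono) auto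
      also have "\<dots> = sqrt (real n) * x"
        unfolding x_def lamr[symmetric] by (simp add: real_sqrt_mult mult_ac)
      finally show ?thesis by (simp add: mult_ac)
    qed
    have "(M + \<bar>\<kappa>\<bar> * norm f) * t \<le> sqrt (real n) * x" using Mt ft by (simp add: distrib_right)
    from power_mono[OF this, of 2] show ?thesis using M t1 by (simp add: power_mult_distrib x_def)
  qed
  have c3: "(2 * real q + 1) * \<bar>\<kappa>\<bar>\<^sup>2 / (real n * lam) \<le> 1 / 4"
  proof -
    have "(2 * real q + 1) * \<kappa>\<^sup>2 \<le> (2 * ln (real n) + 3) * \<kappa>\<^sup>2" using q by (intro mult_right_mono) auto
    then have "(2 * real q + 1) * \<kappa>\<^sup>2 \<le> (1 / 4) * (real n * lam)" using small by (simp add: mult_ac)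
    then show ?thesis using nl by (simp add: pos_divide_le_eq)
  qed
  obtain Gs where Gs: "Gs \<in> sets (PiM {..<n} (\<lambda>_. \<rho>))"
    "measure (PiM {..<n} (\<lambda>_. \<rho>)) Gs \<ge> 1 - (4 * exp (1 - t) + real n * exp (- (2 * real q)))"
    "\<And>d u. d \<in> Gs \<Longrightarrow> brv.T u \<bullet> u \<le> 8 * exp 1 * (empirical_cov n (\<lambda>j. \<Psi> (fst (d j))) u \<bullet> u + lam * (norm u)\<^sup>2)"
    "\<And>d u. d \<in> Gs \<Longrightarrow> ((1 / real n) *\<^sub>R (\<Sum>j<n. (snd (d j) - \<Psi> (fst (d j)) \<bullet> f) *\<^sub>R \<Psi> (fst (d j)))) \<bullet> u
      \<le> (sqrt 2 * (R * lam powr r) + sqrt (8 * exp 1 + 1) * (t * (2 * M * sqrt N') / sqrt (real n)))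
          * sqrt (empirical_cov n (\<lambda>j. \<Psi> (fst (d j))) u \<bullet> u + lam * (norm u)\<^sup>2)"
    by (rule reg.first_stage_event[OF lam(1) R M N'0(1,2) n0(1) c1 t1 q(1) f(1) c2 c3]) blast
  have prob: "4 * exp (1 - t) + real n * exp (- (2 * real q)) \<le> \<delta>"
  proof -
    have "4 * exp (1 - t) = \<delta> / 2" using \<delta> by (simp add: t exp_minus)
    moreover have "real n * exp (- (2 * real q)) \<le> \<delta> / 2"
    proof -
      have "exp (- (2 * real q)) \<le> exp (- (2 * ln (real n)))" using q by simp
      also have "\<dots> = 1 / (real n * real n)" using n0 by (simp add: exp_minus exp_double power2_eq_square divide_simps)
      finally have "real n * exp (- (2 * real q)) \<le> real n * (1 / (real n * real n))" by (rule mult_left_mono) simp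
      also have "\<dots> = 1 / real n" using n0 by simp
      also have "\<dots> \<le> \<delta> / 2" using n(2) n0 \<delta> by (simp add: field_simps)
      finally show ?thesis .
    qed
    ultimately show ?thesis by simp
  qed
  have Qle: "sqrt 2 * (R * lam powr r) + sqrt (8 * exp 1 + 1) * (t * (2 * M * sqrt N') / sqrt (real n)) \<le> Q"
  proof -
    have "M * sqrt N' \<le> sqrt (max c\<nu> 1) * x * sqrt (real n)"
      using real_sqrt_le_mono[OF noise] M x0 by (simp add: real_sqrt_mult)
    then have "M * sqrt N' / sqrt (real n) \<le> sqrt (max c\<nu> 1) * x" using n0 by (simp add: pos_divide_le_eq)
    from mult_left_mono[OF this, of "sqrt (8 * exp 1 + 1) * (2 * t)"]
    have h1: "sqrt (8 * exp 1 + 1) * (t * (2 * M * sqrt N') / sqrt (real n)) \<le> 2 * sqrt (8 * exp 1 + 1) * sqrt (max c\<nu> 1) * (t * x)"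
      using t1 by (simp add: mult_ac)
    have h2: "sqrt 2 * x \<le> sqrt 2 * (t * x)" using t1 x0 by simp
    show ?thesis unfolding Q_def x_def[symmetric] distrib_right by (rule add_mono[OF h2 h1])
  qed
  show thesis
  proof (rule that[OF f Gs(1) _ Gs(3)])
    show "1 - \<delta> \<le> measure (PiM {..<n} (\<lambda>_. \<rho>)) Gs" using Gs(2) prob by linarith
    fix d u assume d: "d \<in> Gs"
    have "0 \<le> empirical_cov n (\<lambda>j. \<Psi> (fst (d j))) u \<bullet> u + lam * (norm u)\<^sup>2"
      using psd_opD(3)[OF psd_op_empirical_cov[of n "\<lambda>j. \<Psi> (fst (d j))"], of u] lam by simp
    then show "((1 / real n) *\<^sub>R (\<Sum>j<n. (snd (d j) - \<Psi> (fst (d j)) \<bullet> f) *\<^sub>R \<Psi> (fst (d j)))) \<bullet> u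
        \<le> Q * sqrt (empirical_cov n (\<lambda>j. \<Psi> (fst (d j))) u \<bullet> u + lam * (norm u)\<^sup>2)"
      by (intro order_trans[OF Gs(4)[OF d] mult_right_mono[OF Qle]]) simp
  qed
qed

text \<open>Every term is compared with t R lam^r. The square root of \<open>b\<close> is of order
  \<open>lam\<close>, so the factor built from \<open>b\<close> is of order \<open>sqrt lam\<close>;
  this compensates the growth by \<open>1 / sqrt lam\<close> in \<open>F\<close> and in
  \<open>Q / sqrt lam\<close>. The term \<open>M / T\<close> is small by
  \<open>\<kappa>\<^sup>2 \<le> T * lam\<close>.\<close>

lemma error_bound:
  fixes lam t F Q b B :: real and T :: nat
  assumes R: "0 < R" and lam: "0 < lam" "lam \<le> 1" and t: "1 \<le> t" and \<kappa>: "\<kappa> \<noteq> 0"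
    and F: "0 \<le> F" "F \<le> R * lam powr (r - 1 / 2)" and Q: "Q = cQ * (t * (R * lam powr r))" "0 \<le> cQ"
    and ef: "ef = R * lam powr r" and b: "0 \<le> b" "b \<le> B * lam powr (2 + \<nu>)" and B: "0 \<le> B"
    and T: "\<kappa>\<^sup>2 \<le> real T * lam" and C: "0 \<le> C"
  shows "2 * (ef + sqrt C * (2 * sqrt lam * F + 3 * Q)
      + (M + 2 * \<bar>\<kappa>\<bar> * (2 * F + 3 * Q / sqrt lam)) * (4 * sqrt C / sqrt lam * sqrt b + \<bar>\<kappa>\<bar> / (lam * sqrt lam) * b)) + M / real T
    \<le> (2 * (1 + sqrt C * (2 + 3 * cQ) + (4 * sqrt C * sqrt B + \<bar>\<kappa>\<bar> * B) * (M / R + 2 * \<bar>\<kappa>\<bar> * (2 + 3 * cQ))) + M / (\<kappa>\<^sup>2 * R))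
        * (t * (R * lam powr r))"
proof -
  define x where "x = t * (R * lam powr r)"
  define s where "s = sqrt lam"
  have s0: "0 < s" using lam by (simp add: s_def)
  have ss: "lam = s * s" using lam by (simp add: s_def)
  have lr: "lam powr r \<le> 1" "s \<le> lam powr r" "lam \<le> lam powr r"
    using powr_mono'[of r "1 / 2" lam] powr_mono'[of r 1 lam] source lam
    by (auto simp: s_def powr_half_sqrt intro: powr_le1)
  have R1: "R * lam powr r \<le> x" using mult_right_mono[OF t, of "R * lam powr r"] R by (simp add: x_def)
  have x0: "0 < x" using R lam t by (simp add: x_def)
  have sF: "s * F \<le> x"
  proof -
    have "s * F \<le> s * (R * lam powr (r - 1 / 2))" using F s0 by simp
    also have "\<dots> = R * lam powr r"
      using lam by (simp add: s_def powr_half_sqrt[symmetric] powr_add[symmetric])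
    finally show ?thesis using R1 by linarith
  qed
  have sx: "M * y \<le> M / R * x" if "y \<le> lam powr r" for y
  proof -
    have "M * y \<le> M * lam powr r" using that M by simp
    also have "\<dots> = M / R * (R * lam powr r)" using R by simp
    also have "\<dots> \<le> M / R * x" using R1 M R by (intro mult_left_mono) auto
    finally show ?thesis .
  qed
  have 1: "sqrt C * (2 * s * F + 3 * Q) \<le> sqrt C * (2 + 3 * cQ) * x"
  proof -
    have "2 * s * F + 3 * Q \<le> (2 + 3 * cQ) * x" using sF by (simp add: Q x_def[symmetric] distrib_right)
    from mult_left_mono[OF this, of "sqrt C"] show ?thesis using C by (simp add: mult.assoc)
  qed
  have 2: "(M + 2 * \<bar>\<kappa>\<bar> * (2 * F + 3 * Q / s)) * s \<le> (M / R + 2 * \<bar>\<kappa>\<bar> * (2 + 3 * cQ)) * x"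
  proof -
    have "(2 * F + 3 * Q / s) * s = 2 * (s * F) + 3 * Q" using s0 by (simp add: field_simps)
    also have "\<dots> \<le> (2 + 3 * cQ) * x" using sF by (simp add: Q x_def[symmetric] distrib_right)
    finally have "2 * \<bar>\<kappa>\<bar> * ((2 * F + 3 * Q / s) * s) \<le> 2 * \<bar>\<kappa>\<bar> * ((2 + 3 * cQ) * x)" by (rule mult_left_mono) simp
    with sx[OF lr(2)] show ?thesis by (simp add: distrib_right mult.assoc)
  qed
  have b1: "b \<le> B * (lam * lam)"
  proof -
    have "lam powr (2 + \<nu>) \<le> lam powr 2" using lam capacity by (intro powr_mono') auto
    then have "B * lam powr (2 + \<nu>) \<le> B * (lam * lam)" using lam B by (intro mult_left_mono) (simp_all add: power2_eq_square)
    then show ?thesis using b by linarith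
  qed
  have 3: "4 * sqrt C / s * sqrt b + \<bar>\<kappa>\<bar> / (lam * s) * b \<le> (4 * sqrt C * sqrt B + \<bar>\<kappa>\<bar> * B) * s"
  proof -
    have "sqrt b \<le> sqrt B * lam" using real_sqrt_le_mono[OF b1] lam by (simp add: real_sqrt_mult)
    then have "4 * sqrt C / s * sqrt b \<le> 4 * sqrt C / s * (sqrt B * (s * s))"
      using C s0 ss by (intro mult_left_mono) auto
    moreover have "\<bar>\<kappa>\<bar> / (lam * s) * b \<le> \<bar>\<kappa>\<bar> / (lam * s) * (B * (lam * lam))"
      using b1 lam s0 by (intro mult_left_mono) auto
    moreover have "\<bar>\<kappa>\<bar> / (lam * s) * (B * (lam * lam)) = \<bar>\<kappa>\<bar> * B * s" using s0 by (simp add: ss)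
    ultimately show ?thesis using s0 by (simp add: distrib_right)
  qed
  have 4: "(M + 2 * \<bar>\<kappa>\<bar> * (2 * F + 3 * Q / s)) * (4 * sqrt C / s * sqrt b + \<bar>\<kappa>\<bar> / (lam * s) * b)
      \<le> (4 * sqrt C * sqrt B + \<bar>\<kappa>\<bar> * B) * (M / R + 2 * \<bar>\<kappa>\<bar> * (2 + 3 * cQ)) * x"
  proof -
    have c0: "0 \<le> M + 2 * \<bar>\<kappa>\<bar> * (2 * F + 3 * Q / s)"
      using M F Q(2) s0 x0 by (simp add: Q(1) x_def[symmetric])
    have "(M + 2 * \<bar>\<kappa>\<bar> * (2 * F + 3 * Q / s)) * (4 * sqrt C / s * sqrt b + \<bar>\<kappa>\<bar> / (lam * s) * b)
      \<le> (M + 2 * \<bar>\<kappa>\<bar> * (2 * F + 3 * Q / s)) * ((4 * sqrt C * sqrt B + \<bar>\<kappa>\<bar> * B) * s)"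
      by (rule mult_left_mono[OF 3 c0])
    also have "\<dots> = (4 * sqrt C * sqrt B + \<bar>\<kappa>\<bar> * B) * ((M + 2 * \<bar>\<kappa>\<bar> * (2 * F + 3 * Q / s)) * s)" by (simp only: mult_ac)
    also have "\<dots> \<le> (4 * sqrt C * sqrt B + \<bar>\<kappa>\<bar> * B) * ((M / R + 2 * \<bar>\<kappa>\<bar> * (2 + 3 * cQ)) * x)"
      by (rule mult_left_mono[OF 2]) (use B C in simp)
    finally show ?thesis by (simp only: mult.assoc)
  qed
  have 5: "M / real T \<le> M / (\<kappa>\<^sup>2 * R) * x"
  proof -
    have T0: "0 < real T" using T \<kappa> lam by (cases "T = 0") auto
    have "M / real T \<le> M * lam / \<kappa>\<^sup>2"
      using mult_left_mono[OF T, of M] M T0 \<kappa> by (simp add: field_simps)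
    also have "\<dots> \<le> (M / R * x) / \<kappa>\<^sup>2" using sx[OF lr(3)] by (rule divide_right_mono) simp
    finally show ?thesis by (simp add: mult.commute)
  qed
  have combine: "2 * (a1 + a2 + a3) + a4 \<le> (2 * (1 + p2 + p3) + p4) * y" if "a1 \<le> y" "a2 \<le> p2 * y" "a3 \<le> p3 * y" "a4 \<le> p4 * y"
    for a1 a2 a3 a4 p2 p3 p4 y :: real
    using that by (simp add: algebra_simps)
  show ?thesis
    unfolding ef s_def[symmetric] x_def[symmetric] by (rule combine[OF R1 1 4 5])
qed

lemma cond_exp_measurable: "cond_exp_given_first_stage \<Phi> \<tau> \<rho> n N Z \<in> borel_measurable (two_stage_sample \<tau> n N)"
  unfolding cond_exp_given_first_stage_def
  by (rule measurable_from_subalg[OF subalgebra_data borel_measurable_cond_exp])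

lemma prob_cond_exp_mono:
  assumes "a \<le> b"
  shows "\<P>(\<omega> in two_stage_sample \<tau> n N. cond_exp_given_first_stage \<Phi> \<tau> \<rho> n N Z \<omega> \<le> a)
    \<le> \<P>(\<omega> in two_stage_sample \<tau> n N. cond_exp_given_first_stage \<Phi> \<tau> \<rho> n N Z \<omega> \<le> b)"
proof -
  interpret S: prob_space "two_stage_sample \<tau> n N" by (rule prob_Smp)
  have [measurable]: "cond_exp_given_first_stage \<Phi> \<tau> \<rho> n N Z \<in> borel_measurable (two_stage_sample \<tau> n N)"
    by (rule cond_exp_measurable)
  show ?thesis by (rule S.finite_measure_mono) (use assms in auto)
qed

text \<open>\<open>C\<close> is fixed before \<delta>, \<open>lam\<close>, \<eta>, \<open>n\<close>,
  \<open>N\<close> and \<open>T\<close>, hence depends on the problem parameters only. The condition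
  on \<open>N\<close> is what makes the mean squared feature error at most of order
  \<open>lam powr (2 + \<nu>)\<close>.\<close>

lemma error_rate:
  assumes R: "0 < R" and \<kappa>: "\<kappa> \<noteq> 0"
  obtains C where "\<And>\<delta> lam \<eta> n N T. 0 < \<delta> \<Longrightarrow> \<delta> \<le> 1 \<Longrightarrow> 0 < lam \<Longrightarrow> lam \<le> 1 \<Longrightarrow> 3 \<le> n \<Longrightarrow> 2 / \<delta> \<le> real n \<Longrightarrow>
    M\<^sup>2 \<le> R\<^sup>2 * lam powr (2 * r + \<nu>) * real n \<Longrightarrow> 4 * (1 + ln (8 / \<delta>))\<^sup>2 * lam powr \<nu> \<le> 1 \<Longrightarrow>
    4 * \<kappa>\<^sup>2 * (1 + ln (8 / \<delta>))\<^sup>2 \<le> real n * lam \<Longrightarrow> 4 * \<kappa>\<^sup>2 * (2 * ln (real n) + 3) \<le> real n * lam \<Longrightarrow>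
    0 < \<eta> \<Longrightarrow> \<eta> < 1 / \<kappa>\<^sup>2 \<Longrightarrow> \<eta> * real T * lam = 1 \<Longrightarrow> lam powr (- ((2 + \<nu>) / \<alpha>)) \<le> real N \<Longrightarrow>
    1 - \<delta> \<le> measure (two_stage_sample \<tau> n N) {\<omega> \<in> space (two_stage_sample \<tau> n N).
      cond_exp_given_first_stage \<Phi> \<tau> \<rho> n N (\<lambda>\<omega>. norm (SK (tail_average evK \<Psi> \<eta> n (second_stage_data \<Phi> N \<omega>) T) - cls f\<rho>)) \<omega>
        \<le> C * ((1 + ln (8 / \<delta>)) * (R * lam powr r))}"
proof -
  define cQ where "cQ = sqrt 2 + 2 * sqrt (8 * exp 1 + 1) * sqrt (max c\<nu> 1)"
  define B where "B = L\<^sup>2 * (\<gamma>\<^sup>2 + 1) powr \<alpha>"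
  define c where "c = 8 * exp (1 :: real)"
  show thesis
  proof (rule that)
    fix \<delta> lam \<eta> :: real and n N T :: nat
    assume \<delta>: "0 < \<delta>" "\<delta> \<le> 1" and lam: "0 < lam" "lam \<le> 1" and n: "3 \<le> n" "2 / \<delta> \<le> real n"
      and rate: "M\<^sup>2 \<le> R\<^sup>2 * lam powr (2 * r + \<nu>) * real n"
      and big: "4 * (1 + ln (8 / \<delta>))\<^sup>2 * lam powr \<nu> \<le> 1" "4 * \<kappa>\<^sup>2 * (1 + ln (8 / \<delta>))\<^sup>2 \<le> real n * lam"
      and small: "4 * \<kappa>\<^sup>2 * (2 * ln (real n) + 3) \<le> real n * lam"
      and eta: "0 < \<eta>" "\<eta> < 1 / \<kappa>\<^sup>2" "\<eta> * real T * lam = 1" and N: "lam powr (- ((2 + \<nu>) / \<alpha>)) \<le> real N"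
    define t where "t = 1 + ln (8 / \<delta>)"
    have t1: "1 \<le> t" using \<delta> by (simp add: t_def)
    have eta1: "\<eta> * \<kappa>\<^sup>2 \<le> 1" using eta(2) \<kappa> by (simp add: pos_less_divide_eq)
    have T0: "0 < T" using eta(3) by (cases T) auto
    have N0: "0 < N" using N lam by (cases N) auto
    have n0: "0 < n" using n by simp
    define Q where "Q = cQ * (t * (R * lam powr r))"
    have cQ0: "0 \<le> cQ" by (simp add: cQ_def)
    have Q0: "0 \<le> Q" using cQ0 t1 R by (simp add: Q_def)
    obtain f Gs where f: "norm (SK f - cls f\<rho>) \<le> R * lam powr r" "norm f \<le> R * lam powr (r - 1 / 2)"
      and Gs: "Gs \<in> sets (PiM {..<n} (\<lambda>_. \<rho>))" "measure (PiM {..<n} (\<lambda>_. \<rho>)) Gs \<ge> 1 - \<delta>"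
      "\<And>d u. d \<in> Gs \<Longrightarrow> brv.T u \<bullet> u \<le> c * (empirical_cov n (\<lambda>j. \<Psi> (fst (d j))) u \<bullet> u + lam * (norm u)\<^sup>2)"
      "\<And>d u. d \<in> Gs \<Longrightarrow> ((1 / real n) *\<^sub>R (\<Sum>j<n. (snd (d j) - \<Psi> (fst (d j)) \<bullet> f) *\<^sub>R \<Psi> (fst (d j)))) \<bullet> u
          \<le> Q * sqrt (empirical_cov n (\<lambda>j. \<Psi> (fst (d j))) u \<bullet> u + lam * (norm u)\<^sup>2)"
      unfolding c_def Q_def cQ_def
      by (rule first_stage_rate[OF R \<delta> lam n rate t_def big[folded t_def] small]) blast
    define b where "b = L\<^sup>2 * ((\<gamma>\<^sup>2 + 1) / real N) powr \<alpha>"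
    have g: "0 < \<gamma>\<^sup>2 + 1" "\<gamma>\<^sup>2 \<le> \<gamma>\<^sup>2 + 1" by (auto intro: add_nonneg_pos)
    have b: "0 \<le> b" "b \<le> B * lam powr (2 + \<nu>)"
    proof -
      show "0 \<le> b" by (simp add: b_def)
      have "(\<gamma>\<^sup>2 + 1) / real N \<le> (\<gamma>\<^sup>2 + 1) / lam powr (- ((2 + \<nu>) / \<alpha>))"
        using N lam g by (intro divide_left_mono) (auto simp: N0)
      then have "((\<gamma>\<^sup>2 + 1) / real N) powr \<alpha> \<le> ((\<gamma>\<^sup>2 + 1) / lam powr (- ((2 + \<nu>) / \<alpha>))) powr \<alpha>"
        using hoelder g by (intro powr_mono2) auto
      also have "\<dots> = ((\<gamma>\<^sup>2 + 1) * lam powr ((2 + \<nu>) / \<alpha>)) powr \<alpha>" by (simp add: powr_minus divide_inverse)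
      also have "\<dots> = (\<gamma>\<^sup>2 + 1) powr \<alpha> * lam powr (2 + \<nu>)"
        using g hoelder(1) by (simp add: powr_mult powr_powr)
      finally show "b \<le> B * lam powr (2 + \<nu>)" unfolding b_def B_def mult.assoc by (rule mult_left_mono) simp
    qed
    \<comment> \<open>\<open>T * lam\<close> is the reciprocal of \<eta>, which is below
      \<open>1 / \<kappa>\<^sup>2\<close>.\<close>
    have Tl: "\<kappa>\<^sup>2 \<le> real T * lam"
    proof -
      have "0 \<le> (1 - \<eta> * \<kappa>\<^sup>2) * (real T * lam)" using eta1 lam by (intro mult_nonneg_nonneg) auto
      then have "\<kappa>\<^sup>2 * (\<eta> * real T * lam) \<le> real T * lam" by (simp add: algebra_simps)
      then show ?thesis by (simp add: eta)
    qed
    have "0 \<le> B" by (simp add: B_def)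
    have c0: "0 \<le> c" by (simp add: c_def)
    note bound = error_bound[OF R lam t1 \<kappa> norm_ge_zero f(2) Q_def cQ0 refl b \<open>0 \<le> B\<close> Tl c0]
    have errf: "err n N T \<eta> = (\<lambda>\<omega>. norm (SK (tail_average evK \<Psi> \<eta> n (second_stage_data \<Phi> N \<omega>) T) - cls f\<rho>))"
      by (rule ext) (simp only: err_def[OF n0 N0 T0 eta(1) eta1 eta(3)])
    have "1 - \<delta> \<le> measure (PiM {..<n} (\<lambda>_. \<rho>)) Gs" by (rule Gs)
    also have "\<dots> \<le> measure (two_stage_sample \<tau> n N) {\<omega> \<in> space (two_stage_sample \<tau> n N).
      cond_exp_given_first_stage \<Phi> \<tau> \<rho> n N (err n N T \<eta>) \<omega> \<le> 2 * (R * lam powr r + sqrt c * (2 * sqrt lam * norm f + 3 * Q)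
        + (M + 2 * \<bar>\<kappa>\<bar> * (2 * norm f + 3 * Q / sqrt lam)) * (4 * sqrt c / sqrt lam * sqrt b + \<bar>\<kappa>\<bar> / (lam * sqrt lam) * b)) + M / real T}"
      unfolding b_def by (rule sample_bound[OF n0 N0 T0 eta(1) eta1 eta(3) Gs(1) c0 Q0 Gs(3,4) f(1) g])
    also have "\<dots> \<le> measure (two_stage_sample \<tau> n N) {\<omega> \<in> space (two_stage_sample \<tau> n N).
      cond_exp_given_first_stage \<Phi> \<tau> \<rho> n N (err n N T \<eta>) \<omega>
        \<le> (2 * (1 + sqrt c * (2 + 3 * cQ) + (4 * sqrt c * sqrt B + \<bar>\<kappa>\<bar> * B) * (M / R + 2 * \<bar>\<kappa>\<bar> * (2 + 3 * cQ))) + M / (\<kappa>\<^sup>2 * R))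
          * (t * (R * lam powr r))}"
      by (rule prob_cond_exp_mono[OF bound])
    finally show "1 - \<delta> \<le> measure (two_stage_sample \<tau> n N) {\<omega> \<in> space (two_stage_sample \<tau> n N).
      cond_exp_given_first_stage \<Phi> \<tau> \<rho> n N (\<lambda>\<omega>. norm (SK (tail_average evK \<Psi> \<eta> n (second_stage_data \<Phi> N \<omega>) T) - cls f\<rho>)) \<omega>
        \<le> (2 * (1 + sqrt c * (2 + 3 * cQ) + (4 * sqrt c * sqrt B + \<bar>\<kappa>\<bar> * B) * (M / R + 2 * \<bar>\<kappa>\<bar> * (2 + 3 * cQ))) + M / (\<kappa>\<^sup>2 * R))
          * ((1 + ln (8 / \<delta>)) * (R * lam powr r))}"
      unfolding t_def errf .
  qed
qed

text \<open>Brings the lower bound on \<open>N\<close> in the theorem to the form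
  \<open>lam powr (- ((2 + \<nu>) / \<alpha>)) \<le> real N\<close>.\<close>

lemma log_factor: "1 \<le> ln (real n) \<Longrightarrow> 0 \<le> x \<Longrightarrow> x \<le> ln (real n) powr (2 / \<alpha>) * x"
  using mult_right_mono[of 1 "ln (real n) powr (2 / \<alpha>)" x] hoelder(1) by (simp add: ge_one_powr_ge_zero)

text \<open>For fixed \<delta>, divergence of \<open>n * lam / ln n\<close> supplies the conditions
  in which \<open>n * lam\<close> has to dominate, the logarithmic one included, and convergence of
  \<open>lam\<close> to 0 supplies the one on \<open>lam powr \<nu>\<close>.\<close>

lemma eventually_error_rate:
  fixes lam :: "nat \<Rightarrow> real"
  assumes R: "0 < R" and lam: "\<forall>\<^sub>F n in sequentially. 0 < lam n" "lam \<longlonglongrightarrow> 0"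
    and big: "filterlim (\<lambda>n. real n * lam n / ln (real n)) at_top sequentially"
    and rate: "\<forall>\<^sub>F n in sequentially. M\<^sup>2 \<le> R\<^sup>2 * lam n powr (2 * r + \<nu>) * real n"
  obtains C where "0 \<le> C" "\<And>\<delta>. 0 < \<delta> \<Longrightarrow> \<delta> \<le> 1 \<Longrightarrow> \<forall>\<^sub>F n in sequentially. \<forall>\<eta> T N.
    0 < \<eta> \<and> \<eta> < 1 / \<kappa>\<^sup>2 \<and> \<eta> * real T * lam n = 1 \<and> lam n powr (- ((2 + \<nu>) / \<alpha>)) \<le> real N \<longrightarrow>
    1 - \<delta> \<le> measure (two_stage_sample \<tau> n N) {\<omega> \<in> space (two_stage_sample \<tau> n N).
      cond_exp_given_first_stage \<Phi> \<tau> \<rho> n N (\<lambda>\<omega>. norm (SK (tail_average evK \<Psi> \<eta> n (second_stage_data \<Phi> N \<omega>) T) - cls f\<rho>)) \<omega>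
        \<le> C * ln (6 / \<delta>) * R * lam n powr r}"
proof (cases "\<kappa> = 0")
  case True
  \<comment> \<open>For \<open>\<kappa> = 0\<close> the term \<open>1 / \<kappa>\<^sup>2\<close>
    evaluates to 0, so no step size is admissible and the claim is vacuous.\<close>
  show thesis by (rule that[of 0]) (auto simp: True intro!: always_eventually)
next
  case False
  obtain C where C: "\<And>\<delta> lam \<eta> n N T. 0 < \<delta> \<Longrightarrow> \<delta> \<le> 1 \<Longrightarrow> 0 < lam \<Longrightarrow> lam \<le> 1 \<Longrightarrow> 3 \<le> n \<Longrightarrow> 2 / \<delta> \<le> real n \<Longrightarrow>
    M\<^sup>2 \<le> R\<^sup>2 * lam powr (2 * r + \<nu>) * real n \<Longrightarrow> 4 * (1 + ln (8 / \<delta>))\<^sup>2 * lam powr \<nu> \<le> 1 \<Longrightarrow>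
    4 * \<kappa>\<^sup>2 * (1 + ln (8 / \<delta>))\<^sup>2 \<le> real n * lam \<Longrightarrow> 4 * \<kappa>\<^sup>2 * (2 * ln (real n) + 3) \<le> real n * lam \<Longrightarrow>
    0 < \<eta> \<Longrightarrow> \<eta> < 1 / \<kappa>\<^sup>2 \<Longrightarrow> \<eta> * real T * lam = 1 \<Longrightarrow> lam powr (- ((2 + \<nu>) / \<alpha>)) \<le> real N \<Longrightarrow>
    1 - \<delta> \<le> measure (two_stage_sample \<tau> n N) {\<omega> \<in> space (two_stage_sample \<tau> n N).
      cond_exp_given_first_stage \<Phi> \<tau> \<rho> n N (\<lambda>\<omega>. norm (SK (tail_average evK \<Psi> \<eta> n (second_stage_data \<Phi> N \<omega>) T) - cls f\<rho>)) \<omega>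
        \<le> C * ((1 + ln (8 / \<delta>)) * (R * lam powr r))}"
    using error_rate[OF R False] by blast
  show thesis
  proof (rule that[of "2 * \<bar>C\<bar>"])
    fix \<delta> :: real assume \<delta>: "0 < \<delta>" "\<delta> \<le> 1"
    define t where "t = 1 + ln (8 / \<delta>)"
    have t0: "0 \<le> t" using \<delta> by (simp add: t_def)
    \<comment> \<open>Amounts to \<open>8 * e / \<delta> \<le> 36 / \<delta>\<^sup>2\<close>, true
      because e < 3 and \<delta> \<le> 1. It yields the logarithm of the second claim, which is the
      smaller of the two.\<close>
    have t: "t \<le> 2 * ln (6 / \<delta>)"
    proof -
      have "exp 1 * (8 / \<delta>) \<le> 3 * (8 / \<delta>)" using e_less_272 \<delta> by (intro mult_right_mono) auto
      also have "\<dots> \<le> (6 / \<delta>)\<^sup>2" using \<delta> by (simp add: power2_eq_square field_simps)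
      finally have "ln (exp 1 * (8 / \<delta>)) \<le> ln ((6 / \<delta>)\<^sup>2)" using \<delta> by (intro ln_mono) auto
      moreover have "ln (exp 1 * (8 / \<delta>)) = 1 + ln (8 / \<delta>)" using \<delta> by (subst ln_mult) auto
      moreover have "ln ((6 / \<delta>)\<^sup>2) = 2 * ln (6 / \<delta>)" using \<delta> by (simp add: ln_realpow)
      ultimately show ?thesis by (simp add: t_def)
    qed
    have "(\<lambda>n. 4 * t\<^sup>2 * lam n powr \<nu>) \<longlonglongrightarrow> 4 * t\<^sup>2 * 0 powr \<nu>"
      using capacity lam by (intro tendsto_intros tendsto_powr') (auto elim: eventually_mono)
    then have "(\<lambda>n. 4 * t\<^sup>2 * lam n powr \<nu>) \<longlonglongrightarrow> 0" by simp
    then have e1: "\<forall>\<^sub>F n in sequentially. 4 * t\<^sup>2 * lam n powr \<nu> < 1" by (rule order_tendstoD) simp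
    have e2: "\<forall>\<^sub>F n in sequentially. lam n < 1" by (rule order_tendstoD[OF lam(2)]) simp
    have e3: "\<forall>\<^sub>F n in sequentially. 4 * \<kappa>\<^sup>2 * (t\<^sup>2 + 5) \<le> real n * lam n / ln (real n)"
      using big by (simp add: filterlim_at_top)
    have e4: "\<forall>\<^sub>F n in sequentially. 2 / \<delta> \<le> real n"
      using filterlim_real_sequentially by (simp add: filterlim_at_top)
    show "\<forall>\<^sub>F n in sequentially. \<forall>\<eta> T N.
      0 < \<eta> \<and> \<eta> < 1 / \<kappa>\<^sup>2 \<and> \<eta> * real T * lam n = 1 \<and> lam n powr (- ((2 + \<nu>) / \<alpha>)) \<le> real N \<longrightarrow>
      1 - \<delta> \<le> measure (two_stage_sample \<tau> n N) {\<omega> \<in> space (two_stage_sample \<tau> n N).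
        cond_exp_given_first_stage \<Phi> \<tau> \<rho> n N (\<lambda>\<omega>. norm (SK (tail_average evK \<Psi> \<eta> n (second_stage_data \<Phi> N \<omega>) T) - cls f\<rho>)) \<omega>
          \<le> 2 * \<bar>C\<bar> * ln (6 / \<delta>) * R * lam n powr r}"
      using e1 e2 e3 e4 lam(1) rate eventually_ge_at_top[of 3]
    proof eventually_elim
      case (elim n)
      have ln1: "1 \<le> ln (real n)" using elim by (intro one_le_ln)
      then have l: "4 * \<kappa>\<^sup>2 * (t\<^sup>2 + 5) * ln (real n) \<le> real n * lam n" using elim by (simp add: pos_le_divide_eq)
      have "4 * \<kappa>\<^sup>2 * t\<^sup>2 * 1 \<le> 4 * \<kappa>\<^sup>2 * (t\<^sup>2 + 5) * ln (real n)" using ln1 by (intro mult_mono) auto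
      with l have l1: "4 * \<kappa>\<^sup>2 * t\<^sup>2 \<le> real n * lam n" by simp
      have "2 * ln (real n) + 3 \<le> 5 * ln (real n)" using ln1 by simp
      also have "\<dots> \<le> (t\<^sup>2 + 5) * ln (real n)" using ln1 by (intro mult_right_mono) auto
      finally have "4 * \<kappa>\<^sup>2 * (2 * ln (real n) + 3) \<le> 4 * \<kappa>\<^sup>2 * ((t\<^sup>2 + 5) * ln (real n))" by (rule mult_left_mono) simp
      with l have l2: "4 * \<kappa>\<^sup>2 * (2 * ln (real n) + 3) \<le> real n * lam n" by (simp add: mult.assoc)
      show ?case
      proof (intro allI impI)
        fix \<eta> :: real and T N :: nat
        assume a: "0 < \<eta> \<and> \<eta> < 1 / \<kappa>\<^sup>2 \<and> \<eta> * real T * lam n = 1 \<and> lam n powr (- ((2 + \<nu>) / \<alpha>)) \<le> real N"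
        let ?Z = "cond_exp_given_first_stage \<Phi> \<tau> \<rho> n N (\<lambda>\<omega>. norm (SK (tail_average evK \<Psi> \<eta> n (second_stage_data \<Phi> N \<omega>) T) - cls f\<rho>))"
        have "C * (t * (R * lam n powr r)) \<le> \<bar>C\<bar> * (2 * ln (6 / \<delta>) * (R * lam n powr r))"
          using t t0 R by (intro mult_mono mult_right_mono) auto
        then have le: "C * (t * (R * lam n powr r)) \<le> 2 * \<bar>C\<bar> * ln (6 / \<delta>) * R * lam n powr r"
          by (simp add: mult_ac)
        have "1 - \<delta> \<le> measure (two_stage_sample \<tau> n N) {\<omega> \<in> space (two_stage_sample \<tau> n N). ?Z \<omega> \<le> C * (t * (R * lam n powr r))}"
          unfolding t_def by (rule C) (use \<delta> elim a l1 l2 in \<open>auto simp: t_def\<close>)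
        also have "\<dots> \<le> measure (two_stage_sample \<tau> n N) {\<omega> \<in> space (two_stage_sample \<tau> n N). ?Z \<omega> \<le> 2 * \<bar>C\<bar> * ln (6 / \<delta>) * R * lam n powr r}"
          by (rule prob_cond_exp_mono[OF le])
        finally show "1 - \<delta> \<le> measure (two_stage_sample \<tau> n N) {\<omega> \<in> space (two_stage_sample \<tau> n N). ?Z \<omega> \<le> 2 * \<bar>C\<bar> * ln (6 / \<delta>) * R * lam n powr r}" .
      qed
    qed
  qed simp
qed

text \<open>For \<open>R = 0\<close> the theorem prescribes \<open>\<eta> * T = 0\<close>, so no
  step is taken and the average is 0. The source condition makes the regression function vanish too,
  and the error is 0.\<close>

lemma error_zero:
  assumes "R = 0"
  shows "measure (two_stage_sample \<tau> n N) {\<omega> \<in> space (two_stage_sample \<tau> n N).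
    cond_exp_given_first_stage \<Phi> \<tau> \<rho> n N (\<lambda>\<omega>. norm (SK (tail_average evK \<Psi> \<eta> n (second_stage_data \<Phi> N \<omega>) 0) - cls f\<rho>)) \<omega> \<le> 0} = 1"
proof -
  have "h\<rho> = 0" using source(4) assms by simp
  then have "cls f\<rho> = 0" using source(3) by (simp add: op_powr_def)
  moreover have "SK 0 = 0" by (rule linear_0[OF bounded_linear.linear[OF SK_bounded_linear]])
  ultimately show ?thesis using cond_exp_zero by (simp add: tail_average_def)
qed

end

theorem corollaryB12:
  fixes G :: "'x::topological_space \<Rightarrow> 'x \<Rightarrow> real"
    and evG :: "'g::{real_inner,banach,second_countable_topology} \<Rightarrow> 'x \<Rightarrow> real"
    and \<Phi> :: "'x \<Rightarrow> 'g"
    and P :: "'g set"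
    and K :: "'g \<Rightarrow> 'g \<Rightarrow> real"
    and evK :: "'h::{real_inner,banach,second_countable_topology} \<Rightarrow> 'g \<Rightarrow> real"
    and \<Psi> :: "'g \<Rightarrow> 'h"
    and M :: real and Y :: "real set"
    and \<rho> :: "('g \<times> real) measure" and \<rho>\<mu> :: "'g measure"
    and cond :: "'g \<Rightarrow> real measure" and f\<rho> :: "'g \<Rightarrow> real"
    and cls :: "('g \<Rightarrow> real) \<Rightarrow> 'l::{real_inner,banach}"
    and SK :: "'h \<Rightarrow> 'l" and TK :: "'h \<Rightarrow> 'h" and LK :: "'l \<Rightarrow> 'l"
    and \<tau> :: "('x measure \<times> real) measure"
    and \<gamma> \<kappa> \<alpha> L r R \<nu> c\<nu> :: real
    and h\<rho> :: 'l
    and cond_v :: "real \<Rightarrow> nat \<Rightarrow> real \<Rightarrow> nat \<Rightarrow> bool"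
    and error :: "real \<Rightarrow> nat \<Rightarrow> nat \<Rightarrow> nat
                  \<Rightarrow> (nat \<Rightarrow> ('x measure \<times> real) \<times> (nat \<Rightarrow> 'x)) \<Rightarrow> real"
  assumes "compact (UNIV :: 'x set)"
    and "M > 0" and "Y \<subseteq> {-M..M}"
    and "mercer_kernel G" and "is_rkhs UNIV G evG \<Phi>"
    and P: "P = mean_embeddings \<Phi>"
    and "is_rkhs P K evK \<Psi>"
    and "prob_space \<rho>"
    and "sets \<rho> = sets (restrict_space borel P \<Otimes>\<^sub>M restrict_space borel Y)"
    and \<rho>\<mu>: "\<rho>\<mu> = distr \<rho> (restrict_space borel P) fst"
    and "is_conditional_law (restrict_space borel P) (restrict_space borel Y) \<rho> cond"
    and f\<rho>: "f\<rho> = (\<lambda>m. \<integral>y. y \<partial>cond m)"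
    and "is_L2 \<rho>\<mu> cls"
    and SK: "SK = (\<lambda>f. cls (evK f))"
    and TK: "TK = adjoint SK \<circ> SK"
    and LK: "LK = SK \<circ> adjoint SK"
    and "prob_space \<tau>"
    and "sets \<tau> = sets (prob_algebra borel \<Otimes>\<^sub>M restrict_space borel Y)"
    and "distr \<tau> (restrict_space borel P \<Otimes>\<^sub>M restrict_space borel Y)
           (\<lambda>(x, y). (mean_embedding \<Phi> x, y)) = \<rho>"
    and error: "\<And>\<eta> T n N. error \<eta> T n N =
           (\<lambda>\<omega>. norm (SK (tail_average evK \<Psi> \<eta> n (second_stage_data \<Phi> N \<omega>) T) - cls f\<rho>))"
    and i_G: "bdd_above (range (\<lambda>s. G s s))" "(SUP s. G s s) = \<gamma>\<^sup>2"
    and i_K: "bdd_above ((\<lambda>m. K m m) ` P)" "(SUP m\<in>P. K m m) = \<kappa>\<^sup>2"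
    and ii: "0 < \<alpha>" "\<alpha> \<le> 1" "L > 0"
            "\<And>m1 m2. m1 \<in> P \<Longrightarrow> m2 \<in> P \<Longrightarrow>
               norm (\<Psi> m1 - \<Psi> m2) \<le> L * norm (m1 - m2) powr \<alpha>"
    and iii: "0 < r" "r \<le> 1 / 2" "cls f\<rho> = op_powr LK r h\<rho>" "norm h\<rho> \<le> R"
    and iv: "0 < \<nu>" "\<nu> \<le> 1" "\<And>lam. lam > 0 \<Longrightarrow> effective_dim LK lam \<le> c\<nu> * lam powr (-\<nu>)"
    and v: "\<And>\<delta> n \<eta> T. cond_v \<delta> n \<eta> T \<longleftrightarrow>
               0 < \<eta> \<and> \<eta> < 1 / \<kappa>\<^sup>2 \<and>
               (let lam = inverse (\<eta> * real T) in
                 real n \<ge> 32 * \<kappa>\<^sup>2 * ln (4 / \<delta>) / lam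
                   * ln (exp 1 * effective_dim LK lam * (1 + lam / onorm TK))) \<and>
               real n \<ge> 64 * exp 1 * \<kappa>\<^sup>2 * (ln (24 / \<delta>))\<^sup>2 * (\<eta> * real T) * ln ((\<eta> * real T) powr \<nu>)"
  shows "(2 * r + \<nu> > 1 \<longrightarrow>
           (\<exists>C. \<forall>\<delta>. 0 < \<delta> \<and> \<delta> \<le> 1 \<longrightarrow> (\<exists>n0. \<forall>n\<ge>n0. \<forall>\<eta> T N.
              cond_v \<delta> n \<eta> T \<and>
              \<eta> * real T = (R\<^sup>2 / M\<^sup>2 * real n) powr (1 / (2 * r + \<nu>)) \<and>
              real N \<ge> ln (real n) powr (2 / \<alpha>)
                         * (R\<^sup>2 * real n / M\<^sup>2) powr ((2 + \<nu>) / (\<alpha> * (2 * r + \<nu>))) \<longrightarrow>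
              \<P>(\<omega> in two_stage_sample \<tau> n N.
                 cond_exp_given_first_stage \<Phi> \<tau> \<rho> n N (error \<eta> T n N) \<omega>
                   \<le> C * ln (24 / \<delta>) * R * (M\<^sup>2 / (R\<^sup>2 * real n)) powr (r / (2 * r + \<nu>)))
                \<ge> 1 - \<delta>)))
       \<and> (2 * r + \<nu> \<le> 1 \<longrightarrow> (\<forall>q>1.
           (\<exists>C'. \<forall>\<delta>. 0 < \<delta> \<and> \<delta> \<le> 1 \<longrightarrow> (\<exists>n0. \<forall>n\<ge>n0. \<forall>\<eta> T N.
              cond_v \<delta> n \<eta> T \<and>
              \<eta> * real T = R\<^sup>2 * real n / (M\<^sup>2 * ln (real n) powr q) \<and>
              real N \<ge> ln (real n) powr (2 / \<alpha>)
                         * (R\<^sup>2 * real n / (M\<^sup>2 * ln (real n) powr q)) powr ((2 + \<nu>) / \<alpha>) \<longrightarrow>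
              \<P>(\<omega> in two_stage_sample \<tau> n N.
                 cond_exp_given_first_stage \<Phi> \<tau> \<rho> n N (error \<eta> T n N) \<omega>
                   \<le> C' * ln (6 / \<delta>) * R * (M\<^sup>2 * ln (real n) powr q / (R\<^sup>2 * real n)) powr r)
                \<ge> 1 - \<delta>))))"
  proof -
  interpret distribution_regression G evG \<Phi> P K evK \<Psi> M Y \<rho> \<rho>\<mu> cond f\<rho> cls SK LK \<tau> \<gamma> \<kappa> \<alpha> L r R \<nu> c\<nu> h\<rho>
    by (rule distribution_regression.intro) (fact assms)+
  have R0: "0 \<le> R" using iii(4) norm_ge_zero order_trans by blast
  define p where "p = 1 / (2 * r + \<nu>)"
  show ?thesis
  proof (cases "R = 0")
    case True
    have zero: "1 - \<delta> \<le> \<P>(\<omega> in two_stage_sample \<tau> n N.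
        cond_exp_given_first_stage \<Phi> \<tau> \<rho> n N (error \<eta> T n N) \<omega> \<le> 0)" if "0 < \<delta>" "0 < \<eta>" "\<eta> * real T = 0" for \<delta> \<eta> n N T
      using error_zero[OF True, of n N \<eta>] that by (simp add: error)
    show ?thesis
      using zero by (auto simp: v True)
  next
    case False
    with R0 have R: "0 < R" by simp
    have MR: "0 < R\<^sup>2 / M\<^sup>2" using R M by simp
    have rate1: "\<exists>C. \<forall>\<delta>. 0 < \<delta> \<and> \<delta> \<le> 1 \<longrightarrow> (\<exists>n0. \<forall>n\<ge>n0. \<forall>\<eta> T N.
              cond_v \<delta> n \<eta> T \<and>
              \<eta> * real T = (R\<^sup>2 / M\<^sup>2 * real n) powr (1 / (2 * r + \<nu>)) \<and>
              real N \<ge> ln (real n) powr (2 / \<alpha>)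
                         * (R\<^sup>2 * real n / M\<^sup>2) powr ((2 + \<nu>) / (\<alpha> * (2 * r + \<nu>))) \<longrightarrow>
              \<P>(\<omega> in two_stage_sample \<tau> n N.
                 cond_exp_given_first_stage \<Phi> \<tau> \<rho> n N (error \<eta> T n N) \<omega>
                   \<le> C * ln (24 / \<delta>) * R * (M\<^sup>2 / (R\<^sup>2 * real n)) powr (r / (2 * r + \<nu>)))
                \<ge> 1 - \<delta>)" if rn: "2 * r + \<nu> > 1"
    proof -
      have p: "0 < p" "p < 1" using rn by (simp_all add: p_def)
      \<comment> \<open>The reciprocal of the prescribed \<open>\<eta> * T\<close>; noise and bias
        balance, with equality in the condition \<open>l3\<close> for n > 0. As
        \<open>p < 1\<close>, \<open>n * lam n\<close> grows like a positive power of
        \<open>n\<close>.\<close>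
      define lam where "lam n = (R\<^sup>2 / M\<^sup>2 * real n) powr (- p)" for n
      have l0: "\<forall>\<^sub>F n in sequentially. 0 < lam n"
        using eventually_gt_at_top[of 0] by eventually_elim (use R M in \<open>simp add: lam_def\<close>)
      have l1: "lam \<longlonglongrightarrow> 0" unfolding lam_def using p MR by real_asymp
      have l2: "filterlim (\<lambda>n. real n * lam n / ln (real n)) at_top sequentially"
      proof -
        have "filterlim (\<lambda>n. real n * (a * real n) powr (- p) / ln (real n)) at_top sequentially" if "0 < a" "0 < p" "1 - p > 0" for a p
          using that by real_asymp
        from this[OF MR] p show ?thesis by (simp add: lam_def)
      qed
      have l3: "\<forall>\<^sub>F n in sequentially. M\<^sup>2 \<le> R\<^sup>2 * lam n powr (2 * r + \<nu>) * real n"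
        using eventually_gt_at_top[of 0]
      proof eventually_elim
        case (elim n)
        have pe: "- p * (2 * r + \<nu>) = - 1" using rn by (simp add: p_def)
        have "lam n powr (2 * r + \<nu>) = inverse (R\<^sup>2 / M\<^sup>2 * real n)"
          unfolding lam_def powr_powr pe using MR elim by (simp only: powr_minus) simp
        then show ?case using elim R M by simp
      qed
      obtain C where C: "0 \<le> C" "\<And>\<delta>. 0 < \<delta> \<Longrightarrow> \<delta> \<le> 1 \<Longrightarrow> \<forall>\<^sub>F n in sequentially. \<forall>\<eta> T N.
        0 < \<eta> \<and> \<eta> < 1 / \<kappa>\<^sup>2 \<and> \<eta> * real T * lam n = 1 \<and> lam n powr (- ((2 + \<nu>) / \<alpha>)) \<le> real N \<longrightarrow>
        1 - \<delta> \<le> \<P>(\<omega> in two_stage_sample \<tau> n N.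
          cond_exp_given_first_stage \<Phi> \<tau> \<rho> n N (error \<eta> T n N) \<omega> \<le> C * ln (6 / \<delta>) * R * lam n powr r)"
        unfolding error using eventually_error_rate[OF R l0 l1 l2 l3] by blast
      show ?thesis
      proof (intro exI[of _ C] allI impI)
        fix \<delta> :: real assume d: "0 < \<delta> \<and> \<delta> \<le> 1"
        have "\<forall>\<^sub>F n in sequentially. \<forall>\<eta> T N.
              cond_v \<delta> n \<eta> T \<and>
              \<eta> * real T = (R\<^sup>2 / M\<^sup>2 * real n) powr (1 / (2 * r + \<nu>)) \<and>
              real N \<ge> ln (real n) powr (2 / \<alpha>)
                         * (R\<^sup>2 * real n / M\<^sup>2) powr ((2 + \<nu>) / (\<alpha> * (2 * r + \<nu>))) \<longrightarrow>
              \<P>(\<omega> in two_stage_sample \<tau> n N.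
                 cond_exp_given_first_stage \<Phi> \<tau> \<rho> n N (error \<eta> T n N) \<omega>
                   \<le> C * ln (24 / \<delta>) * R * (M\<^sup>2 / (R\<^sup>2 * real n)) powr (r / (2 * r + \<nu>)))
                \<ge> 1 - \<delta>"
          using C(2)[of \<delta>, OF conjunct1[OF d] conjunct2[OF d]] eventually_ge_at_top[of 3]
        proof eventually_elim
          case (elim n)
          have n0: "0 < R\<^sup>2 / M\<^sup>2 * real n" by (rule mult_pos_pos[OF MR]) (use elim(2) in simp)
          have ln1: "1 \<le> ln (real n)" using elim(2) by (rule one_le_ln)
          have lr: "lam n powr r = (M\<^sup>2 / (R\<^sup>2 * real n)) powr (r / (2 * r + \<nu>))"
          proof -
            have "M\<^sup>2 / (R\<^sup>2 * real n) = inverse (R\<^sup>2 / M\<^sup>2 * real n)" by simp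
            then show ?thesis unfolding lam_def powr_powr using n0 by (simp only: powr_minus[symmetric] inverse_powr) (simp add: p_def)
          qed
          show ?case
          proof (intro allI impI, elim conjE)
            fix \<eta> :: real and T N :: nat
            assume cv: "cond_v \<delta> n \<eta> T" and eta: "\<eta> * real T = (R\<^sup>2 / M\<^sup>2 * real n) powr (1 / (2 * r + \<nu>))"
              and N: "real N \<ge> ln (real n) powr (2 / \<alpha>) * (R\<^sup>2 * real n / M\<^sup>2) powr ((2 + \<nu>) / (\<alpha> * (2 * r + \<nu>)))"
            have "\<eta> * real T * lam n = 1" using R M elim(2) unfolding eta lam_def by (simp add: p_def flip: powr_add)
            moreover have "lam n powr (- ((2 + \<nu>) / \<alpha>)) \<le> real N"
            proof -
              have "lam n powr (- ((2 + \<nu>) / \<alpha>)) = (R\<^sup>2 * real n / M\<^sup>2) powr ((2 + \<nu>) / (\<alpha> * (2 * r + \<nu>)))"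
                by (simp add: lam_def powr_powr p_def mult.commute)
              then show ?thesis using N log_factor[OF ln1, of "(R\<^sup>2 * real n / M\<^sup>2) powr ((2 + \<nu>) / (\<alpha> * (2 * r + \<nu>)))"] by simp
            qed
            ultimately have "1 - \<delta> \<le> \<P>(\<omega> in two_stage_sample \<tau> n N.
              cond_exp_given_first_stage \<Phi> \<tau> \<rho> n N (error \<eta> T n N) \<omega> \<le> C * ln (6 / \<delta>) * R * lam n powr r)"
              using elim(1) cv by (simp add: v)
            \<comment> \<open>The rate lemma gives ln (6/\<delta>), which may be enlarged to ln
              (24/\<delta>) because \<open>C\<close> and \<open>R\<close> are not negative.\<close>
            also have "\<dots> \<le> \<P>(\<omega> in two_stage_sample \<tau> n N.
              cond_exp_given_first_stage \<Phi> \<tau> \<rho> n N (error \<eta> T n N) \<omega> \<le> C * ln (24 / \<delta>) * R * lam n powr r)"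
              by (rule prob_cond_exp_mono) (use d C R in \<open>auto intro!: mult_right_mono mult_left_mono simp: divide_right_mono\<close>)
            finally show "1 - \<delta> \<le> \<P>(\<omega> in two_stage_sample \<tau> n N.
                 cond_exp_given_first_stage \<Phi> \<tau> \<rho> n N (error \<eta> T n N) \<omega>
                   \<le> C * ln (24 / \<delta>) * R * (M\<^sup>2 / (R\<^sup>2 * real n)) powr (r / (2 * r + \<nu>)))"
              unfolding lr .
          qed
        qed
        then show "\<exists>n0. \<forall>n\<ge>n0. \<forall>\<eta> T N.
              cond_v \<delta> n \<eta> T \<and>
              \<eta> * real T = (R\<^sup>2 / M\<^sup>2 * real n) powr (1 / (2 * r + \<nu>)) \<and>
              real N \<ge> ln (real n) powr (2 / \<alpha>)
                         * (R\<^sup>2 * real n / M\<^sup>2) powr ((2 + \<nu>) / (\<alpha> * (2 * r + \<nu>))) \<longrightarrow>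
              \<P>(\<omega> in two_stage_sample \<tau> n N.
                 cond_exp_given_first_stage \<Phi> \<tau> \<rho> n N (error \<eta> T n N) \<omega>
                   \<le> C * ln (24 / \<delta>) * R * (M\<^sup>2 / (R\<^sup>2 * real n)) powr (r / (2 * r + \<nu>)))
                \<ge> 1 - \<delta>" by (simp only: eventually_sequentially)
      qed
    qed
    have rate2: "\<exists>C'. \<forall>\<delta>. 0 < \<delta> \<and> \<delta> \<le> 1 \<longrightarrow> (\<exists>n0. \<forall>n\<ge>n0. \<forall>\<eta> T N.
              cond_v \<delta> n \<eta> T \<and>
              \<eta> * real T = R\<^sup>2 * real n / (M\<^sup>2 * ln (real n) powr q) \<and>
              real N \<ge> ln (real n) powr (2 / \<alpha>)
                         * (R\<^sup>2 * real n / (M\<^sup>2 * ln (real n) powr q)) powr ((2 + \<nu>) / \<alpha>) \<longrightarrow>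
              \<P>(\<omega> in two_stage_sample \<tau> n N.
                 cond_exp_given_first_stage \<Phi> \<tau> \<rho> n N (error \<eta> T n N) \<omega>
                   \<le> C' * ln (6 / \<delta>) * R * (M\<^sup>2 * ln (real n) powr q / (R\<^sup>2 * real n)) powr r)
                \<ge> 1 - \<delta>)" if rn: "2 * r + \<nu> \<le> 1" and q: "q > 1" for q
    proof -
      \<comment> \<open>For \<open>2 * r + \<nu> \<le> 1\<close> the balancing choice of the first
        claim would be too small for \<open>n * lam n / ln n\<close> to diverge; the factor
        \<open>ln n powr q\<close> with \<open>q > 1\<close> restores divergence.\<close>
      define lam where "lam n = M\<^sup>2 * ln (real n) powr q / (R\<^sup>2 * real n)" for n
      have M2: "0 < M\<^sup>2" "0 < R\<^sup>2" using M R by auto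
      have l0: "\<forall>\<^sub>F n in sequentially. 0 < lam n"
        using eventually_ge_at_top[of 3] by eventually_elim (use M R one_le_ln in \<open>fastforce simp: lam_def\<close>)
      have l1: "lam \<longlonglongrightarrow> 0" unfolding lam_def using q M2 by real_asymp
      have l2: "filterlim (\<lambda>n. real n * lam n / ln (real n)) at_top sequentially"
        unfolding lam_def using q M2 by real_asymp
      have l4: "\<forall>\<^sub>F n in sequentially. lam n < 1" by (rule order_tendstoD[OF l1]) simp
      \<comment> \<open>For \<open>lam n < 1\<close> an exponent of at most 1 only increases the
        power, so the noise is dominated by the bias.\<close>
      have l3: "\<forall>\<^sub>F n in sequentially. M\<^sup>2 \<le> R\<^sup>2 * lam n powr (2 * r + \<nu>) * real n"
        using l0 l4 eventually_ge_at_top[of 3]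
      proof eventually_elim
        case (elim n)
        have "M\<^sup>2 * 1 \<le> M\<^sup>2 * ln (real n) powr q"
          using one_le_ln[OF elim(3)] q by (intro mult_left_mono ge_one_powr_ge_zero) auto
        also have "\<dots> = R\<^sup>2 * lam n * real n" using elim(3) R by (simp add: lam_def)
        also have "\<dots> \<le> R\<^sup>2 * lam n powr (2 * r + \<nu>) * real n"
          using powr_mono'[OF rn, of "lam n"] elim by (intro mult_right_mono mult_left_mono) auto
        finally show ?case by simp
      qed
      obtain C where C: "0 \<le> C" "\<And>\<delta>. 0 < \<delta> \<Longrightarrow> \<delta> \<le> 1 \<Longrightarrow> \<forall>\<^sub>F n in sequentially. \<forall>\<eta> T N.
        0 < \<eta> \<and> \<eta> < 1 / \<kappa>\<^sup>2 \<and> \<eta> * real T * lam n = 1 \<and> lam n powr (- ((2 + \<nu>) / \<alpha>)) \<le> real N \<longrightarrow>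
        1 - \<delta> \<le> \<P>(\<omega> in two_stage_sample \<tau> n N.
          cond_exp_given_first_stage \<Phi> \<tau> \<rho> n N (error \<eta> T n N) \<omega> \<le> C * ln (6 / \<delta>) * R * lam n powr r)"
        unfolding error using eventually_error_rate[OF R l0 l1 l2 l3] by blast
      show ?thesis
      proof (intro exI[of _ C] allI impI)
        fix \<delta> :: real assume d: "0 < \<delta> \<and> \<delta> \<le> 1"
        have "\<forall>\<^sub>F n in sequentially. \<forall>\<eta> T N.
              cond_v \<delta> n \<eta> T \<and>
              \<eta> * real T = R\<^sup>2 * real n / (M\<^sup>2 * ln (real n) powr q) \<and>
              real N \<ge> ln (real n) powr (2 / \<alpha>)
                         * (R\<^sup>2 * real n / (M\<^sup>2 * ln (real n) powr q)) powr ((2 + \<nu>) / \<alpha>) \<longrightarrow>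
              \<P>(\<omega> in two_stage_sample \<tau> n N.
                 cond_exp_given_first_stage \<Phi> \<tau> \<rho> n N (error \<eta> T n N) \<omega>
                   \<le> C * ln (6 / \<delta>) * R * (M\<^sup>2 * ln (real n) powr q / (R\<^sup>2 * real n)) powr r)
                \<ge> 1 - \<delta>"
          using C(2)[of \<delta>, OF conjunct1[OF d] conjunct2[OF d]] eventually_ge_at_top[of 3] l0
        proof eventually_elim
          case (elim n)
          have ln1: "1 \<le> ln (real n)" using elim(2) by (rule one_le_ln)
          have inv: "R\<^sup>2 * real n / (M\<^sup>2 * ln (real n) powr q) = inverse (lam n)" by (simp add: lam_def)
          show ?case
          proof (intro allI impI, elim conjE)
            fix \<eta> :: real and T N :: nat
            assume cv: "cond_v \<delta> n \<eta> T" and eta: "\<eta> * real T = R\<^sup>2 * real n / (M\<^sup>2 * ln (real n) powr q)"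
              and N: "real N \<ge> ln (real n) powr (2 / \<alpha>) * (R\<^sup>2 * real n / (M\<^sup>2 * ln (real n) powr q)) powr ((2 + \<nu>) / \<alpha>)"
            have "\<eta> * real T * lam n = 1" using elim(3) unfolding eta inv by simp
            moreover have "lam n powr (- ((2 + \<nu>) / \<alpha>)) \<le> real N"
            proof -
              have e: "lam n powr (- ((2 + \<nu>) / \<alpha>)) = inverse (lam n) powr ((2 + \<nu>) / \<alpha>)"
                using elim(3) by (simp add: powr_minus inverse_powr)
              show ?thesis unfolding e by (rule order_trans[OF log_factor[OF ln1] N[unfolded inv]]) simp
            qed
            ultimately show "1 - \<delta> \<le> \<P>(\<omega> in two_stage_sample \<tau> n N.
              cond_exp_given_first_stage \<Phi> \<tau> \<rho> n N (error \<eta> T n N) \<omega> \<le> C * ln (6 / \<delta>) * R * (M\<^sup>2 * ln (real n) powr q / (R\<^sup>2 * real n)) powr r)"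
              using elim(1) cv unfolding lam_def[symmetric] by (simp add: v)
          qed
        qed
        then show "\<exists>n0. \<forall>n\<ge>n0. \<forall>\<eta> T N.
              cond_v \<delta> n \<eta> T \<and>
              \<eta> * real T = R\<^sup>2 * real n / (M\<^sup>2 * ln (real n) powr q) \<and>
              real N \<ge> ln (real n) powr (2 / \<alpha>)
                         * (R\<^sup>2 * real n / (M\<^sup>2 * ln (real n) powr q)) powr ((2 + \<nu>) / \<alpha>) \<longrightarrow>
              \<P>(\<omega> in two_stage_sample \<tau> n N.
                 cond_exp_given_first_stage \<Phi> \<tau> \<rho> n N (error \<eta> T n N) \<omega>
                   \<le> C * ln (6 / \<delta>) * R * (M\<^sup>2 * ln (real n) powr q / (R\<^sup>2 * real n)) powr r)
                \<ge> 1 - \<delta>" by (simp only: eventually_sequentially)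
      qed
    qed
    show ?thesis using rate1 rate2 by blast
  qed
qed

end
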